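(* Let $\mathcal{A}(\mathbb{R}^{++}_q)=\mathcal{O}(\mathbb{R}^2_q)\oplus\mathfrak{A}(\mathbb{R}^2)$ (direct sum of vector spaces) be the $\ast$-algebra of functions on the quantum quarter plane, and let $U_q(gl_2)$ act on it by $f\triangleright(z+a):=f\triangleright z+f\triangleright a$ for $f\in U_q(gl_2)$, $z\in\mathcal{O}(\mathbb{R}^2_q)$, $a\in\mathfrak{A}(\mathbb{R}^2)$, where the actions on the two summands are those given in the context. Then $\mathcal{A}(\mathbb{R}^{++}_q)$ is a left $U_q(gl_2(\mathbb{R}))$-module $\ast$-algebra.
   Context: Parameters: $q\neq\pm1$ is a complex number of modulus one, $\gamma\in\mathbb{R}$ is fixed with $q=e^{2\pi i\gamma}$, $q^{r}:=e^{2\pi i\gamma r}$ for rational $r$, $\alpha,\beta\in\mathbb{R}$ satisfy $\alpha\beta=\gamma$, and $\lambda:=q-q^{-1}$. The Hopf algebra $U_q(gl_2)$ is the complex unital algebra with generators $E,F,K_1^{\pm1},K_2^{\pm1}$ and relations $K_1K_2=K_2K_1$, $K_jK_j^{-1}=K_j^{-1}K_j=1$, $K_1EK_1^{-1}=q^{1/2}E$, $K_2EK_2^{-1}=q^{-1/2}E$, $K_1FK_1^{-1}=q^{-1/2}F$, $K_2FK_2^{-1}=q^{1/2}F$, $EF-FE=\lambda^{-1}(K^2-K^{-2})$, where $K:=K_1K_2^{-1}$; with $\Delta(K_j)=K_j\otimes K_j$, $\Delta(E)=E\otimes K+K^{-1}\otimes E$, $\Delta(F)=F\otimes K+K^{-1}\otimes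 F$, $\varepsilon(K_j)=1$, $\varepsilon(E)=\varepsilon(F)=0$, $S(K_j)=K_j^{-1}$, $S(E)=-qE$, $S(F)=-q^{-1}F$. With the involution $E^\ast=-qE$, $F^\ast=-q^{-1}F$, $K_j^\ast=K_j$ it is a Hopf $\ast$-algebra denoted $U_q(gl_2(\mathbb{R}))$. For a Hopf $\ast$-algebra $\mathcal{U}$, a left $\mathcal{U}$-module $\ast$-algebra is a $\ast$-algebra $\mathcal{Z}$ (not necessarily unital) with a left $\mathcal{U}$-module structure $\triangleright$ such that $f\triangleright(zz')=(f_{(1)}\triangleright z)(f_{(2)}\triangleright z')$ and $(f\triangleright z)^\ast=S(f)^\ast\triangleright z^\ast$ for all $f\in\mathcal{U}$, $z,z'\in\mathcal{Z}$ (Sweedler notation $\Delta(f)=f_{(1)}\otimes f_{(2)}$). $\mathcal{O}(\mathbb{R}^2_q)$ is the unital $\ast$-algebra with hermitean generators $x,y$ and the relation $xy=qyx$. It is a left $U_q(gl_2(\mathbb{R}))$-module $\ast$-algebra with action determined by $K_1\triangleright x=q^{-1/2}x$, $K_1\triangleright y=y$, $K_2\triangleright x=x$, $K_2\triangleright y=q^{-1/2}y$, $E\triangleright x=y$, $E\triangleright y=0$, $F\triangleright x=0$, $F\triangleright y=x$, $f\triangleright 1=\varepsilon(f)1$. $\mathfrak{A}(\mathbb{R}^2)$ is the space of functions $a(x_1,x_2)$ on $\mathbb{R}^2$ that extend to entire functions on $\mathbb{C}^2$ (denoted by the same symbol) with $\sup_{|y_1|<\nu_1,|y_2|<\nu_2}\iint|a(x_1+iy_1,x_2+iy_2)|^2e^{4\pi(\mu_1|x_1|+\mu_2|x_2|)}dx_1dx_2<\infty$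 for all $\mu_1,\mu_2,\nu_1,\nu_2>0$. It is a $\ast$-algebra with product $$(a\# b)(x_1,x_2)=4\iiiint a(u_1,u_2)b(v_1,v_2)e^{4\pi i[(x_1-u_1)(x_2-v_2)-(x_1-v_1)(x_2-u_2)]}du_1du_2dv_1dv_2$$ and involution $a^\ast(x_1,x_2)=\overline{a(x_1,x_2)}$ ($x_1,x_2\in\mathbb{R}$). The algebra $U_q(gl_2)$ acts on $\mathfrak{A}(\mathbb{R}^2)$ by $(E\triangleright a)(x_1,x_2)=\lambda^{-1}e^{2\pi(\beta x_2-\alpha x_1)}(a(x_1+\beta i,x_2)-a(x_1-\beta i,x_2))$, $(F\triangleright a)(x_1,x_2)=\lambda^{-1}e^{2\pi(\alpha x_1-\beta x_2)}(a(x_1,x_2+\alpha i)-a(x_1,x_2-\alpha i))$, $(K_1\triangleright a)(x_1,x_2)=a(x_1-\tfrac{\beta}{2}i,x_2)$, $(K_2\triangleright a)(x_1,x_2)=a(x_1,x_2-\tfrac{\alpha}{2}i)$. The $\ast$-algebra structure of $\mathcal{A}(\mathbb{R}^{++}_q)=\mathcal{O}(\mathbb{R}^2_q)\oplus\mathfrak{A}(\mathbb{R}^2)$ is the unique one for which $\mathcal{O}(\mathbb{R}^2_q)$ and $\mathfrak{A}(\mathbb{R}^2)$ are $\ast$-subalgebras and, for $a\in\mathfrak{A}(\mathbb{R}^2)$, $(xa)(x_1,x_2)=e^{2\pi\alpha x_1}a(x_1,x_2+\tfrac{\alpha}{2}i)$, $(ax)(x_1,x_2)=e^{2\pi\alpha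 x_1}a(x_1,x_2-\tfrac{\alpha}{2}i)$, $(ya)(x_1,x_2)=e^{2\pi\beta x_2}a(x_1-\tfrac{\beta}{2}i,x_2)$, $(ay)(x_1,x_2)=e^{2\pi\beta x_2}a(x_1+\tfrac{\beta}{2}i,x_2)$. *)

theory Defs
  imports
    "HOL-Analysis.Analysis"
    "HOL-Library.Poly_Mapping"
    "HOL-Algebra.QuotRing"
    "HOL-Algebra.Module"
    "HOL-Algebra.Algebraic_Closure_Type"
begin

section \<open>Complex \<open>*\<close>-algebras and module \<open>*\<close>-algebras\<close>

text \<open>
  Complex algebras are HOL-Algebra module records over the field of complex numbers.
  A \<open>*\<close>-algebra is not required to have a unit: the field \<open>one\<close> of the record is then irrelevant.
\<close>

record 'a star_algebra = "(complex, 'a) module" +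
  star :: "'a \<Rightarrow> 'a"

locale star_algebra = module "ring_of_type_algebra :: complex ring" Z
  for Z :: "('a, 'm) star_algebra_scheme" (structure) +
  assumes mult_closed: "\<lbrakk>x \<in> carrier Z; y \<in> carrier Z\<rbrakk> \<Longrightarrow> x \<otimes> y \<in> carrier Z"
    and mult_assoc: "\<lbrakk>x \<in> carrier Z; y \<in> carrier Z; z \<in> carrier Z\<rbrakk>
      \<Longrightarrow> (x \<otimes> y) \<otimes> z = x \<otimes> (y \<otimes> z)"
    and mult_add_left: "\<lbrakk>x \<in> carrier Z; y \<in> carrier Z; z \<in> carrier Z\<rbrakk>
      \<Longrightarrow> (x \<oplus> y) \<otimes> z = (x \<otimes> z) \<oplus> (y \<otimes> z)"
    and mult_add_right: "\<lbrakk>x \<in> carrier Z; y \<in> carrier Z; z \<in> carrier Z\<rbrakk>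
      \<Longrightarrow> x \<otimes> (y \<oplus> z) = (x \<otimes> y) \<oplus> (x \<otimes> z)"
    and mult_smult_left: "\<lbrakk>x \<in> carrier Z; y \<in> carrier Z\<rbrakk>
      \<Longrightarrow> (c \<odot> x) \<otimes> y = c \<odot> (x \<otimes> y)"
    and mult_smult_right: "\<lbrakk>x \<in> carrier Z; y \<in> carrier Z\<rbrakk>
      \<Longrightarrow> x \<otimes> (c \<odot> y) = c \<odot> (x \<otimes> y)"
    and star_closed: "x \<in> carrier Z \<Longrightarrow> star Z x \<in> carrier Z"
    and star_star: "x \<in> carrier Z \<Longrightarrow> star Z (star Z x) = x"
    and star_add: "\<lbrakk>x \<in> carrier Z; y \<in> carrier Z\<rbrakk>
      \<Longrightarrow> star Z (x \<oplus> y) = star Z x \<oplus> star Z y"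
    and star_smult: "x \<in> carrier Z \<Longrightarrow> star Z (c \<odot> x) = cnj c \<odot> star Z x"
    and star_mult: "\<lbrakk>x \<in> carrier Z; y \<in> carrier Z\<rbrakk>
      \<Longrightarrow> star Z (x \<otimes> y) = star Z y \<otimes> star Z x"

text \<open>
  An element of the tensor product of \<open>U\<close> with itself is a coset of formal linear combinations
  of pairs (\<open>tensor_square\<close> below); \<open>comult U f\<close> is therefore the set of all formal
  sums representing the coproduct of \<open>f\<close>.
\<close>

record 'u hopf_star_algebra = "'u star_algebra" +
  comult :: "'u \<Rightarrow> ('u \<times> 'u \<Rightarrow>\<^sub>0 complex) set"
  counit :: "'u \<Rightarrow> complex"
  antipode :: "'u \<Rightarrow> 'u"

definition lin_ext ::
    "(complex, 'b, 'c) module_scheme \<Rightarrow> ('a \<Rightarrow> 'b) \<Rightarrow> ('a \<Rightarrow>\<^sub>0 complex) \<Rightarrow> 'b" where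
  "lin_ext V h p =
    (\<Oplus>\<^bsub>V\<^esub>w\<in>Poly_Mapping.keys p. Poly_Mapping.lookup p w \<odot>\<^bsub>V\<^esub> h w)"

text \<open>
  The Sweedler condition below says that evaluating any representative of the coproduct of \<open>f\<close>
  gives \<open>act f (x \<otimes> y)\<close> (and that there is such a representative).
\<close>

locale module_star_algebra = star_algebra Z
  for U :: "('u, 'm) hopf_star_algebra_scheme" and Z :: "('z, 'n) star_algebra_scheme" (structure) +
  fixes act :: "'u \<Rightarrow> 'z \<Rightarrow> 'z"
  assumes act_closed: "\<lbrakk>f \<in> carrier U; x \<in> carrier Z\<rbrakk> \<Longrightarrow> act f x \<in> carrier Z"
    and act_add_left: "\<lbrakk>f \<in> carrier U; g \<in> carrier U; x \<in> carrier Z\<rbrakk>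
      \<Longrightarrow> act (f \<oplus>\<^bsub>U\<^esub> g) x = act f x \<oplus> act g x"
    and act_smult_left: "\<lbrakk>f \<in> carrier U; x \<in> carrier Z\<rbrakk>
      \<Longrightarrow> act (c \<odot>\<^bsub>U\<^esub> f) x = c \<odot> act f x"
    and act_add_right: "\<lbrakk>f \<in> carrier U; x \<in> carrier Z; y \<in> carrier Z\<rbrakk>
      \<Longrightarrow> act f (x \<oplus> y) = act f x \<oplus> act f y"
    and act_smult_right: "\<lbrakk>f \<in> carrier U; x \<in> carrier Z\<rbrakk>
      \<Longrightarrow> act f (c \<odot> x) = c \<odot> act f x"
    and act_mult: "\<lbrakk>f \<in> carrier U; g \<in> carrier U; x \<in> carrier Z\<rbrakk>
      \<Longrightarrow> act (f \<otimes>\<^bsub>U\<^esub> g) x = act f (act g x)"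
    and act_one: "x \<in> carrier Z \<Longrightarrow> act \<one>\<^bsub>U\<^esub> x = x"
    and act_product: "\<lbrakk>f \<in> carrier U; x \<in> carrier Z; y \<in> carrier Z\<rbrakk>
      \<Longrightarrow> lin_ext Z (\<lambda>(g, h). act g x \<otimes> act h y) ` comult U f = {act f (x \<otimes> y)}"
    and act_star: "\<lbrakk>f \<in> carrier U; x \<in> carrier Z\<rbrakk>
      \<Longrightarrow> star Z (act f x) = act (star U (antipode U f)) (star Z x)"


section \<open>Algebras given by generators and relations, tensor squares\<close>

definition monoid_algebra :: "('m, 'x) monoid_scheme \<Rightarrow> (complex, 'm \<Rightarrow>\<^sub>0 complex) module" where
  "monoid_algebra M =
    \<lparr>carrier = {p. Poly_Mapping.keys p \<subseteq> carrier M},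
     mult = (\<lambda>p q. \<Sum>a\<in>Poly_Mapping.keys p. \<Sum>b\<in>Poly_Mapping.keys q.
       Poly_Mapping.single (a \<otimes>\<^bsub>M\<^esub> b) (Poly_Mapping.lookup p a * Poly_Mapping.lookup q b)),
     one = Poly_Mapping.single \<one>\<^bsub>M\<^esub> 1,
     zero = 0,
     add = (+),
     smult = (\<lambda>c. Poly_Mapping.map ((*) c))\<rparr>"

definition free_algebra :: "(complex, 'g list \<Rightarrow>\<^sub>0 complex) module" where
  "free_algebra = monoid_algebra \<lparr>carrier = UNIV, mult = (@), one = []\<rparr>"

abbreviation fmono :: "complex \<Rightarrow> 'g list \<Rightarrow> ('g list \<Rightarrow>\<^sub>0 complex)" where
  "fmono c w \<equiv> Poly_Mapping.single w c"

definition quot_algebra ::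
    "(complex, 'a, 'x) module_scheme \<Rightarrow> 'a set \<Rightarrow> (complex, 'a set) module" where
  "quot_algebra A I =
    \<lparr>carrier = carrier (A Quot I), mult = mult (A Quot I), one = one (A Quot I),
     zero = zero (A Quot I), add = add (A Quot I),
     smult = (\<lambda>c S. \<Union>x\<in>S. I +>\<^bsub>A\<^esub> (c \<odot>\<^bsub>A\<^esub> x))\<rparr>"

text \<open>A function on representatives, regarded as a function of the coset.\<close>

definition quot_fun :: "('a \<Rightarrow> 'b) \<Rightarrow> 'a set \<Rightarrow> 'b" where
  "quot_fun h S = the_elem (h ` S)"

text \<open>
  The span of the bilinearity relations is a two-sided ideal of the monoid algebra of
  \<open>U \<times> U\<close>, because the relations are stable under multiplication by pairs.
\<close>

definition tensor_rels :: "(complex, 'u, 'x) module_scheme \<Rightarrow> ('u \<times> 'u \<Rightarrow>\<^sub>0 complex) set" where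
  "tensor_rels U =
    {Poly_Mapping.single (f \<oplus>\<^bsub>U\<^esub> f', g) 1 - Poly_Mapping.single (f, g) 1
        - Poly_Mapping.single (f', g) 1 | f f' g.
      f \<in> carrier U \<and> f' \<in> carrier U \<and> g \<in> carrier U} \<union>
    {Poly_Mapping.single (f, g \<oplus>\<^bsub>U\<^esub> g') 1 - Poly_Mapping.single (f, g) 1
        - Poly_Mapping.single (f, g') 1 | f g g'.
      f \<in> carrier U \<and> g \<in> carrier U \<and> g' \<in> carrier U} \<union>
    {Poly_Mapping.single (c \<odot>\<^bsub>U\<^esub> f, g) 1 - Poly_Mapping.single (f, g) c | c f g.
      f \<in> carrier U \<and> g \<in> carrier U} \<union>
    {Poly_Mapping.single (f, c \<odot>\<^bsub>U\<^esub> g) 1 - Poly_Mapping.single (f, g) c | c f g.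
      f \<in> carrier U \<and> g \<in> carrier U}"

definition tensor_ideal :: "(complex, 'u, 'x) module_scheme \<Rightarrow> ('u \<times> 'u \<Rightarrow>\<^sub>0 complex) set" where
  "tensor_ideal U = Idl\<^bsub>monoid_algebra (U \<times>\<times> U)\<^esub> (tensor_rels U)"

definition tensor_square ::
    "(complex, 'u, 'x) module_scheme \<Rightarrow> (complex, ('u \<times> 'u \<Rightarrow>\<^sub>0 complex) set) module" where
  "tensor_square U = quot_algebra (monoid_algebra (U \<times>\<times> U)) (tensor_ideal U)"

definition pure_tensor ::
    "(complex, 'u, 'x) module_scheme \<Rightarrow> 'u \<Rightarrow> 'u \<Rightarrow> ('u \<times> 'u \<Rightarrow>\<^sub>0 complex) set" where
  "pure_tensor U f g =
    tensor_ideal U +>\<^bsub>monoid_algebra (U \<times>\<times> U)\<^esub> Poly_Mapping.single (f, g) 1"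

text \<open>
  \<open>alg_ext B \<phi>\<close> is the homomorphism from the free algebra to \<open>B\<close> with values \<open>\<phi>\<close> on the
  generators. Antihomomorphisms are homomorphisms into the opposite algebra, and antilinear
  maps are linear maps into the conjugate vector space.
\<close>

definition alg_ext ::
    "(complex, 'b, 'x) module_scheme \<Rightarrow> ('g \<Rightarrow> 'b) \<Rightarrow> ('g list \<Rightarrow>\<^sub>0 complex) \<Rightarrow> 'b" where
  "alg_ext B \<phi> = lin_ext B (\<lambda>w. foldr (\<lambda>g r. \<phi> g \<otimes>\<^bsub>B\<^esub> r) w \<one>\<^bsub>B\<^esub>)"

definition opp_algebra :: "(complex, 'b, 'x) module_scheme \<Rightarrow> (complex, 'b, 'x) module_scheme" where
  "opp_algebra B = B\<lparr>mult := \<lambda>a b. b \<otimes>\<^bsub>B\<^esub> a\<rparr>"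

definition conj_algebra :: "(complex, 'b, 'x) module_scheme \<Rightarrow> (complex, 'b, 'x) module_scheme" where
  "conj_algebra B = B\<lparr>smult := \<lambda>c. smult B (cnj c)\<rparr>"

definition complex_algebra :: "(complex, complex) module" where
  "complex_algebra = \<lparr>carrier = UNIV, mult = (*), one = 1, zero = 0, add = (+), smult = (*)\<rparr>"

text \<open>The action of an element of the free algebra, the generators acting by \<open>\<rho>\<close>.\<close>

definition free_act ::
    "(complex, 'v, 'x) module_scheme \<Rightarrow> ('g \<Rightarrow> 'v \<Rightarrow> 'v) \<Rightarrow> ('g list \<Rightarrow>\<^sub>0 complex) \<Rightarrow> 'v \<Rightarrow> 'v" where
  "free_act V \<rho> p v = lin_ext V (\<lambda>w. foldr \<rho> w v) p"

definition free_right_act ::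
    "(complex, 'v, 'x) module_scheme \<Rightarrow> ('g \<Rightarrow> 'v \<Rightarrow> 'v) \<Rightarrow> ('g list \<Rightarrow>\<^sub>0 complex) \<Rightarrow> 'v \<Rightarrow> 'v" where
  "free_right_act V \<rho> p v = lin_ext V (\<lambda>w. fold \<rho> w v) p"


section \<open>The Hopf \<open>*\<close>-algebra \<open>U\<^sub>q(gl\<^sub>2(\<real>))\<close>\<close>

definition qpow :: "real \<Rightarrow> real \<Rightarrow> complex" where
  "qpow \<gamma> r = exp (2 * of_real pi * \<i> * of_real \<gamma> * of_real r)"

definition qlam :: "real \<Rightarrow> complex" where
  "qlam \<gamma> = qpow \<gamma> 1 - qpow \<gamma> (-1)"

text \<open>\<open>UK1i\<close> and \<open>UK2i\<close> are the inverses of \<open>UK1\<close> and \<open>UK2\<close>.\<close>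

datatype ugen = UE | UF | UK1 | UK1i | UK2 | UK2i

type_synonym uq = "(ugen list \<Rightarrow>\<^sub>0 complex) set"

text \<open>The relations \<open>a = b\<close> are written as \<open>a - b\<close>; note \<open>K\<^sup>2 = UK1 UK2i UK1 UK2i\<close>.\<close>

definition uq_rels :: "real \<Rightarrow> (ugen list \<Rightarrow>\<^sub>0 complex) set" where
  "uq_rels \<gamma> =
    {fmono 1 [UK1, UK2] - fmono 1 [UK2, UK1],
     fmono 1 [UK1, UK1i] - fmono 1 [], fmono 1 [UK1i, UK1] - fmono 1 [],
     fmono 1 [UK2, UK2i] - fmono 1 [], fmono 1 [UK2i, UK2] - fmono 1 [],
     fmono 1 [UK1, UE, UK1i] - fmono (qpow \<gamma> (1/2)) [UE],
     fmono 1 [UK2, UE, UK2i] - fmono (qpow \<gamma> (-1/2)) [UE],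
     fmono 1 [UK1, UF, UK1i] - fmono (qpow \<gamma> (-1/2)) [UF],
     fmono 1 [UK2, UF, UK2i] - fmono (qpow \<gamma> (1/2)) [UF],
     fmono 1 [UE, UF] - fmono 1 [UF, UE]
       - (fmono (1 / qlam \<gamma>) [UK1, UK2i, UK1, UK2i] - fmono (1 / qlam \<gamma>) [UK2, UK1i, UK2, UK1i])}"

definition uq_ideal :: "real \<Rightarrow> (ugen list \<Rightarrow>\<^sub>0 complex) set" where
  "uq_ideal \<gamma> = Idl\<^bsub>free_algebra\<^esub> (uq_rels \<gamma>)"

definition uq_algebra :: "real \<Rightarrow> (complex, uq) module" where
  "uq_algebra \<gamma> = quot_algebra free_algebra (uq_ideal \<gamma>)"

definition umono :: "real \<Rightarrow> complex \<Rightarrow> ugen list \<Rightarrow> uq" where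
  "umono \<gamma> c w = uq_ideal \<gamma> +>\<^bsub>free_algebra\<^esub> fmono c w"

fun uq_comult_gen :: "real \<Rightarrow> ugen \<Rightarrow> (uq \<times> uq \<Rightarrow>\<^sub>0 complex) set" where
  "uq_comult_gen \<gamma> UE =
    pure_tensor (uq_algebra \<gamma>) (umono \<gamma> 1 [UE]) (umono \<gamma> 1 [UK1, UK2i])
    \<oplus>\<^bsub>tensor_square (uq_algebra \<gamma>)\<^esub>
    pure_tensor (uq_algebra \<gamma>) (umono \<gamma> 1 [UK2, UK1i]) (umono \<gamma> 1 [UE])"
| "uq_comult_gen \<gamma> UF =
    pure_tensor (uq_algebra \<gamma>) (umono \<gamma> 1 [UF]) (umono \<gamma> 1 [UK1, UK2i])
    \<oplus>\<^bsub>tensor_square (uq_algebra \<gamma>)\<^esub>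
    pure_tensor (uq_algebra \<gamma>) (umono \<gamma> 1 [UK2, UK1i]) (umono \<gamma> 1 [UF])"
| "uq_comult_gen \<gamma> k = pure_tensor (uq_algebra \<gamma>) (umono \<gamma> 1 [k]) (umono \<gamma> 1 [k])"

fun uq_counit_gen :: "ugen \<Rightarrow> complex" where
  "uq_counit_gen UE = 0"
| "uq_counit_gen UF = 0"
| "uq_counit_gen k = 1"

fun uq_antipode_gen :: "real \<Rightarrow> ugen \<Rightarrow> uq" where
  "uq_antipode_gen \<gamma> UE = umono \<gamma> (- qpow \<gamma> 1) [UE]"
| "uq_antipode_gen \<gamma> UF = umono \<gamma> (- qpow \<gamma> (-1)) [UF]"
| "uq_antipode_gen \<gamma> UK1 = umono \<gamma> 1 [UK1i]"
| "uq_antipode_gen \<gamma> UK1i = umono \<gamma> 1 [UK1]"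
| "uq_antipode_gen \<gamma> UK2 = umono \<gamma> 1 [UK2i]"
| "uq_antipode_gen \<gamma> UK2i = umono \<gamma> 1 [UK2]"

fun uq_star_gen :: "real \<Rightarrow> ugen \<Rightarrow> uq" where
  "uq_star_gen \<gamma> UE = umono \<gamma> (- qpow \<gamma> 1) [UE]"
| "uq_star_gen \<gamma> UF = umono \<gamma> (- qpow \<gamma> (-1)) [UF]"
| "uq_star_gen \<gamma> k = umono \<gamma> 1 [k]"

definition uq_gl2_R :: "real \<Rightarrow> uq hopf_star_algebra" where
  "uq_gl2_R \<gamma> =
    \<lparr>carrier = carrier (uq_algebra \<gamma>), mult = mult (uq_algebra \<gamma>), one = one (uq_algebra \<gamma>),
     zero = zero (uq_algebra \<gamma>), add = add (uq_algebra \<gamma>), smult = smult (uq_algebra \<gamma>),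
     star = quot_fun (alg_ext (conj_algebra (opp_algebra (uq_algebra \<gamma>))) (uq_star_gen \<gamma>)),
     comult = quot_fun (alg_ext (tensor_square (uq_algebra \<gamma>)) (uq_comult_gen \<gamma>)),
     counit = quot_fun (alg_ext complex_algebra uq_counit_gen),
     antipode = quot_fun (alg_ext (opp_algebra (uq_algebra \<gamma>)) (uq_antipode_gen \<gamma>))\<rparr>"


section \<open>The \<open>*\<close>-algebra \<open>\<O>(\<real>\<^sup>2\<^sub>q)\<close> and the action on it\<close>

datatype ogen = OX | OY

type_synonym oq = "(ogen list \<Rightarrow>\<^sub>0 complex) set"

definition oq_ideal :: "real \<Rightarrow> (ogen list \<Rightarrow>\<^sub>0 complex) set" where
  "oq_ideal \<gamma> = Idl\<^bsub>free_algebra\<^esub> {fmono 1 [OX, OY] - fmono (qpow \<gamma> 1) [OY, OX]}"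

definition oq_algebra :: "real \<Rightarrow> (complex, oq) module" where
  "oq_algebra \<gamma> = quot_algebra free_algebra (oq_ideal \<gamma>)"

definition omono :: "real \<Rightarrow> complex \<Rightarrow> ogen list \<Rightarrow> oq" where
  "omono \<gamma> c w = oq_ideal \<gamma> +>\<^bsub>free_algebra\<^esub> fmono c w"

definition O_R2q :: "real \<Rightarrow> oq star_algebra" where
  "O_R2q \<gamma> =
    \<lparr>carrier = carrier (oq_algebra \<gamma>), mult = mult (oq_algebra \<gamma>), one = one (oq_algebra \<gamma>),
     zero = zero (oq_algebra \<gamma>), add = add (oq_algebra \<gamma>), smult = smult (oq_algebra \<gamma>),
     star = quot_fun (alg_ext (conj_algebra (opp_algebra (oq_algebra \<gamma>))) (\<lambda>a. omono \<gamma> 1 [a]))\<rparr>"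

fun oq_gen_val :: "real \<Rightarrow> ugen \<Rightarrow> ogen \<Rightarrow> oq" where
  "oq_gen_val \<gamma> UK1 OX = omono \<gamma> (qpow \<gamma> (-1/2)) [OX]"
| "oq_gen_val \<gamma> UK1 OY = omono \<gamma> 1 [OY]"
| "oq_gen_val \<gamma> UK1i OX = omono \<gamma> (qpow \<gamma> (1/2)) [OX]"
| "oq_gen_val \<gamma> UK1i OY = omono \<gamma> 1 [OY]"
| "oq_gen_val \<gamma> UK2 OX = omono \<gamma> 1 [OX]"
| "oq_gen_val \<gamma> UK2 OY = omono \<gamma> (qpow \<gamma> (-1/2)) [OY]"
| "oq_gen_val \<gamma> UK2i OX = omono \<gamma> 1 [OX]"
| "oq_gen_val \<gamma> UK2i OY = omono \<gamma> (qpow \<gamma> (1/2)) [OY]"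
| "oq_gen_val \<gamma> UE OX = omono \<gamma> 1 [OY]"
| "oq_gen_val \<gamma> UE OY = \<zero>\<^bsub>oq_algebra \<gamma>\<^esub>"
| "oq_gen_val \<gamma> UF OX = \<zero>\<^bsub>oq_algebra \<gamma>\<^esub>"
| "oq_gen_val \<gamma> UF OY = omono \<gamma> 1 [OX]"

text \<open>
  The values on the generators are extended to products as prescribed by the coproduct:
  the group-like generators act by algebra automorphisms, and \<open>g = UE, UF\<close> act by
  \<open>g \<triangleright> (a z) = (g \<triangleright> a) (K \<triangleright> z) + (K\<^sup>-\<^sup>1 \<triangleright> a) (g \<triangleright> z)\<close> and \<open>g \<triangleright> 1 = 0\<close>.
\<close>

definition oq_aut :: "real \<Rightarrow> ugen \<Rightarrow> oq \<Rightarrow> oq" where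
  "oq_aut \<gamma> k = quot_fun (alg_ext (oq_algebra \<gamma>) (oq_gen_val \<gamma> k))"

definition oq_K :: "real \<Rightarrow> oq \<Rightarrow> oq" where
  "oq_K \<gamma> z = oq_aut \<gamma> UK1 (oq_aut \<gamma> UK2i z)"

definition oq_K_inv :: "real \<Rightarrow> oq \<Rightarrow> oq" where
  "oq_K_inv \<gamma> z = oq_aut \<gamma> UK2 (oq_aut \<gamma> UK1i z)"

fun oq_skew :: "real \<Rightarrow> ugen \<Rightarrow> ogen list \<Rightarrow> oq" where
  "oq_skew \<gamma> g [] = \<zero>\<^bsub>oq_algebra \<gamma>\<^esub>"
| "oq_skew \<gamma> g (a # w) =
    (oq_gen_val \<gamma> g a \<otimes>\<^bsub>oq_algebra \<gamma>\<^esub> oq_K \<gamma> (omono \<gamma> 1 w))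
    \<oplus>\<^bsub>oq_algebra \<gamma>\<^esub>
    (oq_K_inv \<gamma> (omono \<gamma> 1 [a]) \<otimes>\<^bsub>oq_algebra \<gamma>\<^esub> oq_skew \<gamma> g w)"

definition oq_gen_act :: "real \<Rightarrow> ugen \<Rightarrow> oq \<Rightarrow> oq" where
  "oq_gen_act \<gamma> g =
    (if g = UE \<or> g = UF then quot_fun (lin_ext (oq_algebra \<gamma>) (oq_skew \<gamma> g)) else oq_aut \<gamma> g)"

definition oq_act :: "real \<Rightarrow> uq \<Rightarrow> oq \<Rightarrow> oq" where
  "oq_act \<gamma> f z = quot_fun (\<lambda>p. free_act (oq_algebra \<gamma>) (oq_gen_act \<gamma>) p z) f"


section \<open>The \<open>*\<close>-algebra \<open>\<AA>(\<real>\<^sup>2)\<close> and the action on it\<close>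

text \<open>Complex differentiability at every point of \<open>\<complex>\<^sup>2\<close>.\<close>

definition entire2 :: "(complex \<times> complex \<Rightarrow> complex) \<Rightarrow> bool" where
  "entire2 A \<longleftrightarrow> (\<forall>z. \<exists>c d. (A has_derivative (\<lambda>(h, k). c * h + d * k)) (at z))"

definition entire_extension :: "(real \<times> real \<Rightarrow> complex) \<Rightarrow> (complex \<times> complex \<Rightarrow> complex) \<Rightarrow> bool" where
  "entire_extension a A \<longleftrightarrow> entire2 A \<and> (\<forall>x1 x2. A (of_real x1, of_real x2) = a (x1, x2))"

definition entire_ext :: "(real \<times> real \<Rightarrow> complex) \<Rightarrow> complex \<times> complex \<Rightarrow> complex" where
  "entire_ext a = (THE A. entire_extension a A)"

definition frakA :: "(real \<times> real \<Rightarrow> complex) set" where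
  "frakA = {a. \<exists>A. entire_extension a A \<and>
    (\<forall>\<mu>1>0. \<forall>\<mu>2>0. \<forall>\<nu>1>0. \<forall>\<nu>2>0.
      (SUP (y1, y2) \<in> {- \<nu>1<..<\<nu>1} \<times> {- \<nu>2<..<\<nu>2}.
        \<integral>\<^sup>+ (x1, x2). ennreal ((cmod (A (Complex x1 y1, Complex x2 y2)))\<^sup>2
          * exp (4 * pi * (\<mu>1 * \<bar>x1\<bar> + \<mu>2 * \<bar>x2\<bar>))) \<partial>lborel) < \<infinity>)}"

definition twisted_prod ::
    "(real \<times> real \<Rightarrow> complex) \<Rightarrow> (real \<times> real \<Rightarrow> complex) \<Rightarrow> real \<times> real \<Rightarrow> complex" where
  "twisted_prod a b = (\<lambda>(x1, x2).
    4 * (\<integral>((u1, u2), (v1, v2)). a (u1, u2) * b (v1, v2)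
      * exp (4 * of_real pi * \<i> * of_real ((x1 - u1) * (x2 - v2) - (x1 - v1) * (x2 - u2))) \<partial>lborel))"

text \<open>This algebra has no unit, so the field \<open>one\<close> is left unspecified.\<close>

definition A_R2 :: "(real \<times> real \<Rightarrow> complex) star_algebra" where
  "A_R2 =
    \<lparr>carrier = frakA, mult = twisted_prod, one = undefined,
     zero = (\<lambda>x. 0), add = (\<lambda>a b x. a x + b x), smult = (\<lambda>c a x. c * a x),
     star = (\<lambda>a x. cnj (a x))\<rparr>"

fun fa_gen_act :: "real \<Rightarrow> real \<Rightarrow> real \<Rightarrow> ugen \<Rightarrow> (real \<times> real \<Rightarrow> complex) \<Rightarrow> real \<times> real \<Rightarrow> complex" where
  "fa_gen_act \<gamma> \<alpha> \<beta> UE a = (\<lambda>(x1, x2). 1 / qlam \<gamma> * exp (2 * pi * (\<beta> * x2 - \<alpha> * x1))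
    * (entire_ext a (x1 + \<beta> * \<i>, x2) - entire_ext a (x1 - \<beta> * \<i>, x2)))"
| "fa_gen_act \<gamma> \<alpha> \<beta> UF a = (\<lambda>(x1, x2). 1 / qlam \<gamma> * exp (2 * pi * (\<alpha> * x1 - \<beta> * x2))
    * (entire_ext a (x1, x2 + \<alpha> * \<i>) - entire_ext a (x1, x2 - \<alpha> * \<i>)))"
| "fa_gen_act \<gamma> \<alpha> \<beta> UK1 a = (\<lambda>(x1, x2). entire_ext a (x1 - \<beta> / 2 * \<i>, x2))"
| "fa_gen_act \<gamma> \<alpha> \<beta> UK1i a = (\<lambda>(x1, x2). entire_ext a (x1 + \<beta> / 2 * \<i>, x2))"
| "fa_gen_act \<gamma> \<alpha> \<beta> UK2 a = (\<lambda>(x1, x2). entire_ext a (x1, x2 - \<alpha> / 2 * \<i>))"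
| "fa_gen_act \<gamma> \<alpha> \<beta> UK2i a = (\<lambda>(x1, x2). entire_ext a (x1, x2 + \<alpha> / 2 * \<i>))"

definition fa_act :: "real \<Rightarrow> real \<Rightarrow> real \<Rightarrow> uq \<Rightarrow> (real \<times> real \<Rightarrow> complex) \<Rightarrow> real \<times> real \<Rightarrow> complex" where
  "fa_act \<gamma> \<alpha> \<beta> f a = quot_fun (\<lambda>p. free_act A_R2 (fa_gen_act \<gamma> \<alpha> \<beta>) p a) f"


section \<open>The \<open>*\<close>-algebra of functions on the quantum quarter plane\<close>

fun left_mult_gen :: "real \<Rightarrow> real \<Rightarrow> ogen \<Rightarrow> (real \<times> real \<Rightarrow> complex) \<Rightarrow> real \<times> real \<Rightarrow> complex" where
  "left_mult_gen \<alpha> \<beta> OX a = (\<lambda>(x1, x2). exp (2 * pi * \<alpha> * x1) * entire_ext a (x1, x2 + \<alpha> / 2 * \<i>))"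
| "left_mult_gen \<alpha> \<beta> OY a = (\<lambda>(x1, x2). exp (2 * pi * \<beta> * x2) * entire_ext a (x1 - \<beta> / 2 * \<i>, x2))"

fun right_mult_gen :: "real \<Rightarrow> real \<Rightarrow> ogen \<Rightarrow> (real \<times> real \<Rightarrow> complex) \<Rightarrow> real \<times> real \<Rightarrow> complex" where
  "right_mult_gen \<alpha> \<beta> OX a = (\<lambda>(x1, x2). exp (2 * pi * \<alpha> * x1) * entire_ext a (x1, x2 - \<alpha> / 2 * \<i>))"
| "right_mult_gen \<alpha> \<beta> OY a = (\<lambda>(x1, x2). exp (2 * pi * \<beta> * x2) * entire_ext a (x1 + \<beta> / 2 * \<i>, x2))"

definition left_mult :: "real \<Rightarrow> real \<Rightarrow> oq \<Rightarrow> (real \<times> real \<Rightarrow> complex) \<Rightarrow> real \<times> real \<Rightarrow> complex" where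
  "left_mult \<alpha> \<beta> z a = quot_fun (\<lambda>p. free_act A_R2 (left_mult_gen \<alpha> \<beta>) p a) z"

definition right_mult :: "real \<Rightarrow> real \<Rightarrow> (real \<times> real \<Rightarrow> complex) \<Rightarrow> oq \<Rightarrow> real \<times> real \<Rightarrow> complex" where
  "right_mult \<alpha> \<beta> a z = quot_fun (\<lambda>p. free_right_act A_R2 (right_mult_gen \<alpha> \<beta>) p a) z"

text \<open>
  The pair \<open>(z, a)\<close> stands for \<open>z + a\<close>. Bilinearity and associativity force the mixed
  products to be the iterated left and right multiplications by the generators.
\<close>

definition A_Rqpp ::
    "real \<Rightarrow> real \<Rightarrow> real \<Rightarrow> (oq \<times> (real \<times> real \<Rightarrow> complex)) star_algebra" where
  "A_Rqpp \<gamma> \<alpha> \<beta> =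
    \<lparr>carrier = carrier (O_R2q \<gamma>) \<times> carrier A_R2,
     mult = (\<lambda>(z, a) (w, b).
       (z \<otimes>\<^bsub>O_R2q \<gamma>\<^esub> w,
        left_mult \<alpha> \<beta> z b \<oplus>\<^bsub>A_R2\<^esub> right_mult \<alpha> \<beta> a w \<oplus>\<^bsub>A_R2\<^esub> (a \<otimes>\<^bsub>A_R2\<^esub> b))),
     one = (\<one>\<^bsub>O_R2q \<gamma>\<^esub>, \<zero>\<^bsub>A_R2\<^esub>),
     zero = (\<zero>\<^bsub>O_R2q \<gamma>\<^esub>, \<zero>\<^bsub>A_R2\<^esub>),
     add = (\<lambda>(z, a) (w, b). (z \<oplus>\<^bsub>O_R2q \<gamma>\<^esub> w, a \<oplus>\<^bsub>A_R2\<^esub> b)),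
     smult = (\<lambda>c (z, a). (c \<odot>\<^bsub>O_R2q \<gamma>\<^esub> z, c \<odot>\<^bsub>A_R2\<^esub> a)),
     star = (\<lambda>(z, a). (star (O_R2q \<gamma>) z, star A_R2 a))\<rparr>"

definition A_Rqpp_act :: "real \<Rightarrow> real \<Rightarrow> real \<Rightarrow> uq
    \<Rightarrow> oq \<times> (real \<times> real \<Rightarrow> complex) \<Rightarrow> oq \<times> (real \<times> real \<Rightarrow> complex)" where
  "A_Rqpp_act \<gamma> \<alpha> \<beta> f = (\<lambda>(z, a). (oq_act \<gamma> f z, fa_act \<gamma> \<alpha> \<beta> f a))"

end

theory Submission
  imports Defs "HOL-Complex_Analysis.Complex_Analysis" "HOL-Probability.Sinc_Integral"
begin

text \<open>
  Both compatibility conditions of a module \<open>*\<close>-algebra propagate from the generators of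
  \<open>U\<^sub>q(gl\<^sub>2)\<close> to all elements, so that finitely many operator identities remain. On
  \<open>\<O>(\<real>\<^sup>2\<^sub>q)\<close> they follow by induction along words in \<open>x, y\<close>. On
  \<open>\<AA>(\<real>\<^sup>2)\<close>, which consists of the restrictions of the entire functions that decay faster than every
  exponential on horizontal strips, the generators and the multiplications by \<open>x, y\<close> are combinations of Weyl
  operators \<open>a \<mapsto> e\<^sub>k a(\<cdot> + w)\<close> with \<open>e\<^sub>k(z) = exp (4 \<pi> i (k\<^sub>1 z\<^sub>2 - k\<^sub>2 z\<^sub>1))\<close> and imaginary \<open>k, w\<close> in the
  lattice spanned by \<open>(0, i\<alpha>/2)\<close> and \<open>(- i\<beta>/2, 0)\<close>. Shifting contours in the integral defining
  \<open>a # b\<close> gives \<open>a(\<cdot> + w) # e\<^sub>w b = e\<^sub>w (a # b)\<close> and \<open>e\<^sub>-\<^sub>w a # b(\<cdot> + w) = e\<^sub>-\<^sub>w (a # b)\<close>. These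
  rules move all translations out of a twisted product, and then both sides of each identity agree term by term.
  Associativity of \<open>#\<close> is Fubini's theorem together with a reflection of the inner variable.
\<close>

text \<open>The conclusion includes that \<open>A_Rqpp\<close> is a star algebra at all, so closure
  and associativity of its product have to be proved together with the action laws. A value of
  \<open>quot_fun\<close> is meaningful only when the underlying map is constant on cosets. The maps
  on presented algebras are therefore recognised as homomorphisms, as components of homomorphisms,
  or as representations by words; each of these vanishes on an ideal as soon as it vanishes on the
  generators. For the coproduct this is less direct: the tensor square is cut out by a two-sided
  ideal, whereas evaluation on a pair of vectors is merely linear, and an auxiliary ideal on which
  all evaluations vanish has to be built. On the analytic side, \<open>frakA\<close> is defined by
  square integrals over horizontal lines, whereas contour shifts and Fubini need pointwise bounds; a
  mean value inequality over squares converts one into the other. Decay of a twisted product is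
  inherited from the symplectic Fourier transform of one factor, whose decay comes from a contour
  shift in a direction that depends on the frequency.\<close>

locale complex_vs = abelian_group V for V :: "(complex, 'v, 'm) module_scheme" (structure) +
  assumes sm_closed [simp, intro]: "x \<in> carrier V \<Longrightarrow> c \<odot> x \<in> carrier V"
    and sm_add_left: "x \<in> carrier V \<Longrightarrow> (c + d) \<odot> x = c \<odot> x \<oplus> d \<odot> x"
    and sm_add_right: "x \<in> carrier V \<Longrightarrow> y \<in> carrier V \<Longrightarrow> c \<odot> (x \<oplus> y) = c \<odot> x \<oplus> c \<odot> y"
    and sm_mult: "x \<in> carrier V \<Longrightarrow> (c * d) \<odot> x = c \<odot> (d \<odot> x)"
    and sm_1 [simp]: "x \<in> carrier V \<Longrightarrow> 1 \<odot> x = x"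
begin

lemma sm_0 [simp]:
  assumes "x \<in> carrier V" shows "0 \<odot> x = \<zero>"
proof -
  have "0 \<odot> x \<oplus> 0 \<odot> x = 0 \<odot> x" using sm_add_left[of x 0 0] assms by simp
  thus ?thesis using assms by (metis add.l_cancel_one sm_closed)
qed

lemma sm_zero [simp]: "c \<odot> \<zero> = \<zero>"
  by (metis mult_zero_right sm_0 sm_mult zero_closed)

lemma sm_minus_left: "x \<in> carrier V \<Longrightarrow> (- c) \<odot> x = \<ominus> (c \<odot> x)"
  by (metis add.inv_equality add.left_inverse sm_0 sm_add_left sm_closed add.m_comm ab_left_minus)

lemma minus_eq_sm: "x \<in> carrier V \<Longrightarrow> \<ominus> x = (- 1) \<odot> x"
  by (simp add: sm_minus_left)

lemma diff_eq_sm: "x \<in> carrier V \<Longrightarrow> y \<in> carrier V \<Longrightarrow> x \<ominus> y = x \<oplus> (- 1) \<odot> y"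
  by (simp add: minus_eq minus_eq_sm)

lemma a_swap4:
  "\<lbrakk>a \<in> carrier V; b \<in> carrier V; c \<in> carrier V; d \<in> carrier V\<rbrakk>
    \<Longrightarrow> (a \<oplus> b) \<oplus> (c \<oplus> d) = (a \<oplus> c) \<oplus> (b \<oplus> d)"
  by (simp add: a_ac)

lemma module_complex: "module (ring_of_type_algebra :: complex ring) V"
proof (rule moduleI)
  show "cring (ring_of_type_algebra :: complex ring)" by (rule cring_from_type_algebra)
  show "abelian_group V" by (rule abelian_group_axioms)
qed (auto simp: ring_of_type_algebra_def sm_add_left sm_add_right sm_mult)

end

text \<open>Additive inverses need not be exhibited: distributivity and \<open>null\<close> give
  (-1) x + x = 0, so the scalar laws already make the carrier a group.\<close>

lemma complex_vsI:
  fixes V (structure)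
  assumes closed: "\<And>x y. \<lbrakk>x \<in> carrier V; y \<in> carrier V\<rbrakk> \<Longrightarrow> x \<oplus> y \<in> carrier V"
    and zero: "\<zero> \<in> carrier V"
    and assoc: "\<And>x y z. \<lbrakk>x \<in> carrier V; y \<in> carrier V; z \<in> carrier V\<rbrakk> \<Longrightarrow> (x \<oplus> y) \<oplus> z = x \<oplus> (y \<oplus> z)"
    and comm: "\<And>x y. \<lbrakk>x \<in> carrier V; y \<in> carrier V\<rbrakk> \<Longrightarrow> x \<oplus> y = y \<oplus> x"
    and l_zero: "\<And>x. x \<in> carrier V \<Longrightarrow> \<zero> \<oplus> x = x"
    and null: "\<And>x. x \<in> carrier V \<Longrightarrow> 0 \<odot> x = \<zero>"
    and smc: "\<And>c x. x \<in> carrier V \<Longrightarrow> c \<odot> x \<in> carrier V"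
    and smal: "\<And>c d x. x \<in> carrier V \<Longrightarrow> (c + d) \<odot> x = c \<odot> x \<oplus> d \<odot> x"
    and smar: "\<And>c x y. x \<in> carrier V \<Longrightarrow> y \<in> carrier V \<Longrightarrow> c \<odot> (x \<oplus> y) = c \<odot> x \<oplus> c \<odot> y"
    and smm: "\<And>c d x. x \<in> carrier V \<Longrightarrow> (c * d) \<odot> x = c \<odot> (d \<odot> x)"
    and sm1: "\<And>x. x \<in> carrier V \<Longrightarrow> 1 \<odot> x = x"
  shows "complex_vs V"
proof (intro complex_vs.intro complex_vs_axioms.intro)
  show "abelian_group V"
  proof (rule abelian_groupI)
    fix x assume x: "x \<in> carrier V"
    have "(-1) \<odot> x \<oplus> 1 \<odot> x = \<zero>" using smal[of x "-1" 1] x null by simp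
    thus "\<exists>y\<in>carrier V. y \<oplus> x = \<zero>" using x sm1 smc by metis
  qed (use assms in auto)
qed (use assms in auto)

locale complex_alg = complex_vs A + ring A for A :: "(complex, 'v, 'm) module_scheme" (structure) +
  assumes sm_mult_left: "\<lbrakk>x \<in> carrier A; y \<in> carrier A\<rbrakk> \<Longrightarrow> (c \<odot> x) \<otimes> y = c \<odot> (x \<otimes> y)"
    and sm_mult_right: "\<lbrakk>x \<in> carrier A; y \<in> carrier A\<rbrakk> \<Longrightarrow> x \<otimes> (c \<odot> y) = c \<odot> (x \<otimes> y)"

lemma complex_algI:
  fixes A (structure)
  assumes "complex_vs A"
    and "\<And>x y. \<lbrakk>x \<in> carrier A; y \<in> carrier A\<rbrakk> \<Longrightarrow> x \<otimes> y \<in> carrier A"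
    and "\<one> \<in> carrier A"
    and "\<And>x y z. \<lbrakk>x \<in> carrier A; y \<in> carrier A; z \<in> carrier A\<rbrakk> \<Longrightarrow> (x \<otimes> y) \<otimes> z = x \<otimes> (y \<otimes> z)"
    and "\<And>x. x \<in> carrier A \<Longrightarrow> \<one> \<otimes> x = x"
    and "\<And>x. x \<in> carrier A \<Longrightarrow> x \<otimes> \<one> = x"
    and "\<And>x y z. \<lbrakk>x \<in> carrier A; y \<in> carrier A; z \<in> carrier A\<rbrakk> \<Longrightarrow> (x \<oplus> y) \<otimes> z = x \<otimes> z \<oplus> y \<otimes> z"
    and "\<And>x y z. \<lbrakk>x \<in> carrier A; y \<in> carrier A; z \<in> carrier A\<rbrakk> \<Longrightarrow> z \<otimes> (x \<oplus> y) = z \<otimes> x \<oplus> z \<otimes> y"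
    and "\<And>c x y. \<lbrakk>x \<in> carrier A; y \<in> carrier A\<rbrakk> \<Longrightarrow> (c \<odot> x) \<otimes> y = c \<odot> (x \<otimes> y)"
    and "\<And>c x y. \<lbrakk>x \<in> carrier A; y \<in> carrier A\<rbrakk> \<Longrightarrow> x \<otimes> (c \<odot> y) = c \<odot> (x \<otimes> y)"
  shows "complex_alg A"
proof -
  interpret complex_vs A by fact
  have "ring A"
    by (intro ringI monoidI abelian_group_axioms assms; assumption)
  thus ?thesis
    by (intro complex_alg.intro complex_alg_axioms.intro assms)
qed

subsection \<open>Linear extension\<close>

lemma keys_plus_subset:
  "Poly_Mapping.keys p \<subseteq> D \<Longrightarrow> Poly_Mapping.keys q \<subseteq> D \<Longrightarrow> Poly_Mapping.keys (p + q) \<subseteq> D"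
  by (meson Poly_Mapping.keys_add Un_least subset_trans)

lemma lookup_pmap_times: "Poly_Mapping.lookup (Poly_Mapping.map ((*) c) p) w
    = (c::complex) * Poly_Mapping.lookup p w"
  by (simp add: Poly_Mapping.map.rep_eq when_def)

lemma keys_pmap_times: "Poly_Mapping.keys (Poly_Mapping.map ((*) (c::complex)) p) \<subseteq> Poly_Mapping.keys p"
  by (auto simp: in_keys_iff lookup_pmap_times)

lemma pmap_times_single: "Poly_Mapping.map ((*) c) (Poly_Mapping.single w d)
    = Poly_Mapping.single w ((c::complex) * d)"
  by (rule poly_mapping_eqI) (auto simp: lookup_pmap_times lookup_single when_def)

lemma pmap_times_zero [simp]: "Poly_Mapping.map ((*) (c::complex)) 0 = 0"
  by (rule poly_mapping_eqI) (simp add: lookup_pmap_times)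

lemma pmap_times_add: "Poly_Mapping.map ((*) (c::complex)) (p + q)
    = Poly_Mapping.map ((*) c) p + Poly_Mapping.map ((*) c) q"
  by (rule poly_mapping_eqI) (auto simp: lookup_pmap_times lookup_add algebra_simps)

text \<open>Keys are stripped off one at a time. The step does not promise that \<open>a\<close> is
  a new key of \<open>p\<close>; additive statements do not need this, and all summands stay
  supported in \<open>D\<close>.\<close>

lemma pm_induct [consumes 1, case_names zero single]:
  fixes p :: "'a \<Rightarrow>\<^sub>0 complex"
  assumes "Poly_Mapping.keys p \<subseteq> D" and "P 0"
    and "\<And>a c p. \<lbrakk>a \<in> D; Poly_Mapping.keys p \<subseteq> D; P p\<rbrakk> \<Longrightarrow> P (Poly_Mapping.single a c + p)"
  shows "P p"
  using assms(1)
proof (induction "card (Poly_Mapping.keys p)" arbitrary: p rule: less_induct)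
  case less
  show ?case
  proof (cases "p = 0")
    case False
    then obtain a where a: "a \<in> Poly_Mapping.keys p" by (metis keys_eq_empty ex_in_conv)
    define p' where "p' = p - Poly_Mapping.single a (Poly_Mapping.lookup p a)"
    have k: "Poly_Mapping.keys p' \<subseteq> Poly_Mapping.keys p - {a}"
      by (auto simp: p'_def in_keys_iff lookup_minus lookup_single when_def split: if_splits)
    hence "card (Poly_Mapping.keys p') < card (Poly_Mapping.keys p)"
      using a by (meson card_Diff1_less card_mono finite_Diff finite_keys le_less_trans)
    hence "P p'" using less k by blast
    moreover have "p = Poly_Mapping.single a (Poly_Mapping.lookup p a) + p'" by (simp add: p'_def)
    ultimately show ?thesis using assms(3)[of a p'] a k less.prems by (metis (no_types, lifting) Diff_subset subset_iff)
  qed (use assms in simp)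
qed

context complex_vs
begin

text \<open>The sums for \<open>p\<close>, \<open>q\<close> and \<open>p + q\<close> run over
  different key sets; padding with zero coefficients gives them a common index set.\<close>

lemma lin_ext_superset:
  assumes "finite S" "Poly_Mapping.keys p \<subseteq> S" "h \<in> S \<rightarrow> carrier V"
  shows "lin_ext V h p = (\<Oplus>w\<in>S. Poly_Mapping.lookup p w \<odot> h w)"
  unfolding lin_ext_def
  by (rule add.finprod_mono_neutral_cong_left) (use assms in \<open>auto simp: in_keys_iff Pi_iff\<close>)

lemma lin_ext_closed:
  assumes "h \<in> D \<rightarrow> carrier V" "Poly_Mapping.keys p \<subseteq> D"
  shows "lin_ext V h p \<in> carrier V"
  unfolding lin_ext_def by (rule finsum_closed) (use assms in auto)

lemma lin_ext_0 [simp]: "lin_ext V h 0 = \<zero>"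
  by (simp add: lin_ext_def)

lemma lin_ext_add:
  assumes h: "h \<in> D \<rightarrow> carrier V" and "Poly_Mapping.keys p \<subseteq> D" "Poly_Mapping.keys q \<subseteq> D"
  shows "lin_ext V h (p + q) = lin_ext V h p \<oplus> lin_ext V h q"
proof -
  let ?S = "Poly_Mapping.keys p \<union> Poly_Mapping.keys q"
  have hS: "h \<in> ?S \<rightarrow> carrier V" using assms by auto
  have "lin_ext V h (p + q) = (\<Oplus>w\<in>?S. Poly_Mapping.lookup (p + q) w \<odot> h w)"
    by (rule lin_ext_superset) (use hS in \<open>auto dest!: subsetD[OF Poly_Mapping.keys_add]\<close>)
  also have "\<dots> = (\<Oplus>w\<in>?S. Poly_Mapping.lookup p w \<odot> h w \<oplus> Poly_Mapping.lookup q w \<odot> h w)"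
    by (rule finsum_cong') (use hS in \<open>auto simp: lookup_add sm_add_left Pi_iff\<close>)
  also have "\<dots> = (\<Oplus>w\<in>?S. Poly_Mapping.lookup p w \<odot> h w) \<oplus> (\<Oplus>w\<in>?S. Poly_Mapping.lookup q w \<odot> h w)"
    by (rule finsum_addf) (use hS in \<open>auto simp: Pi_iff\<close>)
  also have "\<dots> = lin_ext V h p \<oplus> lin_ext V h q"
    using lin_ext_superset[of ?S p h] lin_ext_superset[of ?S q h] hS by auto
  finally show ?thesis .
qed

lemma lin_ext_single: "h w \<in> carrier V \<Longrightarrow> lin_ext V h (Poly_Mapping.single w c) = c \<odot> h w"
  by (cases "c = 0") (auto simp: lin_ext_def finsum_insert)

lemma lin_ext_smult:
  assumes "h \<in> D \<rightarrow> carrier V" "Poly_Mapping.keys p \<subseteq> D"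
  shows "lin_ext V h (Poly_Mapping.map ((*) c) p) = c \<odot> lin_ext V h p"
  using assms(2)
proof (induction p rule: pm_induct)
  case zero
  show ?case by simp
next
  case (single a d p)
  have "h a \<in> carrier V" using single assms by auto
  moreover have "Poly_Mapping.keys (Poly_Mapping.map ((*) c) p) \<subseteq> D"
    by (rule subset_trans[OF keys_pmap_times single(2)])
  ultimately show ?case
    using single assms(1) lin_ext_closed[OF assms(1)]
    by (simp add: pmap_times_add pmap_times_single lin_ext_add[OF assms(1)] lin_ext_single sm_add_right sm_mult)
qed

end

section \<open>Linear maps between complex vector spaces\<close>

definition lin_map :: "(complex, 'a, 'x) module_scheme \<Rightarrow> (complex, 'b, 'y) module_scheme \<Rightarrow> ('a \<Rightarrow> 'b) \<Rightarrow> bool" where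
  "lin_map V W f \<longleftrightarrow> f \<in> carrier V \<rightarrow> carrier W
    \<and> (\<forall>x\<in>carrier V. \<forall>y\<in>carrier V. f (x \<oplus>\<^bsub>V\<^esub> y) = f x \<oplus>\<^bsub>W\<^esub> f y)
    \<and> (\<forall>c. \<forall>x\<in>carrier V. f (c \<odot>\<^bsub>V\<^esub> x) = c \<odot>\<^bsub>W\<^esub> f x)"

lemma lin_mapI:
  assumes "\<And>x. x \<in> carrier V \<Longrightarrow> f x \<in> carrier W"
    and "\<And>x y. \<lbrakk>x \<in> carrier V; y \<in> carrier V\<rbrakk> \<Longrightarrow> f (x \<oplus>\<^bsub>V\<^esub> y) = f x \<oplus>\<^bsub>W\<^esub> f y"
    and "\<And>c x. x \<in> carrier V \<Longrightarrow> f (c \<odot>\<^bsub>V\<^esub> x) = c \<odot>\<^bsub>W\<^esub> f x"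
  shows "lin_map V W f"
  using assms by (auto simp: lin_map_def)

lemma lin_mapD:
  assumes "lin_map V W f"
  shows "x \<in> carrier V \<Longrightarrow> f x \<in> carrier W"
    and "\<lbrakk>x \<in> carrier V; y \<in> carrier V\<rbrakk> \<Longrightarrow> f (x \<oplus>\<^bsub>V\<^esub> y) = f x \<oplus>\<^bsub>W\<^esub> f y"
    and "x \<in> carrier V \<Longrightarrow> f (c \<odot>\<^bsub>V\<^esub> x) = c \<odot>\<^bsub>W\<^esub> f x"
  using assms by (auto simp: lin_map_def)

lemma lin_map_zero:
  assumes "complex_vs V" "complex_vs W" "lin_map V W f"
  shows "f \<zero>\<^bsub>V\<^esub> = \<zero>\<^bsub>W\<^esub>"
proof -
  interpret V: complex_vs V by fact
  interpret W: complex_vs W by fact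
  have "f (0 \<odot>\<^bsub>V\<^esub> \<zero>\<^bsub>V\<^esub>) = 0 \<odot>\<^bsub>W\<^esub> f \<zero>\<^bsub>V\<^esub>" using lin_mapD(3)[OF assms(3)] by blast
  thus ?thesis using lin_mapD(1)[OF assms(3)] by simp
qed

lemma lin_map_lin_ext:
  assumes "complex_vs V" "complex_vs W" "lin_map V W f" and h: "h \<in> D \<rightarrow> carrier V" "Poly_Mapping.keys p \<subseteq> D"
  shows "f (lin_ext V h p) = lin_ext W (f \<circ> h) p"
  using h(2)
proof (induction p rule: pm_induct)
  case zero
  interpret V: complex_vs V by fact
  interpret W: complex_vs W by fact
  show ?case using lin_map_zero[OF assms(1-3)] by simp
next
  case (single a c p)
  interpret V: complex_vs V by fact
  interpret W: complex_vs W by fact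
  have fh: "f \<circ> h \<in> D \<rightarrow> carrier W" using h lin_mapD(1)[OF assms(3)] by (auto simp: Pi_iff)
  have ha: "h a \<in> carrier V" using single h by auto
  show ?case
    using single ha V.lin_ext_closed[OF h(1), of p] fh
    by (subst V.lin_ext_add[OF h(1)], simp, simp, subst W.lin_ext_add[OF fh], simp, simp)
      (simp add: lin_mapD[OF assms(3)] V.lin_ext_single W.lin_ext_single o_def)
qed

subsection \<open>Monoid algebras\<close>

lemma monoid_algebra_simps [simp]:
  "carrier (monoid_algebra M) = {p. Poly_Mapping.keys p \<subseteq> carrier M}"
  "one (monoid_algebra M) = Poly_Mapping.single \<one>\<^bsub>M\<^esub> 1"
  "zero (monoid_algebra M) = 0"
  "add (monoid_algebra M) = (+)"
  "smult (monoid_algebra M) = (\<lambda>c. Poly_Mapping.map ((*) c))"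
  by (simp_all add: monoid_algebra_def)

lemma complex_vs_monoid_algebra: "complex_vs (monoid_algebra M)"
proof (rule complex_vsI)
  fix c d :: complex and x :: "'a \<Rightarrow>\<^sub>0 complex"
  show "x \<in> carrier (monoid_algebra M) \<Longrightarrow> c \<odot>\<^bsub>monoid_algebra M\<^esub> x \<in> carrier (monoid_algebra M)"
    using keys_pmap_times by fastforce
  show "(c + d) \<odot>\<^bsub>monoid_algebra M\<^esub> x = c \<odot>\<^bsub>monoid_algebra M\<^esub> x \<oplus>\<^bsub>monoid_algebra M\<^esub> d \<odot>\<^bsub>monoid_algebra M\<^esub> x"
    by (rule poly_mapping_eqI) (simp add: lookup_pmap_times lookup_add algebra_simps)
  show "(c * d) \<odot>\<^bsub>monoid_algebra M\<^esub> x = c \<odot>\<^bsub>monoid_algebra M\<^esub> (d \<odot>\<^bsub>monoid_algebra M\<^esub> x)"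
    by (rule poly_mapping_eqI) (simp add: lookup_pmap_times)
  show "1 \<odot>\<^bsub>monoid_algebra M\<^esub> x = x" "0 \<odot>\<^bsub>monoid_algebra M\<^esub> x = \<zero>\<^bsub>monoid_algebra M\<^esub>"
    by (rule poly_mapping_eqI, simp add: lookup_pmap_times)+
qed (auto simp: keys_plus_subset pmap_times_add ac_simps dest!: subsetD[OF Poly_Mapping.keys_add])

text \<open>Padding both key sets, as in \<open>lin_ext_superset\<close>, makes the convolution
  visibly bilinear.\<close>

lemma monoid_algebra_mult_superset:
  assumes "finite A" "finite B" "Poly_Mapping.keys p \<subseteq> A" "Poly_Mapping.keys q \<subseteq> B"
  shows "p \<otimes>\<^bsub>monoid_algebra M\<^esub> q = (\<Sum>a\<in>A. \<Sum>b\<in>B.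
       Poly_Mapping.single (a \<otimes>\<^bsub>M\<^esub> b) (Poly_Mapping.lookup p a * Poly_Mapping.lookup q b))"
proof -
  have "(\<Sum>b\<in>Poly_Mapping.keys q. Poly_Mapping.single (a \<otimes>\<^bsub>M\<^esub> b) (Poly_Mapping.lookup p a * Poly_Mapping.lookup q b))
    = (\<Sum>b\<in>B. Poly_Mapping.single (a \<otimes>\<^bsub>M\<^esub> b) (Poly_Mapping.lookup p a * Poly_Mapping.lookup q b))" for a
    by (rule sum.mono_neutral_left) (use assms in \<open>auto simp: in_keys_iff\<close>)
  hence "p \<otimes>\<^bsub>monoid_algebra M\<^esub> q = (\<Sum>a\<in>Poly_Mapping.keys p. \<Sum>b\<in>B.
       Poly_Mapping.single (a \<otimes>\<^bsub>M\<^esub> b) (Poly_Mapping.lookup p a * Poly_Mapping.lookup q b))"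
    by (simp add: monoid_algebra_def)
  also have "\<dots> = (\<Sum>a\<in>A. \<Sum>b\<in>B.
       Poly_Mapping.single (a \<otimes>\<^bsub>M\<^esub> b) (Poly_Mapping.lookup p a * Poly_Mapping.lookup q b))"
    by (rule sum.mono_neutral_left) (use assms in \<open>auto simp: in_keys_iff\<close>)
  finally show ?thesis .
qed

lemma monoid_algebra_mult_add_left:
  "(p + p') \<otimes>\<^bsub>monoid_algebra M\<^esub> q = p \<otimes>\<^bsub>monoid_algebra M\<^esub> q + p' \<otimes>\<^bsub>monoid_algebra M\<^esub> q"
  by (simp add: monoid_algebra_mult_superset[of "Poly_Mapping.keys p \<union> Poly_Mapping.keys p'" "Poly_Mapping.keys q"]
      keys_plus_subset lookup_add single_add distrib_right sum.distrib)

lemma monoid_algebra_mult_add_right: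
  "q \<otimes>\<^bsub>monoid_algebra M\<^esub> (p + p') = q \<otimes>\<^bsub>monoid_algebra M\<^esub> p + q \<otimes>\<^bsub>monoid_algebra M\<^esub> p'"
  by (simp add: monoid_algebra_mult_superset[of "Poly_Mapping.keys q" "Poly_Mapping.keys p \<union> Poly_Mapping.keys p'"]
      keys_plus_subset lookup_add single_add distrib_left sum.distrib)

lemma monoid_algebra_mult_zero [simp]:
  "0 \<otimes>\<^bsub>monoid_algebra M\<^esub> q = 0" "q \<otimes>\<^bsub>monoid_algebra M\<^esub> 0 = 0"
  by (simp_all add: monoid_algebra_def)

lemma monoid_algebra_single_mult:
  "Poly_Mapping.single a c \<otimes>\<^bsub>monoid_algebra M\<^esub> Poly_Mapping.single b d = Poly_Mapping.single (a \<otimes>\<^bsub>M\<^esub> b) (c * d)"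
  using monoid_algebra_mult_superset[of "{a}" "{b}" "Poly_Mapping.single a c" "Poly_Mapping.single b d" M]
  by simp

lemmas monoid_algebra_mult = monoid_algebra_mult_add_left monoid_algebra_mult_add_right monoid_algebra_single_mult

lemma complex_alg_monoid_algebra:
  assumes "monoid M" shows "complex_alg (monoid_algebra M)"
proof -
  interpret M: monoid M by fact
  let ?A = "monoid_algebra M"
  have closed: "Poly_Mapping.keys (x \<otimes>\<^bsub>?A\<^esub> y) \<subseteq> carrier M"
    if "Poly_Mapping.keys x \<subseteq> carrier M" "Poly_Mapping.keys y \<subseteq> carrier M" for x y
    using that(1)
  proof (induction x rule: pm_induct)
    case (single a c p)
    have "Poly_Mapping.keys (Poly_Mapping.single a c \<otimes>\<^bsub>?A\<^esub> y) \<subseteq> carrier M"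
      using that(2)
      by (induction y rule: pm_induct)
        (auto simp: monoid_algebra_mult single dest!: subsetD[OF Poly_Mapping.keys_add] split: if_splits)
    thus ?case using single by (simp add: monoid_algebra_mult_add_left keys_plus_subset)
  qed simp
  show ?thesis
  proof (rule complex_algI)
    show "complex_vs ?A" by (rule complex_vs_monoid_algebra)
    show "x \<otimes>\<^bsub>?A\<^esub> y \<in> carrier ?A" if "x \<in> carrier ?A" "y \<in> carrier ?A" for x y
      using closed that by simp
    show "\<one>\<^bsub>?A\<^esub> \<in> carrier ?A" by simp
    show "\<one>\<^bsub>?A\<^esub> \<otimes>\<^bsub>?A\<^esub> x = x" if "x \<in> carrier ?A" for x
      using that[simplified]
      by (induction x rule: pm_induct) (auto simp: monoid_algebra_mult)
    show "x \<otimes>\<^bsub>?A\<^esub> \<one>\<^bsub>?A\<^esub> = x" if "x \<in> carrier ?A" for x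
      using that[simplified]
      by (induction x rule: pm_induct) (auto simp: monoid_algebra_mult)
    show "(x \<otimes>\<^bsub>?A\<^esub> y) \<otimes>\<^bsub>?A\<^esub> z = x \<otimes>\<^bsub>?A\<^esub> (y \<otimes>\<^bsub>?A\<^esub> z)"
      if "x \<in> carrier ?A" "y \<in> carrier ?A" "z \<in> carrier ?A" for x y z
      using that(1)[simplified]
    proof (induction x rule: pm_induct)
      case (single a c p)
      have "(Poly_Mapping.single a c \<otimes>\<^bsub>?A\<^esub> y) \<otimes>\<^bsub>?A\<^esub> z = Poly_Mapping.single a c \<otimes>\<^bsub>?A\<^esub> (y \<otimes>\<^bsub>?A\<^esub> z)"
        using that(2)[simplified]
      proof (induction y rule: pm_induct)
        case (single b d y)
        have "(Poly_Mapping.single a c \<otimes>\<^bsub>?A\<^esub> Poly_Mapping.single b d) \<otimes>\<^bsub>?A\<^esub> z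
           = Poly_Mapping.single a c \<otimes>\<^bsub>?A\<^esub> (Poly_Mapping.single b d \<otimes>\<^bsub>?A\<^esub> z)"
          using that(3)[simplified]
          by (induction z rule: pm_induct)
            (use \<open>a \<in> carrier M\<close> single in \<open>auto simp: monoid_algebra_mult M.m_assoc mult.assoc\<close>)
        thus ?case using single by (simp add: monoid_algebra_mult)
      qed simp
      thus ?case using single by (simp add: monoid_algebra_mult)
    qed simp
    fix c :: complex and x y assume xy: "x \<in> carrier ?A" "y \<in> carrier ?A"
    have keysx: "Poly_Mapping.keys (Poly_Mapping.map ((*) c) x) \<subseteq> Poly_Mapping.keys x" for x :: "'a \<Rightarrow>\<^sub>0 complex"
      by (rule keys_pmap_times)
    have pms: "Poly_Mapping.map ((*) c) (sum f B) = (\<Sum>b\<in>B. Poly_Mapping.map ((*) c) (f b))" if "finite B"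
      for f :: "'a \<Rightarrow> ('a \<Rightarrow>\<^sub>0 complex)" and B
      using that
    proof induction
      case empty show ?case by simp
    qed (auto simp: pmap_times_add)
    show "(c \<odot>\<^bsub>?A\<^esub> x) \<otimes>\<^bsub>?A\<^esub> y = c \<odot>\<^bsub>?A\<^esub> (x \<otimes>\<^bsub>?A\<^esub> y)"
      "x \<otimes>\<^bsub>?A\<^esub> (c \<odot>\<^bsub>?A\<^esub> y) = c \<odot>\<^bsub>?A\<^esub> (x \<otimes>\<^bsub>?A\<^esub> y)"
      by (simp_all add: monoid_algebra_mult_superset[of "Poly_Mapping.keys x" "Poly_Mapping.keys y"]
          keysx lookup_pmap_times pms pmap_times_single mult_ac)
  qed (auto simp: monoid_algebra_mult)
qed

text \<open>Evaluation of a product becomes an iterated evaluation. When \<open>h\<close> turns the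
  product of two keys into a composition, in either order, this makes left and right representations
  by words multiplicative.\<close>

lemma (in complex_vs) lin_ext_mult:
  assumes M: "monoid M" and h: "h \<in> carrier M \<rightarrow> carrier V"
    and p: "Poly_Mapping.keys p \<subseteq> carrier M" and q: "Poly_Mapping.keys q \<subseteq> carrier M"
  shows "lin_ext V h (p \<otimes>\<^bsub>monoid_algebra M\<^esub> q) = lin_ext V (\<lambda>a. lin_ext V (\<lambda>b. h (a \<otimes>\<^bsub>M\<^esub> b)) q) p"
proof -
  interpret M: monoid M by fact
  interpret A: complex_alg "monoid_algebra M" by (rule complex_alg_monoid_algebra[OF M])
  have hab: "(\<lambda>b. h (a \<otimes>\<^bsub>M\<^esub> b)) \<in> carrier M \<rightarrow> carrier V" if "a \<in> carrier M" for a
    using h that by auto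
  have ha: "(\<lambda>a. lin_ext V (\<lambda>b. h (a \<otimes>\<^bsub>M\<^esub> b)) q) \<in> carrier M \<rightarrow> carrier V"
    using lin_ext_closed[OF hab q] by auto
  show ?thesis using p
  proof (induction p rule: pm_induct)
    case (single a c p)
    have ac: "Poly_Mapping.keys (Poly_Mapping.single a c) \<subseteq> carrier M" using single by simp
    have "lin_ext V h (Poly_Mapping.single a c \<otimes>\<^bsub>monoid_algebra M\<^esub> q) = c \<odot> lin_ext V (\<lambda>b. h (a \<otimes>\<^bsub>M\<^esub> b)) q"
      using q
    proof (induction q rule: pm_induct)
      case (single b d q)
      have k: "Poly_Mapping.keys (Poly_Mapping.single a c \<otimes>\<^bsub>monoid_algebra M\<^esub> q) \<subseteq> carrier M"
        using A.m_closed ac single by simp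
      have hb: "h (a \<otimes>\<^bsub>M\<^esub> b) \<in> carrier V" using h \<open>a \<in> carrier M\<close> single by auto
      have ab: "a \<otimes>\<^bsub>M\<^esub> b \<in> carrier M" using \<open>a \<in> carrier M\<close> single by auto
      have e: "lin_ext V h (Poly_Mapping.single (a \<otimes>\<^bsub>M\<^esub> b) (c * d) + Poly_Mapping.single a c \<otimes>\<^bsub>monoid_algebra M\<^esub> q)
        = (c * d) \<odot> h (a \<otimes>\<^bsub>M\<^esub> b) \<oplus> lin_ext V h (Poly_Mapping.single a c \<otimes>\<^bsub>monoid_algebra M\<^esub> q)"
        by (subst lin_ext_add[OF h]) (use k hb ab in \<open>auto simp: lin_ext_single\<close>)
      have e2: "lin_ext V (\<lambda>b. h (a \<otimes>\<^bsub>M\<^esub> b)) (Poly_Mapping.single b d + q)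
         = d \<odot> h (a \<otimes>\<^bsub>M\<^esub> b) \<oplus> lin_ext V (\<lambda>b. h (a \<otimes>\<^bsub>M\<^esub> b)) q"
        by (subst lin_ext_add[OF hab[OF \<open>a \<in> carrier M\<close>]])
          (use single hb in \<open>auto simp: lin_ext_single\<close>)
      show ?case using single hb lin_ext_closed[OF hab[OF \<open>a \<in> carrier M\<close>] single(2)]
        by (simp add: monoid_algebra_mult e e2 sm_add_right sm_mult)
    qed simp
    moreover have "Poly_Mapping.keys (p \<otimes>\<^bsub>monoid_algebra M\<^esub> q) \<subseteq> carrier M"
      "Poly_Mapping.keys (Poly_Mapping.single a c \<otimes>\<^bsub>monoid_algebra M\<^esub> q) \<subseteq> carrier M"
      using A.m_closed single ac q by auto
    ultimately show ?case using single ac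
      by (simp add: monoid_algebra_mult lin_ext_add[OF h] lin_ext_add[OF ha] lin_ext_single
          funcset_mem[OF ha \<open>a \<in> carrier M\<close>])
  qed simp
qed

subsection \<open>Quotients\<close>

context complex_alg
begin

text \<open>Stability under scalars contains multiplication by -1, which supplies the negatives of
  an additive subgroup.\<close>

lemma linear_idealI:
  assumes "N \<subseteq> carrier A" "\<zero> \<in> N"
    and add: "\<And>x y. \<lbrakk>x \<in> N; y \<in> N\<rbrakk> \<Longrightarrow> x \<oplus> y \<in> N"
    and sm: "\<And>c x. x \<in> N \<Longrightarrow> c \<odot> x \<in> N"
    and "\<And>a x. \<lbrakk>a \<in> N; x \<in> carrier A\<rbrakk> \<Longrightarrow> x \<otimes> a \<in> N"
    and "\<And>a x. \<lbrakk>a \<in> N; x \<in> carrier A\<rbrakk> \<Longrightarrow> a \<otimes> x \<in> N"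
  shows "ideal N A"
proof (rule idealI[OF ring_axioms])
  show "subgroup N (add_monoid A)"
  proof (rule add.subgroupI)
    fix a assume "a \<in> N"
    thus "\<ominus> a \<in> N" using sm[of a "-1"] assms(1) by (simp add: minus_eq_sm subset_iff)
  qed (use assms in auto)
qed (use assms in auto)

text \<open>\<open>ideal\<close> refers to the ring structure only; scalars enter because c x is the
  product of c 1 with x.\<close>

lemma ideal_sm:
  assumes "ideal I A" "i \<in> I" shows "c \<odot> i \<in> I"
proof -
  have i: "i \<in> carrier A" using assms additive_subgroup.a_subset ideal.axioms(1) by blast
  have "(c \<odot> \<one>) \<otimes> i = c \<odot> i" using i by (simp add: sm_mult_left)
  thus ?thesis using ideal.I_l_closed[OF assms, of "c \<odot> \<one>"] by simp
qed

context
  fixes I assumes I: "ideal I A"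
begin

interpretation I: ideal I A by (rule I)

lemma mem_coset: "z \<in> I +> x \<longleftrightarrow> (\<exists>i\<in>I. z = i \<oplus> x)"
  by (auto simp: a_r_coset_def')

lemma carrier_quot: "carrier (quot_algebra A I) = (\<lambda>x. I +> x) ` carrier A"
  by (auto simp: quot_algebra_def FactRing_def A_RCOSETS_def')

lemma quot_carrierE:
  assumes "z \<in> carrier (quot_algebra A I)" obtains x where "x \<in> carrier A" "z = I +> x"
  using assms by (auto simp: carrier_quot)

lemma quot_one: "\<one>\<^bsub>quot_algebra A I\<^esub> = I +> \<one>"
  by (simp add: quot_algebra_def FactRing_def)

lemma quot_zero: "\<zero>\<^bsub>quot_algebra A I\<^esub> = I +> \<zero>"
proof -
  have "i \<oplus> \<zero> = i" if "i \<in> I" for i using that I.a_subset by auto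
  hence "I +> \<zero> = I" by (force simp: a_r_coset_def')
  thus ?thesis by (simp add: quot_algebra_def FactRing_def)
qed

lemma quot_add:
  "\<lbrakk>x \<in> carrier A; y \<in> carrier A\<rbrakk> \<Longrightarrow> (I +> x) \<oplus>\<^bsub>quot_algebra A I\<^esub> (I +> y) = I +> (x \<oplus> y)"
  by (simp add: quot_algebra_def FactRing_def I.a_rcos_sum)

lemma quot_mult:
  "\<lbrakk>x \<in> carrier A; y \<in> carrier A\<rbrakk> \<Longrightarrow> (I +> x) \<otimes>\<^bsub>quot_algebra A I\<^esub> (I +> y) = I +> (x \<otimes> y)"
  by (simp add: quot_algebra_def FactRing_def I.rcoset_mult_add)

lemma coset_eqI:
  assumes "x \<in> carrier A" "i \<in> I" shows "I +> (i \<oplus> x) = I +> x"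
proof -
  have "i \<oplus> x \<in> I +> x" using assms by (auto simp: mem_coset)
  thus ?thesis using a_repr_independence[of "i \<oplus> x" I x] assms I.a_subgroup by simp
qed

text \<open>The definition takes the union of the cosets of c x over all representatives x. These
  cosets coincide: two representatives differ by an element of \<open>I\<close>, and
  \<open>ideal_sm\<close> keeps its multiples in \<open>I\<close>.\<close>

lemma quot_smult:
  assumes "x \<in> carrier A" shows "c \<odot>\<^bsub>quot_algebra A I\<^esub> (I +> x) = I +> (c \<odot> x)"
proof -
  have "I +> (c \<odot> y) = I +> (c \<odot> x)" if "y \<in> I +> x" for y
  proof -
    obtain i where i: "i \<in> I" "y = i \<oplus> x" using \<open>y \<in> I +> x\<close> by (auto simp: mem_coset)
    show ?thesis
      using coset_eqI[of "c \<odot> x" "c \<odot> i"] ideal_sm[OF I i(1)] assms i I.a_subset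
      by (simp add: sm_add_right subset_iff)
  qed
  moreover have "I +> x \<noteq> {}" using I.a_rcos_self[OF assms] by blast
  ultimately show ?thesis unfolding quot_algebra_def by auto
qed

lemmas quot_simps = quot_one quot_zero quot_add quot_mult quot_smult

lemma coset_closed: "x \<in> carrier A \<Longrightarrow> I +> x \<in> carrier (quot_algebra A I)"
  by (simp add: carrier_quot)

lemma complex_alg_quot: "complex_alg (quot_algebra A I)"
proof -
  let ?Q = "quot_algebra A I"
  have vs: "complex_vs ?Q"
  proof (rule complex_vsI)
    fix x y z assume "x \<in> carrier ?Q" "y \<in> carrier ?Q" "z \<in> carrier ?Q"
    thus "x \<oplus>\<^bsub>?Q\<^esub> y \<oplus>\<^bsub>?Q\<^esub> z = x \<oplus>\<^bsub>?Q\<^esub> (y \<oplus>\<^bsub>?Q\<^esub> z)"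
      by (auto elim!: quot_carrierE simp: quot_add a_assoc)
  next
    fix x y assume "x \<in> carrier ?Q" "y \<in> carrier ?Q"
    thus "x \<oplus>\<^bsub>?Q\<^esub> y = y \<oplus>\<^bsub>?Q\<^esub> x" "x \<oplus>\<^bsub>?Q\<^esub> y \<in> carrier ?Q"
      by (auto elim!: quot_carrierE simp: quot_add a_comm coset_closed)
  next
    fix c d and x assume "x \<in> carrier ?Q"
    thus "c \<odot>\<^bsub>?Q\<^esub> x \<in> carrier ?Q" "(c + d) \<odot>\<^bsub>?Q\<^esub> x = c \<odot>\<^bsub>?Q\<^esub> x \<oplus>\<^bsub>?Q\<^esub> d \<odot>\<^bsub>?Q\<^esub> x"
      "(c * d) \<odot>\<^bsub>?Q\<^esub> x = c \<odot>\<^bsub>?Q\<^esub> (d \<odot>\<^bsub>?Q\<^esub> x)" "1 \<odot>\<^bsub>?Q\<^esub> x = x" "0 \<odot>\<^bsub>?Q\<^esub> x = \<zero>\<^bsub>?Q\<^esub>"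
      "\<zero>\<^bsub>?Q\<^esub> \<oplus>\<^bsub>?Q\<^esub> x = x"
      by (auto elim!: quot_carrierE simp: quot_simps coset_closed sm_add_left sm_mult)
  next
    fix c and x y assume "x \<in> carrier ?Q" "y \<in> carrier ?Q"
    thus "c \<odot>\<^bsub>?Q\<^esub> (x \<oplus>\<^bsub>?Q\<^esub> y) = c \<odot>\<^bsub>?Q\<^esub> x \<oplus>\<^bsub>?Q\<^esub> c \<odot>\<^bsub>?Q\<^esub> y"
      by (auto elim!: quot_carrierE simp: quot_simps sm_add_right)
  qed (auto simp: quot_zero coset_closed)
  show ?thesis
  proof (rule complex_algI[OF vs])
    fix x y z assume "x \<in> carrier ?Q" "y \<in> carrier ?Q" "z \<in> carrier ?Q"
    thus "x \<otimes>\<^bsub>?Q\<^esub> y \<otimes>\<^bsub>?Q\<^esub> z = x \<otimes>\<^bsub>?Q\<^esub> (y \<otimes>\<^bsub>?Q\<^esub> z)"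
      "(x \<oplus>\<^bsub>?Q\<^esub> y) \<otimes>\<^bsub>?Q\<^esub> z = x \<otimes>\<^bsub>?Q\<^esub> z \<oplus>\<^bsub>?Q\<^esub> y \<otimes>\<^bsub>?Q\<^esub> z"
      "z \<otimes>\<^bsub>?Q\<^esub> (x \<oplus>\<^bsub>?Q\<^esub> y) = z \<otimes>\<^bsub>?Q\<^esub> x \<oplus>\<^bsub>?Q\<^esub> z \<otimes>\<^bsub>?Q\<^esub> y"
      by (auto elim!: quot_carrierE simp: quot_simps m_assoc l_distr r_distr)
  next
    fix c and x y assume xy: "x \<in> carrier ?Q" "y \<in> carrier ?Q"
    thus "x \<otimes>\<^bsub>?Q\<^esub> y \<in> carrier ?Q"
      by (auto elim!: quot_carrierE simp: quot_mult coset_closed)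
    show "(c \<odot>\<^bsub>?Q\<^esub> x) \<otimes>\<^bsub>?Q\<^esub> y = c \<odot>\<^bsub>?Q\<^esub> (x \<otimes>\<^bsub>?Q\<^esub> y)"
      "x \<otimes>\<^bsub>?Q\<^esub> (c \<odot>\<^bsub>?Q\<^esub> y) = c \<odot>\<^bsub>?Q\<^esub> (x \<otimes>\<^bsub>?Q\<^esub> y)"
      using xy by (auto elim!: quot_carrierE simp: quot_simps sm_mult_left sm_mult_right)
  next
    fix x assume "x \<in> carrier ?Q"
    thus "\<one>\<^bsub>?Q\<^esub> \<otimes>\<^bsub>?Q\<^esub> x = x" "x \<otimes>\<^bsub>?Q\<^esub> \<one>\<^bsub>?Q\<^esub> = x"
      by (auto elim!: quot_carrierE simp: quot_simps)
  qed (auto simp: quot_one coset_closed)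
qed

text \<open>\<open>quot_fun\<close> picks the single element of the image of a coset, so evaluating
  it amounts to constancy of \<open>f\<close> there. The image itself is recorded because
  \<open>act_product\<close> is an equation between images.\<close>

lemma quot_fun_image:
  assumes "x \<in> carrier A" "\<And>i. i \<in> I \<Longrightarrow> f (i \<oplus> x) = f x"
  shows "f ` (I +> x) = {f x}"
proof -
  have "f y = f x" if "y \<in> I +> x" for y using that assms by (auto simp: mem_coset)
  moreover have "x \<in> I +> x" using I.a_rcos_self assms(1) by blast
  ultimately show ?thesis by blast
qed

lemma lin_map_coset_image:
  assumes W: "complex_vs W" and f: "lin_map A W f" and x: "x \<in> carrier A" and z: "\<And>i. i \<in> I \<Longrightarrow> f i = \<zero>\<^bsub>W\<^esub>"
  shows "f ` (I +> x) = {f x}"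
proof (rule quot_fun_image[OF x])
  interpret W: complex_vs W by fact
  show "f (i \<oplus> x) = f x" if "i \<in> I" for i
    using lin_mapD[OF f] that I.a_subset x z by (auto simp: subset_iff)
qed

lemma quot_fun_lin:
  assumes "complex_vs W" "lin_map A W f" "x \<in> carrier A" "\<And>i. i \<in> I \<Longrightarrow> f i = \<zero>\<^bsub>W\<^esub>"
  shows "quot_fun f (I +> x) = f x"
  using lin_map_coset_image[OF assms] by (simp add: quot_fun_def)

lemma lin_map_quot_fun:
  assumes W: "complex_vs W" and f: "lin_map A W f" and z: "\<And>i. i \<in> I \<Longrightarrow> f i = \<zero>\<^bsub>W\<^esub>"
  shows "lin_map (quot_algebra A I) W (quot_fun f)"
  by (rule lin_mapI)
    (auto elim!: quot_carrierE simp: quot_simps quot_fun_lin[OF W f _ z] lin_mapD[OF f])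

end

end

section \<open>Unital algebra homomorphisms\<close>

definition alg_hom :: "(complex, 'a, 'x) module_scheme \<Rightarrow> (complex, 'b, 'y) module_scheme \<Rightarrow> ('a \<Rightarrow> 'b) \<Rightarrow> bool" where
  "alg_hom A B f \<longleftrightarrow> lin_map A B f \<and> f \<one>\<^bsub>A\<^esub> = \<one>\<^bsub>B\<^esub>
    \<and> (\<forall>x\<in>carrier A. \<forall>y\<in>carrier A. f (x \<otimes>\<^bsub>A\<^esub> y) = f x \<otimes>\<^bsub>B\<^esub> f y)"

lemma alg_homD:
  assumes "alg_hom A B f"
  shows "lin_map A B f" "f \<one>\<^bsub>A\<^esub> = \<one>\<^bsub>B\<^esub>"
    and "\<lbrakk>x \<in> carrier A; y \<in> carrier A\<rbrakk> \<Longrightarrow> f (x \<otimes>\<^bsub>A\<^esub> y) = f x \<otimes>\<^bsub>B\<^esub> f y"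
  using assms by (auto simp: alg_hom_def)

text \<open>The kernel is an ideal containing \<open>S\<close>, hence contains the ideal generated
  by \<open>S\<close>.\<close>

lemma alg_hom_genideal:
  assumes A: "complex_alg A" and B: "complex_alg B" and f: "alg_hom A B f"
    and S: "S \<subseteq> carrier A" "\<And>s. s \<in> S \<Longrightarrow> f s = \<zero>\<^bsub>B\<^esub>" and x: "x \<in> Idl\<^bsub>A\<^esub> S"
  shows "f x = \<zero>\<^bsub>B\<^esub>"
proof -
  interpret A: complex_alg A by fact
  interpret B: complex_alg B by fact
  note l = lin_mapD[OF alg_homD(1)[OF f]]
  have "ideal {x \<in> carrier A. f x = \<zero>\<^bsub>B\<^esub>} A"
    by (rule A.linear_idealI)
      (auto simp: l alg_homD[OF f] lin_map_zero[OF A.complex_vs_axioms B.complex_vs_axioms])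
  from A.genideal_minimal[OF this, of S] show ?thesis using S x by auto
qed

lemma alg_hom_quot_fun:
  assumes A: "complex_alg A" and B: "complex_alg B" and f: "alg_hom A B f" and I: "ideal I A"
    and z: "\<And>i. i \<in> I \<Longrightarrow> f i = \<zero>\<^bsub>B\<^esub>"
  shows "alg_hom (quot_algebra A I) B (quot_fun f)"
proof -
  interpret A: complex_alg A by fact
  interpret B: complex_alg B by fact
  note q = A.quot_fun_lin[OF I B.complex_vs_axioms alg_homD(1)[OF f] _ z]
  show ?thesis unfolding alg_hom_def
    using A.lin_map_quot_fun[OF I B.complex_vs_axioms alg_homD(1)[OF f] z]
    by (auto elim!: A.quot_carrierE[OF I] simp: A.quot_simps[OF I] q alg_homD[OF f])
qed

subsection \<open>Opposite and conjugate algebras\<close>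

lemma opp_algebra_simps [simp]:
  "carrier (opp_algebra B) = carrier B" "one (opp_algebra B) = one B" "zero (opp_algebra B) = zero B"
  "add (opp_algebra B) = add B" "smult (opp_algebra B) = smult B"
  "mult (opp_algebra B) = (\<lambda>a b. b \<otimes>\<^bsub>B\<^esub> a)"
  by (simp_all add: opp_algebra_def)

lemma conj_algebra_simps [simp]:
  "carrier (conj_algebra B) = carrier B" "one (conj_algebra B) = one B" "zero (conj_algebra B) = zero B"
  "add (conj_algebra B) = add B" "smult (conj_algebra B) = (\<lambda>c. smult B (cnj c))"
  "mult (conj_algebra B) = mult B"
  by (simp_all add: conj_algebra_def)

lemma complex_alg_opp:
  assumes "complex_alg B" shows "complex_alg (opp_algebra B)"
proof -
  interpret B: complex_alg B by fact
  have "complex_vs (opp_algebra B)"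
    by (rule complex_vsI) (auto simp: B.sm_add_left B.sm_add_right B.sm_mult B.a_ac)
  thus ?thesis
    by (rule complex_algI) (auto simp: B.m_assoc B.l_distr B.r_distr B.sm_mult_left B.sm_mult_right)
qed

lemma complex_alg_conj:
  assumes "complex_alg B" shows "complex_alg (conj_algebra B)"
proof -
  interpret B: complex_alg B by fact
  have "complex_vs (conj_algebra B)"
    by (rule complex_vsI) (auto simp: B.sm_add_left B.sm_add_right B.sm_mult B.a_ac)
  thus ?thesis
    by (rule complex_algI) (auto simp: B.m_assoc B.l_distr B.r_distr B.sm_mult_left B.sm_mult_right)
qed

subsection \<open>Presented algebras\<close>

abbreviation word_monoid :: "'g list monoid" where
  "word_monoid \<equiv> \<lparr>carrier = UNIV, mult = (@), one = []\<rparr>"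

lemma monoid_word_monoid: "monoid word_monoid"
  by (rule monoidI) auto

lemma complex_alg_free: "complex_alg free_algebra"
  unfolding free_algebra_def by (rule complex_alg_monoid_algebra[OF monoid_word_monoid])

lemma free_algebra_simps [simp]:
  "carrier free_algebra = UNIV" "one free_algebra = fmono 1 []" "zero free_algebra = 0"
  "add free_algebra = (+)" "smult free_algebra = (\<lambda>c. Poly_Mapping.map ((*) c))"
  by (simp_all add: free_algebra_def)

lemma fmono_mult: "fmono c w \<otimes>\<^bsub>free_algebra\<^esub> fmono d w' = fmono (c * d) (w @ w')"
  by (simp add: free_algebra_def monoid_algebra_single_mult)

abbreviation word_val :: "(complex, 'b, 'x) module_scheme \<Rightarrow> ('g \<Rightarrow> 'b) \<Rightarrow> 'g list \<Rightarrow> 'b" where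
  "word_val B \<phi> w \<equiv> foldr (\<lambda>g r. \<phi> g \<otimes>\<^bsub>B\<^esub> r) w \<one>\<^bsub>B\<^esub>"

context complex_vs
begin

lemma lin_map_lin_ext_free: "(\<And>w. h w \<in> carrier V) \<Longrightarrow> lin_map free_algebra V (lin_ext V h)"
  by (rule lin_mapI) (auto simp: lin_ext_closed[where D = UNIV] lin_ext_add[where D = UNIV] lin_ext_smult[where D = UNIV])

lemma lin_map_minus:
  assumes f: "lin_map (monoid_algebra M) V f" and "p \<in> carrier (monoid_algebra M)" "q \<in> carrier (monoid_algebra M)"
  shows "f (p - q) = f p \<ominus> f q"
proof -
  interpret M: complex_vs "monoid_algebra M" by (rule complex_vs_monoid_algebra)
  have e: "p - q = p \<oplus>\<^bsub>monoid_algebra M\<^esub> (- 1) \<odot>\<^bsub>monoid_algebra M\<^esub> q"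
    by (rule poly_mapping_eqI) (simp add: lookup_minus lookup_add lookup_pmap_times)
  have "f (p - q) = f p \<oplus> (-1) \<odot> f q"
    unfolding e by (simp only: lin_mapD[OF f] assms M.sm_closed)
  thus ?thesis using lin_mapD(1)[OF f] assms by (simp add: diff_eq_sm)
qed

lemma lin_map_minus_free: "lin_map free_algebra V f \<Longrightarrow> f (p - q) = f p \<ominus> f q"
  using lin_map_minus[of word_monoid f p q] by (simp add: free_algebra_def)

end

context complex_alg
begin

lemma word_val_closed: "(\<And>g. \<phi> g \<in> carrier A) \<Longrightarrow> word_val A \<phi> w \<in> carrier A"
  by (induction w) auto

lemma word_val_append:
  "(\<And>g. \<phi> g \<in> carrier A) \<Longrightarrow> word_val A \<phi> (w @ w') = word_val A \<phi> w \<otimes> word_val A \<phi> w'"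
  using word_val_closed[of \<phi>] by (induction w) (auto simp: m_assoc)

lemma alg_ext_mono:
  "(\<And>g. \<phi> g \<in> carrier A) \<Longrightarrow> alg_ext A \<phi> (fmono c w) = c \<odot> word_val A \<phi> w"
  unfolding alg_ext_def by (rule lin_ext_single) (rule word_val_closed)

lemma lin_map_mult_right: "x \<in> carrier A \<Longrightarrow> lin_map A A (\<lambda>y. y \<otimes> x)"
  by (rule lin_mapI) (auto simp: l_distr sm_mult_left)

lemma lin_map_mult_left: "x \<in> carrier A \<Longrightarrow> lin_map A A (\<lambda>y. x \<otimes> y)"
  by (rule lin_mapI) (auto simp: r_distr sm_mult_right)

text \<open>Universal property of the free algebra: concatenation goes to the product by
  \<open>word_val_append\<close>, and \<open>lin_ext_mult\<close> extends this to linear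
  combinations.\<close>

lemma alg_hom_alg_ext:
  assumes \<phi>: "\<And>g. \<phi> g \<in> carrier A"
  shows "alg_hom free_algebra A (alg_ext A \<phi>)"
proof -
  let ?W = "word_val A \<phi>"
  have W: "?W w \<in> carrier A" for w by (rule word_val_closed[OF \<phi>])
  have lm: "lin_map free_algebra A (alg_ext A \<phi>)"
    unfolding alg_ext_def using W by (rule lin_map_lin_ext_free)
  have "alg_ext A \<phi> (p \<otimes>\<^bsub>free_algebra\<^esub> q) = alg_ext A \<phi> p \<otimes> alg_ext A \<phi> q" for p q
  proof -
    have q: "lin_ext A ?W q \<in> carrier A" using W by (intro lin_ext_closed[where D = UNIV]) auto
    have "lin_ext A ?W (p \<otimes>\<^bsub>free_algebra\<^esub> q) = lin_ext A (\<lambda>a. lin_ext A (\<lambda>b. ?W (a @ b)) q) p"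
      unfolding free_algebra_def using W by (subst lin_ext_mult[OF monoid_word_monoid]) auto
    also have "(\<lambda>a. lin_ext A (\<lambda>b. ?W (a @ b)) q) = (\<lambda>a. ?W a \<otimes> lin_ext A ?W q)"
    proof
      fix a
      have "?W a \<otimes> lin_ext A ?W q = lin_ext A ((\<otimes>) (?W a) \<circ> ?W) q"
        by (rule lin_map_lin_ext[where D = UNIV, OF complex_vs_axioms complex_vs_axioms lin_map_mult_left[OF W]])
          (use W in auto)
      thus "lin_ext A (\<lambda>b. ?W (a @ b)) q = ?W a \<otimes> lin_ext A ?W q"
        by (simp add: o_def word_val_append[OF \<phi>] del: foldr_append)
    qed
    also have "lin_ext A (\<lambda>a. ?W a \<otimes> lin_ext A ?W q) p = lin_ext A ?W p \<otimes> lin_ext A ?W q"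
      using lin_map_lin_ext[where D = UNIV, OF complex_vs_axioms complex_vs_axioms lin_map_mult_right[OF q], of ?W p] W
      by (simp add: o_def)
    finally show ?thesis by (simp add: alg_ext_def)
  qed
  moreover have "alg_ext A \<phi> (fmono 1 []) = \<one>" by (subst alg_ext_mono[OF \<phi>]) simp_all
  ultimately show ?thesis using lm by (simp add: alg_hom_def)
qed

end

text \<open>Common form of \<open>uq_algebra\<close> and \<open>oq_algebra\<close>, so that
  quotients by generated ideals are treated once for arbitrary relators.\<close>

definition pres_algebra :: "('g list \<Rightarrow>\<^sub>0 complex) set \<Rightarrow> (complex, ('g list \<Rightarrow>\<^sub>0 complex) set) module" where
  "pres_algebra R = quot_algebra free_algebra (Idl\<^bsub>free_algebra\<^esub> R)"

definition pres_mono :: "('g list \<Rightarrow>\<^sub>0 complex) set \<Rightarrow> complex \<Rightarrow> 'g list \<Rightarrow> ('g list \<Rightarrow>\<^sub>0 complex) set" where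
  "pres_mono R c w = Idl\<^bsub>free_algebra\<^esub> R +>\<^bsub>free_algebra\<^esub> fmono c w"

interpretation Free: complex_alg free_algebra by (rule complex_alg_free)

lemma ideal_pres: "ideal (Idl\<^bsub>free_algebra\<^esub> R) free_algebra"
  by (rule Free.genideal_ideal) simp

lemma complex_alg_pres: "complex_alg (pres_algebra R)"
  unfolding pres_algebra_def by (rule Free.complex_alg_quot[OF ideal_pres])

context
  fixes R :: "('g list \<Rightarrow>\<^sub>0 complex) set"
begin

interpretation P: complex_alg "pres_algebra R" by (rule complex_alg_pres)

lemma pres_mono_closed [simp]: "pres_mono R c w \<in> carrier (pres_algebra R)"
  unfolding pres_algebra_def pres_mono_def by (rule Free.coset_closed[OF ideal_pres]) simp

lemma pres_mono_mult [simp]: "pres_mono R c w \<otimes>\<^bsub>pres_algebra R\<^esub> pres_mono R d w' = pres_mono R (c * d) (w @ w')"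
  unfolding pres_algebra_def pres_mono_def by (subst Free.quot_mult[OF ideal_pres]) (simp_all add: fmono_mult)

lemma pres_mono_smult [simp]: "c \<odot>\<^bsub>pres_algebra R\<^esub> pres_mono R d w = pres_mono R (c * d) w"
  unfolding pres_algebra_def pres_mono_def by (subst Free.quot_smult[OF ideal_pres]) (simp_all add: pmap_times_single)

lemma pres_one: "\<one>\<^bsub>pres_algebra R\<^esub> = pres_mono R 1 []"
  unfolding pres_algebra_def pres_mono_def by (subst Free.quot_one[OF ideal_pres]) simp

lemma pres_mono_add [simp]: "pres_mono R c w \<oplus>\<^bsub>pres_algebra R\<^esub> pres_mono R d w = pres_mono R (c + d) w"
  unfolding pres_algebra_def pres_mono_def by (subst Free.quot_add[OF ideal_pres]) (simp_all add: single_add)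

lemma pres_mono_0: "pres_mono R 0 w = \<zero>\<^bsub>pres_algebra R\<^esub>"
  using P.sm_0[of "pres_mono R 1 w"] by simp

lemma pres_zero: "\<zero>\<^bsub>pres_algebra R\<^esub> = Idl\<^bsub>free_algebra\<^esub> R +>\<^bsub>free_algebra\<^esub> 0"
  using Free.quot_zero[OF ideal_pres[of R]] by (simp add: pres_algebra_def)

lemma pres_add: "(Idl\<^bsub>free_algebra\<^esub> R +>\<^bsub>free_algebra\<^esub> p) \<oplus>\<^bsub>pres_algebra R\<^esub> (Idl\<^bsub>free_algebra\<^esub> R +>\<^bsub>free_algebra\<^esub> q)
    = Idl\<^bsub>free_algebra\<^esub> R +>\<^bsub>free_algebra\<^esub> (p + q)"
  unfolding pres_algebra_def by (subst Free.quot_add[OF ideal_pres]) simp_all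

lemma pres_carrierE:
  assumes "z \<in> carrier (pres_algebra R)"
  obtains p where "z = Idl\<^bsub>free_algebra\<^esub> R +>\<^bsub>free_algebra\<^esub> p"
  using assms Free.quot_carrierE[OF ideal_pres[of R], of z] unfolding pres_algebra_def by blast

lemma pres_rel:
  assumes "r \<in> R" shows "Idl\<^bsub>free_algebra\<^esub> R +>\<^bsub>free_algebra\<^esub> r = \<zero>\<^bsub>pres_algebra R\<^esub>"
proof -
  have "r \<in> Idl\<^bsub>free_algebra\<^esub> R" using Free.genideal_self[of R] assms by auto
  from Free.coset_eqI[OF ideal_pres _ this, of 0] show ?thesis by (simp add: pres_zero)
qed

lemma pres_rel2:
  assumes "fmono c w - fmono d w' \<in> R" shows "pres_mono R c w = pres_mono R d w'"
proof -
  have "pres_mono R c w = (Idl\<^bsub>free_algebra\<^esub> R +>\<^bsub>free_algebra\<^esub> (fmono c w - fmono d w')) \<oplus>\<^bsub>pres_algebra R\<^esub> pres_mono R d w'"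
    by (simp add: pres_mono_def pres_add)
  also have "\<dots> = pres_mono R d w'" by (simp add: pres_rel[OF assms])
  finally show ?thesis .
qed

text \<open>The relator has the shape of the one for E F - F E; moving the negative terms across
  keeps subtraction out of the quotient.\<close>

lemma pres_rel4:
  assumes "fmono c w - fmono c' w' - (fmono d v - fmono d' v') \<in> R"
  shows "pres_mono R c w \<oplus>\<^bsub>pres_algebra R\<^esub> pres_mono R d' v' = pres_mono R c' w' \<oplus>\<^bsub>pres_algebra R\<^esub> pres_mono R d v"
proof -
  have "pres_mono R c w \<oplus>\<^bsub>pres_algebra R\<^esub> pres_mono R d' v' =
     (Idl\<^bsub>free_algebra\<^esub> R +>\<^bsub>free_algebra\<^esub> (fmono c w - fmono c' w' - (fmono d v - fmono d' v')))
       \<oplus>\<^bsub>pres_algebra R\<^esub> (pres_mono R c' w' \<oplus>\<^bsub>pres_algebra R\<^esub> pres_mono R d v)"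
    by (simp add: pres_mono_def pres_add)
  thus ?thesis by (simp add: pres_rel[OF assms])
qed

text \<open>Cosets of words are reached from the unit by left multiplication with generators, and
  every coset is a linear combination of them.\<close>

lemma pres_induct [consumes 1, case_names one gen add smult]:
  assumes "z \<in> carrier (pres_algebra R)"
    and one: "Q \<one>\<^bsub>pres_algebra R\<^esub>"
    and gen: "\<And>g z. z \<in> carrier (pres_algebra R) \<Longrightarrow> Q z \<Longrightarrow> Q (pres_mono R 1 [g] \<otimes>\<^bsub>pres_algebra R\<^esub> z)"
    and add: "\<And>y z. \<lbrakk>y \<in> carrier (pres_algebra R); z \<in> carrier (pres_algebra R); Q y; Q z\<rbrakk> \<Longrightarrow> Q (y \<oplus>\<^bsub>pres_algebra R\<^esub> z)"
    and smult: "\<And>c z. z \<in> carrier (pres_algebra R) \<Longrightarrow> Q z \<Longrightarrow> Q (c \<odot>\<^bsub>pres_algebra R\<^esub> z)"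
  shows "Q z"
proof -
  have w: "Q (pres_mono R 1 w)" for w
  proof (induction w)
    case (Cons g w)
    thus ?case using gen[of "pres_mono R 1 w" g] by simp
  qed (use one pres_one in simp)
  hence cw: "Q (pres_mono R c w)" for c w using smult[of "pres_mono R 1 w" c] by simp
  obtain p where p: "z = Idl\<^bsub>free_algebra\<^esub> R +>\<^bsub>free_algebra\<^esub> p" using pres_carrierE assms(1) by blast
  have pc: "Idl\<^bsub>free_algebra\<^esub> R +>\<^bsub>free_algebra\<^esub> p \<in> carrier (pres_algebra R)" for p
    unfolding pres_algebra_def by (rule Free.coset_closed[OF ideal_pres]) simp
  have "Poly_Mapping.keys p \<subseteq> UNIV" by simp
  hence "Q (Idl\<^bsub>free_algebra\<^esub> R +>\<^bsub>free_algebra\<^esub> p)"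
  proof (induction p rule: pm_induct)
    case zero
    show ?case using cw[of 0 "[]"] by (simp add: pres_mono_0 pres_zero)
  next
    case (single a c p)
    show ?case using add[OF _ _ cw[of c a] single(3)] pc by (simp add: pres_mono_def pres_add)
  qed
  thus ?thesis using p by simp
qed

end

text \<open>Universal property of a presentation: only the relators are checked, and
  \<open>alg_hom_genideal\<close> passes to the ideal.\<close>

lemma pres_alg_hom:
  assumes B: "complex_alg B" and \<phi>: "\<And>g. \<phi> g \<in> carrier B"
    and R: "\<And>r. r \<in> R \<Longrightarrow> alg_ext B \<phi> r = \<zero>\<^bsub>B\<^esub>"
  shows "alg_hom (pres_algebra R) B (quot_fun (alg_ext B \<phi>))"
    and "quot_fun (alg_ext B \<phi>) (pres_mono R c w) = c \<odot>\<^bsub>B\<^esub> word_val B \<phi> w"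
proof -
  interpret B: complex_alg B by fact
  note h = B.alg_hom_alg_ext[of \<phi>, OF \<phi>]
  have z: "alg_ext B \<phi> i = \<zero>\<^bsub>B\<^esub>" if "i \<in> Idl\<^bsub>free_algebra\<^esub> R" for i
    using alg_hom_genideal[OF complex_alg_free B h _ R that] by simp
  show "alg_hom (pres_algebra R) B (quot_fun (alg_ext B \<phi>))"
    unfolding pres_algebra_def by (rule alg_hom_quot_fun[OF complex_alg_free B h ideal_pres z])
  show "quot_fun (alg_ext B \<phi>) (pres_mono R c w) = c \<odot>\<^bsub>B\<^esub> word_val B \<phi> w"
    unfolding pres_mono_def
    by (subst Free.quot_fun_lin[OF ideal_pres B.complex_vs_axioms alg_homD(1)[OF h] _ z])
      (simp_all add: B.alg_ext_mono[OF \<phi>])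
qed

lemma alg_hom_pres_eqI:
  assumes B: "complex_alg B" and f: "alg_hom (pres_algebra R) B f" and f': "alg_hom (pres_algebra R) B f'"
    and "\<And>g. f (pres_mono R 1 [g]) = f' (pres_mono R 1 [g])" and z: "z \<in> carrier (pres_algebra R)"
  shows "f z = f' z"
  using z by (induction z rule: pres_induct)
    (simp_all add: assms(4) alg_homD[OF f] alg_homD[OF f'] lin_mapD[OF alg_homD(1)[OF f]] lin_mapD[OF alg_homD(1)[OF f']])

subsection \<open>Representations of presented algebras\<close>

text \<open>Words act through an arbitrary family \<open>\<theta>\<close> and not through iterated
  generators, because \<open>foldr\<close> gives left actions and \<open>fold\<close> gives right
  actions, and both are to share the development.\<close>

definition word_act :: "(complex, 'v, 'x) module_scheme \<Rightarrow> ('g list \<Rightarrow> 'v \<Rightarrow> 'v) \<Rightarrow> ('g list \<Rightarrow>\<^sub>0 complex) set \<Rightarrow> 'v \<Rightarrow> 'v" where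
  "word_act V \<theta> z v = quot_fun (lin_ext V (\<lambda>w. \<theta> w v)) z"

locale word_rep = complex_vs V for V :: "(complex, 'v, 'm) module_scheme" (structure) +
  fixes R :: "('g list \<Rightarrow>\<^sub>0 complex) set" and \<theta> :: "'g list \<Rightarrow> 'v \<Rightarrow> 'v"
  assumes lin: "lin_map V V (\<theta> w)"
    and Nil: "v \<in> carrier V \<Longrightarrow> \<theta> [] v = v"
    and rel: "r \<in> R \<Longrightarrow> v \<in> carrier V \<Longrightarrow> lin_ext V (\<lambda>w. \<theta> w v) r = \<zero>"
begin

abbreviation fact :: "('g list \<Rightarrow>\<^sub>0 complex) \<Rightarrow> 'v \<Rightarrow> 'v" where "fact p v \<equiv> lin_ext V (\<lambda>w. \<theta> w v) p"

lemmas closed = lin_mapD(1)[OF lin]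

lemma fact_closed: "v \<in> carrier V \<Longrightarrow> fact p v \<in> carrier V"
  by (rule lin_ext_closed[where D = UNIV]) (auto simp: closed)

lemma fact_lin_left: "v \<in> carrier V \<Longrightarrow> lin_map free_algebra V (\<lambda>p. fact p v)"
  by (rule lin_map_lin_ext_free) (simp add: closed)

lemma fact_plus: "v \<in> carrier V \<Longrightarrow> fact (p + q) v = fact p v \<oplus> fact q v"
  using lin_mapD(2)[OF fact_lin_left, of v p q] by simp

lemma fact_single: "v \<in> carrier V \<Longrightarrow> fact (fmono c w) v = c \<odot> \<theta> w v"
  by (rule lin_ext_single) (simp add: closed)

lemma fact_lin_right: "lin_map V V (fact p)"
proof -
  have "Poly_Mapping.keys p \<subseteq> UNIV" by simp
  thus ?thesis
  proof (induction p rule: pm_induct)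
    case zero
    show ?case by (rule lin_mapI) auto
  next
    case (single a c p)
    show ?case
    proof (rule lin_mapI)
      fix x y assume xy: "x \<in> carrier V" "y \<in> carrier V"
      show "fact (fmono c a + p) (x \<oplus> y) = fact (fmono c a + p) x \<oplus> fact (fmono c a + p) y"
        using xy by (simp add: fact_plus fact_single lin_mapD(2)[OF lin, of x y a] lin_mapD(2)[OF single(3)] sm_add_right fact_closed closed a_swap4)
    next
      fix d x assume x: "x \<in> carrier V"
      show "fact (fmono c a + p) (d \<odot> x) = d \<odot> fact (fmono c a + p) x"
        using x by (simp add: fact_plus fact_single lin_mapD(3)[OF lin, of x a d] lin_mapD(3)[OF single(3)] sm_add_right fact_closed closed
            flip: sm_mult) (simp add: mult.commute)
    qed (rule fact_closed)
  qed
qed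

end

locale left_word_rep = word_rep +
  assumes left: "v \<in> carrier V \<Longrightarrow> \<theta> (a @ b) v = \<theta> a (\<theta> b v)"

locale right_word_rep = word_rep +
  assumes right: "v \<in> carrier V \<Longrightarrow> \<theta> (a @ b) v = \<theta> b (\<theta> a v)"

lemma (in left_word_rep) fact_mult:
  assumes "v \<in> carrier V" shows "fact (p \<otimes>\<^bsub>free_algebra\<^esub> q) v = fact p (fact q v)"
proof -
  have "fact (p \<otimes>\<^bsub>free_algebra\<^esub> q) v = lin_ext V (\<lambda>a. lin_ext V (\<lambda>b. \<theta> (a @ b) v) q) p"
    unfolding free_algebra_def by (subst lin_ext_mult[OF monoid_word_monoid]) (auto simp: closed assms)
  also have "(\<lambda>a. lin_ext V (\<lambda>b. \<theta> (a @ b) v) q) = (\<lambda>a. \<theta> a (fact q v))"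
    using lin_map_lin_ext[where D = UNIV, OF complex_vs_axioms complex_vs_axioms lin, of "\<lambda>w. \<theta> w v" q]
    by (simp add: left assms o_def closed)
  finally show ?thesis .
qed

lemma (in right_word_rep) fact_mult:
  assumes "v \<in> carrier V" shows "fact (p \<otimes>\<^bsub>free_algebra\<^esub> q) v = fact q (fact p v)"
proof -
  have "fact (p \<otimes>\<^bsub>free_algebra\<^esub> q) v = lin_ext V (\<lambda>a. lin_ext V (\<lambda>b. \<theta> (a @ b) v) q) p"
    unfolding free_algebra_def by (subst lin_ext_mult[OF monoid_word_monoid]) (auto simp: closed assms)
  also have "\<dots> = lin_ext V (fact q \<circ> (\<lambda>a. \<theta> a v)) p"
    by (simp add: right assms o_def)
  also have "\<dots> = fact q (fact p v)"
    by (rule lin_map_lin_ext[symmetric, where D = UNIV, OF complex_vs_axioms complex_vs_axioms fact_lin_right])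
      (auto simp: closed assms)
  finally show ?thesis .
qed

context word_rep
begin

text \<open>The annihilator of one vector is in general only a one-sided ideal; annihilating all
  vectors at once gives a two-sided one, provided that it absorbs products on either side. The two
  providers of \<open>l\<close> and \<open>r\<close> are the left and right versions of
  \<open>fact_mult\<close>.\<close>

lemma ideal_annihilator:
  assumes l: "\<And>p q. (\<And>v. v \<in> carrier V \<Longrightarrow> fact q v = \<zero>) \<Longrightarrow> (\<And>v. v \<in> carrier V \<Longrightarrow> fact (p \<otimes>\<^bsub>free_algebra\<^esub> q) v = \<zero>)"
    and r: "\<And>p q. (\<And>v. v \<in> carrier V \<Longrightarrow> fact q v = \<zero>) \<Longrightarrow> (\<And>v. v \<in> carrier V \<Longrightarrow> fact (q \<otimes>\<^bsub>free_algebra\<^esub> p) v = \<zero>)"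
    and i: "i \<in> Idl\<^bsub>free_algebra\<^esub> R" and v: "v \<in> carrier V"
  shows "fact i v = \<zero>"
proof -
  have "ideal {p \<in> carrier free_algebra. \<forall>v\<in>carrier V. fact p v = \<zero>} free_algebra"
  proof (rule Free.linear_idealI)
    fix c x assume "x \<in> {p \<in> carrier free_algebra. \<forall>v\<in>carrier V. fact p v = \<zero>}"
    thus "c \<odot>\<^bsub>free_algebra\<^esub> x \<in> {p \<in> carrier free_algebra. \<forall>v\<in>carrier V. fact p v = \<zero>}"
      using lin_mapD(3)[OF fact_lin_left, of _ x c] by simp
  qed (auto simp: fact_plus l r)
  from Free.genideal_minimal[OF this, of R] show ?thesis using i v rel by auto
qed

end

locale word_rep_factor = word_rep +
  assumes ideal: "\<lbrakk>i \<in> Idl\<^bsub>free_algebra\<^esub> R; v \<in> carrier V\<rbrakk> \<Longrightarrow> fact i v = \<zero>"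
begin

abbreviation "P \<equiv> pres_algebra R"

lemma word_act_coset:
  assumes "v \<in> carrier V"
  shows "word_act V \<theta> (Idl\<^bsub>free_algebra\<^esub> R +>\<^bsub>free_algebra\<^esub> p) v = fact p v"
  unfolding word_act_def
  by (rule Free.quot_fun_lin[OF ideal_pres complex_vs_axioms fact_lin_left]) (auto simp: assms ideal)

lemma word_act_lin_left: "v \<in> carrier V \<Longrightarrow> lin_map P V (\<lambda>z. word_act V \<theta> z v)"
  unfolding word_act_def pres_algebra_def
  by (rule Free.lin_map_quot_fun[OF ideal_pres complex_vs_axioms fact_lin_left]) (auto simp: ideal)

lemma word_act_lin_right:
  assumes "z \<in> carrier P" shows "lin_map V V (word_act V \<theta> z)"
proof -
  obtain p where p: "z = Idl\<^bsub>free_algebra\<^esub> R +>\<^bsub>free_algebra\<^esub> p" using pres_carrierE assms by blast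
  show ?thesis unfolding p
    by (rule lin_mapI) (simp_all add: word_act_coset lin_mapD[OF fact_lin_right])
qed

lemma word_act_mono: "v \<in> carrier V \<Longrightarrow> word_act V \<theta> (pres_mono R c w) v = c \<odot> \<theta> w v"
  unfolding pres_mono_def by (simp add: word_act_coset fact_single)

lemma word_act_one: "v \<in> carrier V \<Longrightarrow> word_act V \<theta> \<one>\<^bsub>P\<^esub> v = v"
  by (simp add: pres_one word_act_mono Nil)

lemma pres_mult_coset: "(Idl\<^bsub>free_algebra\<^esub> R +>\<^bsub>free_algebra\<^esub> p) \<otimes>\<^bsub>P\<^esub> (Idl\<^bsub>free_algebra\<^esub> R +>\<^bsub>free_algebra\<^esub> q)
   = Idl\<^bsub>free_algebra\<^esub> R +>\<^bsub>free_algebra\<^esub> (p \<otimes>\<^bsub>free_algebra\<^esub> q)"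
  unfolding pres_algebra_def by (rule Free.quot_mult[OF ideal_pres]) auto

end

sublocale left_word_rep \<subseteq> word_rep_factor
proof
  show "fact i v = \<zero>" if "i \<in> Idl\<^bsub>free_algebra\<^esub> R" "v \<in> carrier V" for i v
    by (rule ideal_annihilator[OF _ _ that]) (auto simp: fact_mult fact_closed lin_map_zero[OF complex_vs_axioms complex_vs_axioms fact_lin_right])
qed

sublocale right_word_rep \<subseteq> word_rep_factor
proof
  show "fact i v = \<zero>" if "i \<in> Idl\<^bsub>free_algebra\<^esub> R" "v \<in> carrier V" for i v
    by (rule ideal_annihilator[OF _ _ that]) (auto simp: fact_mult fact_closed lin_map_zero[OF complex_vs_axioms complex_vs_axioms fact_lin_right])
qed

lemma (in left_word_rep) word_act_mult:
  "\<lbrakk>y \<in> carrier P; z \<in> carrier P; v \<in> carrier V\<rbrakk>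
    \<Longrightarrow> word_act V \<theta> (y \<otimes>\<^bsub>P\<^esub> z) v = word_act V \<theta> y (word_act V \<theta> z v)"
  by (auto elim!: pres_carrierE simp: word_act_coset pres_mult_coset fact_mult fact_closed)

lemma (in right_word_rep) word_act_mult:
  "\<lbrakk>y \<in> carrier P; z \<in> carrier P; v \<in> carrier V\<rbrakk>
    \<Longrightarrow> word_act V \<theta> (y \<otimes>\<^bsub>P\<^esub> z) v = word_act V \<theta> z (word_act V \<theta> y v)"
  by (auto elim!: pres_carrierE simp: word_act_coset pres_mult_coset fact_mult fact_closed)

lemma (in complex_vs) lin_map_foldr:
  "(\<And>g. lin_map V V (\<rho> g)) \<Longrightarrow> lin_map V V (foldr \<rho> w)"
proof (induction w)
  case (Cons g w)
  note l = lin_mapD[OF Cons.prems[of g]] and r = lin_mapD[OF Cons.IH[OF Cons.prems]]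
  show ?case by (rule lin_mapI) (simp_all add: l r)
qed (auto intro: lin_mapI)

lemma (in complex_vs) left_word_repI:
  assumes "\<And>g. lin_map V V (\<rho> g)"
    and "\<And>r v. r \<in> R \<Longrightarrow> v \<in> carrier V \<Longrightarrow> lin_ext V (\<lambda>w. foldr \<rho> w v) r = \<zero>"
  shows "left_word_rep V R (foldr \<rho>)"
  by unfold_locales (use assms in \<open>auto intro: lin_map_foldr\<close>)

lemma (in complex_vs) right_word_repI:
  assumes \<rho>: "\<And>g. lin_map V V (\<rho> g)"
    and "\<And>r v. r \<in> R \<Longrightarrow> v \<in> carrier V \<Longrightarrow> lin_ext V (\<lambda>w. fold \<rho> w v) r = \<zero>"
  shows "right_word_rep V R (fold \<rho>)"
proof unfold_locales
  show "lin_map V V (fold \<rho> w)" for w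
    using lin_map_foldr[of \<rho> "rev w", OF \<rho>] by (simp add: foldr_conv_fold)
qed (use assms in auto)

subsection \<open>The relations of \<open>U\<^sub>q(gl\<^sub>2)\<close>\<close>

lemma qpow_add: "qpow \<gamma> r * qpow \<gamma> s = qpow \<gamma> (r + s)"
  by (simp add: qpow_def exp_add[symmetric] algebra_simps)

lemma qpow_0 [simp]: "qpow \<gamma> 0 = 1"
  by (simp add: qpow_def)

lemma cnj_qpow [simp]: "cnj (qpow \<gamma> r) = qpow \<gamma> (- r)"
  by (simp add: qpow_def exp_cnj)

lemma cnj_qlam [simp]: "cnj (qlam \<gamma>) = - qlam \<gamma>"
  by (simp add: qlam_def)

text \<open>Elements of an arbitrary algebra satisfying the relations, that is, the data of a
  homomorphism out of U_q(gl_2). Instances are the algebra itself, its opposite (antipode), its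
  conjugate opposite (involution) and its tensor square (coproduct). Brackets follow
  \<open>word_val\<close>.\<close>

locale uq_rep = complex_alg B for B :: "(complex, 'b, 'm) module_scheme" (structure) +
  fixes \<gamma> :: real and \<phi> :: "ugen \<Rightarrow> 'b"
  assumes gen_closed [simp]: "\<phi> g \<in> carrier B"
    and K1K2: "\<phi> UK1 \<otimes> \<phi> UK2 = \<phi> UK2 \<otimes> \<phi> UK1"
    and K1K1i [simp]: "\<phi> UK1 \<otimes> \<phi> UK1i = \<one>" and K1iK1 [simp]: "\<phi> UK1i \<otimes> \<phi> UK1 = \<one>"
    and K2K2i [simp]: "\<phi> UK2 \<otimes> \<phi> UK2i = \<one>" and K2iK2 [simp]: "\<phi> UK2i \<otimes> \<phi> UK2 = \<one>"
    and K1E: "\<phi> UK1 \<otimes> (\<phi> UE \<otimes> \<phi> UK1i) = qpow \<gamma> (1/2) \<odot> \<phi> UE"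
    and K2E: "\<phi> UK2 \<otimes> (\<phi> UE \<otimes> \<phi> UK2i) = qpow \<gamma> (-1/2) \<odot> \<phi> UE"
    and K1F: "\<phi> UK1 \<otimes> (\<phi> UF \<otimes> \<phi> UK1i) = qpow \<gamma> (-1/2) \<odot> \<phi> UF"
    and K2F: "\<phi> UK2 \<otimes> (\<phi> UF \<otimes> \<phi> UK2i) = qpow \<gamma> (1/2) \<odot> \<phi> UF"
    and EF: "\<phi> UE \<otimes> \<phi> UF \<oplus> (1 / qlam \<gamma>) \<odot> (\<phi> UK2 \<otimes> (\<phi> UK1i \<otimes> (\<phi> UK2 \<otimes> \<phi> UK1i)))
      = \<phi> UF \<otimes> \<phi> UE \<oplus> (1 / qlam \<gamma>) \<odot> (\<phi> UK1 \<otimes> (\<phi> UK2i \<otimes> (\<phi> UK1 \<otimes> \<phi> UK2i)))"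

lemma (in complex_vs) minus_minus_eq_zero:
  assumes "a \<oplus> d = b \<oplus> c" "a \<in> carrier V" "b \<in> carrier V" "c \<in> carrier V" "d \<in> carrier V"
  shows "(a \<ominus> b) \<ominus> (c \<ominus> d) = \<zero>"
proof -
  have "(a \<ominus> b) \<ominus> (c \<ominus> d) = (a \<oplus> d) \<ominus> (b \<oplus> c)"
    using assms(2-) by (simp add: minus_eq minus_add a_ac)
  thus ?thesis using assms by (simp add: minus_eq r_neg)
qed

text \<open>Nine relators compare two monomials and are treated uniformly; the commutator of E and F
  is the exception.\<close>

lemma uq_rels_cases:
  assumes "r \<in> uq_rels \<gamma>"
  shows "(\<exists>(c, w, d, w') \<in> {(1, [UK1, UK2], 1, [UK2, UK1]), (1, [UK1, UK1i], 1, []), (1, [UK1i, UK1], 1, []),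
       (1, [UK2, UK2i], 1, []), (1, [UK2i, UK2], 1, []),
       (1, [UK1, UE, UK1i], qpow \<gamma> (1/2), [UE]), (1, [UK2, UE, UK2i], qpow \<gamma> (-1/2), [UE]),
       (1, [UK1, UF, UK1i], qpow \<gamma> (-1/2), [UF]), (1, [UK2, UF, UK2i], qpow \<gamma> (1/2), [UF])}.
      r = fmono c w - fmono d w')
    \<or> r = fmono 1 [UE, UF] - fmono 1 [UF, UE]
       - (fmono (1 / qlam \<gamma>) [UK1, UK2i, UK1, UK2i] - fmono (1 / qlam \<gamma>) [UK2, UK1i, UK2, UK1i])"
  using assms by (simp add: uq_rels_def)

lemma uq_algebra_eq: "uq_algebra \<gamma> = pres_algebra (uq_rels \<gamma>)"
  by (simp add: uq_algebra_def pres_algebra_def uq_ideal_def)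

lemma umono_eq: "umono \<gamma> c w = pres_mono (uq_rels \<gamma>) c w"
  by (simp add: umono_def pres_mono_def uq_ideal_def)

lemma (in uq_rep) alg_ext_uq_rels:
  assumes "r \<in> uq_rels \<gamma>" shows "alg_ext B \<phi> r = \<zero>"
  using uq_rels_cases[OF assms]
proof (elim disjE bexE)
  fix x assume x: "x \<in> {(1, [UK1, UK2], 1, [UK2, UK1]), (1, [UK1, UK1i], 1, []), (1, [UK1i, UK1], 1, []),
       (1, [UK2, UK2i], 1, []), (1, [UK2i, UK2], 1, []),
       (1, [UK1, UE, UK1i], qpow \<gamma> (1/2), [UE]), (1, [UK2, UE, UK2i], qpow \<gamma> (-1/2), [UE]),
       (1, [UK1, UF, UK1i], qpow \<gamma> (-1/2), [UF]), (1, [UK2, UF, UK2i], qpow \<gamma> (1/2), [UF])}"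
    and r: "case x of (c, w, d, w') \<Rightarrow> r = fmono c w - fmono d w'"
  obtain c w d w' where xe: "x = (c, w, d, w')" by (cases x) auto
  have "alg_ext B \<phi> (fmono c w) = alg_ext B \<phi> (fmono d w')"
    using x unfolding xe by (auto simp: alg_ext_mono K1K2 K1E K2E K1F K2F)
  thus ?thesis using r unfolding xe
    by (simp add: lin_map_minus_free[OF alg_homD(1)[OF alg_hom_alg_ext]] alg_ext_mono word_val_closed)
next
  assume 2: "r = fmono 1 [UE, UF] - fmono 1 [UF, UE]
       - (fmono (1 / qlam \<gamma>) [UK1, UK2i, UK1, UK2i] - fmono (1 / qlam \<gamma>) [UK2, UK1i, UK2, UK1i])"
  show ?thesis unfolding 2
    using minus_minus_eq_zero[OF EF]
    by (simp add: lin_map_minus_free[OF alg_homD(1)[OF alg_hom_alg_ext]] alg_ext_mono)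
qed

lemma (in uq_rep) uq_hom:
  "alg_hom (uq_algebra \<gamma>) B (quot_fun (alg_ext B \<phi>))"
  "quot_fun (alg_ext B \<phi>) (umono \<gamma> c w) = c \<odot> word_val B \<phi> w"
  unfolding uq_algebra_eq umono_eq
  by (rule pres_alg_hom[OF complex_alg_axioms gen_closed alg_ext_uq_rels]; assumption)+

lemma complex_alg_uq: "complex_alg (uq_algebra \<gamma>)"
  unfolding uq_algebra_eq by (rule complex_alg_pres)

lemma umono_simps [simp]:
  "umono \<gamma> c w \<in> carrier (uq_algebra \<gamma>)"
  "umono \<gamma> c w \<otimes>\<^bsub>uq_algebra \<gamma>\<^esub> umono \<gamma> d w' = umono \<gamma> (c * d) (w @ w')"
  "c \<odot>\<^bsub>uq_algebra \<gamma>\<^esub> umono \<gamma> d w = umono \<gamma> (c * d) w"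
  by (simp_all add: uq_algebra_eq umono_eq)

lemma uq_one: "\<one>\<^bsub>uq_algebra \<gamma>\<^esub> = umono \<gamma> 1 []"
  by (simp add: uq_algebra_eq umono_eq pres_one)

text \<open>The generators satisfy their own relations, so every consequence derived in
  \<open>uq_rep\<close> becomes an identity between words of U_q(gl_2).\<close>

lemma uq_rep_uq: "uq_rep (uq_algebra \<gamma>) \<gamma> (\<lambda>g. umono \<gamma> 1 [g])"
proof -
  interpret U: complex_alg "uq_algebra \<gamma>" by (rule complex_alg_uq)
  have r: "umono \<gamma> c w = umono \<gamma> d w'" if "fmono c w - fmono d w' \<in> uq_rels \<gamma>" for c d w w'
    unfolding umono_eq by (rule pres_rel2[OF that])
  show ?thesis
  proof unfold_locales
    show "umono \<gamma> 1 [UE] \<otimes>\<^bsub>uq_algebra \<gamma>\<^esub> umono \<gamma> 1 [UF] \<oplus>\<^bsub>uq_algebra \<gamma>\<^esub>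
      (1 / qlam \<gamma>) \<odot>\<^bsub>uq_algebra \<gamma>\<^esub> (umono \<gamma> 1 [UK2] \<otimes>\<^bsub>uq_algebra \<gamma>\<^esub> (umono \<gamma> 1 [UK1i]
         \<otimes>\<^bsub>uq_algebra \<gamma>\<^esub> (umono \<gamma> 1 [UK2] \<otimes>\<^bsub>uq_algebra \<gamma>\<^esub> umono \<gamma> 1 [UK1i])))
    = umono \<gamma> 1 [UF] \<otimes>\<^bsub>uq_algebra \<gamma>\<^esub> umono \<gamma> 1 [UE] \<oplus>\<^bsub>uq_algebra \<gamma>\<^esub>
      (1 / qlam \<gamma>) \<odot>\<^bsub>uq_algebra \<gamma>\<^esub> (umono \<gamma> 1 [UK1] \<otimes>\<^bsub>uq_algebra \<gamma>\<^esub> (umono \<gamma> 1 [UK2i]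
         \<otimes>\<^bsub>uq_algebra \<gamma>\<^esub> (umono \<gamma> 1 [UK1] \<otimes>\<^bsub>uq_algebra \<gamma>\<^esub> umono \<gamma> 1 [UK2i])))"
      unfolding umono_simps unfolding uq_algebra_eq umono_eq
      by (simp, rule pres_rel4) (simp add: uq_rels_def)
  qed (simp_all add: uq_one, (rule r, simp add: uq_rels_def)+)
qed

section \<open>Commutation rules between K_1, K_2, K, E and F\<close>

context uq_rep
begin

abbreviation "E \<equiv> \<phi> UE"
abbreviation "F \<equiv> \<phi> UF"
abbreviation "K \<equiv> \<phi> UK1 \<otimes> \<phi> UK2i"
abbreviation "Ki \<equiv> \<phi> UK2 \<otimes> \<phi> UK1i"

lemma conj_commute:
  assumes "a \<otimes> (x \<otimes> b) = c \<odot> x" "b \<otimes> a = \<one>" "a \<in> carrier B" "b \<in> carrier B" "x \<in> carrier B"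
  shows "a \<otimes> x = c \<odot> (x \<otimes> a)" "x \<otimes> b = c \<odot> (b \<otimes> x)"
proof -
  have "a \<otimes> x = (a \<otimes> (x \<otimes> b)) \<otimes> a" using assms(2-) by (simp add: m_assoc)
  thus "a \<otimes> x = c \<odot> (x \<otimes> a)" using assms by (simp add: sm_mult_left)
  have "x \<otimes> b = b \<otimes> (a \<otimes> (x \<otimes> b))" using assms(2-) by (simp flip: m_assoc)
  thus "x \<otimes> b = c \<odot> (b \<otimes> x)" using assms by (simp add: sm_mult_right)
qed

lemmas K1E' = conj_commute[OF K1E K1iK1] and K2E' = conj_commute[OF K2E K2iK2]
  and K1F' = conj_commute[OF K1F K1iK1] and K2F' = conj_commute[OF K2F K2iK2]

lemma inv_commute:
  assumes "a \<otimes> x = x \<otimes> a" "a \<otimes> b = \<one>" "b \<otimes> a = \<one>" "a \<in> carrier B" "b \<in> carrier B" "x \<in> carrier B"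
  shows "b \<otimes> x = x \<otimes> b"
proof -
  have "b \<otimes> x = b \<otimes> ((x \<otimes> a) \<otimes> b)" using assms by (simp add: m_assoc)
  also have "\<dots> = b \<otimes> ((a \<otimes> x) \<otimes> b)" by (simp only: assms(1))
  also have "\<dots> = (b \<otimes> a) \<otimes> (x \<otimes> b)" using assms(4-) by (simp add: m_assoc)
  finally show ?thesis using assms by simp
qed

lemma K1iK2: "\<phi> UK1i \<otimes> \<phi> UK2 = \<phi> UK2 \<otimes> \<phi> UK1i"
  by (rule inv_commute[OF K1K2]) simp_all

lemma K2iK1: "\<phi> UK2i \<otimes> \<phi> UK1 = \<phi> UK1 \<otimes> \<phi> UK2i"
  by (rule inv_commute[OF K1K2[symmetric]]) simp_all

lemma K2iK1i: "\<phi> UK2i \<otimes> \<phi> UK1i = \<phi> UK1i \<otimes> \<phi> UK2i"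
  by (rule inv_commute[OF K1iK2[symmetric]]) simp_all

lemma cancel_left:
  assumes "a \<otimes> b = \<one>" "a \<in> carrier B" "b \<in> carrier B" "x \<in> carrier B"
  shows "a \<otimes> (b \<otimes> x) = x"
  using assms by (simp flip: m_assoc)

lemma lcomm:
  assumes "a \<otimes> b = b \<otimes> a" "a \<in> carrier B" "b \<in> carrier B" "x \<in> carrier B"
  shows "a \<otimes> (b \<otimes> x) = b \<otimes> (a \<otimes> x)"
  using assms by (simp flip: m_assoc)

text \<open>Rewriting the commuting generators into the order \<open>K\<^sub>1, K\<^sub>1\<^sup>-\<^sup>1, K\<^sub>2, K\<^sub>2\<^sup>-\<^sup>1\<close>.\<close>

lemmas K_normal = K1K2[symmetric] K1iK2[symmetric] K2iK1 K2iK1i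
  lcomm[OF K1K2[symmetric]] lcomm[OF K1iK2[symmetric]] lcomm[OF K2iK1] lcomm[OF K2iK1i]
  cancel_left[OF K1K1i] cancel_left[OF K1iK1] cancel_left[OF K2K2i] cancel_left[OF K2iK2]

text \<open>Conjugating the coproduct of E or F by that of K_1 or K_2 has to leave the tensor legs K
  and K^(-1) unchanged.\<close>

lemma conj_K:
  "\<phi> UK1 \<otimes> (K \<otimes> \<phi> UK1i) = K" "\<phi> UK1 \<otimes> (Ki \<otimes> \<phi> UK1i) = Ki"
  "\<phi> UK2 \<otimes> (K \<otimes> \<phi> UK2i) = K" "\<phi> UK2 \<otimes> (Ki \<otimes> \<phi> UK2i) = Ki"
  by (simp_all add: m_assoc K_normal)

lemma q_commute_sq:
  assumes "a \<otimes> x = c \<odot> (x \<otimes> a)" "b \<otimes> x = d \<odot> (x \<otimes> b)" "a \<in> carrier B" "b \<in> carrier B" "x \<in> carrier B"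
  shows "(a \<otimes> b) \<otimes> x = (c * d) \<odot> (x \<otimes> (a \<otimes> b))"
proof -
  have "(a \<otimes> b) \<otimes> x = a \<otimes> (b \<otimes> x)" using assms(3-) by (simp add: m_assoc)
  also have "\<dots> = d \<odot> (a \<otimes> x \<otimes> b)" using assms(3-) unfolding assms(2) by (simp add: sm_mult_right m_assoc)
  also have "\<dots> = (c * d) \<odot> (x \<otimes> (a \<otimes> b))"
    using assms(3-) unfolding assms(1) by (simp add: sm_mult_left m_assoc flip: sm_mult) (simp add: mult.commute)
  finally show ?thesis .
qed

lemma flip_commute:
  assumes "x \<otimes> b = c \<odot> (b \<otimes> x)" "d * c = 1" "b \<in> carrier B" "x \<in> carrier B"
  shows "b \<otimes> x = d \<odot> (x \<otimes> b)"
  using assms by (simp flip: sm_mult)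

text \<open>K_1 and K_2^(-1) each contribute q^(1/2) when moved past E, and q^(-1/2) when moved past
  F.\<close>

lemma KE: "K \<otimes> E = qpow \<gamma> 1 \<odot> (E \<otimes> K)" and KF: "K \<otimes> F = qpow \<gamma> (-1) \<odot> (F \<otimes> K)"
  using q_commute_sq[OF K1E'(1) flip_commute[OF K2E'(2), of "qpow \<gamma> (1/2)"]]
    q_commute_sq[OF K1F'(1) flip_commute[OF K2F'(2), of "qpow \<gamma> (-1/2)"]]
  by (simp_all add: qpow_add)

lemma KiE: "Ki \<otimes> E = qpow \<gamma> (-1) \<odot> (E \<otimes> Ki)" and KiF: "Ki \<otimes> F = qpow \<gamma> 1 \<odot> (F \<otimes> Ki)"
  using q_commute_sq[OF K2E'(1) flip_commute[OF K1E'(2), of "qpow \<gamma> (-1/2)"]]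
    q_commute_sq[OF K2F'(1) flip_commute[OF K1F'(2), of "qpow \<gamma> (1/2)"]]
  by (simp_all add: qpow_add)

lemma FK: "F \<otimes> K = qpow \<gamma> 1 \<odot> (K \<otimes> F)"
  unfolding KE KF by (simp_all add: qpow_add flip: sm_mult)

lemma conj_inverse:
  assumes "a \<otimes> (x \<otimes> b) = c \<odot> x" "b \<otimes> a = \<one>" "d * c = 1" "a \<in> carrier B" "b \<in> carrier B" "x \<in> carrier B"
  shows "b \<otimes> (x \<otimes> a) = d \<odot> x"
proof -
  have "b \<otimes> (c \<odot> (x \<otimes> a)) = b \<otimes> (a \<otimes> x)"
    using conj_commute(1)[OF assms(1,2,4-6)] by simp
  hence "c \<odot> (b \<otimes> (x \<otimes> a)) = x"
    using assms(2,4-) by (simp add: sm_mult_right flip: m_assoc)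
  hence "d \<odot> x = (d * c) \<odot> (b \<otimes> (x \<otimes> a))" using assms(4-) by (simp add: sm_mult)
  thus ?thesis using assms by simp
qed

end

subsection \<open>Antipode and involution of \<open>U\<^sub>q(gl\<^sub>2)\<close>\<close>

lemma umono_scale: "umono \<gamma> 1 w = umono \<gamma> d w' \<Longrightarrow> umono \<gamma> c w = umono \<gamma> (c * d) w'"
  by (metis mult.right_neutral umono_simps(3))

text \<open>Rewrite rules for the words into which the relators turn under antipode and involution.
  Both reverse products; the involution fixes the K_j and therefore also produces conjugations by
  inverses such as K_1^(-1) E K_1.\<close>

lemma uq_words:
  "umono \<gamma> c [UK2i, UK1i] = umono \<gamma> c [UK1i, UK2i]" "umono \<gamma> c [UK1, UK2] = umono \<gamma> c [UK2, UK1]"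
  "umono \<gamma> c [UK1, UK1i] = umono \<gamma> c []" "umono \<gamma> c [UK1i, UK1] = umono \<gamma> c []"
  "umono \<gamma> c [UK2, UK2i] = umono \<gamma> c []" "umono \<gamma> c [UK2i, UK2] = umono \<gamma> c []"
  "umono \<gamma> c [UK1, UE, UK1i] = umono \<gamma> (c * qpow \<gamma> (1/2)) [UE]"
  "umono \<gamma> c [UK2, UE, UK2i] = umono \<gamma> (c * qpow \<gamma> (-1/2)) [UE]"
  "umono \<gamma> c [UK1, UF, UK1i] = umono \<gamma> (c * qpow \<gamma> (-1/2)) [UF]"
  "umono \<gamma> c [UK2, UF, UK2i] = umono \<gamma> (c * qpow \<gamma> (1/2)) [UF]"
  "umono \<gamma> c [UK1i, UE, UK1] = umono \<gamma> (c * qpow \<gamma> (-1/2)) [UE]"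
  "umono \<gamma> c [UK2i, UE, UK2] = umono \<gamma> (c * qpow \<gamma> (1/2)) [UE]"
  "umono \<gamma> c [UK1i, UF, UK1] = umono \<gamma> (c * qpow \<gamma> (1/2)) [UF]"
  "umono \<gamma> c [UK2i, UF, UK2] = umono \<gamma> (c * qpow \<gamma> (-1/2)) [UF]"
  "umono \<gamma> c [UK1i, UK2, UK1i, UK2] = umono \<gamma> c [UK2, UK1i, UK2, UK1i]"
  "umono \<gamma> c [UK2i, UK1, UK2i, UK1] = umono \<gamma> c [UK1, UK2i, UK1, UK2i]"
proof -
  interpret U: uq_rep "uq_algebra \<gamma>" \<gamma> "\<lambda>g. umono \<gamma> 1 [g]" by (rule uq_rep_uq)
  have s: "umono \<gamma> c w = umono \<gamma> c w'" if "umono \<gamma> 1 w = umono \<gamma> 1 w'" for w w'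
    using umono_scale[OF that] by simp
  have a: "umono \<gamma> 1 [UK1i, UK2] = umono \<gamma> 1 [UK2, UK1i]" "umono \<gamma> 1 [UK2i, UK1] = umono \<gamma> 1 [UK1, UK2i]"
    using U.K1iK2 U.K2iK1 by simp_all
  have aa: "umono \<gamma> 1 ([a, b] @ [a, b]) = umono \<gamma> 1 ([b, a] @ [b, a])" if "umono \<gamma> 1 [a, b] = umono \<gamma> 1 [b, a]" for a b
    using umono_simps(2)[of \<gamma> 1 "[a, b]" 1 "[a, b]"] umono_simps(2)[of \<gamma> 1 "[b, a]" 1 "[b, a]"] that by simp
  show "umono \<gamma> c [UK2i, UK1i] = umono \<gamma> c [UK1i, UK2i]" "umono \<gamma> c [UK1, UK2] = umono \<gamma> c [UK2, UK1]"
    by (rule s; use U.K2iK1i U.K1K2 in simp)+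
  show "umono \<gamma> c [UK1, UK1i] = umono \<gamma> c []" "umono \<gamma> c [UK1i, UK1] = umono \<gamma> c []"
    "umono \<gamma> c [UK2, UK2i] = umono \<gamma> c []" "umono \<gamma> c [UK2i, UK2] = umono \<gamma> c []"
    by (rule s; use U.K1K1i U.K1iK1 U.K2K2i U.K2iK2 in \<open>simp add: uq_one\<close>)+
  show "umono \<gamma> c [UK1, UE, UK1i] = umono \<gamma> (c * qpow \<gamma> (1/2)) [UE]"
    "umono \<gamma> c [UK2, UE, UK2i] = umono \<gamma> (c * qpow \<gamma> (-1/2)) [UE]"
    "umono \<gamma> c [UK1, UF, UK1i] = umono \<gamma> (c * qpow \<gamma> (-1/2)) [UF]"
    "umono \<gamma> c [UK2, UF, UK2i] = umono \<gamma> (c * qpow \<gamma> (1/2)) [UF]"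
    by (rule umono_scale; use U.K1E U.K2E U.K1F U.K2F in simp)+
  show "umono \<gamma> c [UK1i, UE, UK1] = umono \<gamma> (c * qpow \<gamma> (-1/2)) [UE]"
    "umono \<gamma> c [UK2i, UE, UK2] = umono \<gamma> (c * qpow \<gamma> (1/2)) [UE]"
    "umono \<gamma> c [UK1i, UF, UK1] = umono \<gamma> (c * qpow \<gamma> (1/2)) [UF]"
    "umono \<gamma> c [UK2i, UF, UK2] = umono \<gamma> (c * qpow \<gamma> (-1/2)) [UF]"
    by (rule umono_scale; use U.conj_inverse[OF U.K1E U.K1iK1, of "qpow \<gamma> (-1/2)"]
      U.conj_inverse[OF U.K2E U.K2iK2, of "qpow \<gamma> (1/2)"] U.conj_inverse[OF U.K1F U.K1iK1, of "qpow \<gamma> (1/2)"]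
      U.conj_inverse[OF U.K2F U.K2iK2, of "qpow \<gamma> (-1/2)"] in \<open>simp add: qpow_add\<close>)+
  show "umono \<gamma> c [UK1i, UK2, UK1i, UK2] = umono \<gamma> c [UK2, UK1i, UK2, UK1i]"
    "umono \<gamma> c [UK2i, UK1, UK2i, UK1] = umono \<gamma> c [UK1, UK2i, UK1, UK2i]"
    using s[OF aa[OF a(1)]] s[OF aa[OF a(2)]] by simp_all
qed

lemma uq_EF_words:
  "umono \<gamma> 1 [UE, UF] \<oplus>\<^bsub>uq_algebra \<gamma>\<^esub> umono \<gamma> (1 / qlam \<gamma>) [UK2, UK1i, UK2, UK1i]
    = umono \<gamma> 1 [UF, UE] \<oplus>\<^bsub>uq_algebra \<gamma>\<^esub> umono \<gamma> (1 / qlam \<gamma>) [UK1, UK2i, UK1, UK2i]"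
  using uq_rep.EF[OF uq_rep_uq] by simp

lemma uq_antipode_hom:
  "alg_hom (uq_algebra \<gamma>) (opp_algebra (uq_algebra \<gamma>)) (quot_fun (alg_ext (opp_algebra (uq_algebra \<gamma>)) (uq_antipode_gen \<gamma>)))"
  "quot_fun (alg_ext (opp_algebra (uq_algebra \<gamma>)) (uq_antipode_gen \<gamma>)) (umono \<gamma> 1 [g]) = uq_antipode_gen \<gamma> g"
proof -
  interpret U: complex_alg "uq_algebra \<gamma>" by (rule complex_alg_uq)
  interpret O: complex_alg "opp_algebra (uq_algebra \<gamma>)" by (rule complex_alg_opp[OF complex_alg_uq])
  have cl: "uq_antipode_gen \<gamma> g \<in> carrier (uq_algebra \<gamma>)" for g by (cases g) auto
  \<comment> \<open>The antipode inverts K, and reversal exchanges E F with F E while the factors -q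
    and -q^(-1) cancel. The commutator relation therefore becomes itself with its two sides
    interchanged.\<close>
  interpret S: uq_rep "opp_algebra (uq_algebra \<gamma>)" \<gamma> "uq_antipode_gen \<gamma>"
    by unfold_locales (simp_all add: cl uq_one uq_words uq_EF_words qpow_add mult.commute)
  show "alg_hom (uq_algebra \<gamma>) (opp_algebra (uq_algebra \<gamma>)) (quot_fun (alg_ext (opp_algebra (uq_algebra \<gamma>)) (uq_antipode_gen \<gamma>)))"
    by (rule S.uq_hom)
  show "quot_fun (alg_ext (opp_algebra (uq_algebra \<gamma>)) (uq_antipode_gen \<gamma>)) (umono \<gamma> 1 [g]) = uq_antipode_gen \<gamma> g"
    using cl by (simp add: S.uq_hom(2))
qed

lemma uq_star_hom:
  "alg_hom (uq_algebra \<gamma>) (conj_algebra (opp_algebra (uq_algebra \<gamma>)))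
     (quot_fun (alg_ext (conj_algebra (opp_algebra (uq_algebra \<gamma>))) (uq_star_gen \<gamma>)))"
  "quot_fun (alg_ext (conj_algebra (opp_algebra (uq_algebra \<gamma>))) (uq_star_gen \<gamma>)) (umono \<gamma> c [g]) = cnj c \<odot>\<^bsub>uq_algebra \<gamma>\<^esub> uq_star_gen \<gamma> g"
proof -
  interpret U: complex_alg "uq_algebra \<gamma>" by (rule complex_alg_uq)
  interpret O: complex_alg "conj_algebra (opp_algebra (uq_algebra \<gamma>))" by (intro complex_alg_conj complex_alg_opp complex_alg_uq)
  have cl: "uq_star_gen \<gamma> g \<in> carrier (uq_algebra \<gamma>)" for g by (cases g) auto
  \<comment> \<open>Conjugation sends 1 / \<open>qlam \<gamma>\<close> to its negative, so the terms
    in K^2 and K^(-2) of \<open>uq_EF_words\<close> have to change sides.\<close>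
  have EF: "umono \<gamma> 1 [UF, UE] \<oplus>\<^bsub>uq_algebra \<gamma>\<^esub> umono \<gamma> (- (1 / qlam \<gamma>)) [UK2, UK1i, UK2, UK1i]
    = umono \<gamma> 1 [UE, UF] \<oplus>\<^bsub>uq_algebra \<gamma>\<^esub> umono \<gamma> (- (1 / qlam \<gamma>)) [UK1, UK2i, UK1, UK2i]"
  proof -
    have m: "umono \<gamma> (- c) w = \<ominus>\<^bsub>uq_algebra \<gamma>\<^esub> umono \<gamma> c w" for c w
      using U.minus_eq_sm[of "umono \<gamma> c w"] by simp
    have "x \<oplus>\<^bsub>uq_algebra \<gamma>\<^esub> \<ominus>\<^bsub>uq_algebra \<gamma>\<^esub> d = a \<oplus>\<^bsub>uq_algebra \<gamma>\<^esub> \<ominus>\<^bsub>uq_algebra \<gamma>\<^esub> y"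
      if "a \<oplus>\<^bsub>uq_algebra \<gamma>\<^esub> d = x \<oplus>\<^bsub>uq_algebra \<gamma>\<^esub> y" "a \<in> carrier (uq_algebra \<gamma>)" "d \<in> carrier (uq_algebra \<gamma>)"
        "x \<in> carrier (uq_algebra \<gamma>)" "y \<in> carrier (uq_algebra \<gamma>)" for a d x y
    proof -
      have "x \<oplus>\<^bsub>uq_algebra \<gamma>\<^esub> \<ominus>\<^bsub>uq_algebra \<gamma>\<^esub> d = (x \<oplus>\<^bsub>uq_algebra \<gamma>\<^esub> y) \<oplus>\<^bsub>uq_algebra \<gamma>\<^esub> (\<ominus>\<^bsub>uq_algebra \<gamma>\<^esub> y \<oplus>\<^bsub>uq_algebra \<gamma>\<^esub> \<ominus>\<^bsub>uq_algebra \<gamma>\<^esub> d)"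
        using that(2-) by (simp add: U.a_assoc U.r_neg2)
      also have "\<dots> = a \<oplus>\<^bsub>uq_algebra \<gamma>\<^esub> ((d \<oplus>\<^bsub>uq_algebra \<gamma>\<^esub> \<ominus>\<^bsub>uq_algebra \<gamma>\<^esub> d) \<oplus>\<^bsub>uq_algebra \<gamma>\<^esub> \<ominus>\<^bsub>uq_algebra \<gamma>\<^esub> y)"
        unfolding that(1)[symmetric] using that(2-) by (simp only: U.a_ac U.a_closed U.a_inv_closed)
      finally show ?thesis using that(2-) by (simp add: U.r_neg)
    qed
    from this[OF uq_EF_words] show ?thesis unfolding m by simp
  qed
  interpret S: uq_rep "conj_algebra (opp_algebra (uq_algebra \<gamma>))" \<gamma> "uq_star_gen \<gamma>"
    by unfold_locales (simp_all add: cl uq_one uq_words EF qpow_add mult.commute)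
  show "alg_hom (uq_algebra \<gamma>) (conj_algebra (opp_algebra (uq_algebra \<gamma>)))
     (quot_fun (alg_ext (conj_algebra (opp_algebra (uq_algebra \<gamma>))) (uq_star_gen \<gamma>)))"
    by (rule S.uq_hom)
  show "quot_fun (alg_ext (conj_algebra (opp_algebra (uq_algebra \<gamma>))) (uq_star_gen \<gamma>)) (umono \<gamma> c [g]) = cnj c \<odot>\<^bsub>uq_algebra \<gamma>\<^esub> uq_star_gen \<gamma> g"
    using cl by (simp add: S.uq_hom(2))
qed

subsection \<open>The tensor square\<close>

locale tensor_sq = complex_alg U for U :: "(complex, 'u, 'm) module_scheme" (structure)
begin

abbreviation "M2 \<equiv> monoid_algebra (U \<times>\<times> U)"
abbreviation "TS \<equiv> tensor_square U"
abbreviation "pt \<equiv> pure_tensor U"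
abbreviation tcoset :: "('u \<times> 'u \<Rightarrow>\<^sub>0 complex) \<Rightarrow> ('u \<times> 'u \<Rightarrow>\<^sub>0 complex) set" where
  "tcoset t \<equiv> tensor_ideal U +>\<^bsub>M2\<^esub> t"

lemma monoid_DirProd: "monoid (U \<times>\<times> U)"
  by (rule DirProd_monoid) (rule monoid_axioms)+

lemma complex_alg_M2: "complex_alg M2"
  by (rule complex_alg_monoid_algebra[OF monoid_DirProd])

sublocale M2: complex_alg M2 by (rule complex_alg_M2)

lemma single_in_M2 [simp]: "f \<in> carrier U \<Longrightarrow> g \<in> carrier U \<Longrightarrow> Poly_Mapping.single (f, g) c \<in> carrier M2"
  by simp

lemma minus_in_M2: "p \<in> carrier M2 \<Longrightarrow> q \<in> carrier M2 \<Longrightarrow> p - q \<in> carrier M2"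
proof -
  assume a: "p \<in> carrier M2" "q \<in> carrier M2"
  have "p - q = p \<oplus>\<^bsub>M2\<^esub> (- 1) \<odot>\<^bsub>M2\<^esub> q"
    by (rule poly_mapping_eqI) (simp add: lookup_minus lookup_add lookup_pmap_times)
  thus ?thesis using a M2.sm_closed M2.a_closed by metis
qed

lemma tensor_rels_carrier: "tensor_rels U \<subseteq> carrier M2"
  unfolding tensor_rels_def by (auto intro!: minus_in_M2 simp del: monoid_algebra_simps)

lemma ideal_tensor: "ideal (tensor_ideal U) M2"
  unfolding tensor_ideal_def by (rule M2.genideal_ideal[OF tensor_rels_carrier])

lemma complex_alg_TS: "complex_alg TS"
  unfolding tensor_square_def by (rule M2.complex_alg_quot[OF ideal_tensor])

sublocale TS: complex_alg TS by (rule complex_alg_TS)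

lemmas TS_simps = M2.quot_simps[OF ideal_tensor, folded tensor_square_def]

lemma pt_closed [simp]: "f \<in> carrier U \<Longrightarrow> g \<in> carrier U \<Longrightarrow> pt f g \<in> carrier TS"
  unfolding pure_tensor_def tensor_square_def by (rule M2.coset_closed[OF ideal_tensor]) simp

lemma pt_mult [simp]:
  "\<lbrakk>f \<in> carrier U; g \<in> carrier U; f' \<in> carrier U; g' \<in> carrier U\<rbrakk>
    \<Longrightarrow> pt f g \<otimes>\<^bsub>TS\<^esub> pt f' g' = pt (f \<otimes> f') (g \<otimes> g')"
  unfolding pure_tensor_def by (subst TS_simps) (simp_all add: monoid_algebra_single_mult)

lemma pt_one: "\<one>\<^bsub>TS\<^esub> = pt \<one> \<one>"
  unfolding pure_tensor_def by (subst TS_simps) simp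

lemma tcoset_eqI:
  assumes "p - q \<in> tensor_rels U" "q \<in> carrier M2" shows "tcoset p = tcoset q"
proof -
  have "p - q \<in> tensor_ideal U"
    unfolding tensor_ideal_def using M2.genideal_self[OF tensor_rels_carrier] assms by auto
  from M2.coset_eqI[OF ideal_tensor assms(2) this] show ?thesis by simp
qed

lemma tensor_relsI:
  assumes "f \<in> carrier U" "g \<in> carrier U"
  shows "f' \<in> carrier U \<Longrightarrow> Poly_Mapping.single (f \<oplus> f', g) 1 - (Poly_Mapping.single (f, g) 1 + Poly_Mapping.single (f', g) 1) \<in> tensor_rels U"
    and "g' \<in> carrier U \<Longrightarrow> Poly_Mapping.single (f, g \<oplus> g') 1 - (Poly_Mapping.single (f, g) 1 + Poly_Mapping.single (f, g') 1) \<in> tensor_rels U"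
    and "Poly_Mapping.single (c \<odot> f, g) 1 - Poly_Mapping.single (f, g) c \<in> tensor_rels U"
    and "Poly_Mapping.single (f, c \<odot> g) 1 - Poly_Mapping.single (f, g) c \<in> tensor_rels U"
  unfolding tensor_rels_def diff_diff_eq[symmetric] using assms by blast+

lemma pt_add:
  assumes "f \<in> carrier U" "g \<in> carrier U" "f' \<in> carrier U"
  shows "pt (f \<oplus> f') g = pt f g \<oplus>\<^bsub>TS\<^esub> pt f' g" "pt g (f \<oplus> f') = pt g f \<oplus>\<^bsub>TS\<^esub> pt g f'"
proof -
  have "tcoset (Poly_Mapping.single (f \<oplus> f', g) 1) = tcoset (Poly_Mapping.single (f, g) 1 + Poly_Mapping.single (f', g) 1)"
    "tcoset (Poly_Mapping.single (g, f \<oplus> f') 1) = tcoset (Poly_Mapping.single (g, f) 1 + Poly_Mapping.single (g, f') 1)"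
    using M2.a_closed[OF single_in_M2 single_in_M2, of f g f' g 1 1]
      M2.a_closed[OF single_in_M2 single_in_M2, of g f g f' 1 1] tensor_relsI(1)[of f g f'] tensor_relsI(2)[of g f f'] assms
    by (intro tcoset_eqI; simp)+
  thus "pt (f \<oplus> f') g = pt f g \<oplus>\<^bsub>TS\<^esub> pt f' g" "pt g (f \<oplus> f') = pt g f \<oplus>\<^bsub>TS\<^esub> pt g f'"
    unfolding pure_tensor_def using assms by (simp_all add: TS_simps)
qed

lemma pt_smult:
  assumes "f \<in> carrier U" "g \<in> carrier U"
  shows "pt (c \<odot> f) g = c \<odot>\<^bsub>TS\<^esub> pt f g" "pt f (c \<odot> g) = c \<odot>\<^bsub>TS\<^esub> pt f g"
proof -
  have "tcoset (Poly_Mapping.single (c \<odot> f, g) 1) = tcoset (Poly_Mapping.single (f, g) c)"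
    "tcoset (Poly_Mapping.single (f, c \<odot> g) 1) = tcoset (Poly_Mapping.single (f, g) c)"
    by (rule tcoset_eqI; use tensor_relsI(3,4)[OF assms] single_in_M2[OF assms] in blast)+
  thus "pt (c \<odot> f) g = c \<odot>\<^bsub>TS\<^esub> pt f g" "pt f (c \<odot> g) = c \<odot>\<^bsub>TS\<^esub> pt f g"
    unfolding pure_tensor_def using assms by (simp_all add: TS_simps pmap_times_single)
qed

end

subsection \<open>The coproduct\<close>

text \<open>Both products expand into four terms, and the mixed ones agree by \<open>X\<close> and
  \<open>Y\<close>. For the others, \<open>EF\<close> is used in the first leg against k k and in
  the second leg against l l; the intermediate term c (l l) tensor (k k) arises in both uses and
  drops out.\<close>

lemma (in tensor_sq) skew_commutator:
  assumes [simp]: "e \<in> carrier U" "f \<in> carrier U" "k \<in> carrier U" "l \<in> carrier U"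
    and X: "pt (e \<otimes> l) (k \<otimes> f) = pt (l \<otimes> e) (f \<otimes> k)" and Y: "pt (l \<otimes> f) (e \<otimes> k) = pt (f \<otimes> l) (k \<otimes> e)"
    and EF: "e \<otimes> f \<oplus> c \<odot> (l \<otimes> l) = f \<otimes> e \<oplus> c \<odot> (k \<otimes> k)"
  shows "(pt e k \<oplus>\<^bsub>TS\<^esub> pt l e) \<otimes>\<^bsub>TS\<^esub> (pt f k \<oplus>\<^bsub>TS\<^esub> pt l f) \<oplus>\<^bsub>TS\<^esub> c \<odot>\<^bsub>TS\<^esub> pt (l \<otimes> l) (l \<otimes> l)
    = (pt f k \<oplus>\<^bsub>TS\<^esub> pt l f) \<otimes>\<^bsub>TS\<^esub> (pt e k \<oplus>\<^bsub>TS\<^esub> pt l e) \<oplus>\<^bsub>TS\<^esub> c \<odot>\<^bsub>TS\<^esub> pt (k \<otimes> k) (k \<otimes> k)"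
proof -
  let ?kk = "k \<otimes> k" and ?ll = "l \<otimes> l" and ?X = "pt (e \<otimes> l) (k \<otimes> f)" and ?Y = "pt (l \<otimes> f) (e \<otimes> k)"
  have 1: "(pt e k \<oplus>\<^bsub>TS\<^esub> pt l e) \<otimes>\<^bsub>TS\<^esub> (pt f k \<oplus>\<^bsub>TS\<^esub> pt l f)
     = (pt (e \<otimes> f) ?kk \<oplus>\<^bsub>TS\<^esub> ?X) \<oplus>\<^bsub>TS\<^esub> (?Y \<oplus>\<^bsub>TS\<^esub> pt ?ll (e \<otimes> f))"
    by (simp add: TS.l_distr TS.r_distr TS.a_ac)
  have 2: "(pt f k \<oplus>\<^bsub>TS\<^esub> pt l f) \<otimes>\<^bsub>TS\<^esub> (pt e k \<oplus>\<^bsub>TS\<^esub> pt l e)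
     = (pt (f \<otimes> e) ?kk \<oplus>\<^bsub>TS\<^esub> ?X) \<oplus>\<^bsub>TS\<^esub> (?Y \<oplus>\<^bsub>TS\<^esub> pt ?ll (f \<otimes> e))"
    unfolding X Y by (simp add: TS.l_distr TS.r_distr TS.a_ac)
  have 3: "pt (e \<otimes> f) ?kk \<oplus>\<^bsub>TS\<^esub> c \<odot>\<^bsub>TS\<^esub> pt ?ll ?kk = pt (f \<otimes> e) ?kk \<oplus>\<^bsub>TS\<^esub> c \<odot>\<^bsub>TS\<^esub> pt ?kk ?kk"
    using EF pt_add(1)[of "e \<otimes> f" ?kk "c \<odot> ?ll"] pt_add(1)[of "f \<otimes> e" ?kk "c \<odot> ?kk"]
    by (simp add: pt_smult)
  have 4: "pt ?ll (e \<otimes> f) \<oplus>\<^bsub>TS\<^esub> c \<odot>\<^bsub>TS\<^esub> pt ?ll ?ll = pt ?ll (f \<otimes> e) \<oplus>\<^bsub>TS\<^esub> c \<odot>\<^bsub>TS\<^esub> pt ?ll ?kk"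
    using EF pt_add(2)[of "e \<otimes> f" ?ll "c \<odot> ?ll"] pt_add(2)[of "f \<otimes> e" ?ll "c \<odot> ?kk"]
    by (simp add: pt_smult)
  have "((pt (e \<otimes> f) ?kk \<oplus>\<^bsub>TS\<^esub> ?X) \<oplus>\<^bsub>TS\<^esub> (?Y \<oplus>\<^bsub>TS\<^esub> pt ?ll (e \<otimes> f))) \<oplus>\<^bsub>TS\<^esub> c \<odot>\<^bsub>TS\<^esub> pt ?ll ?ll
     = (pt (e \<otimes> f) ?kk \<oplus>\<^bsub>TS\<^esub> ?X) \<oplus>\<^bsub>TS\<^esub> (?Y \<oplus>\<^bsub>TS\<^esub> (pt ?ll (e \<otimes> f) \<oplus>\<^bsub>TS\<^esub> c \<odot>\<^bsub>TS\<^esub> pt ?ll ?ll))"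
    by (simp add: TS.a_assoc)
  also have "\<dots> = (pt (e \<otimes> f) ?kk \<oplus>\<^bsub>TS\<^esub> c \<odot>\<^bsub>TS\<^esub> pt ?ll ?kk) \<oplus>\<^bsub>TS\<^esub> (?X \<oplus>\<^bsub>TS\<^esub> (?Y \<oplus>\<^bsub>TS\<^esub> pt ?ll (f \<otimes> e)))"
    unfolding 4 by (simp add: TS.a_ac)
  also have "\<dots> = ((pt (f \<otimes> e) ?kk \<oplus>\<^bsub>TS\<^esub> ?X) \<oplus>\<^bsub>TS\<^esub> (?Y \<oplus>\<^bsub>TS\<^esub> pt ?ll (f \<otimes> e))) \<oplus>\<^bsub>TS\<^esub> c \<odot>\<^bsub>TS\<^esub> pt ?kk ?kk"
    unfolding 3 by (simp add: TS.a_ac)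
  finally show ?thesis unfolding 1 2 .
qed

interpretation UU: tensor_sq "uq_algebra \<gamma>" for \<gamma> :: real
  by (intro tensor_sq.intro complex_alg_uq)

lemma uq_comult_gen_closed: "uq_comult_gen \<gamma> g \<in> carrier (tensor_square (uq_algebra \<gamma>))"
  by (cases g) (auto intro!: UU.TS.a_closed UU.pt_closed)

lemma uq_rep_comult: "uq_rep (tensor_square (uq_algebra \<gamma>)) \<gamma> (uq_comult_gen \<gamma>)"
proof -
  interpret U: uq_rep "uq_algebra \<gamma>" \<gamma> "\<lambda>g. umono \<gamma> 1 [g]" by (rule uq_rep_uq)
  have ek: "pure_tensor (uq_algebra \<gamma>) x (umono \<gamma> c w) = c \<odot>\<^bsub>tensor_square (uq_algebra \<gamma>)\<^esub> pure_tensor (uq_algebra \<gamma>) x (umono \<gamma> 1 w)"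
    "pure_tensor (uq_algebra \<gamma>) (umono \<gamma> c w) x = c \<odot>\<^bsub>tensor_square (uq_algebra \<gamma>)\<^esub> pure_tensor (uq_algebra \<gamma>) (umono \<gamma> 1 w) x"
    if "x \<in> carrier (uq_algebra \<gamma>)" for x c w
    using UU.pt_smult[OF that umono_simps(1)[of \<gamma> 1 w], of c] UU.pt_smult[OF umono_simps(1)[of \<gamma> 1 w] that, of c]
    by simp_all
  \<comment> \<open>Instances of \<open>ek\<close> with a power of q as coefficient;
    \<open>ek\<close> itself would rewrite the coefficient 1 to itself forever.\<close>
  have ek': "pure_tensor (uq_algebra \<gamma>) x (umono \<gamma> (qpow \<gamma> r) w) = qpow \<gamma> r \<odot>\<^bsub>tensor_square (uq_algebra \<gamma>)\<^esub> pure_tensor (uq_algebra \<gamma>) x (umono \<gamma> 1 w)"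
    "pure_tensor (uq_algebra \<gamma>) (umono \<gamma> (qpow \<gamma> r) w) x = qpow \<gamma> r \<odot>\<^bsub>tensor_square (uq_algebra \<gamma>)\<^esub> pure_tensor (uq_algebra \<gamma>) (umono \<gamma> 1 w) x"
    if "x \<in> carrier (uq_algebra \<gamma>)" for x r w
    by (rule ek[OF that])+
  have K: "umono \<gamma> 1 [UK1, UK1, UK2i, UK1i] = umono \<gamma> 1 [UK1, UK2i]"
    "umono \<gamma> 1 [UK1, UK2, UK1i, UK1i] = umono \<gamma> 1 [UK2, UK1i]"
    "umono \<gamma> 1 [UK2, UK1, UK2i, UK2i] = umono \<gamma> 1 [UK1, UK2i]"
    "umono \<gamma> 1 [UK2, UK2, UK1i, UK2i] = umono \<gamma> 1 [UK2, UK1i]"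
    using U.conj_K by simp_all
  \<comment> \<open>Moving K and K^(-1) to the right of E and F yields equal powers of q on the two
    sides of each mixed-term hypothesis of \<open>skew_commutator\<close>.\<close>
  have w: "umono \<gamma> 1 [UK1, UK2i, UF] = umono \<gamma> (qpow \<gamma> (-1)) [UF, UK1, UK2i]"
    "umono \<gamma> 1 [UK1, UK2i, UE] = umono \<gamma> (qpow \<gamma> 1) [UE, UK1, UK2i]"
    "umono \<gamma> 1 [UK2, UK1i, UF] = umono \<gamma> (qpow \<gamma> 1) [UF, UK2, UK1i]"
    "umono \<gamma> 1 [UK2, UK1i, UE] = umono \<gamma> (qpow \<gamma> (-1)) [UE, UK2, UK1i]"
    using U.KF U.KE U.KiF U.KiE by simp_all
  note sm = UU.TS.sm_mult[symmetric, of "pure_tensor (uq_algebra \<gamma>) x y" \<gamma> for x y]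
  show ?thesis
  proof (unfold_locales, goal_cases)
    case 1 show ?case by (rule uq_comult_gen_closed)
  next
    \<comment> \<open>Goal 11 is the commutator relation of E and F.\<close>
    case 11
    show ?case
      using UU.skew_commutator[of "umono \<gamma> 1 [UE]" \<gamma> "umono \<gamma> 1 [UF]" "umono \<gamma> 1 [UK1, UK2i]" "umono \<gamma> 1 [UK2, UK1i]" "1 / qlam \<gamma>"]
        uq_EF_words
      by (simp add: w ek' sm qpow_add)
  qed (simp_all add: uq_words UU.pt_one uq_one UU.TS.l_distr UU.TS.r_distr K UU.TS.sm_add_right ek')
qed

subsection \<open>Reduction of the module algebra conditions to generators\<close>

lemma uq_gl2_R_simps [simp]:
  "carrier (uq_gl2_R \<gamma>) = carrier (uq_algebra \<gamma>)" "mult (uq_gl2_R \<gamma>) = mult (uq_algebra \<gamma>)"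
  "one (uq_gl2_R \<gamma>) = one (uq_algebra \<gamma>)" "add (uq_gl2_R \<gamma>) = add (uq_algebra \<gamma>)"
  "smult (uq_gl2_R \<gamma>) = smult (uq_algebra \<gamma>)"
  by (simp_all add: uq_gl2_R_def)

lemma uq_induct [consumes 1, case_names one gen add smult]:
  assumes "z \<in> carrier (uq_algebra \<gamma>)"
    and "Q \<one>\<^bsub>uq_algebra \<gamma>\<^esub>"
    and "\<And>g z. z \<in> carrier (uq_algebra \<gamma>) \<Longrightarrow> Q z \<Longrightarrow> Q (umono \<gamma> 1 [g] \<otimes>\<^bsub>uq_algebra \<gamma>\<^esub> z)"
    and "\<And>y z. \<lbrakk>y \<in> carrier (uq_algebra \<gamma>); z \<in> carrier (uq_algebra \<gamma>); Q y; Q z\<rbrakk> \<Longrightarrow> Q (y \<oplus>\<^bsub>uq_algebra \<gamma>\<^esub> z)"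
    and "\<And>c z. z \<in> carrier (uq_algebra \<gamma>) \<Longrightarrow> Q z \<Longrightarrow> Q (c \<odot>\<^bsub>uq_algebra \<gamma>\<^esub> z)"
  shows "Q z"
  using assms unfolding uq_algebra_eq umono_eq by (rule pres_induct)

lemma comult_hom:
  "alg_hom (uq_algebra \<gamma>) (tensor_square (uq_algebra \<gamma>)) (comult (uq_gl2_R \<gamma>))"
  "comult (uq_gl2_R \<gamma>) (umono \<gamma> 1 [g]) = uq_comult_gen \<gamma> g"
proof -
  interpret uq_rep "tensor_square (uq_algebra \<gamma>)" \<gamma> "uq_comult_gen \<gamma>" by (rule uq_rep_comult)
  show "alg_hom (uq_algebra \<gamma>) (tensor_square (uq_algebra \<gamma>)) (comult (uq_gl2_R \<gamma>))"
    "comult (uq_gl2_R \<gamma>) (umono \<gamma> 1 [g]) = uq_comult_gen \<gamma> g"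
    by (simp_all add: uq_gl2_R_def uq_hom del: uq_comult_gen.simps)
qed

lemma antipode_hom:
  "alg_hom (uq_algebra \<gamma>) (opp_algebra (uq_algebra \<gamma>)) (antipode (uq_gl2_R \<gamma>))"
  "antipode (uq_gl2_R \<gamma>) (umono \<gamma> 1 [g]) = uq_antipode_gen \<gamma> g"
  by (simp_all add: uq_gl2_R_def uq_antipode_hom)

lemma star_hom:
  "alg_hom (uq_algebra \<gamma>) (conj_algebra (opp_algebra (uq_algebra \<gamma>))) (star (uq_gl2_R \<gamma>))"
  "star (uq_gl2_R \<gamma>) (umono \<gamma> c [g]) = cnj c \<odot>\<^bsub>uq_algebra \<gamma>\<^esub> uq_star_gen \<gamma> g"
  by (simp_all add: uq_gl2_R_def uq_star_hom)

fun inv_gen :: "ugen \<Rightarrow> ugen" where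
  "inv_gen UE = UE" | "inv_gen UF = UF" | "inv_gen UK1 = UK1i" | "inv_gen UK1i = UK1"
| "inv_gen UK2 = UK2i" | "inv_gen UK2i = UK2"

text \<open>E and F are fixed because q has modulus one: the antipode and the involution contribute
  -q and its conjugate, whose product with the other sign is 1.\<close>

lemma star_antipode_gen:
  "star (uq_gl2_R \<gamma>) (uq_antipode_gen \<gamma> g) = umono \<gamma> 1 [inv_gen g]"
  by (cases g) (simp_all add: star_hom qpow_add)

text \<open>
  The coproduct is a homomorphism and \<open>f \<mapsto> S(f)\<^sup>*\<close> is an antilinear homomorphism, with values
  \<open>inv_gen k\<close> on the generators \<open>k\<close>; hence both compatibility conditions
  pass from the generators to all of \<open>U\<^sub>q(gl\<^sub>2)\<close>.
\<close>

locale gen_module_star = star_algebra Z for \<gamma> :: real and Z :: "('z, 'n) star_algebra_scheme" (structure) +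
  fixes act :: "uq \<Rightarrow> 'z \<Rightarrow> 'z"
  assumes lin_left: "x \<in> carrier Z \<Longrightarrow> lin_map (uq_algebra \<gamma>) Z (\<lambda>f. act f x)"
    and lin_right: "f \<in> carrier (uq_algebra \<gamma>) \<Longrightarrow> lin_map Z Z (act f)"
    and act_mult: "\<lbrakk>f \<in> carrier (uq_algebra \<gamma>); g \<in> carrier (uq_algebra \<gamma>); x \<in> carrier Z\<rbrakk>
      \<Longrightarrow> act (f \<otimes>\<^bsub>uq_algebra \<gamma>\<^esub> g) x = act f (act g x)"
    and act_one: "x \<in> carrier Z \<Longrightarrow> act \<one>\<^bsub>uq_algebra \<gamma>\<^esub> x = x"
    and leibniz_skew: "\<lbrakk>k = UE \<or> k = UF; x \<in> carrier Z; y \<in> carrier Z\<rbrakk>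
      \<Longrightarrow> act (umono \<gamma> 1 [k]) (x \<otimes> y) = act (umono \<gamma> 1 [k]) x \<otimes> act (umono \<gamma> 1 [UK1, UK2i]) y
         \<oplus> act (umono \<gamma> 1 [UK2, UK1i]) x \<otimes> act (umono \<gamma> 1 [k]) y"
    and leibniz_aut: "\<lbrakk>k \<noteq> UE; k \<noteq> UF; x \<in> carrier Z; y \<in> carrier Z\<rbrakk>
      \<Longrightarrow> act (umono \<gamma> 1 [k]) (x \<otimes> y) = act (umono \<gamma> 1 [k]) x \<otimes> act (umono \<gamma> 1 [k]) y"
    and star_gen: "x \<in> carrier Z \<Longrightarrow> star Z (act (umono \<gamma> 1 [k]) x) = act (umono \<gamma> 1 [inv_gen k]) (star Z x)"
begin

lemma complex_vs_Z: "complex_vs Z"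
proof (intro complex_vs.intro complex_vs_axioms.intro)
  show "abelian_group Z" by (rule M.abelian_group_axioms)
qed (use smult_closed smult_l_distr smult_r_distr smult_assoc1 smult_one in
    \<open>auto simp: ring_of_type_algebra_def\<close>)

sublocale Z: complex_vs Z by (rule complex_vs_Z)

lemmas actD = lin_mapD[OF lin_right]

text \<open>For fixed \<open>x\<close> and \<open>y\<close> this is the function which
  \<open>act_product\<close> applies to the representatives of the coproduct. It is linear but not
  multiplicative, so its vanishing on the tensor ideal is not automatic.\<close>

definition T :: "'z \<Rightarrow> 'z \<Rightarrow> (uq \<times> uq \<Rightarrow>\<^sub>0 complex) \<Rightarrow> 'z" where
  "T x y = lin_ext Z (\<lambda>(g, h). act g x \<otimes> act h y)"

abbreviation "U2 \<equiv> monoid_algebra (uq_algebra \<gamma> \<times>\<times> uq_algebra \<gamma>)"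

lemma T_dom: "\<lbrakk>x \<in> carrier Z; y \<in> carrier Z\<rbrakk>
    \<Longrightarrow> (\<lambda>(g, h). act g x \<otimes> act h y) \<in> carrier (uq_algebra \<gamma> \<times>\<times> uq_algebra \<gamma>) \<rightarrow> carrier Z"
  using lin_mapD(1)[OF lin_left] by (auto intro!: mult_closed)

lemma T_lin: "\<lbrakk>x \<in> carrier Z; y \<in> carrier Z\<rbrakk> \<Longrightarrow> lin_map U2 Z (T x y)"
  unfolding T_def using T_dom
  by (intro lin_mapI) (simp_all add: Z.lin_ext_closed[OF T_dom] Z.lin_ext_add[OF T_dom] Z.lin_ext_smult[OF T_dom])

lemma T_single: "\<lbrakk>x \<in> carrier Z; y \<in> carrier Z; g \<in> carrier (uq_algebra \<gamma>); h \<in> carrier (uq_algebra \<gamma>)\<rbrakk>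
   \<Longrightarrow> T x y (Poly_Mapping.single (g, h) c) = c \<odot> (act g x \<otimes> act h y)"
  unfolding T_def by (subst Z.lin_ext_single) (auto intro!: mult_closed actD)

lemma U2_induct [consumes 1, case_names zero single]:
  assumes "p \<in> carrier U2" "P 0"
    and "\<And>g h c p. \<lbrakk>g \<in> carrier (uq_algebra \<gamma>); h \<in> carrier (uq_algebra \<gamma>); p \<in> carrier U2; P p\<rbrakk>
      \<Longrightarrow> P (Poly_Mapping.single (g, h) c + p)"
  shows "P p"
proof -
  have "Poly_Mapping.keys p \<subseteq> carrier (uq_algebra \<gamma>) \<times> carrier (uq_algebra \<gamma>)" using assms(1) by simp
  thus ?thesis
    by (induction p rule: pm_induct) (use assms(2,3) in auto)
qed

text \<open>The pair multiplied on the right acts first and can be moved into the arguments.\<close>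

lemma T_mult_right:
  assumes "x \<in> carrier Z" "y \<in> carrier Z" "g \<in> carrier (uq_algebra \<gamma>)" "h \<in> carrier (uq_algebra \<gamma>)" "p \<in> carrier U2"
  shows "T x y (p \<otimes>\<^bsub>U2\<^esub> Poly_Mapping.single (g, h) c) = c \<odot> T (act g x) (act h y) p"
  using assms(5)
proof (induction p rule: U2_induct)
  case zero
  show ?case by (simp add: T_def)
next
  case (single a b d p)
  have cl: "Poly_Mapping.single (a, b) d \<in> carrier U2" "Poly_Mapping.single (a \<otimes>\<^bsub>uq_algebra \<gamma>\<^esub> g, b \<otimes>\<^bsub>uq_algebra \<gamma>\<^esub> h) (d * c) \<in> carrier U2"
    "p \<otimes>\<^bsub>U2\<^esub> Poly_Mapping.single (g, h) c \<in> carrier U2"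
    using single assms by (auto intro!: UU.M2.m_closed UU.single_in_M2 simp del: monoid_algebra_simps)
  have gx: "act g x \<in> carrier Z" "act h y \<in> carrier Z" using assms actD by auto
  have "T x y ((Poly_Mapping.single (a, b) d + p) \<otimes>\<^bsub>U2\<^esub> Poly_Mapping.single (g, h) c)
     = T x y (Poly_Mapping.single (a \<otimes>\<^bsub>uq_algebra \<gamma>\<^esub> g, b \<otimes>\<^bsub>uq_algebra \<gamma>\<^esub> h) (d * c)) \<oplus> T x y (p \<otimes>\<^bsub>U2\<^esub> Poly_Mapping.single (g, h) c)"
    using lin_mapD(2)[OF T_lin[OF assms(1,2)] cl(2,3)] by (simp add: monoid_algebra_mult)
  also have "\<dots> = c \<odot> (d \<odot> (act a (act g x) \<otimes> act b (act h y))) \<oplus> c \<odot> T (act g x) (act h y) p"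
    using single assms gx by (simp add: T_single act_mult mult.commute actD mult_closed flip: Z.sm_mult)
  also have "\<dots> = c \<odot> T (act g x) (act h y) (Poly_Mapping.single (a, b) d + p)"
    using lin_mapD(2)[OF T_lin[OF gx] cl(1) single(3)] single gx lin_mapD(1)[OF T_lin[OF gx] single(3)]
    by (simp add: T_single Z.sm_add_right mult_closed actD)
  finally show ?case .
qed

text \<open>An ideal containing the bilinearity relations, on which every \<open>T x y\<close> vanishes.\<close>

definition N2 :: "(uq \<times> uq \<Rightarrow>\<^sub>0 complex) set" where
  "N2 = {p \<in> carrier U2. \<forall>g\<in>carrier (uq_algebra \<gamma>). \<forall>h\<in>carrier (uq_algebra \<gamma>).
     \<forall>x\<in>carrier Z. \<forall>y\<in>carrier Z. T x y (Poly_Mapping.single (g, h) 1 \<otimes>\<^bsub>U2\<^esub> p) = \<zero>}"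

lemma N2D:
  assumes "p \<in> N2" "g \<in> carrier (uq_algebra \<gamma>)" "h \<in> carrier (uq_algebra \<gamma>)" "x \<in> carrier Z" "y \<in> carrier Z"
  shows "T x y (Poly_Mapping.single (g, h) 1 \<otimes>\<^bsub>U2\<^esub> p) = \<zero>"
  using assms by (auto simp: N2_def)

text \<open>Left multiplication by a pair is absorbed into \<open>g\<close> and \<open>h\<close>,
  right multiplication by a pair into \<open>x\<close> and \<open>y\<close> through
  \<open>T_mult_right\<close>. This is why the definition of \<open>N2\<close> quantifies over all
  four.\<close>

lemma ideal_N2: "ideal N2 U2"
proof (rule UU.M2.linear_idealI)
  have cl: "Poly_Mapping.single (g, h) c \<otimes>\<^bsub>U2\<^esub> p \<in> carrier U2"
    if "g \<in> carrier (uq_algebra \<gamma>)" "h \<in> carrier (uq_algebra \<gamma>)" "p \<in> carrier U2" for g h c p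
    using that UU.M2.m_closed UU.single_in_M2 by blast
  have car: "N2 \<subseteq> carrier U2" by (auto simp: N2_def)
  show "N2 \<subseteq> carrier U2" by (rule car)
  show "\<zero>\<^bsub>U2\<^esub> \<in> N2" by (auto simp: N2_def T_def)
  fix p assume p: "p \<in> N2"
  have pc: "p \<in> carrier U2" using p car by blast
  show "p \<oplus>\<^bsub>U2\<^esub> q \<in> N2" if q: "q \<in> N2" for q
  proof -
    have qc: "q \<in> carrier U2" using q car by blast
    have "T x y (Poly_Mapping.single (g, h) 1 \<otimes>\<^bsub>U2\<^esub> (p \<oplus>\<^bsub>U2\<^esub> q)) = \<zero>"
      if "g \<in> carrier (uq_algebra \<gamma>)" "h \<in> carrier (uq_algebra \<gamma>)" "x \<in> carrier Z" "y \<in> carrier Z" for g h x y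
      using lin_mapD(2)[OF T_lin cl cl] that pc qc N2D[OF p] N2D[OF q]
      by (subst UU.M2.r_distr) (simp_all del: monoid_algebra_simps)
    thus ?thesis using UU.M2.a_closed[OF pc qc] unfolding N2_def by blast
  qed
  show "c \<odot>\<^bsub>U2\<^esub> p \<in> N2" for c
  proof -
    have "T x y (Poly_Mapping.single (g, h) 1 \<otimes>\<^bsub>U2\<^esub> (c \<odot>\<^bsub>U2\<^esub> p)) = \<zero>"
      if "g \<in> carrier (uq_algebra \<gamma>)" "h \<in> carrier (uq_algebra \<gamma>)" "x \<in> carrier Z" "y \<in> carrier Z" for g h x y
      using lin_mapD(3)[OF T_lin cl] that pc N2D[OF p]
      by (subst UU.M2.sm_mult_right) (simp_all del: monoid_algebra_simps)
    thus ?thesis using UU.M2.sm_closed[OF pc] unfolding N2_def by blast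
  qed
  fix q assume q: "q \<in> carrier U2"
  show "q \<otimes>\<^bsub>U2\<^esub> p \<in> N2"
  proof -
    have "T x y (Poly_Mapping.single (g, h) 1 \<otimes>\<^bsub>U2\<^esub> (q \<otimes>\<^bsub>U2\<^esub> p)) = \<zero>"
      if gh: "g \<in> carrier (uq_algebra \<gamma>)" "h \<in> carrier (uq_algebra \<gamma>)" "x \<in> carrier Z" "y \<in> carrier Z" for g h x y
      using q
    proof (induction q rule: U2_induct)
      case zero
      show ?case by (simp add: T_def)
    next
      case (single a b c q)
      have ab: "g \<otimes>\<^bsub>uq_algebra \<gamma>\<^esub> a \<in> carrier (uq_algebra \<gamma>)" "h \<otimes>\<^bsub>uq_algebra \<gamma>\<^esub> b \<in> carrier (uq_algebra \<gamma>)"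
        using gh single by auto
      have "Poly_Mapping.single (g, h) 1 \<otimes>\<^bsub>U2\<^esub> (Poly_Mapping.single (a, b) c \<otimes>\<^bsub>U2\<^esub> p)
         = (Poly_Mapping.single (g, h) 1 \<otimes>\<^bsub>U2\<^esub> Poly_Mapping.single (a, b) c) \<otimes>\<^bsub>U2\<^esub> p"
        by (rule UU.M2.m_assoc[symmetric]) (use gh single pc in simp_all)
      also have "\<dots> = (c \<odot>\<^bsub>U2\<^esub> Poly_Mapping.single (g \<otimes>\<^bsub>uq_algebra \<gamma>\<^esub> a, h \<otimes>\<^bsub>uq_algebra \<gamma>\<^esub> b) 1) \<otimes>\<^bsub>U2\<^esub> p"
        by (simp add: monoid_algebra_single_mult pmap_times_single)
      also have "\<dots> = c \<odot>\<^bsub>U2\<^esub> (Poly_Mapping.single (g \<otimes>\<^bsub>uq_algebra \<gamma>\<^esub> a, h \<otimes>\<^bsub>uq_algebra \<gamma>\<^esub> b) 1 \<otimes>\<^bsub>U2\<^esub> p)"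
        by (rule UU.M2.sm_mult_left[OF UU.single_in_M2[OF ab] pc])
      finally have e: "Poly_Mapping.single (g, h) 1 \<otimes>\<^bsub>U2\<^esub> (Poly_Mapping.single (a, b) c \<otimes>\<^bsub>U2\<^esub> p) = \<dots>" .
      have t1: "T x y (Poly_Mapping.single (g, h) 1 \<otimes>\<^bsub>U2\<^esub> (Poly_Mapping.single (a, b) c \<otimes>\<^bsub>U2\<^esub> p)) = \<zero>"
        unfolding e using lin_mapD(3)[OF T_lin[OF gh(3,4)] cl[OF ab pc]] N2D[OF p ab gh(3,4)] by simp
      have "Poly_Mapping.single (g, h) 1 \<otimes>\<^bsub>U2\<^esub> ((Poly_Mapping.single (a, b) c + q) \<otimes>\<^bsub>U2\<^esub> p)
        = Poly_Mapping.single (g, h) 1 \<otimes>\<^bsub>U2\<^esub> (Poly_Mapping.single (a, b) c \<otimes>\<^bsub>U2\<^esub> p)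
          \<oplus>\<^bsub>U2\<^esub> Poly_Mapping.single (g, h) 1 \<otimes>\<^bsub>U2\<^esub> (q \<otimes>\<^bsub>U2\<^esub> p)"
        by (simp add: monoid_algebra_mult)
      thus ?case
        using lin_mapD(2)[OF T_lin[OF gh(3,4)] cl[OF gh(1,2) cl[OF single(1,2) pc]] cl[OF gh(1,2) UU.M2.m_closed[OF single(3) pc]]]
          t1 single(4) by (simp del: monoid_algebra_simps)
    qed
    thus ?thesis using UU.M2.m_closed[OF q pc] unfolding N2_def by blast
  qed
  show "p \<otimes>\<^bsub>U2\<^esub> q \<in> N2"
  proof -
    have "T x y (Poly_Mapping.single (g, h) 1 \<otimes>\<^bsub>U2\<^esub> (p \<otimes>\<^bsub>U2\<^esub> q)) = \<zero>"
      if gh: "g \<in> carrier (uq_algebra \<gamma>)" "h \<in> carrier (uq_algebra \<gamma>)" "x \<in> carrier Z" "y \<in> carrier Z" for g h x y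
      using q
    proof (induction q rule: U2_induct)
      case zero
      show ?case by (simp add: T_def)
    next
      case (single a b c q)
      have ax: "act a x \<in> carrier Z" "act b y \<in> carrier Z" using actD single gh by auto
      have "Poly_Mapping.single (g, h) 1 \<otimes>\<^bsub>U2\<^esub> (p \<otimes>\<^bsub>U2\<^esub> Poly_Mapping.single (a, b) c)
         = (Poly_Mapping.single (g, h) 1 \<otimes>\<^bsub>U2\<^esub> p) \<otimes>\<^bsub>U2\<^esub> Poly_Mapping.single (a, b) c"
        by (rule UU.M2.m_assoc[symmetric]) (use gh single pc in simp_all)
      hence t1: "T x y (Poly_Mapping.single (g, h) 1 \<otimes>\<^bsub>U2\<^esub> (p \<otimes>\<^bsub>U2\<^esub> Poly_Mapping.single (a, b) c)) = \<zero>"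
        using T_mult_right[OF gh(3,4) single(1,2) cl[OF gh(1,2) pc]] N2D[OF p gh(1,2) ax] by simp
      have "Poly_Mapping.single (g, h) 1 \<otimes>\<^bsub>U2\<^esub> (p \<otimes>\<^bsub>U2\<^esub> (Poly_Mapping.single (a, b) c + q))
        = Poly_Mapping.single (g, h) 1 \<otimes>\<^bsub>U2\<^esub> (p \<otimes>\<^bsub>U2\<^esub> Poly_Mapping.single (a, b) c)
          \<oplus>\<^bsub>U2\<^esub> Poly_Mapping.single (g, h) 1 \<otimes>\<^bsub>U2\<^esub> (p \<otimes>\<^bsub>U2\<^esub> q)"
        by (simp add: monoid_algebra_mult)
      thus ?case
        using lin_mapD(2)[OF T_lin[OF gh(3,4)] cl[OF gh(1,2) UU.M2.m_closed[OF pc UU.single_in_M2[OF single(1,2)]]]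
            cl[OF gh(1,2) UU.M2.m_closed[OF pc single(3)]]]
          t1 single(4) by (simp del: monoid_algebra_simps)
    qed
    thus ?thesis using UU.M2.m_closed[OF pc q] unfolding N2_def by blast
  qed
qed

lemma T_minus:
  assumes "x \<in> carrier Z" "y \<in> carrier Z" "p \<in> carrier U2" "q \<in> carrier U2"
  shows "T x y (p - q) = T x y p \<ominus> T x y q"
  by (rule Z.lin_map_minus[OF T_lin]) (fact assms)+

lemma U2_mult_diff: "r \<otimes>\<^bsub>U2\<^esub> (p - q) = r \<otimes>\<^bsub>U2\<^esub> p - r \<otimes>\<^bsub>U2\<^esub> q"
  using monoid_algebra_mult_add_right[where q = r and p = "p - q" and p' = q and M = "uq_algebra \<gamma> \<times>\<times> uq_algebra \<gamma>"] by (simp add: algebra_simps)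

text \<open>A bilinearity relator stays one after left multiplication by a pair. It evaluates to
  zero since \<open>act\<close> is linear in the algebra element and the product of \<open>Z\<close>
  is bilinear.\<close>

lemma tensor_rels_N2: "tensor_rels (uq_algebra \<gamma>) \<subseteq> N2"
proof
  fix r assume r: "r \<in> tensor_rels (uq_algebra \<gamma>)"
  have "T x y (Poly_Mapping.single (g, h) 1 \<otimes>\<^bsub>U2\<^esub> r) = \<zero>"
    if gh: "g \<in> carrier (uq_algebra \<gamma>)" "h \<in> carrier (uq_algebra \<gamma>)" "x \<in> carrier Z" "y \<in> carrier Z" for g h x y
  proof -
    note D = actD lin_mapD[OF lin_left] mult_closed mult_add_left mult_add_right mult_smult_left mult_smult_right
    note M = U2_mult_diff monoid_algebra_single_mult T_minus UU.minus_in_M2 UU.single_in_M2 T_single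
    have z: "((a \<oplus> b) \<ominus> a) \<ominus> b = \<zero>" if "a \<in> carrier Z" "b \<in> carrier Z" for a b
    proof -
      have "((a \<oplus> b) \<ominus> a) \<ominus> b = (a \<oplus> \<ominus> a) \<oplus> (b \<oplus> \<ominus> b)"
        using that by (simp add: M.minus_eq M.a_ac)
      thus ?thesis using that by (simp add: M.r_neg)
    qed
    have z2: "a \<ominus> a = \<zero>" if "a \<in> carrier Z" for a
      using that by (simp add: M.minus_eq M.r_neg)
    show ?thesis using r unfolding tensor_rels_def
      by (elim UnE CollectE exE conjE)
        (use gh in \<open>simp_all add: M act_mult D z z2 del: monoid_algebra_simps\<close>)
  qed
  thus "r \<in> N2" using UU.tensor_rels_carrier r unfolding N2_def by blast
qed

text \<open>\<open>N2\<close> contains the relators and hence their ideal; taking units for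
  \<open>g\<close> and \<open>h\<close> recovers \<open>T x y\<close> itself.\<close>

lemma T_tensor_ideal:
  assumes "i \<in> tensor_ideal (uq_algebra \<gamma>)" "x \<in> carrier Z" "y \<in> carrier Z" shows "T x y i = \<zero>"
proof -
  have i: "i \<in> N2"
    using UU.M2.genideal_minimal[OF ideal_N2 tensor_rels_N2] assms(1) by (auto simp: tensor_ideal_def)
  hence ic: "i \<in> carrier U2" by (auto simp: N2_def)
  have "Poly_Mapping.single (\<one>\<^bsub>uq_algebra \<gamma>\<^esub>, \<one>\<^bsub>uq_algebra \<gamma>\<^esub>) 1 \<otimes>\<^bsub>U2\<^esub> i = i"
    using UU.M2.l_one[OF ic] by simp
  thus ?thesis using N2D[OF i _ _ assms(2,3), of "\<one>\<^bsub>uq_algebra \<gamma>\<^esub>" "\<one>\<^bsub>uq_algebra \<gamma>\<^esub>"] by simp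
qed

lemma T_coset_image:
  "\<lbrakk>x \<in> carrier Z; y \<in> carrier Z; t \<in> carrier U2\<rbrakk> \<Longrightarrow> T x y ` UU.tcoset \<gamma> t = {T x y t}"
  by (rule UU.M2.lin_map_coset_image[OF UU.ideal_tensor complex_vs_Z T_lin]) (simp_all add: T_tensor_ideal)

text \<open>Multiplying \<open>t\<close> by the explicit representative of the coproduct of a
  generator applies, for each pair (a, b) in \<open>t\<close>, the Leibniz rule of that generator to
  \<open>act a x\<close> and \<open>act b y\<close>.\<close>

lemma comult_gen_coset:
  assumes "t \<in> carrier U2"
  obtains s where "s \<in> carrier U2" "uq_comult_gen \<gamma> g \<otimes>\<^bsub>tensor_square (uq_algebra \<gamma>)\<^esub> UU.tcoset \<gamma> t = UU.tcoset \<gamma> s"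
    "\<And>x y. \<lbrakk>x \<in> carrier Z; y \<in> carrier Z\<rbrakk> \<Longrightarrow> T x y s = act (umono \<gamma> 1 [g]) (T x y t)"
proof -
  define s where "s = (if g = UE \<or> g = UF
     then Poly_Mapping.single (umono \<gamma> 1 [g], umono \<gamma> 1 [UK1, UK2i]) 1 + Poly_Mapping.single (umono \<gamma> 1 [UK2, UK1i], umono \<gamma> 1 [g]) 1
     else Poly_Mapping.single (umono \<gamma> 1 [g], umono \<gamma> 1 [g]) (1::complex))"
  have sc: "s \<in> carrier U2"
    using UU.M2.a_closed[OF UU.single_in_M2 UU.single_in_M2] unfolding s_def by (auto simp del: monoid_algebra_simps(1))
  have cg: "uq_comult_gen \<gamma> g = UU.tcoset \<gamma> s"
    using UU.TS_simps(3)[OF UU.single_in_M2 UU.single_in_M2, of _ \<gamma>]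
    unfolding s_def by (cases g) (simp_all add: pure_tensor_def)
  have "T x y (s \<otimes>\<^bsub>U2\<^esub> t) = act (umono \<gamma> 1 [g]) (T x y t)" if xy: "x \<in> carrier Z" "y \<in> carrier Z" for x y
    using assms
  proof (induction t rule: U2_induct)
    case zero
    show ?case using lin_map_zero[OF complex_vs_Z complex_vs_Z lin_right[of "umono \<gamma> 1 [g]"]] by (simp add: T_def)
  next
    case (single a b c t)
    let ?g = "umono \<gamma> 1 [g]" and ?U = "uq_algebra \<gamma>"
    have abx: "act a x \<in> carrier Z" "act b y \<in> carrier Z" using actD single xy by auto
    have abm: "act a x \<otimes> act b y \<in> carrier Z" using abx by (rule mult_closed)
    have sab: "s \<otimes>\<^bsub>U2\<^esub> Poly_Mapping.single (a, b) c \<in> carrier U2"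
      by (rule UU.M2.m_closed[OF sc UU.single_in_M2[OF single(1,2)]])
    have sg: "Poly_Mapping.single (f, h) c \<in> carrier U2" if "f \<in> carrier ?U" "h \<in> carrier ?U" for f h c
      using that by simp
    have t1: "T x y (s \<otimes>\<^bsub>U2\<^esub> Poly_Mapping.single (a, b) c) = c \<odot> act ?g (act a x \<otimes> act b y)"
    proof (cases "g = UE \<or> g = UF")
      case True
      have "T x y (s \<otimes>\<^bsub>U2\<^esub> Poly_Mapping.single (a, b) c)
        = T x y (Poly_Mapping.single (?g \<otimes>\<^bsub>?U\<^esub> a, umono \<gamma> 1 [UK1, UK2i] \<otimes>\<^bsub>?U\<^esub> b) c \<oplus>\<^bsub>U2\<^esub>
            Poly_Mapping.single (umono \<gamma> 1 [UK2, UK1i] \<otimes>\<^bsub>?U\<^esub> a, ?g \<otimes>\<^bsub>?U\<^esub> b) c)"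
        using True by (simp add: s_def monoid_algebra_mult)
      also have "\<dots> = T x y (Poly_Mapping.single (?g \<otimes>\<^bsub>?U\<^esub> a, umono \<gamma> 1 [UK1, UK2i] \<otimes>\<^bsub>?U\<^esub> b) c) \<oplus>
            T x y (Poly_Mapping.single (umono \<gamma> 1 [UK2, UK1i] \<otimes>\<^bsub>?U\<^esub> a, ?g \<otimes>\<^bsub>?U\<^esub> b) c)"
        by (rule lin_mapD(2)[OF T_lin[OF xy]]; rule sg; use single in simp)
      also have "\<dots> = c \<odot> (act ?g (act a x) \<otimes> act (umono \<gamma> 1 [UK1, UK2i]) (act b y)) \<oplus>
         c \<odot> (act (umono \<gamma> 1 [UK2, UK1i]) (act a x) \<otimes> act ?g (act b y))"
        using single xy by (simp add: T_single act_mult)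
      also have "\<dots> = c \<odot> act ?g (act a x \<otimes> act b y)"
        by (simp add: leibniz_skew[OF True abx] Z.sm_add_right mult_closed actD abx)
      finally show ?thesis .
    next
      case False
      thus ?thesis using single xy by (simp add: s_def monoid_algebra_mult T_single act_mult leibniz_aut abx)
    qed
    have "T x y (s \<otimes>\<^bsub>U2\<^esub> (Poly_Mapping.single (a, b) c + t))
       = T x y (s \<otimes>\<^bsub>U2\<^esub> Poly_Mapping.single (a, b) c) \<oplus> T x y (s \<otimes>\<^bsub>U2\<^esub> t)"
      using lin_mapD(2)[OF T_lin[OF xy] sab UU.M2.m_closed[OF sc single(3)]] by (simp add: monoid_algebra_mult)
    also have "\<dots> = act ?g (c \<odot> (act a x \<otimes> act b y)) \<oplus> act ?g (T x y t)"
      unfolding t1 single(4) by (simp add: actD abm)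
    also have "\<dots> = act ?g (T x y (Poly_Mapping.single (a, b) c + t))"
      using lin_mapD(2)[OF T_lin[OF xy] sg[OF single(1,2)] single(3)] lin_mapD(1)[OF T_lin[OF xy] single(3)] single xy
      by (simp add: T_single actD abm)
    finally show ?case .
  qed
  thus ?thesis using that[OF UU.M2.m_closed[OF sc assms]] UU.TS_simps(4)[OF sc assms] cg by simp
qed

text \<open>One representative with the right evaluation is enough, because all others in its coset
  evaluate alike by \<open>T_coset_image\<close>.\<close>

lemma comult_eval:
  assumes "f \<in> carrier (uq_algebra \<gamma>)"
  shows "\<exists>t\<in>carrier U2. comult (uq_gl2_R \<gamma>) f = UU.tcoset \<gamma> t
    \<and> (\<forall>x\<in>carrier Z. \<forall>y\<in>carrier Z. T x y t = act f (x \<otimes> y))"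
  using assms
proof (induction f rule: uq_induct)
  case one
  show ?case
  proof (intro bexI conjI ballI)
    let ?t = "Poly_Mapping.single (\<one>\<^bsub>uq_algebra \<gamma>\<^esub>, \<one>\<^bsub>uq_algebra \<gamma>\<^esub>) (1::complex)"
    show "comult (uq_gl2_R \<gamma>) \<one>\<^bsub>uq_algebra \<gamma>\<^esub> = UU.tcoset \<gamma> ?t"
      using alg_homD(2)[OF comult_hom(1)] by (simp add: UU.TS_simps(1))
    show "T x y ?t = act \<one>\<^bsub>uq_algebra \<gamma>\<^esub> (x \<otimes> y)" if "x \<in> carrier Z" "y \<in> carrier Z" for x y
      using that by (simp add: T_single act_one mult_closed)
    show "?t \<in> carrier U2" by simp
  qed
next
  case (gen g z)
  then obtain t where t: "t \<in> carrier U2" "comult (uq_gl2_R \<gamma>) z = UU.tcoset \<gamma> t"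
    "\<And>x y. x \<in> carrier Z \<Longrightarrow> y \<in> carrier Z \<Longrightarrow> T x y t = act z (x \<otimes> y)" by blast
  obtain s where s: "s \<in> carrier U2" "uq_comult_gen \<gamma> g \<otimes>\<^bsub>tensor_square (uq_algebra \<gamma>)\<^esub> UU.tcoset \<gamma> t = UU.tcoset \<gamma> s"
    "\<And>x y. \<lbrakk>x \<in> carrier Z; y \<in> carrier Z\<rbrakk> \<Longrightarrow> T x y s = act (umono \<gamma> 1 [g]) (T x y t)"
    using comult_gen_coset[OF t(1)] by blast
  have "comult (uq_gl2_R \<gamma>) (umono \<gamma> 1 [g] \<otimes>\<^bsub>uq_algebra \<gamma>\<^esub> z) = UU.tcoset \<gamma> s"
    using alg_homD(3)[OF comult_hom(1)] gen t(2) s(2) by (simp add: comult_hom(2))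
  thus ?case using s t(3) gen by (auto simp: act_mult mult_closed simp del: monoid_algebra_simps)
next
  case (add a b)
  then obtain t s where t: "t \<in> carrier U2" "comult (uq_gl2_R \<gamma>) a = UU.tcoset \<gamma> t"
    "\<And>x y. x \<in> carrier Z \<Longrightarrow> y \<in> carrier Z \<Longrightarrow> T x y t = act a (x \<otimes> y)"
    and s: "s \<in> carrier U2" "comult (uq_gl2_R \<gamma>) b = UU.tcoset \<gamma> s"
    "\<And>x y. x \<in> carrier Z \<Longrightarrow> y \<in> carrier Z \<Longrightarrow> T x y s = act b (x \<otimes> y)" by blast
  have "comult (uq_gl2_R \<gamma>) (a \<oplus>\<^bsub>uq_algebra \<gamma>\<^esub> b) = UU.tcoset \<gamma> (t \<oplus>\<^bsub>U2\<^esub> s)"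
    using lin_mapD(2)[OF alg_homD(1)[OF comult_hom(1)] add(1,2)] t(2) s(2) UU.TS_simps(3)[OF t(1) s(1)] by simp
  moreover have "T x y (t \<oplus>\<^bsub>U2\<^esub> s) = act (a \<oplus>\<^bsub>uq_algebra \<gamma>\<^esub> b) (x \<otimes> y)" if "x \<in> carrier Z" "y \<in> carrier Z" for x y
    using that lin_mapD(2)[OF T_lin t(1) s(1)] lin_mapD(2)[OF lin_left[OF mult_closed] add(1,2)] t(3) s(3) by simp
  ultimately show ?case using UU.M2.a_closed[OF t(1) s(1)] by blast
next
  case (smult c a)
  then obtain t where t: "t \<in> carrier U2" "comult (uq_gl2_R \<gamma>) a = UU.tcoset \<gamma> t"
    "\<And>x y. x \<in> carrier Z \<Longrightarrow> y \<in> carrier Z \<Longrightarrow> T x y t = act a (x \<otimes> y)" by blast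
  have "comult (uq_gl2_R \<gamma>) (c \<odot>\<^bsub>uq_algebra \<gamma>\<^esub> a) = UU.tcoset \<gamma> (c \<odot>\<^bsub>U2\<^esub> t)"
    using lin_mapD(3)[OF alg_homD(1)[OF comult_hom(1)] smult(1)] t(2) UU.TS_simps(5)[OF t(1)] by simp
  moreover have "T x y (c \<odot>\<^bsub>U2\<^esub> t) = act (c \<odot>\<^bsub>uq_algebra \<gamma>\<^esub> a) (x \<otimes> y)" if "x \<in> carrier Z" "y \<in> carrier Z" for x y
    using that lin_mapD(3)[OF T_lin t(1)] lin_mapD(3)[OF lin_left[OF mult_closed] smult(1)] t(3) by simp
  ultimately show ?case using UU.M2.sm_closed[OF t(1)] by blast
qed

text \<open>Antipode and involution both reverse products, so their composite preserves them. The
  induction over left multiplication by generators then has \<open>star_gen\<close> as its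
  step.\<close>

lemma star_eval:
  assumes "f \<in> carrier (uq_algebra \<gamma>)"
  shows "star (uq_gl2_R \<gamma>) (antipode (uq_gl2_R \<gamma>) f) \<in> carrier (uq_algebra \<gamma>)
    \<and> (\<forall>x\<in>carrier Z. star Z (act f x) = act (star (uq_gl2_R \<gamma>) (antipode (uq_gl2_R \<gamma>) f)) (star Z x))"
proof -
  let ?S = "antipode (uq_gl2_R \<gamma>)" and ?s = "star (uq_gl2_R \<gamma>)"
  note S = lin_mapD[OF alg_homD(1)[OF antipode_hom(1)[of \<gamma>]], simplified]
    alg_homD(2,3)[OF antipode_hom(1)[of \<gamma>], simplified]
  note s = lin_mapD[OF alg_homD(1)[OF star_hom(1)[of \<gamma>]], simplified]
    alg_homD(2,3)[OF star_hom(1)[of \<gamma>], simplified]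
  have cl: "?s (?S f) \<in> carrier (uq_algebra \<gamma>)" if "f \<in> carrier (uq_algebra \<gamma>)" for f
    using that S s by simp
  have "star Z (act f x) = act (?s (?S f)) (star Z x)" if "x \<in> carrier Z" for x
    using assms that
  proof (induction f arbitrary: x rule: uq_induct)
    case one
    thus ?case by (simp add: S s act_one star_closed)
  next
    case (gen g z)
    have "?s (?S (umono \<gamma> 1 [g] \<otimes>\<^bsub>uq_algebra \<gamma>\<^esub> z)) = umono \<gamma> 1 [inv_gen g] \<otimes>\<^bsub>uq_algebra \<gamma>\<^esub> ?s (?S z)"
      using gen(1) S(5)[of "umono \<gamma> 1 [g]" z] s(5)[OF S(1) S(1)]
      by (simp add: antipode_hom(2)[symmetric] star_antipode_gen[symmetric])
    thus ?case using gen by (simp add: act_mult star_gen cl star_closed actD)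
  next
    case (add a b)
    thus ?case
      using lin_mapD(2)[OF lin_left[OF add(5)] add(1,2)] lin_mapD(2)[OF lin_left[OF star_closed[OF add(5)]] cl[OF add(1)] cl[OF add(2)]]
      by (simp add: S s star_add actD)
  next
    case (smult c a)
    thus ?case
      using lin_mapD(3)[OF lin_left[OF smult(3)] smult(1)] lin_mapD(3)[OF lin_left[OF star_closed[OF smult(3)]] cl[OF smult(1)]]
      by (simp add: S s star_smult actD)
  qed
  thus ?thesis using cl assms by blast
qed

theorem module_star_algebra: "module_star_algebra (uq_gl2_R \<gamma>) Z act"
proof (unfold_locales, goal_cases)
  \<comment> \<open>Goals 8 and 9 are \<open>act_product\<close> and
    \<open>act_star\<close>.\<close>
  case (8 f x y)
  hence f: "f \<in> carrier (uq_algebra \<gamma>)" by simp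
  obtain t where t: "t \<in> carrier U2" "comult (uq_gl2_R \<gamma>) f = UU.tcoset \<gamma> t"
    "\<And>x y. x \<in> carrier Z \<Longrightarrow> y \<in> carrier Z \<Longrightarrow> T x y t = act f (x \<otimes> y)" using comult_eval[OF f] by blast
  show ?case unfolding t(2) using T_coset_image[OF 8(2,3) t(1)] t(3)[OF 8(2,3)] unfolding T_def by simp
next
  case (9 f x)
  thus ?case using star_eval by auto
qed (simp_all add: actD lin_mapD[OF lin_left] act_mult act_one)

end

subsection \<open>Operators satisfying the relations of \<open>U\<^sub>q(gl\<^sub>2)\<close>\<close>

text \<open>Operator form of \<open>uq_rep\<close>. The relations are required only on vectors of
  the carrier, so that no algebra of endomorphisms has to be formed.\<close>

locale uq_ops = complex_vs V for V :: "(complex, 'v, 'm) module_scheme" (structure) +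
  fixes \<gamma> :: real and \<rho> :: "ugen \<Rightarrow> 'v \<Rightarrow> 'v"
  assumes \<rho>_lin: "lin_map V V (\<rho> g)"
    and \<rho>_K1K2: "v \<in> carrier V \<Longrightarrow> \<rho> UK1 (\<rho> UK2 v) = \<rho> UK2 (\<rho> UK1 v)"
    and \<rho>_inv: "v \<in> carrier V \<Longrightarrow> \<rho> UK1 (\<rho> UK1i v) = v" "v \<in> carrier V \<Longrightarrow> \<rho> UK1i (\<rho> UK1 v) = v"
      "v \<in> carrier V \<Longrightarrow> \<rho> UK2 (\<rho> UK2i v) = v" "v \<in> carrier V \<Longrightarrow> \<rho> UK2i (\<rho> UK2 v) = v"
    and \<rho>_conj: "v \<in> carrier V \<Longrightarrow> \<rho> UK1 (\<rho> UE (\<rho> UK1i v)) = qpow \<gamma> (1/2) \<odot> \<rho> UE v"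
      "v \<in> carrier V \<Longrightarrow> \<rho> UK2 (\<rho> UE (\<rho> UK2i v)) = qpow \<gamma> (-1/2) \<odot> \<rho> UE v"
      "v \<in> carrier V \<Longrightarrow> \<rho> UK1 (\<rho> UF (\<rho> UK1i v)) = qpow \<gamma> (-1/2) \<odot> \<rho> UF v"
      "v \<in> carrier V \<Longrightarrow> \<rho> UK2 (\<rho> UF (\<rho> UK2i v)) = qpow \<gamma> (1/2) \<odot> \<rho> UF v"
    and \<rho>_EF: "v \<in> carrier V \<Longrightarrow> \<rho> UE (\<rho> UF v) \<oplus> (1 / qlam \<gamma>) \<odot> \<rho> UK2 (\<rho> UK1i (\<rho> UK2 (\<rho> UK1i v)))
      = \<rho> UF (\<rho> UE v) \<oplus> (1 / qlam \<gamma>) \<odot> \<rho> UK1 (\<rho> UK2i (\<rho> UK1 (\<rho> UK2i v)))"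
begin

lemma uq_word_rep: "left_word_rep V (uq_rels \<gamma>) (foldr \<rho>)"
proof (rule left_word_repI[OF \<rho>_lin])
  fix r v assume r: "r \<in> uq_rels \<gamma>" and v: "v \<in> carrier V"
  note c = lin_mapD(1)[OF \<rho>_lin]
  have w: "foldr \<rho> w v \<in> carrier V" for w by (induction w) (auto simp: v c)
  have l: "lin_map free_algebra V (lin_ext V (\<lambda>w. foldr \<rho> w v))"
    by (rule lin_map_lin_ext_free) (rule w)
  have s: "lin_ext V (\<lambda>w. foldr \<rho> w v) (fmono d w) = d \<odot> foldr \<rho> w v" for d w
    by (rule lin_ext_single) (rule w)
  show "lin_ext V (\<lambda>w. foldr \<rho> w v) r = \<zero>"
    using uq_rels_cases[OF r]
  proof (elim disjE bexE)
    fix x assume x: "x \<in> {(1, [UK1, UK2], 1, [UK2, UK1]), (1, [UK1, UK1i], 1, []), (1, [UK1i, UK1], 1, []),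
       (1, [UK2, UK2i], 1, []), (1, [UK2i, UK2], 1, []),
       (1, [UK1, UE, UK1i], qpow \<gamma> (1/2), [UE]), (1, [UK2, UE, UK2i], qpow \<gamma> (-1/2), [UE]),
       (1, [UK1, UF, UK1i], qpow \<gamma> (-1/2), [UF]), (1, [UK2, UF, UK2i], qpow \<gamma> (1/2), [UF])}"
      and re: "case x of (c, w, d, w') \<Rightarrow> r = fmono c w - fmono d w'"
    obtain c w d w' where xe: "x = (c, w, d, w')" by (cases x) auto
    have "c \<odot> foldr \<rho> w v = d \<odot> foldr \<rho> w' v"
      using x v unfolding xe by (auto simp: \<rho>_K1K2 \<rho>_inv \<rho>_conj lin_mapD(1)[OF \<rho>_lin])
    thus ?thesis using re w unfolding xe by (simp add: lin_map_minus_free[OF l] s minus_eq r_neg)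
  next
    assume 2: "r = fmono 1 [UE, UF] - fmono 1 [UF, UE]
       - (fmono (1 / qlam \<gamma>) [UK1, UK2i, UK1, UK2i] - fmono (1 / qlam \<gamma>) [UK2, UK1i, UK2, UK1i])"
    show ?thesis unfolding 2 using minus_minus_eq_zero[OF \<rho>_EF[OF v]]
      by (simp add: lin_map_minus_free[OF l] s v c)
  qed
qed

end

subsection \<open>The algebra \<open>\<O>(\<real>\<^sup>2\<^sub>q)\<close>\<close>

abbreviation oq_rels :: "real \<Rightarrow> (ogen list \<Rightarrow>\<^sub>0 complex) set" where
  "oq_rels \<gamma> \<equiv> {fmono 1 [OX, OY] - fmono (qpow \<gamma> 1) [OY, OX]}"

lemma oq_algebra_eq: "oq_algebra \<gamma> = pres_algebra (oq_rels \<gamma>)"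
  by (simp add: oq_algebra_def pres_algebra_def oq_ideal_def)

lemma omono_eq: "omono \<gamma> c w = pres_mono (oq_rels \<gamma>) c w"
  by (simp add: omono_def pres_mono_def oq_ideal_def)

lemma complex_alg_oq: "complex_alg (oq_algebra \<gamma>)"
  unfolding oq_algebra_eq by (rule complex_alg_pres)

interpretation O: complex_alg "oq_algebra \<gamma>" for \<gamma> :: real
  by (rule complex_alg_oq)

lemma omono_simps [simp]:
  "omono \<gamma> c w \<in> carrier (oq_algebra \<gamma>)"
  "omono \<gamma> c w \<otimes>\<^bsub>oq_algebra \<gamma>\<^esub> omono \<gamma> d w' = omono \<gamma> (c * d) (w @ w')"
  "c \<odot>\<^bsub>oq_algebra \<gamma>\<^esub> omono \<gamma> d w = omono \<gamma> (c * d) w"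
  "omono \<gamma> c w \<oplus>\<^bsub>oq_algebra \<gamma>\<^esub> omono \<gamma> d w = omono \<gamma> (c + d) w"
  by (simp_all add: oq_algebra_eq omono_eq)

lemma oq_one: "\<one>\<^bsub>oq_algebra \<gamma>\<^esub> = omono \<gamma> 1 []"
  by (simp add: oq_algebra_eq omono_eq pres_one)

lemma oq_rel: "omono \<gamma> c [OX, OY] = omono \<gamma> (c * qpow \<gamma> 1) [OY, OX]"
proof -
  have "omono \<gamma> 1 [OX, OY] = omono \<gamma> (qpow \<gamma> 1) [OY, OX]"
    unfolding omono_eq by (rule pres_rel2) simp
  hence "c \<odot>\<^bsub>oq_algebra \<gamma>\<^esub> omono \<gamma> 1 [OX, OY] = c \<odot>\<^bsub>oq_algebra \<gamma>\<^esub> omono \<gamma> (qpow \<gamma> 1) [OY, OX]" by (rule arg_cong)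
  thus ?thesis by simp
qed

lemma oq_induct [consumes 1, case_names one gen add smult]:
  assumes "z \<in> carrier (oq_algebra \<gamma>)"
    and "Q \<one>\<^bsub>oq_algebra \<gamma>\<^esub>"
    and "\<And>g z. z \<in> carrier (oq_algebra \<gamma>) \<Longrightarrow> Q z \<Longrightarrow> Q (omono \<gamma> 1 [g] \<otimes>\<^bsub>oq_algebra \<gamma>\<^esub> z)"
    and "\<And>y z. \<lbrakk>y \<in> carrier (oq_algebra \<gamma>); z \<in> carrier (oq_algebra \<gamma>); Q y; Q z\<rbrakk> \<Longrightarrow> Q (y \<oplus>\<^bsub>oq_algebra \<gamma>\<^esub> z)"
    and "\<And>c z. z \<in> carrier (oq_algebra \<gamma>) \<Longrightarrow> Q z \<Longrightarrow> Q (c \<odot>\<^bsub>oq_algebra \<gamma>\<^esub> z)"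
  shows "Q z"
  using assms unfolding oq_algebra_eq omono_eq by (rule pres_induct)

lemma oq_alg_ext_zero:
  assumes B: "complex_alg B" and \<phi>: "\<And>g. \<phi> g \<in> carrier B"
    and rel: "\<phi> OX \<otimes>\<^bsub>B\<^esub> \<phi> OY = qpow \<gamma> 1 \<odot>\<^bsub>B\<^esub> (\<phi> OY \<otimes>\<^bsub>B\<^esub> \<phi> OX)" and r: "r \<in> oq_rels \<gamma>"
  shows "alg_ext B \<phi> r = \<zero>\<^bsub>B\<^esub>"
proof -
  interpret B: complex_alg B by fact
  have "\<phi> OX \<otimes>\<^bsub>B\<^esub> \<phi> OY \<ominus>\<^bsub>B\<^esub> qpow \<gamma> 1 \<odot>\<^bsub>B\<^esub> (\<phi> OY \<otimes>\<^bsub>B\<^esub> \<phi> OX) = \<zero>\<^bsub>B\<^esub>"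
    unfolding rel using \<phi> by (simp add: B.minus_eq B.r_neg)
  thus ?thesis using r \<phi>
    by (simp add: B.lin_map_minus_free[OF alg_homD(1)[OF B.alg_hom_alg_ext[of \<phi>, OF \<phi>]]] B.alg_ext_mono)
qed

lemma oq_hom:
  assumes B: "complex_alg B" and \<phi>: "\<And>g. \<phi> g \<in> carrier B"
    and rel: "\<phi> OX \<otimes>\<^bsub>B\<^esub> \<phi> OY = qpow \<gamma> 1 \<odot>\<^bsub>B\<^esub> (\<phi> OY \<otimes>\<^bsub>B\<^esub> \<phi> OX)"
  shows "alg_hom (oq_algebra \<gamma>) B (quot_fun (alg_ext B \<phi>))"
    and "quot_fun (alg_ext B \<phi>) (omono \<gamma> c w) = c \<odot>\<^bsub>B\<^esub> word_val B \<phi> w"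
  unfolding oq_algebra_eq omono_eq
  by (rule pres_alg_hom[OF B \<phi> oq_alg_ext_zero[OF B \<phi> rel]]; assumption)+

lemma alg_hom_oq_eqI:
  assumes "complex_alg B" "alg_hom (oq_algebra \<gamma>) B f" "alg_hom (oq_algebra \<gamma>) B f'"
    and "\<And>g. f (omono \<gamma> 1 [g]) = f' (omono \<gamma> 1 [g])" "z \<in> carrier (oq_algebra \<gamma>)"
  shows "f z = f' z"
  using assms unfolding oq_algebra_eq omono_eq by (rule alg_hom_pres_eqI)

lemma alg_hom_comp: "alg_hom A B f \<Longrightarrow> alg_hom B C g \<Longrightarrow> alg_hom A C (\<lambda>z. g (f z))"
  by (auto simp: alg_hom_def lin_map_def Pi_iff)

lemma alg_hom_id: "alg_hom A A (\<lambda>z. z)"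
  by (auto simp: alg_hom_def lin_map_def)

lemma O_R2q_simps [simp]:
  "carrier (O_R2q \<gamma>) = carrier (oq_algebra \<gamma>)" "mult (O_R2q \<gamma>) = mult (oq_algebra \<gamma>)"
  "one (O_R2q \<gamma>) = one (oq_algebra \<gamma>)" "add (O_R2q \<gamma>) = add (oq_algebra \<gamma>)"
  "zero (O_R2q \<gamma>) = zero (oq_algebra \<gamma>)" "smult (O_R2q \<gamma>) = smult (oq_algebra \<gamma>)"
  by (simp_all add: O_R2q_def)

lemma oq_star_hom:
  "alg_hom (oq_algebra \<gamma>) (conj_algebra (opp_algebra (oq_algebra \<gamma>))) (star (O_R2q \<gamma>))"
  "star (O_R2q \<gamma>) (omono \<gamma> c [g]) = omono \<gamma> (cnj c) [g]"
proof -
  have B: "complex_alg (conj_algebra (opp_algebra (oq_algebra \<gamma>)))"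
    by (intro complex_alg_conj complex_alg_opp complex_alg_oq)
  note h = oq_hom[OF B, of "\<lambda>a. omono \<gamma> 1 [a]" \<gamma>]
  show "alg_hom (oq_algebra \<gamma>) (conj_algebra (opp_algebra (oq_algebra \<gamma>))) (star (O_R2q \<gamma>))"
    using h(1) by (simp add: O_R2q_def oq_rel qpow_add)
  show "star (O_R2q \<gamma>) (omono \<gamma> c [g]) = omono \<gamma> (cnj c) [g]"
    using h(2)[of c "[g]"] by (simp add: O_R2q_def oq_rel qpow_add)
qed

lemmas oq_starD = lin_mapD[OF alg_homD(1)[OF oq_star_hom(1)], simplified] alg_homD(2,3)[OF oq_star_hom(1), simplified]

lemma oq_star_star: "z \<in> carrier (oq_algebra \<gamma>) \<Longrightarrow> star (O_R2q \<gamma>) (star (O_R2q \<gamma>) z) = z"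
  by (induction z rule: oq_induct) (simp_all add: oq_starD oq_star_hom(2))

subsection \<open>The action on \<open>\<O>(\<real>\<^sup>2\<^sub>q)\<close>\<close>

fun oq_weight :: "real \<Rightarrow> ugen \<Rightarrow> ogen \<Rightarrow> complex" where
  "oq_weight \<gamma> UK1 OX = qpow \<gamma> (-1/2)" | "oq_weight \<gamma> UK1i OX = qpow \<gamma> (1/2)"
| "oq_weight \<gamma> UK2 OY = qpow \<gamma> (-1/2)" | "oq_weight \<gamma> UK2i OY = qpow \<gamma> (1/2)"
| "oq_weight \<gamma> _ _ = 1"

lemma oq_aut_hom:
  assumes "g \<noteq> UE" "g \<noteq> UF"
  shows "alg_hom (oq_algebra \<gamma>) (oq_algebra \<gamma>) (oq_aut \<gamma> g)"
    and "oq_aut \<gamma> g (omono \<gamma> c [a]) = omono \<gamma> (c * oq_weight \<gamma> g a) [a]"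
proof -
  have v: "oq_gen_val \<gamma> g a = omono \<gamma> (oq_weight \<gamma> g a) [a]" for a
    using assms by (cases g; cases a) auto
  have c: "oq_gen_val \<gamma> g a \<in> carrier (oq_algebra \<gamma>)" for a by (simp add: v)
  have r: "oq_gen_val \<gamma> g OX \<otimes>\<^bsub>oq_algebra \<gamma>\<^esub> oq_gen_val \<gamma> g OY
    = qpow \<gamma> 1 \<odot>\<^bsub>oq_algebra \<gamma>\<^esub> (oq_gen_val \<gamma> g OY \<otimes>\<^bsub>oq_algebra \<gamma>\<^esub> oq_gen_val \<gamma> g OX)"
    by (simp add: v oq_rel mult_ac)
  note h = oq_hom[OF complex_alg_oq, of "oq_gen_val \<gamma> g" \<gamma> \<gamma>, OF c r]
  show "alg_hom (oq_algebra \<gamma>) (oq_algebra \<gamma>) (oq_aut \<gamma> g)" unfolding oq_aut_def by (rule h(1))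
  show "oq_aut \<gamma> g (omono \<gamma> c [a]) = omono \<gamma> (c * oq_weight \<gamma> g a) [a]"
    using h(2)[of c "[a]"] by (simp add: oq_aut_def v)
qed

lemma oq_K_hom: "alg_hom (oq_algebra \<gamma>) (oq_algebra \<gamma>) (oq_K \<gamma>)"
  and oq_K_inv_hom: "alg_hom (oq_algebra \<gamma>) (oq_algebra \<gamma>) (oq_K_inv \<gamma>)"
  unfolding oq_K_def oq_K_inv_def by (rule alg_hom_comp[OF oq_aut_hom(1) oq_aut_hom(1)]; simp)+

text \<open>K multiplies x by q^(-1/2) and y by q^(1/2); \<open>oq_sgn\<close> is twice this
  exponent.\<close>

fun oq_sgn :: "ogen \<Rightarrow> real" where
  "oq_sgn OX = -1" | "oq_sgn OY = 1"

lemma oq_K_gen: "oq_K \<gamma> (omono \<gamma> c [a]) = omono \<gamma> (c * qpow \<gamma> (oq_sgn a / 2)) [a]"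
  "oq_K_inv \<gamma> (omono \<gamma> c [a]) = omono \<gamma> (c * qpow \<gamma> (- oq_sgn a / 2)) [a]"
  by (cases a; simp add: oq_K_def oq_K_inv_def oq_aut_hom)+

text \<open>
  A twisted derivation \<open>D\<close> is the upper right corner of a homomorphism into upper triangular
  matrices with the twists \<open>K\<^sup>-\<^sup>1\<close>, \<open>K\<close> on the diagonal, so that it suffices to check the defining relation there.
\<close>

definition tri_algebra :: "(complex, 'b, 'x) module_scheme \<Rightarrow> (complex, 'b \<times> 'b \<times> 'b) module" where
  "tri_algebra B = \<lparr>carrier = carrier B \<times> carrier B \<times> carrier B,
     mult = (\<lambda>(a, b, c) (a', b', c'). (a \<otimes>\<^bsub>B\<^esub> a', b \<otimes>\<^bsub>B\<^esub> c' \<oplus>\<^bsub>B\<^esub> a \<otimes>\<^bsub>B\<^esub> b', c \<otimes>\<^bsub>B\<^esub> c')),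
     one = (\<one>\<^bsub>B\<^esub>, \<zero>\<^bsub>B\<^esub>, \<one>\<^bsub>B\<^esub>), zero = (\<zero>\<^bsub>B\<^esub>, \<zero>\<^bsub>B\<^esub>, \<zero>\<^bsub>B\<^esub>),
     add = (\<lambda>(a, b, c) (a', b', c'). (a \<oplus>\<^bsub>B\<^esub> a', b \<oplus>\<^bsub>B\<^esub> b', c \<oplus>\<^bsub>B\<^esub> c')),
     smult = (\<lambda>d (a, b, c). (d \<odot>\<^bsub>B\<^esub> a, d \<odot>\<^bsub>B\<^esub> b, d \<odot>\<^bsub>B\<^esub> c))\<rparr>"

lemma tri_algebra_simps [simp]:
  "carrier (tri_algebra B) = carrier B \<times> carrier B \<times> carrier B"
  "(a, b, c) \<otimes>\<^bsub>tri_algebra B\<^esub> (a', b', c') = (a \<otimes>\<^bsub>B\<^esub> a', b \<otimes>\<^bsub>B\<^esub> c' \<oplus>\<^bsub>B\<^esub> a \<otimes>\<^bsub>B\<^esub> b', c \<otimes>\<^bsub>B\<^esub> c')"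
  "\<one>\<^bsub>tri_algebra B\<^esub> = (\<one>\<^bsub>B\<^esub>, \<zero>\<^bsub>B\<^esub>, \<one>\<^bsub>B\<^esub>)" "\<zero>\<^bsub>tri_algebra B\<^esub> = (\<zero>\<^bsub>B\<^esub>, \<zero>\<^bsub>B\<^esub>, \<zero>\<^bsub>B\<^esub>)"
  "(a, b, c) \<oplus>\<^bsub>tri_algebra B\<^esub> (a', b', c') = (a \<oplus>\<^bsub>B\<^esub> a', b \<oplus>\<^bsub>B\<^esub> b', c \<oplus>\<^bsub>B\<^esub> c')"
  "d \<odot>\<^bsub>tri_algebra B\<^esub> (a, b, c) = (d \<odot>\<^bsub>B\<^esub> a, d \<odot>\<^bsub>B\<^esub> b, d \<odot>\<^bsub>B\<^esub> c)"
  by (simp_all add: tri_algebra_def)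

lemma complex_alg_tri:
  assumes "complex_alg B" shows "complex_alg (tri_algebra B)"
proof -
  interpret B: complex_alg B by fact
  have vs: "complex_vs (tri_algebra B)"
    by (rule complex_vsI) (auto simp: B.sm_add_left B.sm_add_right B.sm_mult B.a_ac)
  show ?thesis
  proof (rule complex_algI[OF vs])
    fix x y z :: "'a \<times> 'a \<times> 'a"
    assume x: "x \<in> carrier (tri_algebra B)" and y: "y \<in> carrier (tri_algebra B)"
    obtain a b c where xe: "x = (a, b, c)" by (cases x)
    obtain a' b' c' where ye: "y = (a', b', c')" by (cases y)
    show "x \<otimes>\<^bsub>tri_algebra B\<^esub> y \<in> carrier (tri_algebra B)" using x y by (simp add: xe ye)
    show "(d \<odot>\<^bsub>tri_algebra B\<^esub> x) \<otimes>\<^bsub>tri_algebra B\<^esub> y = d \<odot>\<^bsub>tri_algebra B\<^esub> (x \<otimes>\<^bsub>tri_algebra B\<^esub> y)"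
      "x \<otimes>\<^bsub>tri_algebra B\<^esub> (d \<odot>\<^bsub>tri_algebra B\<^esub> y) = d \<odot>\<^bsub>tri_algebra B\<^esub> (x \<otimes>\<^bsub>tri_algebra B\<^esub> y)" for d
      using x y by (simp_all add: xe ye B.sm_mult_left B.sm_mult_right B.sm_add_right)
    assume z: "z \<in> carrier (tri_algebra B)"
    obtain a'' b'' c'' where ze: "z = (a'', b'', c'')" by (cases z)
    show "x \<otimes>\<^bsub>tri_algebra B\<^esub> y \<otimes>\<^bsub>tri_algebra B\<^esub> z = x \<otimes>\<^bsub>tri_algebra B\<^esub> (y \<otimes>\<^bsub>tri_algebra B\<^esub> z)"
      using x y z by (simp add: xe ye ze B.m_assoc B.l_distr B.r_distr B.a_assoc)
    show "(x \<oplus>\<^bsub>tri_algebra B\<^esub> y) \<otimes>\<^bsub>tri_algebra B\<^esub> z = x \<otimes>\<^bsub>tri_algebra B\<^esub> z \<oplus>\<^bsub>tri_algebra B\<^esub> y \<otimes>\<^bsub>tri_algebra B\<^esub> z"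
      "z \<otimes>\<^bsub>tri_algebra B\<^esub> (x \<oplus>\<^bsub>tri_algebra B\<^esub> y) = z \<otimes>\<^bsub>tri_algebra B\<^esub> x \<oplus>\<^bsub>tri_algebra B\<^esub> z \<otimes>\<^bsub>tri_algebra B\<^esub> y"
      using x y z by (simp_all add: xe ye ze B.l_distr B.r_distr B.a_ac)
  qed auto
qed

lemma lin_map_tri_corner: "lin_map (tri_algebra B) B (\<lambda>m. fst (snd m))"
  by (rule lin_mapI) auto

lemma oq_gen_val_closed: "oq_gen_val \<gamma> g a \<in> carrier (oq_algebra \<gamma>)"
  by (cases g; cases a) auto

definition tri_gen :: "real \<Rightarrow> ugen \<Rightarrow> ogen \<Rightarrow> oq \<times> oq \<times> oq" where
  "tri_gen \<gamma> g a = (oq_K_inv \<gamma> (omono \<gamma> 1 [a]), oq_gen_val \<gamma> g a, oq_K \<gamma> (omono \<gamma> 1 [a]))"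

context
  fixes \<gamma> :: real and g :: ugen
  assumes g: "g = UE \<or> g = UF"
begin

lemma tri_gen_closed: "tri_gen \<gamma> g a \<in> carrier (tri_algebra (oq_algebra \<gamma>))"
  by (simp add: tri_gen_def oq_gen_val_closed oq_K_gen)

text \<open>In the corner both sides equal q^(1/2) y^2 for \<open>UE\<close> and q^(1/2) x^2 for
  \<open>UF\<close>. On the diagonal the relation holds because the twists scale x and y.\<close>

lemma tri_gen_rel: "tri_gen \<gamma> g OX \<otimes>\<^bsub>tri_algebra (oq_algebra \<gamma>)\<^esub> tri_gen \<gamma> g OY
   = qpow \<gamma> 1 \<odot>\<^bsub>tri_algebra (oq_algebra \<gamma>)\<^esub> (tri_gen \<gamma> g OY \<otimes>\<^bsub>tri_algebra (oq_algebra \<gamma>)\<^esub> tri_gen \<gamma> g OX)"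
  using g by (auto simp: tri_gen_def oq_K_gen oq_rel qpow_add mult_ac)

abbreviation tri_hom :: "oq \<Rightarrow> oq \<times> oq \<times> oq" where
  "tri_hom \<equiv> quot_fun (alg_ext (tri_algebra (oq_algebra \<gamma>)) (tri_gen \<gamma> g))"

lemma tri_hom: "alg_hom (oq_algebra \<gamma>) (tri_algebra (oq_algebra \<gamma>)) tri_hom"
  "tri_hom (omono \<gamma> c w) = c \<odot>\<^bsub>tri_algebra (oq_algebra \<gamma>)\<^esub> word_val (tri_algebra (oq_algebra \<gamma>)) (tri_gen \<gamma> g) w"
  using oq_hom[OF complex_alg_tri[OF complex_alg_oq] tri_gen_closed tri_gen_rel] by blast+

interpretation Tri: complex_alg "tri_algebra (oq_algebra \<gamma>)" by (rule complex_alg_tri[OF complex_alg_oq])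

lemma tri_word: "word_val (tri_algebra (oq_algebra \<gamma>)) (tri_gen \<gamma> g) w
   = (oq_K_inv \<gamma> (omono \<gamma> 1 w), oq_skew \<gamma> g w, oq_K \<gamma> (omono \<gamma> 1 w))"
proof (induction w)
  case Nil
  show ?case using alg_homD(2)[OF oq_K_hom] alg_homD(2)[OF oq_K_inv_hom] by (simp add: oq_one)
next
  case (Cons a w)
  have "oq_K \<gamma> (omono \<gamma> 1 (a # w)) = oq_K \<gamma> (omono \<gamma> 1 [a]) \<otimes>\<^bsub>oq_algebra \<gamma>\<^esub> oq_K \<gamma> (omono \<gamma> 1 w)"
    "oq_K_inv \<gamma> (omono \<gamma> 1 (a # w)) = oq_K_inv \<gamma> (omono \<gamma> 1 [a]) \<otimes>\<^bsub>oq_algebra \<gamma>\<^esub> oq_K_inv \<gamma> (omono \<gamma> 1 w)"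
    using alg_homD(3)[OF oq_K_hom, of "omono \<gamma> 1 [a]" \<gamma> "omono \<gamma> 1 w"]
      alg_homD(3)[OF oq_K_inv_hom, of "omono \<gamma> 1 [a]" \<gamma> "omono \<gamma> 1 w"] by simp_all
  thus ?case using Cons by (simp add: tri_gen_def)
qed

lemma oq_skew_closed: "oq_skew \<gamma> g w \<in> carrier (oq_algebra \<gamma>)"
  using Tri.word_val_closed[of "tri_gen \<gamma> g" w] tri_gen_closed tri_word[of w] by simp

lemma skew_corner: "lin_ext (oq_algebra \<gamma>) (oq_skew \<gamma> g) p = fst (snd (alg_ext (tri_algebra (oq_algebra \<gamma>)) (tri_gen \<gamma> g) p))"
proof -
  have "fst (snd (lin_ext (tri_algebra (oq_algebra \<gamma>)) (word_val (tri_algebra (oq_algebra \<gamma>)) (tri_gen \<gamma> g)) p))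
    = lin_ext (oq_algebra \<gamma>) ((\<lambda>m. fst (snd m)) \<circ> word_val (tri_algebra (oq_algebra \<gamma>)) (tri_gen \<gamma> g)) p"
    by (rule lin_map_lin_ext[where D = UNIV, OF Tri.complex_vs_axioms O.complex_vs_axioms lin_map_tri_corner])
      (use Tri.word_val_closed[of "tri_gen \<gamma> g", OF tri_gen_closed] in blast)+
  also have "(\<lambda>m. fst (snd m)) \<circ> word_val (tri_algebra (oq_algebra \<gamma>)) (tri_gen \<gamma> g) = oq_skew \<gamma> g"
    by (rule ext) (simp only: o_apply tri_word fst_conv snd_conv)
  finally show ?thesis by (simp only: alg_ext_def)
qed

text \<open>\<open>oq_skew\<close> is given on words. It descends to cosets because it is the corner
  of an algebra homomorphism that vanishes on the defining ideal.\<close>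

lemma oq_skew_act:
  assumes "z \<in> carrier (oq_algebra \<gamma>)"
  shows "oq_gen_act \<gamma> g z = fst (snd (tri_hom z))"
proof -
  obtain p where p: "z = Idl\<^bsub>free_algebra\<^esub> (oq_rels \<gamma>) +>\<^bsub>free_algebra\<^esub> p"
    using assms pres_carrierE unfolding oq_algebra_eq by blast
  have z: "alg_ext (tri_algebra (oq_algebra \<gamma>)) (tri_gen \<gamma> g) i = \<zero>\<^bsub>tri_algebra (oq_algebra \<gamma>)\<^esub>" if "i \<in> Idl\<^bsub>free_algebra\<^esub> (oq_rels \<gamma>)" for i
    by (rule alg_hom_genideal[OF complex_alg_free Tri.complex_alg_axioms Tri.alg_hom_alg_ext _ _ that])
      (use tri_gen_closed oq_alg_ext_zero[OF Tri.complex_alg_axioms tri_gen_closed tri_gen_rel] in auto)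
  have "quot_fun (lin_ext (oq_algebra \<gamma>) (oq_skew \<gamma> g)) z = lin_ext (oq_algebra \<gamma>) (oq_skew \<gamma> g) p"
    unfolding p
    by (rule complex_alg.quot_fun_lin[OF complex_alg_free ideal_pres O.complex_vs_axioms O.lin_map_lin_ext_free[OF oq_skew_closed]])
      (simp_all add: skew_corner z)
  also have "\<dots> = fst (snd (tri_hom z))"
    unfolding p skew_corner
    by (subst complex_alg.quot_fun_lin[OF complex_alg_free ideal_pres Tri.complex_vs_axioms alg_homD(1)[OF Tri.alg_hom_alg_ext]])
      (use tri_gen_closed z in auto)
  finally show ?thesis using g by (simp add: oq_gen_act_def)
qed

text \<open>Diagonal entries of triangular matrices multiply separately, so they are homomorphisms
  and are determined by their values on x and y.\<close>

lemma tri_hom_eq: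
  assumes "z \<in> carrier (oq_algebra \<gamma>)"
  shows "tri_hom z = (oq_K_inv \<gamma> z, oq_gen_act \<gamma> g z, oq_K \<gamma> z)"
proof -
  have p1: "alg_hom (tri_algebra (oq_algebra \<gamma>)) (oq_algebra \<gamma>) fst"
    and p3: "alg_hom (tri_algebra (oq_algebra \<gamma>)) (oq_algebra \<gamma>) (\<lambda>m. snd (snd m))"
    by (auto simp: alg_hom_def lin_map_def)
  have gen: "tri_hom (omono \<gamma> 1 [a]) = tri_gen \<gamma> g a" for a
    using tri_hom(2)[of 1 "[a]"] Tri.r_one[OF tri_gen_closed] Tri.sm_1[OF tri_gen_closed] by (simp del: tri_algebra_simps)
  have "fst (tri_hom z) = oq_K_inv \<gamma> z"
    by (rule alg_hom_oq_eqI[OF complex_alg_oq alg_hom_comp[OF tri_hom(1) p1] oq_K_inv_hom _ assms])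
      (simp add: gen, simp add: tri_gen_def)
  moreover have "snd (snd (tri_hom z)) = oq_K \<gamma> z"
    by (rule alg_hom_oq_eqI[OF complex_alg_oq alg_hom_comp[OF tri_hom(1) p3] oq_K_hom _ assms])
      (simp add: gen, simp add: tri_gen_def)
  ultimately show ?thesis using oq_skew_act[OF assms] by (simp add: prod_eq_iff)
qed

lemma oq_skew_lin: "lin_map (oq_algebra \<gamma>) (oq_algebra \<gamma>) (oq_gen_act \<gamma> g)"
proof -
  note l = lin_mapD[OF alg_homD(1)[OF tri_hom(1)]]
  show ?thesis
    by (rule lin_mapI) (use l in \<open>simp_all add: tri_hom_eq\<close>)
qed

lemma oq_skew_leibniz:
  assumes "y \<in> carrier (oq_algebra \<gamma>)" "z \<in> carrier (oq_algebra \<gamma>)"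
  shows "oq_gen_act \<gamma> g (y \<otimes>\<^bsub>oq_algebra \<gamma>\<^esub> z)
    = oq_gen_act \<gamma> g y \<otimes>\<^bsub>oq_algebra \<gamma>\<^esub> oq_K \<gamma> z \<oplus>\<^bsub>oq_algebra \<gamma>\<^esub> oq_K_inv \<gamma> y \<otimes>\<^bsub>oq_algebra \<gamma>\<^esub> oq_gen_act \<gamma> g z"
  using alg_homD(3)[OF tri_hom(1) assms] assms by (simp add: tri_hom_eq)

lemma oq_skew_one: "oq_gen_act \<gamma> g \<one>\<^bsub>oq_algebra \<gamma>\<^esub> = \<zero>\<^bsub>oq_algebra \<gamma>\<^esub>"
  using alg_homD(2)[OF tri_hom(1)] by (simp add: tri_hom_eq)

lemma oq_skew_gen: "oq_gen_act \<gamma> g (omono \<gamma> c [a]) = c \<odot>\<^bsub>oq_algebra \<gamma>\<^esub> oq_gen_val \<gamma> g a"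
proof -
  have "tri_hom (omono \<gamma> 1 [a]) = tri_gen \<gamma> g a"
    using tri_hom(2)[of 1 "[a]"] Tri.r_one[OF tri_gen_closed] Tri.sm_1[OF tri_gen_closed] by (simp del: tri_algebra_simps)
  hence "oq_gen_act \<gamma> g (omono \<gamma> 1 [a]) = oq_gen_val \<gamma> g a" by (simp add: tri_hom_eq tri_gen_def)
  thus ?thesis using lin_mapD(3)[OF oq_skew_lin, of "omono \<gamma> 1 [a]" c] by simp
qed

end

section \<open>The relations of U_q(gl_2) on the quantum plane\<close>

lemma oq_aut_act: "g \<noteq> UE \<Longrightarrow> g \<noteq> UF \<Longrightarrow> oq_gen_act \<gamma> g = oq_aut \<gamma> g"
  by (simp add: oq_gen_act_def)

lemma oq_gen_act_lin: "lin_map (oq_algebra \<gamma>) (oq_algebra \<gamma>) (oq_gen_act \<gamma> g)"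
  using oq_skew_lin[of g \<gamma>] alg_homD(1)[OF oq_aut_hom(1), of g \<gamma>] by (cases g) (auto simp: oq_aut_act)

lemma twisted_derivation_eqI:
  assumes "lin_map (oq_algebra \<gamma>) (oq_algebra \<gamma>) D" "lin_map (oq_algebra \<gamma>) (oq_algebra \<gamma>) D'"
    and "\<And>y z. \<lbrakk>y \<in> carrier (oq_algebra \<gamma>); z \<in> carrier (oq_algebra \<gamma>)\<rbrakk> \<Longrightarrow> D (y \<otimes>\<^bsub>oq_algebra \<gamma>\<^esub> z)
      = D y \<otimes>\<^bsub>oq_algebra \<gamma>\<^esub> oq_K \<gamma> z \<oplus>\<^bsub>oq_algebra \<gamma>\<^esub> oq_K_inv \<gamma> y \<otimes>\<^bsub>oq_algebra \<gamma>\<^esub> D z"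
    and "\<And>y z. \<lbrakk>y \<in> carrier (oq_algebra \<gamma>); z \<in> carrier (oq_algebra \<gamma>)\<rbrakk> \<Longrightarrow> D' (y \<otimes>\<^bsub>oq_algebra \<gamma>\<^esub> z)
      = D' y \<otimes>\<^bsub>oq_algebra \<gamma>\<^esub> oq_K \<gamma> z \<oplus>\<^bsub>oq_algebra \<gamma>\<^esub> oq_K_inv \<gamma> y \<otimes>\<^bsub>oq_algebra \<gamma>\<^esub> D' z"
    and "D \<one>\<^bsub>oq_algebra \<gamma>\<^esub> = D' \<one>\<^bsub>oq_algebra \<gamma>\<^esub>"
    and "\<And>a. D (omono \<gamma> 1 [a]) = D' (omono \<gamma> 1 [a])"
    and "z \<in> carrier (oq_algebra \<gamma>)"
  shows "D z = D' z"
  using assms(7)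
  by (induction z rule: oq_induct) (simp_all add: assms(3-6) lin_mapD[OF assms(1)] lin_mapD[OF assms(2)])

lemma oq_aut_comp_eqI:
  assumes "alg_hom (oq_algebra \<gamma>) (oq_algebra \<gamma>) f" "alg_hom (oq_algebra \<gamma>) (oq_algebra \<gamma>) f'"
    and "\<And>g. f (omono \<gamma> 1 [g]) = f' (omono \<gamma> 1 [g])" "z \<in> carrier (oq_algebra \<gamma>)"
  shows "f z = f' z"
  using alg_hom_oq_eqI[OF complex_alg_oq assms] .

lemma oq_aut_commute:
  assumes "g \<notin> {UE, UF}" "h \<notin> {UE, UF}" "z \<in> carrier (oq_algebra \<gamma>)"
  shows "oq_aut \<gamma> g (oq_aut \<gamma> h z) = oq_aut \<gamma> h (oq_aut \<gamma> g z)"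
  by (rule oq_aut_comp_eqI[OF alg_hom_comp[OF oq_aut_hom(1) oq_aut_hom(1)] alg_hom_comp[OF oq_aut_hom(1) oq_aut_hom(1)] _ assms(3)])
    (use assms in \<open>simp_all add: oq_aut_hom(2) mult_ac\<close>)

lemma oq_aut_inv:
  assumes "g \<notin> {UE, UF}" "z \<in> carrier (oq_algebra \<gamma>)"
  shows "oq_aut \<gamma> g (oq_aut \<gamma> (inv_gen g) z) = z"
proof -
  have i: "inv_gen g \<noteq> UE" "inv_gen g \<noteq> UF" using assms(1) by (cases g; simp)+
  have "oq_weight \<gamma> (inv_gen g) a * oq_weight \<gamma> g a = 1" for a
    using assms(1) by (cases g; cases a) (auto simp: qpow_add)
  thus ?thesis
    by (intro oq_aut_comp_eqI[OF alg_hom_comp[OF oq_aut_hom(1) oq_aut_hom(1)] alg_hom_id _ assms(2)])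
      (use assms(1) i in \<open>simp_all add: oq_aut_hom(2)\<close>)
qed

lemma oq_K_K_inv:
  assumes "z \<in> carrier (oq_algebra \<gamma>)"
  shows "oq_K \<gamma> (oq_K_inv \<gamma> z) = z" "oq_K_inv \<gamma> (oq_K \<gamma> z) = z"
  by (rule oq_aut_comp_eqI[OF alg_hom_comp[OF oq_K_inv_hom oq_K_hom] alg_hom_id _ assms]
      oq_aut_comp_eqI[OF alg_hom_comp[OF oq_K_hom oq_K_inv_hom] alg_hom_id _ assms],
      simp add: oq_K_gen qpow_add)+

lemma oq_K_aut:
  assumes "g \<notin> {UE, UF}" "z \<in> carrier (oq_algebra \<gamma>)"
  shows "oq_aut \<gamma> g (oq_K \<gamma> z) = oq_K \<gamma> (oq_aut \<gamma> g z)" "oq_aut \<gamma> g (oq_K_inv \<gamma> z) = oq_K_inv \<gamma> (oq_aut \<gamma> g z)"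
proof -
  have g: "g \<noteq> UE" "g \<noteq> UF" using assms by auto
  show "oq_aut \<gamma> g (oq_K \<gamma> z) = oq_K \<gamma> (oq_aut \<gamma> g z)"
    by (rule oq_aut_comp_eqI[OF alg_hom_comp[OF oq_K_hom oq_aut_hom(1)[OF g]] alg_hom_comp[OF oq_aut_hom(1)[OF g] oq_K_hom] _ assms(2)])
      (simp add: oq_aut_hom(2)[OF g] oq_K_gen mult_ac)
  show "oq_aut \<gamma> g (oq_K_inv \<gamma> z) = oq_K_inv \<gamma> (oq_aut \<gamma> g z)"
    by (rule oq_aut_comp_eqI[OF alg_hom_comp[OF oq_K_inv_hom oq_aut_hom(1)[OF g]] alg_hom_comp[OF oq_aut_hom(1)[OF g] oq_K_inv_hom] _ assms(2)])
      (simp add: oq_aut_hom(2)[OF g] oq_K_gen mult_ac)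
qed

text \<open>When the conjugation leaves K and K^(-1) unchanged, the conjugated operator is again a
  twisted derivation with the same twists, and so is a scalar multiple of the original one; the
  values on x and y then decide.\<close>

lemma oq_skew_conj:
  assumes g: "g = UE \<or> g = UF"
    and \<kappa>: "alg_hom (oq_algebra \<gamma>) (oq_algebra \<gamma>) \<kappa>" "alg_hom (oq_algebra \<gamma>) (oq_algebra \<gamma>) \<kappa>'"
    and K: "\<And>z. z \<in> carrier (oq_algebra \<gamma>) \<Longrightarrow> \<kappa> (oq_K \<gamma> (\<kappa>' z)) = oq_K \<gamma> z"
      "\<And>z. z \<in> carrier (oq_algebra \<gamma>) \<Longrightarrow> \<kappa> (oq_K_inv \<gamma> (\<kappa>' z)) = oq_K_inv \<gamma> z"
    and gen: "\<And>a. \<kappa> (oq_gen_act \<gamma> g (\<kappa>' (omono \<gamma> 1 [a]))) = c \<odot>\<^bsub>oq_algebra \<gamma>\<^esub> oq_gen_val \<gamma> g a"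
    and z: "z \<in> carrier (oq_algebra \<gamma>)"
  shows "\<kappa> (oq_gen_act \<gamma> g (\<kappa>' z)) = c \<odot>\<^bsub>oq_algebra \<gamma>\<^esub> oq_gen_act \<gamma> g z"
proof -
  note l = lin_mapD[OF alg_homD(1)[OF \<kappa>(1)]] lin_mapD[OF alg_homD(1)[OF \<kappa>(2)]] lin_mapD[OF oq_skew_lin[OF g]]
    alg_homD(2,3)[OF \<kappa>(1)] alg_homD(2,3)[OF \<kappa>(2)]
    lin_mapD[OF alg_homD(1)[OF oq_K_hom]] lin_mapD[OF alg_homD(1)[OF oq_K_inv_hom]]
  show ?thesis
  proof (rule twisted_derivation_eqI[OF _ _ _ _ _ _ z])
    show "lin_map (oq_algebra \<gamma>) (oq_algebra \<gamma>) (\<lambda>z. \<kappa> (oq_gen_act \<gamma> g (\<kappa>' z)))"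
      by (rule lin_mapI) (simp_all add: l)
    show "lin_map (oq_algebra \<gamma>) (oq_algebra \<gamma>) (\<lambda>z. c \<odot>\<^bsub>oq_algebra \<gamma>\<^esub> oq_gen_act \<gamma> g z)"
      by (rule lin_mapI) (simp_all add: l O.sm_add_right mult.commute flip: O.sm_mult)
    show "\<kappa> (oq_gen_act \<gamma> g (\<kappa>' \<one>\<^bsub>oq_algebra \<gamma>\<^esub>)) = c \<odot>\<^bsub>oq_algebra \<gamma>\<^esub> oq_gen_act \<gamma> g \<one>\<^bsub>oq_algebra \<gamma>\<^esub>"
      using lin_map_zero[OF O.complex_vs_axioms O.complex_vs_axioms alg_homD(1)[OF \<kappa>(1)]]
      by (simp add: l oq_skew_one[OF g])
    show "\<kappa> (oq_gen_act \<gamma> g (\<kappa>' (omono \<gamma> 1 [a]))) = c \<odot>\<^bsub>oq_algebra \<gamma>\<^esub> oq_gen_act \<gamma> g (omono \<gamma> 1 [a])" for a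
      by (simp add: gen oq_skew_gen[OF g] oq_gen_val_closed)
    fix y z assume yz: "y \<in> carrier (oq_algebra \<gamma>)" "z \<in> carrier (oq_algebra \<gamma>)"
    show "\<kappa> (oq_gen_act \<gamma> g (\<kappa>' (y \<otimes>\<^bsub>oq_algebra \<gamma>\<^esub> z))) = \<kappa> (oq_gen_act \<gamma> g (\<kappa>' y)) \<otimes>\<^bsub>oq_algebra \<gamma>\<^esub> oq_K \<gamma> z
       \<oplus>\<^bsub>oq_algebra \<gamma>\<^esub> oq_K_inv \<gamma> y \<otimes>\<^bsub>oq_algebra \<gamma>\<^esub> \<kappa> (oq_gen_act \<gamma> g (\<kappa>' z))"
      using yz by (simp add: l oq_skew_leibniz[OF g] K)
    show "c \<odot>\<^bsub>oq_algebra \<gamma>\<^esub> oq_gen_act \<gamma> g (y \<otimes>\<^bsub>oq_algebra \<gamma>\<^esub> z) = (c \<odot>\<^bsub>oq_algebra \<gamma>\<^esub> oq_gen_act \<gamma> g y) \<otimes>\<^bsub>oq_algebra \<gamma>\<^esub> oq_K \<gamma> z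
       \<oplus>\<^bsub>oq_algebra \<gamma>\<^esub> oq_K_inv \<gamma> y \<otimes>\<^bsub>oq_algebra \<gamma>\<^esub> (c \<odot>\<^bsub>oq_algebra \<gamma>\<^esub> oq_gen_act \<gamma> g z)"
      using yz by (simp add: l oq_skew_leibniz[OF g] O.sm_add_right O.sm_mult_left O.sm_mult_right)
  qed
qed

lemma hom_zero_oq: "alg_hom (oq_algebra \<gamma>) (oq_algebra \<gamma>) f \<Longrightarrow> f \<zero>\<^bsub>oq_algebra \<gamma>\<^esub> = \<zero>\<^bsub>oq_algebra \<gamma>\<^esub>"
  by (rule lin_map_zero[OF O.complex_vs_axioms O.complex_vs_axioms alg_homD(1)])

lemma oq_conj_rels:
  assumes "z \<in> carrier (oq_algebra \<gamma>)"
  shows "oq_aut \<gamma> UK1 (oq_gen_act \<gamma> UE (oq_aut \<gamma> UK1i z)) = qpow \<gamma> (1/2) \<odot>\<^bsub>oq_algebra \<gamma>\<^esub> oq_gen_act \<gamma> UE z"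
    "oq_aut \<gamma> UK2 (oq_gen_act \<gamma> UE (oq_aut \<gamma> UK2i z)) = qpow \<gamma> (-1/2) \<odot>\<^bsub>oq_algebra \<gamma>\<^esub> oq_gen_act \<gamma> UE z"
    "oq_aut \<gamma> UK1 (oq_gen_act \<gamma> UF (oq_aut \<gamma> UK1i z)) = qpow \<gamma> (-1/2) \<odot>\<^bsub>oq_algebra \<gamma>\<^esub> oq_gen_act \<gamma> UF z"
    "oq_aut \<gamma> UK2 (oq_gen_act \<gamma> UF (oq_aut \<gamma> UK2i z)) = qpow \<gamma> (1/2) \<odot>\<^bsub>oq_algebra \<gamma>\<^esub> oq_gen_act \<gamma> UF z"
proof -
  have KK: "oq_aut \<gamma> k (oq_K \<gamma> (oq_aut \<gamma> (inv_gen k) z)) = oq_K \<gamma> z"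
    "oq_aut \<gamma> k (oq_K_inv \<gamma> (oq_aut \<gamma> (inv_gen k) z)) = oq_K_inv \<gamma> z"
    if "k \<notin> {UE, UF}" "z \<in> carrier (oq_algebra \<gamma>)" for k z
    using oq_K_aut[of k "oq_aut \<gamma> (inv_gen k) z" \<gamma>] oq_aut_inv[OF that] that
      lin_mapD(1)[OF alg_homD(1)[OF oq_aut_hom(1)], of "inv_gen k" z \<gamma>]
    by (cases k; simp)+
  have z1: "oq_aut \<gamma> k \<zero>\<^bsub>oq_algebra \<gamma>\<^esub> = \<zero>\<^bsub>oq_algebra \<gamma>\<^esub>" if "k \<notin> {UE, UF}" for k
    using that by (intro hom_zero_oq oq_aut_hom(1)) auto
  have c: "oq_aut \<gamma> k (oq_gen_act \<gamma> g (oq_aut \<gamma> k' z)) = c \<odot>\<^bsub>oq_algebra \<gamma>\<^esub> oq_gen_act \<gamma> g z"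
    if "g = UE \<or> g = UF" "k' = inv_gen k" "k \<notin> {UE, UF}"
      "oq_aut \<gamma> k (oq_gen_act \<gamma> g (oq_aut \<gamma> k' (omono \<gamma> 1 [OX]))) = c \<odot>\<^bsub>oq_algebra \<gamma>\<^esub> oq_gen_val \<gamma> g OX"
      "oq_aut \<gamma> k (oq_gen_act \<gamma> g (oq_aut \<gamma> k' (omono \<gamma> 1 [OY]))) = c \<odot>\<^bsub>oq_algebra \<gamma>\<^esub> oq_gen_val \<gamma> g OY" for k k' g c
  proof (rule oq_skew_conj[OF that(1) _ _ _ _ _ assms])
    show "oq_aut \<gamma> k (oq_gen_act \<gamma> g (oq_aut \<gamma> k' (omono \<gamma> 1 [a]))) = c \<odot>\<^bsub>oq_algebra \<gamma>\<^esub> oq_gen_val \<gamma> g a" for a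
      using that(4,5) by (cases a) simp_all
    show "alg_hom (oq_algebra \<gamma>) (oq_algebra \<gamma>) (oq_aut \<gamma> k)" "alg_hom (oq_algebra \<gamma>) (oq_algebra \<gamma>) (oq_aut \<gamma> k')"
      using that by (cases k; auto intro!: oq_aut_hom(1))+
  qed (use KK that in auto)
  show "oq_aut \<gamma> UK1 (oq_gen_act \<gamma> UE (oq_aut \<gamma> UK1i z)) = qpow \<gamma> (1/2) \<odot>\<^bsub>oq_algebra \<gamma>\<^esub> oq_gen_act \<gamma> UE z"
    "oq_aut \<gamma> UK2 (oq_gen_act \<gamma> UE (oq_aut \<gamma> UK2i z)) = qpow \<gamma> (-1/2) \<odot>\<^bsub>oq_algebra \<gamma>\<^esub> oq_gen_act \<gamma> UE z"
    "oq_aut \<gamma> UK1 (oq_gen_act \<gamma> UF (oq_aut \<gamma> UK1i z)) = qpow \<gamma> (-1/2) \<odot>\<^bsub>oq_algebra \<gamma>\<^esub> oq_gen_act \<gamma> UF z"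
    "oq_aut \<gamma> UK2 (oq_gen_act \<gamma> UF (oq_aut \<gamma> UK2i z)) = qpow \<gamma> (1/2) \<odot>\<^bsub>oq_algebra \<gamma>\<^esub> oq_gen_act \<gamma> UF z"
    by (rule c; simp add: oq_aut_hom(2) oq_skew_gen qpow_add z1)+
qed

text \<open>The equations are oriented for \<open>oq_EF_mult\<close>, where one tensor factor
  contributes q, the other q^(-1), and both disappear.\<close>

lemma oq_K_skew:
  assumes z: "z \<in> carrier (oq_algebra \<gamma>)"
  shows "oq_K \<gamma> (oq_gen_act \<gamma> UF z) = qpow \<gamma> (-1) \<odot>\<^bsub>oq_algebra \<gamma>\<^esub> oq_gen_act \<gamma> UF (oq_K \<gamma> z)"
    "oq_gen_act \<gamma> UE (oq_K \<gamma> z) = qpow \<gamma> (-1) \<odot>\<^bsub>oq_algebra \<gamma>\<^esub> oq_K \<gamma> (oq_gen_act \<gamma> UE z)"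
    "oq_K_inv \<gamma> (oq_gen_act \<gamma> UF z) = qpow \<gamma> 1 \<odot>\<^bsub>oq_algebra \<gamma>\<^esub> oq_gen_act \<gamma> UF (oq_K_inv \<gamma> z)"
    "oq_gen_act \<gamma> UE (oq_K_inv \<gamma> z) = qpow \<gamma> 1 \<odot>\<^bsub>oq_algebra \<gamma>\<^esub> oq_K_inv \<gamma> (oq_gen_act \<gamma> UE z)"
proof -
  note Kc = lin_mapD[OF alg_homD(1)[OF oq_K_hom]] and Kic = lin_mapD[OF alg_homD(1)[OF oq_K_inv_hom]]
  note Dc = lin_mapD(1)[OF oq_gen_act_lin]
  note z0 = hom_zero_oq[OF oq_K_hom] hom_zero_oq[OF oq_K_inv_hom]
  have 1: "oq_K \<gamma> (oq_gen_act \<gamma> g (oq_K_inv \<gamma> z)) = c \<odot>\<^bsub>oq_algebra \<gamma>\<^esub> oq_gen_act \<gamma> g z"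
    if "z \<in> carrier (oq_algebra \<gamma>)" "g = UE \<or> g = UF"
      "oq_K \<gamma> (oq_gen_act \<gamma> g (oq_K_inv \<gamma> (omono \<gamma> 1 [OX]))) = c \<odot>\<^bsub>oq_algebra \<gamma>\<^esub> oq_gen_val \<gamma> g OX"
      "oq_K \<gamma> (oq_gen_act \<gamma> g (oq_K_inv \<gamma> (omono \<gamma> 1 [OY]))) = c \<odot>\<^bsub>oq_algebra \<gamma>\<^esub> oq_gen_val \<gamma> g OY"
    for g c z
    proof (rule oq_skew_conj[OF that(2) oq_K_hom oq_K_inv_hom _ _ _ that(1)])
    show "oq_K \<gamma> (oq_gen_act \<gamma> g (oq_K_inv \<gamma> (omono \<gamma> 1 [a]))) = c \<odot>\<^bsub>oq_algebra \<gamma>\<^esub> oq_gen_val \<gamma> g a" for a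
      using that(3,4) by (cases a) simp_all
  qed (simp_all add: oq_K_K_inv Kic)
  have 2: "oq_K_inv \<gamma> (oq_gen_act \<gamma> g (oq_K \<gamma> z)) = c \<odot>\<^bsub>oq_algebra \<gamma>\<^esub> oq_gen_act \<gamma> g z"
    if "z \<in> carrier (oq_algebra \<gamma>)" "g = UE \<or> g = UF"
      "oq_K_inv \<gamma> (oq_gen_act \<gamma> g (oq_K \<gamma> (omono \<gamma> 1 [OX]))) = c \<odot>\<^bsub>oq_algebra \<gamma>\<^esub> oq_gen_val \<gamma> g OX"
      "oq_K_inv \<gamma> (oq_gen_act \<gamma> g (oq_K \<gamma> (omono \<gamma> 1 [OY]))) = c \<odot>\<^bsub>oq_algebra \<gamma>\<^esub> oq_gen_val \<gamma> g OY"
    for g c z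
    proof (rule oq_skew_conj[OF that(2) oq_K_inv_hom oq_K_hom _ _ _ that(1)])
    show "oq_K_inv \<gamma> (oq_gen_act \<gamma> g (oq_K \<gamma> (omono \<gamma> 1 [a]))) = c \<odot>\<^bsub>oq_algebra \<gamma>\<^esub> oq_gen_val \<gamma> g a" for a
      using that(3,4) by (cases a) simp_all
  qed (simp_all add: oq_K_K_inv Kc)
  have KF: "oq_K \<gamma> (oq_gen_act \<gamma> UF (oq_K_inv \<gamma> z)) = qpow \<gamma> (-1) \<odot>\<^bsub>oq_algebra \<gamma>\<^esub> oq_gen_act \<gamma> UF z"
    and KE: "oq_K \<gamma> (oq_gen_act \<gamma> UE (oq_K_inv \<gamma> z)) = qpow \<gamma> 1 \<odot>\<^bsub>oq_algebra \<gamma>\<^esub> oq_gen_act \<gamma> UE z"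
    and KiF: "oq_K_inv \<gamma> (oq_gen_act \<gamma> UF (oq_K \<gamma> z)) = qpow \<gamma> 1 \<odot>\<^bsub>oq_algebra \<gamma>\<^esub> oq_gen_act \<gamma> UF z"
    and KiE: "oq_K_inv \<gamma> (oq_gen_act \<gamma> UE (oq_K \<gamma> z)) = qpow \<gamma> (-1) \<odot>\<^bsub>oq_algebra \<gamma>\<^esub> oq_gen_act \<gamma> UE z"
    if z: "z \<in> carrier (oq_algebra \<gamma>)" for z
    by (rule 1[OF z] 2[OF z]; simp add: oq_K_gen oq_skew_gen qpow_add z0)+
  show "oq_K \<gamma> (oq_gen_act \<gamma> UF z) = qpow \<gamma> (-1) \<odot>\<^bsub>oq_algebra \<gamma>\<^esub> oq_gen_act \<gamma> UF (oq_K \<gamma> z)"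
    using KF[of "oq_K \<gamma> z"] z by (simp add: Kc oq_K_K_inv)
  show "oq_K_inv \<gamma> (oq_gen_act \<gamma> UF z) = qpow \<gamma> 1 \<odot>\<^bsub>oq_algebra \<gamma>\<^esub> oq_gen_act \<gamma> UF (oq_K_inv \<gamma> z)"
    using KiF[of "oq_K_inv \<gamma> z"] z by (simp add: Kic oq_K_K_inv)
  have "oq_K \<gamma> (oq_K_inv \<gamma> (oq_gen_act \<gamma> UE (oq_K \<gamma> z))) = qpow \<gamma> (-1) \<odot>\<^bsub>oq_algebra \<gamma>\<^esub> oq_K \<gamma> (oq_gen_act \<gamma> UE z)"
    unfolding KiE[OF z] using z by (simp add: Kc Dc)
  thus "oq_gen_act \<gamma> UE (oq_K \<gamma> z) = qpow \<gamma> (-1) \<odot>\<^bsub>oq_algebra \<gamma>\<^esub> oq_K \<gamma> (oq_gen_act \<gamma> UE z)"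
    using z by (simp add: oq_K_K_inv Kc Dc)
  have "oq_K_inv \<gamma> (oq_K \<gamma> (oq_gen_act \<gamma> UE (oq_K_inv \<gamma> z))) = qpow \<gamma> 1 \<odot>\<^bsub>oq_algebra \<gamma>\<^esub> oq_K_inv \<gamma> (oq_gen_act \<gamma> UE z)"
    unfolding KE[OF z] using z by (simp add: Kic Dc)
  thus "oq_gen_act \<gamma> UE (oq_K_inv \<gamma> z) = qpow \<gamma> 1 \<odot>\<^bsub>oq_algebra \<gamma>\<^esub> oq_K_inv \<gamma> (oq_gen_act \<gamma> UE z)"
    using z by (simp add: oq_K_K_inv Kic Dc)
qed

text \<open>E F and F E applied to a product expand into four terms each. The mixed terms
  \<open>p1\<close> and \<open>p2\<close> occur in both by \<open>oq_K_skew\<close>, and the others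
  telescope through the product of \<open>ll\<close> and \<open>kk'\<close>, as in
  \<open>skew_commutator\<close>.\<close>

lemma oq_EF_mult:
  fixes c \<gamma>
  defines "P z \<equiv> oq_gen_act \<gamma> UE (oq_gen_act \<gamma> UF z) \<oplus>\<^bsub>oq_algebra \<gamma>\<^esub> c \<odot>\<^bsub>oq_algebra \<gamma>\<^esub> oq_K_inv \<gamma> (oq_K_inv \<gamma> z)
    = oq_gen_act \<gamma> UF (oq_gen_act \<gamma> UE z) \<oplus>\<^bsub>oq_algebra \<gamma>\<^esub> c \<odot>\<^bsub>oq_algebra \<gamma>\<^esub> oq_K \<gamma> (oq_K \<gamma> z)"
  assumes "P y" "P z" and yz: "y \<in> carrier (oq_algebra \<gamma>)" "z \<in> carrier (oq_algebra \<gamma>)"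
  shows "P (y \<otimes>\<^bsub>oq_algebra \<gamma>\<^esub> z)"
proof -
  note Kc [simp] = lin_mapD(1)[OF alg_homD(1)[OF oq_K_hom[of \<gamma>]]] lin_mapD(1)[OF alg_homD(1)[OF oq_K_inv_hom[of \<gamma>]]]
    lin_mapD(1)[OF oq_gen_act_lin[of \<gamma>]]
  note Km [simp] = alg_homD(3)[OF oq_K_hom[of \<gamma>]] alg_homD(3)[OF oq_K_inv_hom[of \<gamma>]]
  define ll where "ll = oq_K_inv \<gamma> (oq_K_inv \<gamma> y)"
  define ll' where "ll' = oq_K_inv \<gamma> (oq_K_inv \<gamma> z)"
  define kk where "kk = oq_K \<gamma> (oq_K \<gamma> y)"
  define kk' where "kk' = oq_K \<gamma> (oq_K \<gamma> z)"
  define a where "a = oq_gen_act \<gamma> UE (oq_gen_act \<gamma> UF y)"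
  define a' where "a' = oq_gen_act \<gamma> UE (oq_gen_act \<gamma> UF z)"
  define b where "b = oq_gen_act \<gamma> UF (oq_gen_act \<gamma> UE y)"
  define b' where "b' = oq_gen_act \<gamma> UF (oq_gen_act \<gamma> UE z)"
  define p1 where "p1 = oq_K_inv \<gamma> (oq_gen_act \<gamma> UF y) \<otimes>\<^bsub>oq_algebra \<gamma>\<^esub> oq_gen_act \<gamma> UE (oq_K \<gamma> z)"
  define p2 where "p2 = oq_gen_act \<gamma> UE (oq_K_inv \<gamma> y) \<otimes>\<^bsub>oq_algebra \<gamma>\<^esub> oq_K \<gamma> (oq_gen_act \<gamma> UF z)"
  have p1: "p1 = oq_gen_act \<gamma> UF (oq_K_inv \<gamma> y) \<otimes>\<^bsub>oq_algebra \<gamma>\<^esub> oq_K \<gamma> (oq_gen_act \<gamma> UE z)"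
    unfolding p1_def using yz by (simp add: oq_K_skew O.sm_mult_left O.sm_mult_right qpow_add flip: O.sm_mult)
  have p2: "p2 = oq_K_inv \<gamma> (oq_gen_act \<gamma> UE y) \<otimes>\<^bsub>oq_algebra \<gamma>\<^esub> oq_gen_act \<gamma> UF (oq_K \<gamma> z)"
    unfolding p2_def using yz by (simp add: oq_K_skew O.sm_mult_left O.sm_mult_right qpow_add flip: O.sm_mult)
  have [simp]: "ll \<in> carrier (oq_algebra \<gamma>)" "ll' \<in> carrier (oq_algebra \<gamma>)" "kk \<in> carrier (oq_algebra \<gamma>)" "kk' \<in> carrier (oq_algebra \<gamma>)"
    "a \<in> carrier (oq_algebra \<gamma>)" "a' \<in> carrier (oq_algebra \<gamma>)" "b \<in> carrier (oq_algebra \<gamma>)" "b' \<in> carrier (oq_algebra \<gamma>)"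
    "p1 \<in> carrier (oq_algebra \<gamma>)" "p2 \<in> carrier (oq_algebra \<gamma>)"
    using yz by (simp_all add: ll_def ll'_def kk_def kk'_def a_def a'_def b_def b'_def p1_def p2_def)
  have 1: "oq_gen_act \<gamma> UE (oq_gen_act \<gamma> UF (y \<otimes>\<^bsub>oq_algebra \<gamma>\<^esub> z))
      = (a \<otimes>\<^bsub>oq_algebra \<gamma>\<^esub> kk' \<oplus>\<^bsub>oq_algebra \<gamma>\<^esub> p1) \<oplus>\<^bsub>oq_algebra \<gamma>\<^esub> (p2 \<oplus>\<^bsub>oq_algebra \<gamma>\<^esub> ll \<otimes>\<^bsub>oq_algebra \<gamma>\<^esub> a')"
    using yz by (simp add: oq_skew_leibniz lin_mapD(2)[OF oq_gen_act_lin] a_def kk'_def p1_def p2_def ll_def a'_def)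
  have 2: "oq_gen_act \<gamma> UF (oq_gen_act \<gamma> UE (y \<otimes>\<^bsub>oq_algebra \<gamma>\<^esub> z))
      = (b \<otimes>\<^bsub>oq_algebra \<gamma>\<^esub> kk' \<oplus>\<^bsub>oq_algebra \<gamma>\<^esub> p2) \<oplus>\<^bsub>oq_algebra \<gamma>\<^esub> (p1 \<oplus>\<^bsub>oq_algebra \<gamma>\<^esub> ll \<otimes>\<^bsub>oq_algebra \<gamma>\<^esub> b')"
    using yz by (simp add: oq_skew_leibniz lin_mapD(2)[OF oq_gen_act_lin] b_def kk'_def p1 p2 ll_def b'_def)
  have y: "a \<oplus>\<^bsub>oq_algebra \<gamma>\<^esub> c \<odot>\<^bsub>oq_algebra \<gamma>\<^esub> ll = b \<oplus>\<^bsub>oq_algebra \<gamma>\<^esub> c \<odot>\<^bsub>oq_algebra \<gamma>\<^esub> kk"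
    and z: "a' \<oplus>\<^bsub>oq_algebra \<gamma>\<^esub> c \<odot>\<^bsub>oq_algebra \<gamma>\<^esub> ll' = b' \<oplus>\<^bsub>oq_algebra \<gamma>\<^esub> c \<odot>\<^bsub>oq_algebra \<gamma>\<^esub> kk'"
    using \<open>P y\<close> \<open>P z\<close> by (simp_all add: P_def a_def b_def ll_def kk_def a'_def b'_def ll'_def kk'_def)
  have 3: "a \<otimes>\<^bsub>oq_algebra \<gamma>\<^esub> kk' \<oplus>\<^bsub>oq_algebra \<gamma>\<^esub> c \<odot>\<^bsub>oq_algebra \<gamma>\<^esub> (ll \<otimes>\<^bsub>oq_algebra \<gamma>\<^esub> kk')
      = b \<otimes>\<^bsub>oq_algebra \<gamma>\<^esub> kk' \<oplus>\<^bsub>oq_algebra \<gamma>\<^esub> c \<odot>\<^bsub>oq_algebra \<gamma>\<^esub> (kk \<otimes>\<^bsub>oq_algebra \<gamma>\<^esub> kk')"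
    using arg_cong[OF y, of "\<lambda>t. t \<otimes>\<^bsub>oq_algebra \<gamma>\<^esub> kk'"] by (simp add: O.l_distr O.sm_mult_left)
  have 4: "ll \<otimes>\<^bsub>oq_algebra \<gamma>\<^esub> a' \<oplus>\<^bsub>oq_algebra \<gamma>\<^esub> c \<odot>\<^bsub>oq_algebra \<gamma>\<^esub> (ll \<otimes>\<^bsub>oq_algebra \<gamma>\<^esub> ll')
      = ll \<otimes>\<^bsub>oq_algebra \<gamma>\<^esub> b' \<oplus>\<^bsub>oq_algebra \<gamma>\<^esub> c \<odot>\<^bsub>oq_algebra \<gamma>\<^esub> (ll \<otimes>\<^bsub>oq_algebra \<gamma>\<^esub> kk')"
    using arg_cong[OF z, of "\<lambda>t. ll \<otimes>\<^bsub>oq_algebra \<gamma>\<^esub> t"] by (simp add: O.r_distr O.sm_mult_right)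
  have "((a \<otimes>\<^bsub>oq_algebra \<gamma>\<^esub> kk' \<oplus>\<^bsub>oq_algebra \<gamma>\<^esub> p1) \<oplus>\<^bsub>oq_algebra \<gamma>\<^esub> (p2 \<oplus>\<^bsub>oq_algebra \<gamma>\<^esub> ll \<otimes>\<^bsub>oq_algebra \<gamma>\<^esub> a')) \<oplus>\<^bsub>oq_algebra \<gamma>\<^esub> c \<odot>\<^bsub>oq_algebra \<gamma>\<^esub> (ll \<otimes>\<^bsub>oq_algebra \<gamma>\<^esub> ll')
     = (a \<otimes>\<^bsub>oq_algebra \<gamma>\<^esub> kk' \<oplus>\<^bsub>oq_algebra \<gamma>\<^esub> p1) \<oplus>\<^bsub>oq_algebra \<gamma>\<^esub> (p2 \<oplus>\<^bsub>oq_algebra \<gamma>\<^esub> (ll \<otimes>\<^bsub>oq_algebra \<gamma>\<^esub> a' \<oplus>\<^bsub>oq_algebra \<gamma>\<^esub> c \<odot>\<^bsub>oq_algebra \<gamma>\<^esub> (ll \<otimes>\<^bsub>oq_algebra \<gamma>\<^esub> ll')))"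
    by (simp add: O.a_assoc)
  also have "\<dots> = (a \<otimes>\<^bsub>oq_algebra \<gamma>\<^esub> kk' \<oplus>\<^bsub>oq_algebra \<gamma>\<^esub> c \<odot>\<^bsub>oq_algebra \<gamma>\<^esub> (ll \<otimes>\<^bsub>oq_algebra \<gamma>\<^esub> kk')) \<oplus>\<^bsub>oq_algebra \<gamma>\<^esub> (p2 \<oplus>\<^bsub>oq_algebra \<gamma>\<^esub> (p1 \<oplus>\<^bsub>oq_algebra \<gamma>\<^esub> ll \<otimes>\<^bsub>oq_algebra \<gamma>\<^esub> b'))"
    unfolding 4 by (simp add: O.a_ac)
  also have "\<dots> = ((b \<otimes>\<^bsub>oq_algebra \<gamma>\<^esub> kk' \<oplus>\<^bsub>oq_algebra \<gamma>\<^esub> p2) \<oplus>\<^bsub>oq_algebra \<gamma>\<^esub> (p1 \<oplus>\<^bsub>oq_algebra \<gamma>\<^esub> ll \<otimes>\<^bsub>oq_algebra \<gamma>\<^esub> b')) \<oplus>\<^bsub>oq_algebra \<gamma>\<^esub> c \<odot>\<^bsub>oq_algebra \<gamma>\<^esub> (kk \<otimes>\<^bsub>oq_algebra \<gamma>\<^esub> kk')"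
    unfolding 3 by (simp add: O.a_ac)
  finally show ?thesis
    unfolding P_def 1 2 using yz by (simp add: ll_def ll'_def kk_def kk'_def)
qed

lemma oq_EF:
  assumes q: "qlam \<gamma> \<noteq> 0" and z: "z \<in> carrier (oq_algebra \<gamma>)"
  shows "oq_gen_act \<gamma> UE (oq_gen_act \<gamma> UF z) \<oplus>\<^bsub>oq_algebra \<gamma>\<^esub> (1 / qlam \<gamma>) \<odot>\<^bsub>oq_algebra \<gamma>\<^esub> oq_K_inv \<gamma> (oq_K_inv \<gamma> z)
    = oq_gen_act \<gamma> UF (oq_gen_act \<gamma> UE z) \<oplus>\<^bsub>oq_algebra \<gamma>\<^esub> (1 / qlam \<gamma>) \<odot>\<^bsub>oq_algebra \<gamma>\<^esub> oq_K \<gamma> (oq_K \<gamma> z)"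
  using z
proof (induction z rule: oq_induct)
  case one
  have "oq_gen_act \<gamma> g \<zero>\<^bsub>oq_algebra \<gamma>\<^esub> = \<zero>\<^bsub>oq_algebra \<gamma>\<^esub>" for g
    by (rule lin_map_zero[OF O.complex_vs_axioms O.complex_vs_axioms oq_gen_act_lin])
  thus ?case
    by (simp add: oq_skew_one alg_homD(2)[OF oq_K_hom] alg_homD(2)[OF oq_K_inv_hom])
next
  case (gen a z)
  have z0: "oq_gen_act \<gamma> g \<zero>\<^bsub>oq_algebra \<gamma>\<^esub> = \<zero>\<^bsub>oq_algebra \<gamma>\<^esub>" for g
    by (rule lin_map_zero[OF O.complex_vs_axioms O.complex_vs_axioms oq_gen_act_lin])
  \<comment> \<open>The relation on generators: E F y = y, F E x = x, the opposite products vanish,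
    and K^2 has eigenvalue q on y and q^(-1) on x.\<close>
  have "qpow \<gamma> 1 / qlam \<gamma> = 1 + qpow \<gamma> (-1) / qlam \<gamma>" using q by (simp add: field_simps) (simp add: qlam_def)
  hence "oq_gen_act \<gamma> UE (oq_gen_act \<gamma> UF (omono \<gamma> 1 [a])) \<oplus>\<^bsub>oq_algebra \<gamma>\<^esub> (1 / qlam \<gamma>) \<odot>\<^bsub>oq_algebra \<gamma>\<^esub> oq_K_inv \<gamma> (oq_K_inv \<gamma> (omono \<gamma> 1 [a]))
    = oq_gen_act \<gamma> UF (oq_gen_act \<gamma> UE (omono \<gamma> 1 [a])) \<oplus>\<^bsub>oq_algebra \<gamma>\<^esub> (1 / qlam \<gamma>) \<odot>\<^bsub>oq_algebra \<gamma>\<^esub> oq_K \<gamma> (oq_K \<gamma> (omono \<gamma> 1 [a]))"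
    by (cases a) (simp_all add: oq_skew_gen oq_K_gen qpow_add z0)
  from oq_EF_mult[OF this gen(2) _ gen(1)] show ?case by simp
next
  case (add y z)
  note l = lin_mapD(1,2)[OF oq_gen_act_lin[of \<gamma>]] lin_mapD(1,2)[OF alg_homD(1)[OF oq_K_hom[of \<gamma>]]] lin_mapD(1,2)[OF alg_homD(1)[OF oq_K_inv_hom[of \<gamma>]]]
  have s: "(a \<oplus>\<^bsub>oq_algebra \<gamma>\<^esub> b) \<oplus>\<^bsub>oq_algebra \<gamma>\<^esub> (d \<oplus>\<^bsub>oq_algebra \<gamma>\<^esub> e) = (a' \<oplus>\<^bsub>oq_algebra \<gamma>\<^esub> b') \<oplus>\<^bsub>oq_algebra \<gamma>\<^esub> (d' \<oplus>\<^bsub>oq_algebra \<gamma>\<^esub> e')"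
    if "a \<oplus>\<^bsub>oq_algebra \<gamma>\<^esub> d = a' \<oplus>\<^bsub>oq_algebra \<gamma>\<^esub> d'" "b \<oplus>\<^bsub>oq_algebra \<gamma>\<^esub> e = b' \<oplus>\<^bsub>oq_algebra \<gamma>\<^esub> e'"
      "{a, b, d, e, a', b', d', e'} \<subseteq> carrier (oq_algebra \<gamma>)" for a b d e a' b' d' e'
    using that O.a_swap4[of a \<gamma> b d e] O.a_swap4[of a' \<gamma> b' d' e'] by simp
  show ?case using add(1,2)
    by (simp add: l O.sm_add_right) (rule s[OF add(3,4)], simp add: l)
next
  case (smult c z)
  note l = lin_mapD(1,3)[OF oq_gen_act_lin[of \<gamma>]] lin_mapD(1,3)[OF alg_homD(1)[OF oq_K_hom[of \<gamma>]]] lin_mapD(1,3)[OF alg_homD(1)[OF oq_K_inv_hom[of \<gamma>]]]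
  have s: "c \<odot>\<^bsub>oq_algebra \<gamma>\<^esub> x \<oplus>\<^bsub>oq_algebra \<gamma>\<^esub> d \<odot>\<^bsub>oq_algebra \<gamma>\<^esub> (c \<odot>\<^bsub>oq_algebra \<gamma>\<^esub> y) = c \<odot>\<^bsub>oq_algebra \<gamma>\<^esub> (x \<oplus>\<^bsub>oq_algebra \<gamma>\<^esub> d \<odot>\<^bsub>oq_algebra \<gamma>\<^esub> y)"
    if "x \<in> carrier (oq_algebra \<gamma>)" "y \<in> carrier (oq_algebra \<gamma>)" for x y d
    using that by (simp add: O.sm_add_right mult.commute flip: O.sm_mult)
  from smult show ?case by (simp add: l s)
qed

lemma uq_ops_oq:
  assumes "qlam \<gamma> \<noteq> 0" shows "uq_ops (oq_algebra \<gamma>) \<gamma> (oq_gen_act \<gamma>)"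
proof unfold_locales
  note l = lin_mapD(1)[OF oq_gen_act_lin]
  fix v assume v: "v \<in> carrier (oq_algebra \<gamma>)"
  show "oq_gen_act \<gamma> UK1 (oq_gen_act \<gamma> UK1i v) = v" "oq_gen_act \<gamma> UK1i (oq_gen_act \<gamma> UK1 v) = v"
    "oq_gen_act \<gamma> UK2 (oq_gen_act \<gamma> UK2i v) = v" "oq_gen_act \<gamma> UK2i (oq_gen_act \<gamma> UK2 v) = v"
    using oq_aut_inv[of UK1 v \<gamma>] oq_aut_inv[of UK1i v \<gamma>] oq_aut_inv[of UK2 v \<gamma>] oq_aut_inv[of UK2i v \<gamma>] v
    by (simp_all add: oq_aut_act)
  show "oq_gen_act \<gamma> UK1 (oq_gen_act \<gamma> UK2 v) = oq_gen_act \<gamma> UK2 (oq_gen_act \<gamma> UK1 v)"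
    using v by (simp add: oq_aut_act oq_aut_commute)
  show "oq_gen_act \<gamma> UE (oq_gen_act \<gamma> UF v) \<oplus>\<^bsub>oq_algebra \<gamma>\<^esub> (1 / qlam \<gamma>) \<odot>\<^bsub>oq_algebra \<gamma>\<^esub>
       oq_gen_act \<gamma> UK2 (oq_gen_act \<gamma> UK1i (oq_gen_act \<gamma> UK2 (oq_gen_act \<gamma> UK1i v)))
     = oq_gen_act \<gamma> UF (oq_gen_act \<gamma> UE v) \<oplus>\<^bsub>oq_algebra \<gamma>\<^esub> (1 / qlam \<gamma>) \<odot>\<^bsub>oq_algebra \<gamma>\<^esub>
       oq_gen_act \<gamma> UK1 (oq_gen_act \<gamma> UK2i (oq_gen_act \<gamma> UK1 (oq_gen_act \<gamma> UK2i v)))"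
    using oq_EF[OF assms v] by (simp add: oq_aut_act oq_K_def oq_K_inv_def)
qed (use oq_conj_rels in \<open>simp_all add: oq_aut_act oq_gen_act_lin\<close>)

text \<open>The involution reverses products and exchanges K with K^(-1), so it carries the twisted
  Leibniz rule into itself. For the group-like generators it conjugates the weights, which is the
  same as inverting them.\<close>

lemma oq_star_gen_act:
  assumes z: "z \<in> carrier (oq_algebra \<gamma>)"
  shows "star (O_R2q \<gamma>) (oq_gen_act \<gamma> g z) = oq_gen_act \<gamma> (inv_gen g) (star (O_R2q \<gamma>) z)"
proof -
  let ?B = "conj_algebra (opp_algebra (oq_algebra \<gamma>))"
  have B: "complex_alg ?B" by (intro complex_alg_conj complex_alg_opp complex_alg_oq)
  have op: "alg_hom ?B ?B f" if "alg_hom (oq_algebra \<gamma>) (oq_algebra \<gamma>) f" for f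
    using that by (auto simp: alg_hom_def lin_map_def)
  have K: "star (O_R2q \<gamma>) (f y) = f' (star (O_R2q \<gamma>) y)"
    if "alg_hom (oq_algebra \<gamma>) (oq_algebra \<gamma>) f" "alg_hom (oq_algebra \<gamma>) (oq_algebra \<gamma>) f'"
      "\<And>a. star (O_R2q \<gamma>) (f (omono \<gamma> 1 [a])) = f' (omono \<gamma> 1 [a])" "y \<in> carrier (oq_algebra \<gamma>)" for f f' y
    by (rule alg_hom_oq_eqI[OF B alg_hom_comp[OF that(1) oq_star_hom(1)] alg_hom_comp[OF oq_star_hom(1) op[OF that(2)]] _ that(4)])
      (simp add: that(3) oq_star_hom(2))
  show ?thesis
  proof (cases "g = UE \<or> g = UF")
    case False
    hence i: "inv_gen g \<noteq> UE" "inv_gen g \<noteq> UF" by (cases g; simp)+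
    have w: "cnj (oq_weight \<gamma> g a) = oq_weight \<gamma> (inv_gen g) a" for a using False by (cases g; cases a) auto
    have g: "g \<noteq> UE" "g \<noteq> UF" using False by auto
    show ?thesis unfolding oq_aut_act[OF i] oq_aut_act[OF g]
      by (rule K[OF oq_aut_hom(1)[OF g] oq_aut_hom(1)[OF i] _ z])
        (simp add: oq_aut_hom(2)[OF g] oq_aut_hom(2)[OF i] oq_star_hom(2) w)
  next
    case True
    hence ig: "inv_gen g = g" by auto
    have sK: "star (O_R2q \<gamma>) (oq_K \<gamma> y) = oq_K_inv \<gamma> (star (O_R2q \<gamma>) y)"
      "star (O_R2q \<gamma>) (oq_K_inv \<gamma> y) = oq_K \<gamma> (star (O_R2q \<gamma>) y)" if "y \<in> carrier (oq_algebra \<gamma>)" for y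
      by (rule K[OF oq_K_hom oq_K_inv_hom _ that] K[OF oq_K_inv_hom oq_K_hom _ that], simp add: oq_K_gen oq_star_hom(2))+
    have s0: "star (O_R2q \<gamma>) \<zero>\<^bsub>oq_algebra \<gamma>\<^esub> = \<zero>\<^bsub>oq_algebra \<gamma>\<^esub>"
      using lin_map_zero[OF O.complex_vs_axioms complex_alg.axioms(1)[OF B] alg_homD(1)[OF oq_star_hom(1)]] by simp
    note l = lin_mapD[OF oq_gen_act_lin[of \<gamma> g]] lin_mapD(1)[OF alg_homD(1)[OF oq_K_hom]] lin_mapD(1)[OF alg_homD(1)[OF oq_K_inv_hom]]
    show ?thesis unfolding ig using z
    proof (induction z rule: oq_induct)
      case one
      show ?case by (simp add: oq_skew_one[OF True] oq_starD s0)
    next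
      case (gen a z)
      have ga: "star (O_R2q \<gamma>) (oq_gen_act \<gamma> g (omono \<gamma> 1 [a])) = oq_gen_act \<gamma> g (omono \<gamma> 1 [a])"
        using True by (cases a) (auto simp: oq_skew_gen oq_star_hom(2) s0)
      let ?s = "star (O_R2q \<gamma>) z" and ?a = "omono \<gamma> 1 [a]"
      have zc: "?s \<in> carrier (oq_algebra \<gamma>)" using gen by (simp add: oq_starD)
      have "star (O_R2q \<gamma>) (oq_gen_act \<gamma> g (?a \<otimes>\<^bsub>oq_algebra \<gamma>\<^esub> z))
         = oq_K_inv \<gamma> ?s \<otimes>\<^bsub>oq_algebra \<gamma>\<^esub> oq_gen_act \<gamma> g ?a \<oplus>\<^bsub>oq_algebra \<gamma>\<^esub> oq_gen_act \<gamma> g ?s \<otimes>\<^bsub>oq_algebra \<gamma>\<^esub> oq_K \<gamma> ?a"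
        using gen by (simp add: oq_skew_leibniz[OF True] oq_starD l sK ga oq_star_hom(2))
      also have "\<dots> = oq_gen_act \<gamma> g ?s \<otimes>\<^bsub>oq_algebra \<gamma>\<^esub> oq_K \<gamma> ?a \<oplus>\<^bsub>oq_algebra \<gamma>\<^esub> oq_K_inv \<gamma> ?s \<otimes>\<^bsub>oq_algebra \<gamma>\<^esub> oq_gen_act \<gamma> g ?a"
        by (rule O.a_comm) (simp_all add: l zc)
      also have "\<dots> = oq_gen_act \<gamma> g (star (O_R2q \<gamma>) (?a \<otimes>\<^bsub>oq_algebra \<gamma>\<^esub> z))"
        using gen zc by (simp add: oq_skew_leibniz[OF True] oq_starD oq_star_hom(2))
      finally show ?case .
    qed (simp_all add: l oq_starD)
  qed
qed

lemma oq_act_eq: "oq_act \<gamma> f z = word_act (oq_algebra \<gamma>) (foldr (oq_gen_act \<gamma>)) f z"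
  by (simp add: oq_act_def word_act_def free_act_def)

subsection \<open>Entire functions of two variables\<close>

type_synonym c2 = "complex \<times> complex"

lemma entire2I: "(\<And>z. \<exists>c d. (A has_derivative (\<lambda>h. c * fst h + d * snd h)) (at z)) \<Longrightarrow> entire2 A"
  unfolding entire2_def case_prod_unfold by blast

lemma entire2D: "entire2 A \<Longrightarrow> \<exists>c d. (A has_derivative (\<lambda>h. c * fst h + d * snd h)) (at z)"
  unfolding entire2_def case_prod_unfold by blast

lemma entire2_continuous: "entire2 A \<Longrightarrow> continuous_on UNIV A"
  by (meson entire2D continuous_at_imp_continuous_on has_derivative_continuous)

lemma entire2_add: assumes "entire2 A" "entire2 B" shows "entire2 (\<lambda>z. A z + B z)"
proof (rule entire2I)
  fix z
  obtain c d where A: "(A has_derivative (\<lambda>h. c * fst h + d * snd h)) (at z)" using entire2D[OF assms(1)] by blast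
  obtain c' d' where B: "(B has_derivative (\<lambda>h. c' * fst h + d' * snd h)) (at z)" using entire2D[OF assms(2)] by blast
  from has_derivative_add[OF A B]
  have "((\<lambda>z. A z + B z) has_derivative (\<lambda>h. (c + c') * fst h + (d + d') * snd h)) (at z)"
    by (simp add: algebra_simps)
  thus "\<exists>c d. ((\<lambda>z. A z + B z) has_derivative (\<lambda>h. c * fst h + d * snd h)) (at z)" by blast
qed

lemma entire2_mult: assumes "entire2 A" "entire2 B" shows "entire2 (\<lambda>z. A z * B z)"
proof (rule entire2I)
  fix z
  obtain c d where A: "(A has_derivative (\<lambda>h. c * fst h + d * snd h)) (at z)" using entire2D[OF assms(1)] by blast
  obtain c' d' where B: "(B has_derivative (\<lambda>h. c' * fst h + d' * snd h)) (at z)" using entire2D[OF assms(2)] by blast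
  from has_derivative_mult[OF A B]
  have "((\<lambda>z. A z * B z) has_derivative (\<lambda>h. (A z * c' + c * B z) * fst h + (A z * d' + d * B z) * snd h)) (at z)"
    by (simp add: algebra_simps)
  thus "\<exists>c d. ((\<lambda>z. A z * B z) has_derivative (\<lambda>h. c * fst h + d * snd h)) (at z)" by blast
qed

lemma entire2_const: "entire2 (\<lambda>z. c)"
  by (rule entire2I, rule exI[of _ 0], rule exI[of _ 0]) simp

lemma entire2_linear: "entire2 (\<lambda>z. a * fst z + b * snd z)"
  by (rule entire2I, rule exI[of _ a], rule exI[of _ b]) (auto intro!: derivative_eq_intros)

lemma entire2_shift: assumes "entire2 A" shows "entire2 (\<lambda>z. A (z + w))"
proof (rule entire2I)
  fix z
  obtain c d where A: "(A has_derivative (\<lambda>h. c * fst h + d * snd h)) (at (z + w))" using entire2D[OF assms] by blast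
  have "((\<lambda>z. z + w) has_derivative (\<lambda>h. h)) (at z)" by (auto intro!: derivative_eq_intros)
  from has_derivative_compose[OF this A]
  show "\<exists>c d. ((\<lambda>z. A (z + w)) has_derivative (\<lambda>h. c * fst h + d * snd h)) (at z)" by blast
qed

lemma entire2_exp: assumes "entire2 A" shows "entire2 (\<lambda>z. exp (A z))"
proof (rule entire2I)
  fix z
  obtain c d where A: "(A has_derivative (\<lambda>h. c * fst h + d * snd h)) (at z)" using entire2D[OF assms] by blast
  have "((\<lambda>z. exp (A z)) has_derivative (\<lambda>h. (exp (A z) * c) * fst h + (exp (A z) * d) * snd h)) (at z)"
    by (rule has_derivative_eq_rhs[OF has_derivative_compose[OF A DERIV_exp[unfolded has_field_derivative_def]]])
      (auto simp: algebra_simps)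
  thus "\<exists>c d. ((\<lambda>z. exp (A z)) has_derivative (\<lambda>h. c * fst h + d * snd h)) (at z)" by blast
qed

lemma entire2_cnj: assumes "entire2 A" shows "entire2 (\<lambda>z. cnj (A (cnj (fst z), cnj (snd z))))"
proof (rule entire2I)
  fix z :: c2
  obtain c d where A: "(A has_derivative (\<lambda>h. c * fst h + d * snd h)) (at (cnj (fst z), cnj (snd z)))"
    using entire2D[OF assms] by blast
  have bl: "bounded_linear (\<lambda>h::c2. (cnj (fst h), cnj (snd h)))"
    by (intro bounded_linear_Pair bounded_linear_cnj[THEN bounded_linear_compose] bounded_linear_fst bounded_linear_snd)
  have "((\<lambda>z. (cnj (fst z), cnj (snd z))) has_derivative (\<lambda>h::c2. (cnj (fst h), cnj (snd h)))) (at z)"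
    by (rule bounded_linear_imp_has_derivative[OF bl])
  from bounded_linear.has_derivative[OF bounded_linear_cnj has_derivative_compose[OF this A]]
  have "((\<lambda>z. cnj (A (cnj (fst z), cnj (snd z)))) has_derivative (\<lambda>h. cnj c * fst h + cnj d * snd h)) (at z)"
    by simp
  thus "\<exists>c d. ((\<lambda>z. cnj (A (cnj (fst z), cnj (snd z)))) has_derivative (\<lambda>h. c * fst h + d * snd h)) (at z)" by blast
qed

lemma entire2_holomorphic:
  assumes "entire2 A"
  shows "(\<lambda>z. A (z, w)) holomorphic_on S" "(\<lambda>z. A (w, z)) holomorphic_on S"
proof -
  have "(\<lambda>z. A (z, w)) field_differentiable at z" for z
  proof -
    obtain c d where A: "(A has_derivative (\<lambda>h. c * fst h + d * snd h)) (at (z, w))" using entire2D[OF assms] by blast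
    have "((\<lambda>z. (z, w)) has_derivative (\<lambda>h. (h, 0))) (at z)" by (auto intro!: derivative_eq_intros)
    from has_derivative_compose[OF this A] have "((\<lambda>z. A (z, w)) has_field_derivative c) (at z)"
      by (simp add: has_field_derivative_def)
    thus ?thesis by (auto simp: field_differentiable_def)
  qed
  thus "(\<lambda>z. A (z, w)) holomorphic_on S"
    by (simp add: field_differentiable_at_within holomorphic_on_def)
  have "(\<lambda>z. A (w, z)) field_differentiable at z" for z
  proof -
    obtain c d where A: "(A has_derivative (\<lambda>h. c * fst h + d * snd h)) (at (w, z))" using entire2D[OF assms] by blast
    have "((\<lambda>z. (w, z)) has_derivative (\<lambda>h. (0, h))) (at z)" by (auto intro!: derivative_eq_intros)
    from has_derivative_compose[OF this A] have "((\<lambda>z. A (w, z)) has_field_derivative d) (at z)"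
      by (simp add: has_field_derivative_def)
    thus ?thesis by (auto simp: field_differentiable_def)
  qed
  thus "(\<lambda>z. A (w, z)) holomorphic_on S"
    by (simp add: field_differentiable_at_within holomorphic_on_def)
qed

definition emb :: "real \<times> real \<Rightarrow> c2" where
  "emb x = (of_real (fst x), of_real (snd x))"

lemma emb_simps [simp]: "fst (emb x) = of_real (fst x)" "snd (emb x) = of_real (snd x)"
  by (simp_all add: emb_def)

lemma emb_add: "emb (x + y) = emb x + emb y" and emb_diff: "emb (x - y) = emb x - emb y"
  and emb_minus: "emb (- x) = - emb x"
  by (simp_all add: emb_def prod_eq_iff)

lemma continuous_emb: "continuous_on S emb"
  unfolding emb_def by (intro continuous_intros)

text \<open>The identity theorem in one variable is applied twice: in the first coordinate with the
  second one real, then in the second with the first one arbitrary.\<close>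

lemma entire2_eq_0_on_reals:
  assumes "entire2 A" and "\<And>x. A (emb x) = 0"
  shows "A z = 0"
proof -
  have lim: "(0::complex) islimpt \<real>"
    unfolding islimpt_approachable
  proof safe
    fix e :: real assume "e > 0"
    hence "complex_of_real (e / 2) \<in> \<real>" "complex_of_real (e / 2) \<noteq> 0" "dist (complex_of_real (e / 2)) 0 < e"
      by (auto simp: dist_norm)
    thus "\<exists>x'\<in>\<real>. x' \<noteq> 0 \<and> dist x' (0::complex) < e" by blast
  qed
  have real2: "A (w, of_real y) = 0" for w y
  proof (rule analytic_continuation[of "\<lambda>z. A (z, of_real y)" UNIV \<real> 0])
    show "A (z, of_real y) = 0" if "z \<in> \<real>" for z
      using that assms(2)[of "(Re z, y)"] by (auto elim!: Reals_cases simp: emb_def)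
  qed (use lim entire2_holomorphic[OF assms(1)] in auto)
  have "A (fst z, w) = 0" for w
  proof (rule analytic_continuation[of "\<lambda>w. A (fst z, w)" UNIV \<real> 0])
    show "A (fst z, w) = 0" if "w \<in> \<real>" for w
      using that real2 by (auto elim!: Reals_cases)
  qed (use lim entire2_holomorphic[OF assms(1)] in auto)
  from this[of "snd z"] show ?thesis by simp
qed

lemma entire2_cmult: "entire2 A \<Longrightarrow> entire2 (\<lambda>z. c * A z)"
  by (intro entire2_mult entire2_const)

lemma entire2_unique:
  assumes "entire2 A" "entire2 B" "\<And>x. A (emb x) = B (emb x)" shows "A = B"
proof
  fix z
  have "entire2 (\<lambda>z. A z + (-1) * B z)" using assms by (intro entire2_add entire2_cmult)
  from entire2_eq_0_on_reals[OF this, of z] show "A z = B z" using assms(3) by simp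
qed

subsection \<open>Rapid decay\<close>

definition rnorm :: "c2 \<Rightarrow> real" where
  "rnorm z = \<bar>Re (fst z)\<bar> + \<bar>Re (snd z)\<bar>"

definition in_strip :: "real \<Rightarrow> c2 \<Rightarrow> bool" where
  "in_strip \<nu> z \<longleftrightarrow> \<bar>Im (fst z)\<bar> \<le> \<nu> \<and> \<bar>Im (snd z)\<bar> \<le> \<nu>"

definition rapid :: "(c2 \<Rightarrow> complex) \<Rightarrow> bool" where
  "rapid A \<longleftrightarrow> entire2 A \<and> (\<forall>\<mu>>0. \<forall>\<nu>>0. \<exists>C. \<forall>z. in_strip \<nu> z \<longrightarrow> cmod (A z) \<le> C * exp (- \<mu> * rnorm z))"

text \<open>The standard symplectic form, extended bilinearly to complex vectors. The kernel of
  \<open>twisted_prod\<close> is \<open>ewave (x - u) (x - v)\<close>.\<close>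

definition omega :: "c2 \<Rightarrow> c2 \<Rightarrow> complex" where
  "omega k z = fst k * snd z - snd k * fst z"

definition ewave :: "c2 \<Rightarrow> c2 \<Rightarrow> complex" where
  "ewave k z = exp (4 * of_real pi * \<i> * omega k z)"

lemma rapidI:
  assumes "entire2 A" "\<And>\<mu> \<nu>. \<mu> > 0 \<Longrightarrow> \<nu> > 0 \<Longrightarrow> \<exists>C. \<forall>z. in_strip \<nu> z \<longrightarrow> cmod (A z) \<le> C * exp (- \<mu> * rnorm z)"
  shows "rapid A"
  using assms by (auto simp: rapid_def)

lemma rapid_entire2: "rapid A \<Longrightarrow> entire2 A"
  by (simp add: rapid_def)

text \<open>Raising \<mu> and \<nu> to at least 1 removes their sign conditions, and raising the
  constant makes it positive.\<close>

lemma rapidE: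
  assumes "rapid A"
  obtains C where "C > 0" "\<And>z. in_strip \<nu> z \<Longrightarrow> cmod (A z) \<le> C * exp (- \<mu> * rnorm z)"
proof -
  obtain C where C: "in_strip (max \<nu> 1) z \<Longrightarrow> cmod (A z) \<le> C * exp (- (max \<mu> 1) * rnorm z)" for z
    using assms unfolding rapid_def by (meson less_max_iff_disj zero_less_one)
  show ?thesis
  proof (rule that[of "max C 1"])
    fix z assume "in_strip \<nu> z"
    hence "cmod (A z) \<le> C * exp (- (max \<mu> 1) * rnorm z)" by (intro C) (auto simp: in_strip_def)
    also have "\<dots> \<le> max C 1 * exp (- \<mu> * rnorm z)"
      by (intro mult_mono) (auto simp: rnorm_def intro!: mult_right_mono)
    finally show "cmod (A z) \<le> max C 1 * exp (- \<mu> * rnorm z)" .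
  qed simp
qed

lemma rnorm_nonneg [simp]: "rnorm z \<ge> 0"
  by (simp add: rnorm_def)

lemma rnorm_triangle: "rnorm z \<le> rnorm (z + w) + rnorm w"
  by (simp add: rnorm_def)

lemma rapid_add: assumes "rapid A" "rapid B" shows "rapid (\<lambda>z. A z + B z)"
proof (rule rapidI)
  show "entire2 (\<lambda>z. A z + B z)" using assms by (intro entire2_add rapid_entire2)
  fix \<mu> \<nu> :: real
  obtain C where C: "\<And>z. in_strip \<nu> z \<Longrightarrow> cmod (A z) \<le> C * exp (- \<mu> * rnorm z)" using assms rapidE by metis
  obtain D where D: "\<And>z. in_strip \<nu> z \<Longrightarrow> cmod (B z) \<le> D * exp (- \<mu> * rnorm z)" using assms rapidE by metis
  have "cmod (A z + B z) \<le> (C + D) * exp (- \<mu> * rnorm z)" if "in_strip \<nu> z" for z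
    using norm_triangle_ineq[of "A z" "B z"] C[OF that] D[OF that] by (simp add: distrib_right)
  thus "\<exists>C. \<forall>z. in_strip \<nu> z \<longrightarrow> cmod (A z + B z) \<le> C * exp (- \<mu> * rnorm z)" by blast
qed

lemma rapid_cmult: assumes "rapid A" shows "rapid (\<lambda>z. c * A z)"
proof (rule rapidI)
  show "entire2 (\<lambda>z. c * A z)" using assms by (intro entire2_cmult rapid_entire2)
  fix \<mu> \<nu> :: real
  obtain C where C: "\<And>z. in_strip \<nu> z \<Longrightarrow> cmod (A z) \<le> C * exp (- \<mu> * rnorm z)" using assms rapidE by metis
  have "cmod (c * A z) \<le> (cmod c * C) * exp (- \<mu> * rnorm z)" if "in_strip \<nu> z" for z
    using C[OF that] by (simp add: norm_mult mult.assoc mult_left_mono)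
  thus "\<exists>C. \<forall>z. in_strip \<nu> z \<longrightarrow> cmod (c * A z) \<le> C * exp (- \<mu> * rnorm z)" by blast
qed

lemma rapid_diff: assumes "rapid A" "rapid B" shows "rapid (\<lambda>z. A z - B z)"
  using rapid_add[OF assms(1) rapid_cmult[OF assms(2), of "-1"]] by simp

lemma rapid_shift: assumes "rapid A" shows "rapid (\<lambda>z. A (z + w))"
proof (rule rapidI)
  show "entire2 (\<lambda>z. A (z + w))" using assms by (intro entire2_shift rapid_entire2)
  fix \<mu> \<nu> :: real assume "\<mu> > 0"
  obtain C where C: "C > 0" "\<And>z. in_strip (\<nu> + (\<bar>Im (fst w)\<bar> + \<bar>Im (snd w)\<bar>)) z \<Longrightarrow> cmod (A z) \<le> C * exp (- \<mu> * rnorm z)"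
    using assms rapidE by metis
  have "cmod (A (z + w)) \<le> (C * exp (\<mu> * rnorm w)) * exp (- \<mu> * rnorm z)" if "in_strip \<nu> z" for z
  proof -
    have "cmod (A (z + w)) \<le> C * exp (- \<mu> * rnorm (z + w))"
      by (rule C(2)) (use that in \<open>auto simp: in_strip_def\<close>)
    also have "\<dots> \<le> C * exp (\<mu> * rnorm w + - \<mu> * rnorm z)"
    proof -
      have "\<mu> * rnorm z \<le> \<mu> * rnorm (z + w) + \<mu> * rnorm w"
        using mult_left_mono[OF rnorm_triangle[of z w], of \<mu>] \<open>\<mu> > 0\<close> by (simp add: distrib_left)
      thus ?thesis using C(1) by simp
    qed
    finally show ?thesis by (simp only: exp_add mult.assoc)
  qed
  thus "\<exists>C. \<forall>z. in_strip \<nu> z \<longrightarrow> cmod (A (z + w)) \<le> C * exp (- \<mu> * rnorm z)" by blast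
qed

definition size2 :: "c2 \<Rightarrow> real" where
  "size2 k = cmod (fst k) + cmod (snd k)"

lemma cmod_fst_snd_le:
  assumes "in_strip \<nu> z" shows "cmod (fst z) \<le> rnorm z + \<nu>" "cmod (snd z) \<le> rnorm z + \<nu>"
  using assms cmod_le[of "fst z"] cmod_le[of "snd z"] by (auto simp: in_strip_def rnorm_def)

lemma cmod_ewave_le:
  assumes "in_strip \<nu> z" "\<nu> \<ge> 0" shows "cmod (ewave k z) \<le> exp (4 * pi * size2 k * (rnorm z + \<nu>))"
proof -
  have "cmod (omega k z) \<le> cmod (fst k) * cmod (snd z) + cmod (snd k) * cmod (fst z)"
    unfolding omega_def by (rule order_trans[OF norm_triangle_ineq4]) (simp add: norm_mult)
  also have "\<dots> \<le> cmod (fst k) * (rnorm z + \<nu>) + cmod (snd k) * (rnorm z + \<nu>)"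
    using cmod_fst_snd_le[OF assms(1)] by (intro add_mono mult_left_mono) auto
  finally have *: "cmod (omega k z) \<le> size2 k * (rnorm z + \<nu>)" by (simp add: size2_def distrib_right)
  have "cmod (ewave k z) \<le> exp (cmod (4 * of_real pi * \<i> * omega k z))"
    unfolding ewave_def by (rule norm_exp)
  also have "\<dots> \<le> exp (4 * pi * size2 k * (rnorm z + \<nu>))"
    using * by (simp add: norm_mult mult.assoc)
  finally show ?thesis .
qed

lemma entire2_ewave: "entire2 (ewave k)"
proof -
  have eq: "ewave k = (\<lambda>z. exp ((- (4 * of_real pi * \<i> * snd k)) * fst z + (4 * of_real pi * \<i> * fst k) * snd z))"
    by (rule ext) (simp add: ewave_def omega_def algebra_simps)
  show ?thesis unfolding eq by (intro entire2_exp entire2_linear)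
qed

text \<open>On a strip \<open>ewave k\<close> grows at most at the exponential rate 4 pi
  \<open>size2 k\<close>, and this rate can be demanded of \<open>A\<close> in addition to
  \<mu>.\<close>

lemma rapid_ewave: assumes "rapid A" shows "rapid (\<lambda>z. ewave k z * A z)"
proof (rule rapidI)
  show "entire2 (\<lambda>z. ewave k z * A z)" using assms by (intro entire2_mult entire2_ewave rapid_entire2)
  fix \<mu> \<nu> :: real assume "\<nu> > 0"
  let ?M = "4 * pi * size2 k"
  obtain C where C: "C > 0" "\<And>z. in_strip \<nu> z \<Longrightarrow> cmod (A z) \<le> C * exp (- (\<mu> + ?M) * rnorm z)"
    using assms rapidE by metis
  have "cmod (ewave k z * A z) \<le> (C * exp (?M * \<nu>)) * exp (- \<mu> * rnorm z)" if "in_strip \<nu> z" for z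
  proof -
    have "cmod (ewave k z * A z) \<le> exp (?M * (rnorm z + \<nu>)) * (C * exp (- (\<mu> + ?M) * rnorm z))"
      unfolding norm_mult using \<open>\<nu> > 0\<close> by (intro mult_mono cmod_ewave_le C(2) that) auto
    also have "\<dots> = C * exp (?M * (rnorm z + \<nu>) + - (\<mu> + ?M) * rnorm z)"
      by (simp only: exp_add mult_ac)
    also have "?M * (rnorm z + \<nu>) + - (\<mu> + ?M) * rnorm z = ?M * \<nu> + - \<mu> * rnorm z"
      by (simp add: algebra_simps)
    finally show ?thesis by (simp only: exp_add mult.assoc)
  qed
  thus "\<exists>C. \<forall>z. in_strip \<nu> z \<longrightarrow> cmod (ewave k z * A z) \<le> C * exp (- \<mu> * rnorm z)" by blast
qed

lemma rapid_cnj: assumes "rapid A" shows "rapid (\<lambda>z. cnj (A (cnj (fst z), cnj (snd z))))"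
proof (rule rapidI)
  show "entire2 (\<lambda>z. cnj (A (cnj (fst z), cnj (snd z))))" using assms by (intro entire2_cnj rapid_entire2)
  fix \<mu> \<nu> :: real
  obtain C where C: "C > 0" "\<And>z. in_strip \<nu> z \<Longrightarrow> cmod (A z) \<le> C * exp (- \<mu> * rnorm z)" using assms rapidE by metis
  have "cmod (A (cnj (fst z), cnj (snd z))) \<le> C * exp (- \<mu> * rnorm z)" if "in_strip \<nu> z" for z
    using C(2)[of "(cnj (fst z), cnj (snd z))"] that by (simp add: in_strip_def rnorm_def)
  thus "\<exists>C. \<forall>z. in_strip \<nu> z \<longrightarrow> cmod (cnj (A (cnj (fst z), cnj (snd z)))) \<le> C * exp (- \<mu> * rnorm z)"
    unfolding complex_mod_cnj by blast
qed

subsection \<open>Integrability\<close>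

lemma integrable_exp_abs: "integrable lborel (\<lambda>x::real. exp (- \<bar>x\<bar>))"
proof -
  have 1: "integrable lborel (\<lambda>x::real. exp (- x) * indicator {0..} x)"
    using has_bochner_integral_I0i_power_exp_m'[of 0] by (auto simp: has_bochner_integral_iff)
  from lborel_integrable_real_affine[OF this, of "-1" 0]
  have 2: "integrable lborel (\<lambda>x::real. exp x * indicator {0..} (- x))" by simp
  show ?thesis
    by (rule Bochner_Integration.integrable_bound[OF Bochner_Integration.integrable_add[OF 1 2]])
      (auto split: split_indicator)
qed

lemma integrable_exp_abs2: "integrable lborel (\<lambda>x::real \<times> real. exp (- (\<bar>fst x\<bar> + \<bar>snd x\<bar>)))"
proof -
  have "integrable (lborel \<Otimes>\<^sub>M lborel) (\<lambda>(x::real, y::real). exp (- \<bar>x\<bar>) * exp (- \<bar>y\<bar>))"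
  proof (rule lborel_pair.Fubini_integrable)
    have "integrable lborel (\<lambda>x::real. (\<integral>y. exp (- \<bar>y::real\<bar>) \<partial>lborel) * exp (- \<bar>x\<bar>))"
      by (intro integrable_mult_right integrable_exp_abs)
    thus "integrable lborel (\<lambda>x::real. \<integral>y. norm (case (x, y::real) of (x, y) \<Rightarrow> exp (- \<bar>x\<bar>) * exp (- \<bar>y\<bar>)) \<partial>lborel)"
      by (simp add: mult.commute)
  qed (auto simp: integrable_exp_abs)
  thus ?thesis
    by (simp add: lborel_prod case_prod_unfold exp_add[symmetric])
qed

lemma rapid_measurable:
  assumes "rapid A" shows "(\<lambda>x. A (emb x + w)) \<in> borel_measurable borel"
proof (rule borel_measurable_continuous_onI)
  have "continuous_on UNIV (A \<circ> (\<lambda>x. emb x + w))"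
    by (intro continuous_on_compose continuous_intros continuous_emb continuous_on_subset[OF entire2_continuous[OF rapid_entire2[OF assms]]]) auto
  thus "continuous_on UNIV (\<lambda>x. A (emb x + w))" by (simp add: o_def)
qed

lemma rnorm_emb: "rnorm (emb x) = \<bar>fst x\<bar> + \<bar>snd x\<bar>"
  by (simp add: rnorm_def)

text \<open>Decay at rate M + 1 pays for the weight and leaves an integrable exponential.\<close>

lemma rapid_integrable_weight:
  assumes "rapid A"
  shows "integrable lborel (\<lambda>x. cmod (A (emb x + w)) * exp (M * rnorm (emb x)))"
proof -
  obtain C where C: "C > 0" "\<And>z. in_strip 0 z \<Longrightarrow> cmod (A (z + w)) \<le> C * exp (- (M + 1) * rnorm z)"
    using rapidE[OF rapid_shift[OF assms, of w], of 0 "M + 1"] by metis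
  show ?thesis
  proof (rule Bochner_Integration.integrable_bound)
    show "integrable lborel (\<lambda>x::real \<times> real. C * exp (- (\<bar>fst x\<bar> + \<bar>snd x\<bar>)))"
      by (intro integrable_mult_right integrable_exp_abs2)
    show "(\<lambda>x. cmod (A (emb x + w)) * exp (M * rnorm (emb x))) \<in> borel_measurable lborel"
    proof -
      have "(\<lambda>x::real \<times> real. exp (M * rnorm (emb x))) \<in> borel_measurable borel"
        unfolding rnorm_emb by (intro borel_measurable_continuous_onI continuous_intros)
      thus ?thesis using rapid_measurable[OF assms, of w] by measurable
    qed
    have "cmod (A (emb x + w)) * exp (M * rnorm (emb x)) \<le> C * exp (- (\<bar>fst x\<bar> + \<bar>snd x\<bar>))" for x
    proof -
      have "cmod (A (emb x + w)) * exp (M * rnorm (emb x)) \<le> (C * exp (- (M + 1) * rnorm (emb x))) * exp (M * rnorm (emb x))"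
        by (intro mult_right_mono C(2)) (auto simp: in_strip_def)
      also have "\<dots> = C * exp (- (M + 1) * rnorm (emb x) + M * rnorm (emb x))" by (simp only: exp_add mult.assoc)
      also have "- (M + 1) * rnorm (emb x) + M * rnorm (emb x) = - (\<bar>fst x\<bar> + \<bar>snd x\<bar>)"
        by (simp add: rnorm_emb algebra_simps)
      finally show ?thesis .
    qed
    thus "AE x in lborel. norm (cmod (A (emb x + w)) * exp (M * rnorm (emb x))) \<le> norm (C * exp (- (\<bar>fst x\<bar> + \<bar>snd x\<bar>)))"
      using C(1) by (auto simp: abs_mult)
  qed
qed

lemma rapid_integrable: assumes "rapid A" shows "integrable lborel (\<lambda>x. A (emb x + w))"
  using rapid_integrable_weight[OF assms, of w 0] rapid_measurable[OF assms, of w]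
  by (intro integrable_norm_cancel[of lborel "\<lambda>x. A (emb x + w)"]) simp_all

lemma rapid_integrable0: assumes "rapid A" shows "integrable lborel (\<lambda>x. A (emb x))"
  using rapid_integrable[OF assms, of 0] by simp

definition J2 :: "(c2 \<Rightarrow> complex) \<Rightarrow> complex" where
  "J2 A = (\<integral>x. A (emb x) \<partial>lborel)"

subsection \<open>Fourier-Laplace integrals are entire\<close>

lemma exp_remainder: "cmod (exp w - 1 - w) \<le> (cmod w)\<^sup>2 * exp (cmod w)"
proof -
  have "cmod (exp w - (\<Sum>k\<le>1. w ^ k / fact k)) \<le> exp \<bar>Re w\<bar> * cmod w ^ Suc 1 / fact 1" by (rule Taylor_exp)
  also have "\<dots> = (cmod w)\<^sup>2 * exp \<bar>Re w\<bar>" by (simp add: power2_eq_square)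
  also have "\<dots> \<le> (cmod w)\<^sup>2 * exp (cmod w)" using abs_Re_le_cmod[of w] by (intro mult_left_mono) auto
  finally show ?thesis by (simp add: algebra_simps)
qed

text \<open>The remainder exp w - 1 - w of the integrand is bounded by the square of the increment
  times a fixed integrable weight. This gives the total derivative at once, without passing through
  separate holomorphy.\<close>

lemma entire2_laplace:
  fixes f :: "'a \<Rightarrow> complex" and p q :: "'a \<Rightarrow> real"
  assumes [measurable]: "f \<in> borel_measurable M" "p \<in> borel_measurable M" "q \<in> borel_measurable M"
    and int: "\<And>R. integrable M (\<lambda>\<xi>. cmod (f \<xi>) * exp (R * (\<bar>p \<xi>\<bar> + \<bar>q \<xi>\<bar>)))"
  shows "entire2 (\<lambda>z. \<integral>\<xi>. f \<xi> * exp (\<i> * (fst z * of_real (p \<xi>) + snd z * of_real (q \<xi>))) \<partial>M)"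
proof (rule entire2I)
  fix z :: c2
  define s where "s \<xi> = \<bar>p \<xi>\<bar> + \<bar>q \<xi>\<bar>" for \<xi>
  define \<phi> where "\<phi> z \<xi> = exp (\<i> * (fst z * of_real (p \<xi>) + snd z * of_real (q \<xi>)))" for z :: c2 and \<xi>
  have [measurable]: "\<phi> z \<in> borel_measurable M" for z unfolding \<phi>_def by measurable
  have [measurable]: "s \<in> borel_measurable M" unfolding s_def by measurable
  have s0: "s \<xi> \<ge> 0" for \<xi> by (simp add: s_def)
  have \<phi>: "cmod (\<phi> z \<xi>) \<le> exp (size2 z * s \<xi>)" for z \<xi>
  proof -
    have "cmod (fst z * of_real (p \<xi>) + snd z * of_real (q \<xi>)) \<le> cmod (fst z) * \<bar>p \<xi>\<bar> + cmod (snd z) * \<bar>q \<xi>\<bar>"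
      by (rule order_trans[OF norm_triangle_ineq]) (simp add: norm_mult)
    also have "\<dots> \<le> size2 z * s \<xi>" unfolding size2_def s_def
      by (simp add: distrib_left distrib_right)
    finally have "cmod (\<i> * (fst z * of_real (p \<xi>) + snd z * of_real (q \<xi>))) \<le> size2 z * s \<xi>" by (simp add: norm_mult)
    thus ?thesis unfolding \<phi>_def by (intro order_trans[OF norm_exp]) simp
  qed
  have intb: "integrable M g" if "g \<in> borel_measurable M" "\<And>\<xi>. cmod (g \<xi>) \<le> cmod (f \<xi>) * exp (R * s \<xi>)" for g :: "'a \<Rightarrow> complex" and R
    by (rule Bochner_Integration.integrable_bound[OF int[of R]]) (use that in \<open>auto simp: s_def\<close>)
  have int0: "integrable M (\<lambda>\<xi>. f \<xi> * \<phi> z \<xi>)" for z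
    by (rule intb[of _ "size2 z"]) (auto simp: norm_mult intro!: mult_left_mono \<phi>)
  define c where "c = (\<integral>\<xi>. f \<xi> * \<phi> z \<xi> * (\<i> * of_real (p \<xi>)) \<partial>M)"
  define d where "d = (\<integral>\<xi>. f \<xi> * \<phi> z \<xi> * (\<i> * of_real (q \<xi>)) \<partial>M)"
  have es: "\<bar>p \<xi>\<bar> \<le> exp (s \<xi>)" "\<bar>q \<xi>\<bar> \<le> exp (s \<xi>)" for \<xi>
  proof -
    have "\<bar>p \<xi>\<bar> \<le> s \<xi>" "\<bar>q \<xi>\<bar> \<le> s \<xi>" by (simp_all add: s_def)
    thus "\<bar>p \<xi>\<bar> \<le> exp (s \<xi>)" "\<bar>q \<xi>\<bar> \<le> exp (s \<xi>)" using exp_ge_add_one_self[of "s \<xi>"] by linarith+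
  qed
  have intc: "integrable M (\<lambda>\<xi>. f \<xi> * \<phi> z \<xi> * (\<i> * of_real (p \<xi>)))"
    by (rule intb[of _ "size2 z + 1"])
      (auto simp: norm_mult distrib_right exp_add mult.assoc intro!: mult_left_mono mult_mono \<phi> es)
  have intd: "integrable M (\<lambda>\<xi>. f \<xi> * \<phi> z \<xi> * (\<i> * of_real (q \<xi>)))"
    by (rule intb[of _ "size2 z + 1"])
      (auto simp: norm_mult distrib_right exp_add mult.assoc intro!: mult_left_mono mult_mono \<phi> es)
  \<comment> \<open>The rate is \<open>size2 z\<close> for \<open>\<phi> z\<close>, plus 2 for the
    square of \<open>s\<close> and 1 for the exponential in \<open>exp_remainder\<close>; 4 in place
    of 3 leaves room.\<close>
  define C where "C = (\<integral>\<xi>. cmod (f \<xi>) * exp ((size2 z + 4) * s \<xi>) \<partial>M)"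
  have intC: "integrable M (\<lambda>\<xi>. cmod (f \<xi>) * exp ((size2 z + 4) * s \<xi>))"
    using int[of "size2 z + 4"] by (simp add: s_def)
  have "((\<lambda>z. \<integral>\<xi>. f \<xi> * \<phi> z \<xi> \<partial>M) has_derivative (\<lambda>h. c * fst h + d * snd h)) (at z)"
  proof (rule has_derivativeI_sandwich[of 1 _ _ _ _ "\<lambda>y. C * norm (y - z)"])
    show "bounded_linear (\<lambda>h::c2. c * fst h + d * snd h)"
      by (intro bounded_linear_add bounded_linear_const_mult bounded_linear_fst bounded_linear_snd)
    have "((\<lambda>y. C * norm (y - z)) \<longlongrightarrow> C * norm (z - z)) (at z)" by (intro tendsto_intros)
    thus "((\<lambda>y. C * norm (y - z)) \<longlongrightarrow> 0) (at z)" by simp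
    fix y assume y: "y \<noteq> z" "dist y z < 1"
    define h where "h = y - z"
    have "norm h \<le> 1" "norm h > 0" using y by (simp_all add: h_def dist_norm)
    moreover have "cmod (fst h) \<le> norm h" "cmod (snd h) \<le> norm h"
      using norm_fst_le[of "fst h" "snd h"] norm_snd_le[of "snd h" "fst h"] by (simp_all only: prod.collapse)
    ultimately have h: "norm h \<le> 1" "norm h > 0" "cmod (fst h) \<le> norm h" "cmod (snd h) \<le> norm h" .
    define w where "w \<xi> = \<i> * (fst h * of_real (p \<xi>) + snd h * of_real (q \<xi>))" for \<xi>
    have w: "cmod (w \<xi>) \<le> norm h * s \<xi>" for \<xi>
    proof -
      have "cmod (w \<xi>) \<le> cmod (fst h) * \<bar>p \<xi>\<bar> + cmod (snd h) * \<bar>q \<xi>\<bar>"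
        unfolding w_def norm_mult by (simp, rule order_trans[OF norm_triangle_ineq]) (simp add: norm_mult)
      also have "\<dots> \<le> norm h * s \<xi>" unfolding s_def distrib_left
        using h by (intro add_mono mult_right_mono) auto
      finally show ?thesis .
    qed
    have ye: "\<phi> y \<xi> = \<phi> z \<xi> * exp (w \<xi>)" for \<xi>
      unfolding \<phi>_def w_def h_def by (simp add: exp_add[symmetric] algebra_simps)
    have eq: "f \<xi> * \<phi> y \<xi> - f \<xi> * \<phi> z \<xi> - (f \<xi> * \<phi> z \<xi> * (\<i> * of_real (p \<xi>)) * fst h + f \<xi> * \<phi> z \<xi> * (\<i> * of_real (q \<xi>)) * snd h)
       = f \<xi> * \<phi> z \<xi> * (exp (w \<xi>) - 1 - w \<xi>)" for \<xi>
      unfolding ye by (simp add: w_def algebra_simps)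
    have bd: "cmod (f \<xi> * \<phi> z \<xi> * (exp (w \<xi>) - 1 - w \<xi>)) \<le> (norm h)\<^sup>2 * (cmod (f \<xi>) * exp ((size2 z + 4) * s \<xi>))" for \<xi>
    proof -
      have "cmod (exp (w \<xi>) - 1 - w \<xi>) \<le> (norm h * s \<xi>)\<^sup>2 * exp (s \<xi>)"
      proof (rule order_trans[OF exp_remainder])
        have "norm h * s \<xi> \<le> 1 * s \<xi>" using h s0 by (intro mult_right_mono) auto
        thus "(cmod (w \<xi>))\<^sup>2 * exp (cmod (w \<xi>)) \<le> (norm h * s \<xi>)\<^sup>2 * exp (s \<xi>)"
          using w[of \<xi>] by (intro mult_mono power_mono) auto
      qed
      also have "\<dots> \<le> (norm h)\<^sup>2 * exp (3 * s \<xi>)"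
      proof -
        have "s \<xi> \<le> exp (s \<xi>)" using exp_ge_add_one_self[of "s \<xi>"] by linarith
        hence "(s \<xi>)\<^sup>2 \<le> (exp (s \<xi>))\<^sup>2" using s0 by (intro power_mono) auto
        hence "(s \<xi>)\<^sup>2 * exp (s \<xi>) \<le> (exp (s \<xi>))\<^sup>2 * exp (s \<xi>)" by (intro mult_right_mono) auto
        also have "\<dots> = exp (3 * s \<xi>)" by (simp add: power2_eq_square exp_add[symmetric])
        finally show ?thesis by (simp add: power_mult_distrib mult.assoc mult_left_mono)
      qed
      finally have "cmod (f \<xi>) * cmod (\<phi> z \<xi>) * cmod (exp (w \<xi>) - 1 - w \<xi>)
          \<le> cmod (f \<xi>) * exp (size2 z * s \<xi>) * ((norm h)\<^sup>2 * exp (3 * s \<xi>))"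
        by (intro mult_mono mult_left_mono \<phi>) auto
      also have "\<dots> = (norm h)\<^sup>2 * (cmod (f \<xi>) * exp (size2 z * s \<xi> + 3 * s \<xi>))" by (simp only: exp_add mult_ac)
      also have "\<dots> \<le> (norm h)\<^sup>2 * (cmod (f \<xi>) * exp ((size2 z + 4) * s \<xi>))"
        using s0[of \<xi>] by (intro mult_left_mono) (auto simp: distrib_right)
      finally show ?thesis by (simp add: norm_mult)
    qed
    have "(\<integral>\<xi>. f \<xi> * \<phi> y \<xi> \<partial>M) - (\<integral>\<xi>. f \<xi> * \<phi> z \<xi> \<partial>M) - (c * fst h + d * snd h)
       = (\<integral>\<xi>. f \<xi> * \<phi> y \<xi> - f \<xi> * \<phi> z \<xi> - (f \<xi> * \<phi> z \<xi> * (\<i> * of_real (p \<xi>)) * fst h + f \<xi> * \<phi> z \<xi> * (\<i> * of_real (q \<xi>)) * snd h) \<partial>M)"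
      using int0 intc intd by (simp add: c_def d_def del: mult.commute)
    also have "\<dots> = (\<integral>\<xi>. f \<xi> * \<phi> z \<xi> * (exp (w \<xi>) - 1 - w \<xi>) \<partial>M)" unfolding eq ..
    finally have "cmod ((\<integral>\<xi>. f \<xi> * \<phi> y \<xi> \<partial>M) - (\<integral>\<xi>. f \<xi> * \<phi> z \<xi> \<partial>M) - (c * fst h + d * snd h))
       \<le> (\<integral>\<xi>. (norm h)\<^sup>2 * (cmod (f \<xi>) * exp ((size2 z + 4) * s \<xi>)) \<partial>M)"
      using order_trans[OF integral_norm_bound integral_mono'[OF integrable_mult_right[OF intC] bd]] by simp
    also have "\<dots> = (norm h)\<^sup>2 * C" by (simp add: C_def)
    finally show "norm ((\<integral>\<xi>. f \<xi> * \<phi> y \<xi> \<partial>M) - (\<integral>\<xi>. f \<xi> * \<phi> z \<xi> \<partial>M) - (c * fst (y - z) + d * snd (y - z))) / norm (y - z) \<le> C * norm (y - z)"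
      using h unfolding h_def[symmetric] by (simp add: divide_simps power2_eq_square mult_ac)
  qed simp
  thus "\<exists>c d. ((\<lambda>z. \<integral>\<xi>. f \<xi> * exp (\<i> * (fst z * of_real (p \<xi>) + snd z * of_real (q \<xi>))) \<partial>M) has_derivative (\<lambda>h. c * fst h + d * snd h)) (at z)"
    unfolding \<phi>_def by blast
qed

subsection \<open>Shifting the domain of integration\<close>

text \<open>With a primitive \<open>F\<close> on the plane, the truncated integrals at heights t and
  0 differ by the increments of \<open>F\<close> along two vertical segments. These are at most C
  |t| exp (- n) and vanish in the limit.\<close>

lemma integral_shift_1d:
  fixes f :: "complex \<Rightarrow> complex"
  assumes hol: "f holomorphic_on UNIV"
    and C: "\<And>x s. \<bar>s\<bar> \<le> \<bar>t\<bar> \<Longrightarrow> cmod (f (Complex x s)) \<le> C * exp (- \<bar>x\<bar>)"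
  shows "(\<integral>x. f (Complex x t) \<partial>lborel) = (\<integral>x. f (of_real x) \<partial>lborel)"
proof -
  obtain F where F: "\<And>z. (F has_field_derivative f z) (at z)"
    using holomorphic_convex_primitive'[OF convex_UNIV open_UNIV hol] by auto
  have cont: "continuous_on UNIV f" using hol holomorphic_on_imp_continuous_on by blast
  have int: "integrable lborel (\<lambda>x. f (Complex x s))" if "\<bar>s\<bar> \<le> \<bar>t\<bar>" for s
  proof (rule Bochner_Integration.integrable_bound[OF integrable_mult_right[OF integrable_exp_abs, of C]])
    have "continuous_on UNIV (\<lambda>x. f (Complex x s))"
      unfolding Complex_eq by (intro continuous_on_compose2[OF cont] continuous_intros) auto
    thus "(\<lambda>x. f (Complex x s)) \<in> borel_measurable lborel" using borel_measurable_continuous_onI by simp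
    show "AE x in lborel. norm (f (Complex x s)) \<le> norm (C * exp (- \<bar>x\<bar>))"
      using order_trans[OF C[OF that] abs_ge_self] by (intro AE_I2) (simp only: real_norm_def)
  qed
  have fin: "(\<integral>x\<in>{-real n..real n}. f (Complex x s) \<partial>lborel) = F (Complex (real n) s) - F (Complex (- real n) s)" for n s
  proof -
    have "((\<lambda>x. F (Complex x s)) has_vector_derivative f (Complex x s)) (at x within {- real n..real n})" for x
    proof -
      have "((\<lambda>x. Complex x s) has_vector_derivative 1) (at x)"
        unfolding Complex_eq by (auto intro!: derivative_eq_intros)
      from field_vector_diff_chain_at[OF this F] show ?thesis
        by (simp add: o_def has_vector_derivative_at_within)
    qed
    moreover have "continuous_on {-real n..real n} (\<lambda>x. f (Complex x s))"
      unfolding Complex_eq by (intro continuous_on_compose2[OF cont] continuous_intros) auto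
    ultimately show ?thesis
      using integral_FTC_Icc[of "-real n" "real n" "\<lambda>x. F (Complex x s)" "\<lambda>x. f (Complex x s)"]
      by (simp add: set_lebesgue_integral_def)
  qed
  have lim: "(\<lambda>n. \<integral>x\<in>{-real n..real n}. f (Complex x s) \<partial>lborel) \<longlonglongrightarrow> (\<integral>x. f (Complex x s) \<partial>lborel)" if "\<bar>s\<bar> \<le> \<bar>t\<bar>" for s
    unfolding set_lebesgue_integral_def
  proof (rule integral_dominated_convergence[where w = "\<lambda>x. cmod (f (Complex x s))"])
    show "integrable lborel (\<lambda>x. cmod (f (Complex x s)))" using int[OF that] by simp
    show "AE x in lborel. (\<lambda>i. indicat_real {- real i..real i} x *\<^sub>R f (Complex x s)) \<longlonglongrightarrow> f (Complex x s)"
    proof (intro AE_I2 tendsto_eventually)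
      fix x :: real
      obtain N :: nat where "\<bar>x\<bar> \<le> real N" using real_arch_simple by blast
      thus "\<forall>\<^sub>F i in sequentially. indicat_real {- real i..real i} x *\<^sub>R f (Complex x s) = f (Complex x s)"
        by (intro eventually_sequentiallyI[of N]) (auto simp: indicator_def)
    qed
  qed (use int[OF that] in \<open>auto split: split_indicator\<close>)
  have side: "cmod (F (Complex x t) - F (Complex x 0)) \<le> C * exp (- \<bar>x\<bar>) * \<bar>t\<bar>" for x
  proof -
    have "cmod (F (Complex x t) - F (Complex x 0)) \<le> C * exp (- \<bar>x\<bar>) * cmod (Complex x t - Complex x 0)"
    proof (rule field_differentiable_bound[of "closed_segment (Complex x 0) (Complex x t)" F f])
      fix z assume "z \<in> closed_segment (Complex x 0) (Complex x t)"
      then obtain u where u: "0 \<le> u" "u \<le> 1" "z = Complex x (u * t)"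
        by (auto simp: in_segment complex_eq_iff algebra_simps)
      have "\<bar>u * t\<bar> \<le> \<bar>t\<bar>" using u by (simp add: abs_mult mult_left_le_one_le)
      thus "norm (f z) \<le> C * exp (- \<bar>x\<bar>)" using C[of "u * t" x] u by simp
    qed (auto intro: has_field_derivative_at_within[OF F])
    thus ?thesis by (simp add: cmod_def)
  qed
  have "(\<lambda>n. (\<integral>x\<in>{-real n..real n}. f (Complex x t) \<partial>lborel) - (\<integral>x\<in>{-real n..real n}. f (Complex x 0) \<partial>lborel)) \<longlonglongrightarrow> 0"
  proof (rule Lim_null_comparison)
    show "\<forall>\<^sub>F n in sequentially. norm ((\<integral>x\<in>{-real n..real n}. f (Complex x t) \<partial>lborel) - (\<integral>x\<in>{-real n..real n}. f (Complex x 0) \<partial>lborel))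
        \<le> 2 * (C * exp (- real n) * \<bar>t\<bar>)"
    proof (intro always_eventually allI)
      fix n
      have "(\<integral>x\<in>{-real n..real n}. f (Complex x t) \<partial>lborel) - (\<integral>x\<in>{-real n..real n}. f (Complex x 0) \<partial>lborel)
        = (F (Complex (real n) t) - F (Complex (real n) 0)) - (F (Complex (- real n) t) - F (Complex (- real n) 0))"
        unfolding fin by simp
      also have "norm \<dots> \<le> 2 * (C * exp (- real n) * \<bar>t\<bar>)"
        using norm_triangle_ineq4[of "F (Complex (real n) t) - F (Complex (real n) 0)" "F (Complex (- real n) t) - F (Complex (- real n) 0)"]
          side[of "real n"] side[of "- real n"] by simp
      finally show "norm ((\<integral>x\<in>{-real n..real n}. f (Complex x t) \<partial>lborel) - (\<integral>x\<in>{-real n..real n}. f (Complex x 0) \<partial>lborel))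
        \<le> 2 * (C * exp (- real n) * \<bar>t\<bar>)" .
    qed
    have "(\<lambda>n. exp (- real n)) \<longlonglongrightarrow> 0"
      by (intro filterlim_compose[OF exp_at_bot] filterlim_uminus_at_bot_at_top[THEN filterlim_compose] filterlim_real_sequentially)
    hence "(\<lambda>n. 2 * (C * exp (- real n) * \<bar>t\<bar>)) \<longlonglongrightarrow> 2 * (C * 0 * \<bar>t\<bar>)" by (intro tendsto_intros)
    thus "(\<lambda>n. 2 * (C * exp (- real n) * \<bar>t\<bar>)) \<longlonglongrightarrow> 0" by simp
  qed
  moreover have "(\<lambda>n. (\<integral>x\<in>{-real n..real n}. f (Complex x t) \<partial>lborel) - (\<integral>x\<in>{-real n..real n}. f (Complex x 0) \<partial>lborel))
     \<longlonglongrightarrow> (\<integral>x. f (Complex x t) \<partial>lborel) - (\<integral>x. f (Complex x 0) \<partial>lborel)"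
    by (intro tendsto_diff lim) auto
  ultimately have "(\<integral>x. f (Complex x t) \<partial>lborel) - (\<integral>x. f (Complex x 0) \<partial>lborel) = 0"
    by (rule LIMSEQ_unique[rotated])
  thus ?thesis by (simp add: complex_of_real_def)
qed

lemma integral_prod_lborel:
  fixes f :: "real \<times> real \<Rightarrow> complex"
  assumes "integrable lborel f"
  shows "(\<integral>x. f x \<partial>lborel) = (\<integral>x1. (\<integral>x2. f (x1, x2) \<partial>lborel) \<partial>lborel)"
    and "(\<integral>x. f x \<partial>lborel) = (\<integral>x2. (\<integral>x1. f (x1, x2) \<partial>lborel) \<partial>lborel)"
  using lborel_pair.integral_fst'[of f] lborel_pair.integral_snd[of "\<lambda>x y. f (x, y)"] assms
  by (simp_all add: lborel_prod)

definition imag2 :: "real \<times> real \<Rightarrow> c2" where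
  "imag2 t = (\<i> * of_real (fst t), \<i> * of_real (snd t))"

text \<open>One coordinate is shifted at a time; Fubini makes it the innermost one.\<close>

lemma rapid_J2_shift:
  assumes A: "rapid A" shows "J2 (\<lambda>z. A (z + imag2 t)) = J2 A"
proof -
  obtain t1 t2 where t: "t = (t1, t2)" by (cases t)
  have hol: "(\<lambda>z. A (z, w)) holomorphic_on UNIV" "(\<lambda>z. A (w, z)) holomorphic_on UNIV" for w
    using entire2_holomorphic[OF rapid_entire2[OF A]] by auto
  have e: "emb (x1, x2) + imag2 (s1, s2) = (Complex x1 s1, Complex x2 s2)" for x1 x2 s1 s2
    by (simp add: emb_def imag2_def Complex_eq)
  obtain C where C: "C > 0" "\<And>z. in_strip (\<bar>t1\<bar> + \<bar>t2\<bar>) z \<Longrightarrow> cmod (A z) \<le> C * exp (- 1 * rnorm z)"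
    using A rapidE by metis
  have b: "cmod (A (Complex x1 s1, Complex x2 s2)) \<le> C * exp (- \<bar>x1\<bar>)"
    "cmod (A (Complex x1 s1, Complex x2 s2)) \<le> C * exp (- \<bar>x2\<bar>)" if "\<bar>s1\<bar> \<le> \<bar>t1\<bar>" "\<bar>s2\<bar> \<le> \<bar>t2\<bar>" for x1 x2 s1 s2
  proof -
    have "cmod (A (Complex x1 s1, Complex x2 s2)) \<le> C * exp (- (\<bar>x1\<bar> + \<bar>x2\<bar>))"
    proof -
      have "in_strip (\<bar>t1\<bar> + \<bar>t2\<bar>) (Complex x1 s1, Complex x2 s2)" using that by (auto simp: in_strip_def)
      from C(2)[OF this] show ?thesis by (simp add: rnorm_def)
    qed
    moreover have "C * exp (- (\<bar>x1\<bar> + \<bar>x2\<bar>)) \<le> C * exp (- \<bar>x1\<bar>)" "C * exp (- (\<bar>x1\<bar> + \<bar>x2\<bar>)) \<le> C * exp (- \<bar>x2\<bar>)"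
      using C(1) by simp_all
    ultimately show "cmod (A (Complex x1 s1, Complex x2 s2)) \<le> C * exp (- \<bar>x1\<bar>)"
      "cmod (A (Complex x1 s1, Complex x2 s2)) \<le> C * exp (- \<bar>x2\<bar>)" by linarith+
  qed
  have s2: "(\<integral>x2. A (Complex x1 t1, Complex x2 t2) \<partial>lborel) = (\<integral>x2. A (Complex x1 t1, Complex x2 0) \<partial>lborel)" for x1
    using integral_shift_1d[of "\<lambda>z. A (Complex x1 t1, z)" t2 C, OF hol(2) b(2)] by (simp only: order_refl complex_of_real_def)
  have s1: "(\<integral>x1. A (Complex x1 t1, Complex x2 0) \<partial>lborel) = (\<integral>x1. A (Complex x1 0, Complex x2 0) \<partial>lborel)" for x2
    using integral_shift_1d[of "\<lambda>z. A (z, Complex x2 0)" t1 C, OF hol(1) b(1)] by (simp only: complex_of_real_def abs_zero abs_ge_zero)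
  have "J2 (\<lambda>z. A (z + imag2 t)) = (\<integral>x1. (\<integral>x2. A (Complex x1 t1, Complex x2 t2) \<partial>lborel) \<partial>lborel)"
    unfolding J2_def t by (subst integral_prod_lborel(1)) (auto simp: e rapid_integrable[OF A])
  also have "\<dots> = (\<integral>x1. (\<integral>x2. A (Complex x1 t1, Complex x2 0) \<partial>lborel) \<partial>lborel)"
    unfolding s2 ..
  also have "\<dots> = (\<integral>x. A (emb x + imag2 (t1, 0)) \<partial>lborel)"
    by (subst integral_prod_lborel(1)) (auto simp: e rapid_integrable[OF A])
  also have "\<dots> = (\<integral>x2. (\<integral>x1. A (Complex x1 t1, Complex x2 0) \<partial>lborel) \<partial>lborel)"
    by (subst integral_prod_lborel(2)) (auto simp: e rapid_integrable[OF A])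
  also have "\<dots> = (\<integral>x2. (\<integral>x1. A (Complex x1 0, Complex x2 0) \<partial>lborel) \<partial>lborel)"
    unfolding s1 ..
  also have "\<dots> = (\<integral>x. A (emb x + imag2 (0, 0)) \<partial>lborel)"
    by (subst integral_prod_lborel(2)) (auto simp: e rapid_integrable[OF A])
  also have "imag2 (0, 0) = 0" by (simp add: imag2_def zero_prod_def)
  finally show ?thesis by (simp add: J2_def)
qed

subsection \<open>A mean value inequality over squares\<close>

text \<open>Squares replace discs because they are products: an integral over a square is an
  iterated one over horizontal segments, and horizontal lines are where the norms of
  \<open>frakA\<close> control a function.\<close>

definition sq_int :: "(complex \<Rightarrow> real) \<Rightarrow> ennreal" where
  "sq_int g = (\<integral>\<^sup>+y. \<integral>\<^sup>+x. ennreal (indicator {-2..2} y * indicator {-2..2} x * g (Complex x y)) \<partial>lborel \<partial>lborel)"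

lemma measurable_Complex [measurable (raw)]:
  assumes "f \<in> borel_measurable M" "g \<in> borel_measurable M"
  shows "(\<lambda>x. Complex (f x) (g x)) \<in> borel_measurable M"
  unfolding Complex_eq using assms by measurable

text \<open>Multiplication by i maps the square onto itself, which reduces its four sides to the
  bottom one.\<close>

lemma sq_int_rotate:
  assumes g [measurable]: "g \<in> borel_measurable borel"
  shows "sq_int (\<lambda>w. g (\<i> * w)) = sq_int g"
proof -
  have e: "\<i> * Complex x y = Complex (- y) x" for x y by (simp add: complex_eq_iff)
  have "sq_int (\<lambda>w. g (\<i> * w))
     = (\<integral>\<^sup>+y. \<integral>\<^sup>+x. ennreal (indicator {-2..2} y * indicator {-2..2} x * g (Complex (- y) x)) \<partial>lborel \<partial>lborel)"
    by (simp add: sq_int_def e)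
  also have "\<dots> = (\<integral>\<^sup>+y. \<integral>\<^sup>+x. ennreal (indicator {-2..2} (- y) * indicator {-2..2} x * g (Complex y x)) \<partial>lborel \<partial>lborel)"
    by (subst nn_integral_real_affine[where c = "-1" and t = 0]) simp_all
  also have "\<dots> = (\<integral>\<^sup>+y. \<integral>\<^sup>+x. ennreal (indicator {-2..2} x * indicator {-2..2} y * g (Complex y x)) \<partial>lborel \<partial>lborel)"
    by (intro nn_integral_cong) (auto split: split_indicator)
  also have "\<dots> = sq_int g"
    unfolding sq_int_def by (rule lborel_pair.Fubini') measurable
  finally show ?thesis .
qed

text \<open>The points (- s + 2 s t, - s) fill a trapezoid at the bottom of the square. The
  substitution x = - s + 2 s t has derivative 2 s >= 2, which absorbs the factor 2.\<close>

lemma nn_integral_side: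
  assumes g [measurable]: "g \<in> borel_measurable borel" and g0: "\<And>w. g w \<ge> 0"
  shows "(\<integral>\<^sup>+s. \<integral>\<^sup>+t. ennreal (indicator {1..2} s * indicator {0..1} t * (2 * g (Complex (- s + 2 * s * t) (- s)))) \<partial>lborel \<partial>lborel)
    \<le> sq_int g"
proof -
  have "(\<integral>\<^sup>+t. ennreal (indicator {1..2} s * indicator {0..1} t * (2 * g (Complex (- s + 2 * s * t) (- s)))) \<partial>lborel)
     \<le> (\<integral>\<^sup>+x. ennreal (indicator {-2..2} (- s) * indicator {-2..2} x * g (Complex x (- s))) \<partial>lborel)" for s
  proof (cases "s \<in> {1..2}")
    case True
    hence s: "1 \<le> s" "s \<le> 2" by auto
    have "(\<integral>\<^sup>+t. ennreal (indicator {1..2} s * indicator {0..1} t * (2 * g (Complex (- s + 2 * s * t) (- s)))) \<partial>lborel)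
       \<le> (\<integral>\<^sup>+t. ennreal \<bar>2 * s\<bar> * ennreal (indicator {-s..s} (- s + (2 * s) * t) * g (Complex (- s + (2 * s) * t) (- s))) \<partial>lborel)"
    proof (rule nn_integral_mono)
      fix t :: real
      have "indicator {1..2} s * indicator {0..1} t * (2 * g (Complex (- s + 2 * s * t) (- s)))
         \<le> \<bar>2 * s\<bar> * (indicator {-s..s} (- s + (2 * s) * t) * g (Complex (- s + (2 * s) * t) (- s)))"
      proof (cases "t \<in> {0..1}")
        case True
        hence "-s \<le> - s + (2 * s) * t" "- s + (2 * s) * t \<le> s" using s mult_left_le[of t "2 * s"] by auto
        moreover have "2 * g (Complex (- s + (2 * s) * t) (- s)) \<le> (2 * s) * g (Complex (- s + (2 * s) * t) (- s))"
          using s g0 by (intro mult_right_mono) auto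
        ultimately show ?thesis using True s by simp
      qed (use g0 s in auto)
      thus "ennreal (indicator {1..2} s * indicator {0..1} t * (2 * g (Complex (- s + 2 * s * t) (- s))))
         \<le> ennreal \<bar>2 * s\<bar> * ennreal (indicator {-s..s} (- s + (2 * s) * t) * g (Complex (- s + (2 * s) * t) (- s)))"
        using g0 by (simp add: ennreal_mult[symmetric] ennreal_leI)
    qed
    also have "\<dots> = ennreal \<bar>2 * s\<bar> * (\<integral>\<^sup>+t. ennreal (indicator {-s..s} (- s + (2 * s) * t) * g (Complex (- s + (2 * s) * t) (- s))) \<partial>lborel)"
      by (rule nn_integral_cmult) measurable
    also have "\<dots> = (\<integral>\<^sup>+x. ennreal (indicator {-s..s} x * g (Complex x (- s))) \<partial>lborel)"
      using s by (intro nn_integral_real_affine[symmetric]) auto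
    also have "\<dots> \<le> (\<integral>\<^sup>+x. ennreal (indicator {-2..2} (- s) * indicator {-2..2} x * g (Complex x (- s))) \<partial>lborel)"
      using s g0 by (intro nn_integral_mono ennreal_leI) (auto split: split_indicator)
    finally show ?thesis .
  qed simp
  hence "(\<integral>\<^sup>+s. \<integral>\<^sup>+t. ennreal (indicator {1..2} s * indicator {0..1} t * (2 * g (Complex (- s + 2 * s * t) (- s)))) \<partial>lborel \<partial>lborel)
     \<le> (\<integral>\<^sup>+s. \<integral>\<^sup>+x. ennreal (indicator {-2..2} (- s) * indicator {-2..2} x * g (Complex x (- s))) \<partial>lborel \<partial>lborel)"
    by (rule nn_integral_mono)
  also have "\<dots> = sq_int g"
    unfolding sq_int_def by (subst nn_integral_real_affine[where c = "-1" and t = 0]) simp_all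
  finally show ?thesis .
qed

text \<open>Cauchy's formula on the boundary of the square of half side s. Its sides are the images
  of the bottom one under multiplication by i^k; on each of them |w| >= s and the length is 2 s, so
  |dw / w| is at most 2 dt.\<close>

lemma cauchy_square:
  assumes hol: "f holomorphic_on UNIV" and s: "s \<ge> 1"
  shows "2 * pi * cmod (f 0) \<le> (\<Sum>k<4. integral {0..1} (\<lambda>t. 2 * cmod (f (\<i> ^ k * Complex (- s + 2 * s * t) (- s)))))"
proof -
  define a where "a = Complex (- s) (- s)"
  define l where "l t = Complex (- s + 2 * s * t) (- s)" for t
  have cont: "continuous_on S f" for S using hol holomorphic_on_imp_continuous_on holomorphic_on_subset by blast
  define g where "g w = f w / (w - 0)" for w
  have lp: "linepath (\<i> ^ k * a) (\<i> ^ Suc k * a) t = \<i> ^ k * l t" for k t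
  proof -
    have "linepath a (\<i> * a) t = l t" by (simp add: linepath_def a_def l_def complex_eq_iff algebra_simps)
    moreover have "linepath (\<i> ^ k * a) (\<i> ^ Suc k * a) t = \<i> ^ k * linepath a (\<i> * a) t"
      by (simp add: linepath_def scaleR_conv_of_real algebra_simps)
    ultimately show ?thesis by simp
  qed
  have lbig: "s \<le> cmod (\<i> ^ k * l t)" for k t
    using abs_Im_le_cmod[of "l t"] s by (simp add: norm_mult norm_power l_def)
  have seg0: "w \<noteq> 0" if w: "w \<in> closed_segment (\<i> ^ k * a) (\<i> ^ Suc k * a)" for w k
  proof -
    obtain t where "w = linepath (\<i> ^ k * a) (\<i> ^ Suc k * a) t" using w by (auto simp: linepath_image_01[symmetric])
    thus ?thesis using lbig[of k t] s unfolding lp by auto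
  qed
  have gc: "continuous_on (closed_segment (\<i> ^ k * a) (\<i> ^ Suc k * a)) g" for k
    unfolding g_def by (intro continuous_intros cont) (use seg0 in auto)
  have ig: "g contour_integrable_on linepath (\<i> ^ k * a) (\<i> ^ Suc k * a)" for k
    by (rule contour_integrable_continuous_linepath[OF gc])
  have bound: "cmod (contour_integral (linepath (\<i> ^ k * a) (\<i> ^ Suc k * a)) g) \<le> integral {0..1} (\<lambda>t. 2 * cmod (f (\<i> ^ k * l t)))" for k
  proof -
    have "contour_integral (linepath (\<i> ^ k * a) (\<i> ^ Suc k * a)) g
      = integral {0..1} (\<lambda>t. g (linepath (\<i> ^ k * a) (\<i> ^ Suc k * a) t) * (\<i> ^ Suc k * a - \<i> ^ k * a))"
      by (simp add: contour_integral_integral)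
    also have "cmod \<dots> \<le> integral {0..1} (\<lambda>t. 2 * cmod (f (\<i> ^ k * l t)))"
    proof (rule integral_norm_bound_integral)
      show "(\<lambda>t. g (linepath (\<i> ^ k * a) (\<i> ^ Suc k * a) t) * (\<i> ^ Suc k * a - \<i> ^ k * a)) integrable_on {0..1}"
        using ig[of k] unfolding contour_integrable_on has_contour_integral_linepath
        by (auto simp: integrable_on_def)
      have "continuous_on {0..1} (\<lambda>t. 2 * cmod (f (\<i> ^ k * l t)))"
        unfolding l_def Complex_eq by (intro continuous_intros continuous_on_compose2[OF cont]) auto
      thus "(\<lambda>t. 2 * cmod (f (\<i> ^ k * l t))) integrable_on {0..1}" by (rule integrable_continuous_real)
      fix t :: real assume "t \<in> {0..1}"
      have "\<i> ^ Suc k * a - \<i> ^ k * a = \<i> ^ k * of_real (2 * s)"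
        by (simp add: a_def complex_eq_iff algebra_simps)
      hence "cmod (\<i> ^ Suc k * a - \<i> ^ k * a) = 2 * s" using s by (simp only: norm_mult norm_power) simp
      hence "cmod (g (linepath (\<i> ^ k * a) (\<i> ^ Suc k * a) t) * (\<i> ^ Suc k * a - \<i> ^ k * a)) = cmod (f (\<i> ^ k * l t)) / cmod (\<i> ^ k * l t) * (2 * s)"
        unfolding lp g_def by (simp only: norm_mult norm_divide diff_zero)
      also have "\<dots> \<le> cmod (f (\<i> ^ k * l t)) / s * (2 * s)"
        using lbig[of k t] s by (intro mult_right_mono divide_left_mono mult_pos_pos) auto
      finally show "norm (g (linepath (\<i> ^ k * a) (\<i> ^ Suc k * a) t) * (\<i> ^ Suc k * a - \<i> ^ k * a)) \<le> 2 * cmod (f (\<i> ^ k * l t))"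
        using s by simp
    qed
    finally show ?thesis .
  qed
  have corners: "Complex s (- s) = \<i> ^ 1 * a" "Complex s s = \<i> ^ 2 * a" "Complex (- s) s = \<i> ^ 3 * a" "a = \<i> ^ 4 * a"
    by (simp_all add: a_def complex_eq_iff power3_eq_cube power4_eq_xxxx power2_eq_square)
  have rp: "rectpath a (\<i> ^ 2 * a) = linepath (\<i> ^ 0 * a) (\<i> ^ Suc 0 * a) +++ linepath (\<i> ^ 1 * a) (\<i> ^ Suc 1 * a)
     +++ linepath (\<i> ^ 2 * a) (\<i> ^ Suc 2 * a) +++ linepath (\<i> ^ 3 * a) (\<i> ^ Suc 3 * a)"
  proof -
    have "Complex (Re (\<i> ^ 2 * a)) (Im a) = \<i> ^ 1 * a" "Complex (Re a) (Im (\<i> ^ 2 * a)) = \<i> ^ 3 * a"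
      by (simp_all add: a_def complex_eq_iff power3_eq_cube power2_eq_square)
    thus ?thesis unfolding rectpath_def Let_def using corners(4) by (simp add: numeral_eq_Suc)
  qed
  have "(g has_contour_integral (2 * pi * \<i> * winding_number (rectpath a (\<i> ^ 2 * a)) 0 * f 0)) (rectpath a (\<i> ^ 2 * a))"
    unfolding g_def
  proof (rule Cauchy_integral_formula_convex_simple[OF convex_UNIV hol])
    have "0 \<notin> path_image (rectpath a (\<i> ^ 2 * a))"
      unfolding corners(2)[symmetric] using s
      by (subst path_image_rectpath_cbox_minus_box) (auto simp: a_def in_box_complex_iff)
    thus "path_image (rectpath a (\<i> ^ 2 * a)) \<subseteq> UNIV - {0}" by auto
  qed auto
  moreover have "winding_number (rectpath a (\<i> ^ 2 * a)) 0 = 1"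
    unfolding corners(2)[symmetric] using s by (intro winding_number_rectpath) (auto simp: a_def in_box_complex_iff)
  ultimately have "2 * pi * \<i> * f 0 = contour_integral (rectpath a (\<i> ^ 2 * a)) g"
    by (simp add: contour_integral_unique)
  also have "\<dots> = (\<Sum>k<4. contour_integral (linepath (\<i> ^ k * a) (\<i> ^ Suc k * a)) g)"
    unfolding rp using ig[of 0] ig[of 1] ig[of 2] ig[of 3]
    by (simp add: numeral_eq_Suc valid_path_join contour_integrable_joinI)
  finally have "cmod (2 * pi * \<i> * f 0) \<le> (\<Sum>k<4. integral {0..1} (\<lambda>t. 2 * cmod (f (\<i> ^ k * l t))))"
    using bound by (simp only:) (intro sum_norm_le)
  thus ?thesis by (simp add: norm_mult l_def)
qed

text \<open>Integrating \<open>cauchy_square\<close> over s between 1 and 2 turns each side into an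
  area integral bounded by \<open>sq_int\<close>. The four sides are compensated by 4 <= 2
  pi.\<close>

lemma mean_value_square:
  assumes hol: "f holomorphic_on UNIV"
  shows "ennreal (cmod (f 0)) \<le> sq_int (\<lambda>w. cmod (f w))"
proof -
  have cont: "continuous_on S f" for S using hol holomorphic_on_imp_continuous_on holomorphic_on_subset by blast
  have [measurable]: "f \<in> borel_measurable borel" by (rule borel_measurable_continuous_onI[OF cont])
  have nnI: "ennreal (integral {0..1} h) = (\<integral>\<^sup>+t. ennreal (indicator {0..1} t * h t) \<partial>lborel)"
    if "continuous_on UNIV h" "\<And>t. h t \<ge> 0" for h :: "real \<Rightarrow> real"
  proof -
    have [measurable]: "h \<in> borel_measurable borel" by (rule borel_measurable_continuous_onI[OF that(1)])
    have "(h has_integral integral {0..1} h) {0..1}"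
      by (intro integrable_integral integrable_continuous_real continuous_on_subset[OF that(1)]) auto
    hence "((\<lambda>t. if t \<in> {0..1} then h t else 0) has_integral integral {0..1} h) UNIV"
      by (simp only: has_integral_restrict_UNIV)
    moreover have "(\<lambda>t. if t \<in> {0..1} then h t else 0) = (\<lambda>t. indicator {0..1} t * h t)" by (auto simp: indicator_def)
    ultimately show ?thesis
      using nn_integral_has_integral_lborel[of "\<lambda>t. indicator {0..1} t * h t"] that(2) by (simp add: indicator_def)
  qed
  let ?g = "\<lambda>k w. cmod (f (\<i> ^ k * w))"
  let ?S = "\<lambda>k s. \<integral>\<^sup>+t. ennreal (indicator {1..2} s * indicator {0..1} t * (2 * ?g k (Complex (- s + 2 * s * t) (- s)))) \<partial>lborel"
  have pt: "ennreal (2 * pi * cmod (f 0)) * indicator {1..2} s \<le> (\<Sum>k<4. ?S k s)" for s :: real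
  proof (cases "s \<in> {1..2}")
    case True
    have "ennreal (2 * pi * cmod (f 0)) \<le> ennreal (\<Sum>k<4. integral {0..1} (\<lambda>t. 2 * ?g k (Complex (- s + 2 * s * t) (- s))))"
      using True by (intro ennreal_leI cauchy_square[OF hol]) auto
    also have "\<dots> = (\<Sum>k<4. ennreal (integral {0..1} (\<lambda>t. 2 * ?g k (Complex (- s + 2 * s * t) (- s)))))"
      by (intro sum_ennreal[symmetric] Henstock_Kurzweil_Integration.integral_nonneg integrable_continuous_real)
        (auto simp: Complex_eq intro!: continuous_intros continuous_on_compose2[OF cont])
    also have "\<dots> = (\<Sum>k<4. ?S k s)"
      using True by (intro sum.cong refl) (subst nnI, auto simp: Complex_eq intro!: continuous_intros continuous_on_compose2[OF cont])
    finally show ?thesis using True by simp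
  qed simp
  have "ennreal (2 * pi * cmod (f 0)) = (\<integral>\<^sup>+s. ennreal (2 * pi * cmod (f 0)) * indicator {1..2::real} s \<partial>lborel)"
    by (subst nn_integral_cmult) auto
  also have "\<dots> \<le> (\<integral>\<^sup>+s. (\<Sum>k<4. ?S k s) \<partial>lborel)" by (intro nn_integral_mono pt)
  also have "\<dots> = (\<Sum>k<4. \<integral>\<^sup>+s. ?S k s \<partial>lborel)" by (rule nn_integral_sum) measurable
  also have "\<dots> \<le> (\<Sum>k<(4::nat). sq_int (\<lambda>w. cmod (f w)))"
  proof (rule sum_mono)
    fix k :: nat
    have "(\<integral>\<^sup>+s. ?S k s \<partial>lborel) \<le> sq_int (?g k)" by (rule nn_integral_side) auto
    also have "\<dots> = sq_int (\<lambda>w. cmod (f w))"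
    proof (induction k)
      case (Suc k)
      have "(\<lambda>w. cmod (f (\<i> ^ Suc k * w))) = (\<lambda>w. ?g k (\<i> * w))" by (simp add: mult_ac)
      thus ?case using sq_int_rotate[of "?g k"] Suc by simp
    qed simp
    finally show "(\<integral>\<^sup>+s. ?S k s \<partial>lborel) \<le> sq_int (\<lambda>w. cmod (f w))" .
  qed
  also have "\<dots> = 4 * sq_int (\<lambda>w. cmod (f w))" by simp
  finally have "ennreal (2 * pi * cmod (f 0)) \<le> 4 * sq_int (\<lambda>w. cmod (f w))" .
  moreover have "4 * ennreal (cmod (f 0)) \<le> ennreal (2 * pi * cmod (f 0))"
  proof -
    have "4 * cmod (f 0) \<le> 2 * pi * cmod (f 0)" using pi_ge_two by (intro mult_right_mono) auto
    from ennreal_leI[OF this] show ?thesis by (simp add: ennreal_mult)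
  qed
  ultimately have "4 * ennreal (cmod (f 0)) \<le> 4 * sq_int (\<lambda>w. cmod (f w))" by (rule order_trans[rotated])
  thus ?thesis by (subst (asm) ennreal_mult_le_mult_iff) auto
qed

subsection \<open>The space \<open>\<AA>(\<real>\<^sup>2)\<close>\<close>

definition strip_norm :: "(c2 \<Rightarrow> complex) \<Rightarrow> real \<Rightarrow> real \<Rightarrow> real \<Rightarrow> real \<Rightarrow> ennreal" where
  "strip_norm A \<mu>1 \<mu>2 y1 y2 = (\<integral>\<^sup>+ (x1, x2). ennreal ((cmod (A (Complex x1 y1, Complex x2 y2)))\<^sup>2
          * exp (4 * pi * (\<mu>1 * \<bar>x1\<bar> + \<mu>2 * \<bar>x2\<bar>))) \<partial>lborel)"

lemma entire2_measurable [measurable_dest]: "entire2 A \<Longrightarrow> A \<in> borel_measurable (borel \<Otimes>\<^sub>M borel)"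
  unfolding borel_prod by (rule borel_measurable_continuous_onI[OF entire2_continuous])

lemma strip_norm_iterated:
  assumes "entire2 A"
  shows "strip_norm A \<mu>1 \<mu>2 y1 y2 = (\<integral>\<^sup>+x1. \<integral>\<^sup>+x2. ennreal ((cmod (A (Complex x1 y1, Complex x2 y2)))\<^sup>2
          * exp (4 * pi * (\<mu>1 * \<bar>x1\<bar> + \<mu>2 * \<bar>x2\<bar>))) \<partial>lborel \<partial>lborel)"
proof -
  note [measurable] = entire2_measurable[OF assms]
  have "(\<lambda>(x1, x2). ennreal ((cmod (A (Complex x1 y1, Complex x2 y2)))\<^sup>2
          * exp (4 * pi * (\<mu>1 * \<bar>x1\<bar> + \<mu>2 * \<bar>x2\<bar>)))) \<in> borel_measurable (lborel \<Otimes>\<^sub>M lborel)"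
    by measurable
  from lborel.nn_integral_fst[OF this] show ?thesis by (simp add: strip_norm_def lborel_prod)
qed

lemma nn_integral_translate:
  fixes f :: "real \<Rightarrow> ennreal"
  assumes "f \<in> borel_measurable borel" shows "(\<integral>\<^sup>+x. f (t + x) \<partial>lborel) = (\<integral>\<^sup>+x. f x \<partial>lborel)"
  using nn_integral_real_affine[OF assms, of 1 t] by simp

text \<open>Inside the square each real part moves by at most 2, so the weight in the strip norm is
  at least exp (4 pi \<mu> (rnorm - 4)) there.\<close>

lemma square_strip_bound:
  assumes A: "entire2 A" and \<mu>: "\<mu> > 0"
  shows "(\<integral>\<^sup>+x1. \<integral>\<^sup>+x2. ennreal (indicator {-2..2} x1 * indicator {-2..2} x2 * (cmod (A (z1 + Complex x1 y1, z2 + Complex x2 y2)))\<^sup>2) \<partial>lborel \<partial>lborel)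
    \<le> ennreal (exp (- (4 * pi * \<mu> * (rnorm (z1, z2) - 4)))) * strip_norm A \<mu> \<mu> (Im z1 + y1) (Im z2 + y2)"
proof -
  note [measurable] = entire2_measurable[OF A]
  let ?c = "exp (- (4 * pi * \<mu> * (rnorm (z1, z2) - 4)))"
  let ?F = "\<lambda>x1 x2. ennreal ((cmod (A (Complex x1 (Im z1 + y1), Complex x2 (Im z2 + y2))))\<^sup>2 * exp (4 * pi * (\<mu> * \<bar>x1\<bar> + \<mu> * \<bar>x2\<bar>)))"
  have e: "z1 + Complex x1 y1 = Complex (Re z1 + x1) (Im z1 + y1)" "z2 + Complex x2 y2 = Complex (Re z2 + x2) (Im z2 + y2)" for x1 x2
    by (simp_all add: complex_eq_iff)
  have pt: "ennreal (indicator {-2..2} x1 * indicator {-2..2} x2 * (cmod (A (z1 + Complex x1 y1, z2 + Complex x2 y2)))\<^sup>2)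
     \<le> ennreal ?c * ?F (Re z1 + x1) (Re z2 + x2)" for x1 x2
  proof (cases "x1 \<in> {-2..2} \<and> x2 \<in> {-2..2}")
    case True
    have "0 \<le> (4 * pi * \<mu>) * (\<bar>Re z1 + x1\<bar> + \<bar>Re z2 + x2\<bar> - (rnorm (z1, z2) - 4))"
      using True \<mu> by (intro mult_nonneg_nonneg) (auto simp: rnorm_def)
    hence "1 \<le> exp (- (4 * pi * \<mu> * (rnorm (z1, z2) - 4)) + 4 * pi * (\<mu> * \<bar>Re z1 + x1\<bar> + \<mu> * \<bar>Re z2 + x2\<bar>))"
      by (simp add: algebra_simps)
    hence "1 \<le> ?c * exp (4 * pi * (\<mu> * \<bar>Re z1 + x1\<bar> + \<mu> * \<bar>Re z2 + x2\<bar>))" by (simp only: exp_add)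
    from mult_left_mono[OF this, of "(cmod (A (z1 + Complex x1 y1, z2 + Complex x2 y2)))\<^sup>2"] show ?thesis
      using True unfolding e by (subst ennreal_mult[symmetric]) (auto intro!: ennreal_leI simp: mult_ac)
  qed auto
  have "(\<integral>\<^sup>+x1. \<integral>\<^sup>+x2. ennreal (indicator {-2..2} x1 * indicator {-2..2} x2 * (cmod (A (z1 + Complex x1 y1, z2 + Complex x2 y2)))\<^sup>2) \<partial>lborel \<partial>lborel)
    \<le> (\<integral>\<^sup>+x1. \<integral>\<^sup>+x2. ennreal ?c * ?F (Re z1 + x1) (Re z2 + x2) \<partial>lborel \<partial>lborel)"
    by (intro nn_integral_mono pt)
  also have "\<dots> = ennreal ?c * (\<integral>\<^sup>+x1. \<integral>\<^sup>+x2. ?F (Re z1 + x1) (Re z2 + x2) \<partial>lborel \<partial>lborel)"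
    by (simp add: nn_integral_cmult)
  also have "(\<integral>\<^sup>+x1. \<integral>\<^sup>+x2. ?F (Re z1 + x1) (Re z2 + x2) \<partial>lborel \<partial>lborel) = (\<integral>\<^sup>+x1. \<integral>\<^sup>+x2. ?F (Re z1 + x1) x2 \<partial>lborel \<partial>lborel)"
    by (intro nn_integral_cong nn_integral_translate) measurable
  also have "\<dots> = (\<integral>\<^sup>+x1. \<integral>\<^sup>+x2. ?F x1 x2 \<partial>lborel \<partial>lborel)"
    by (rule nn_integral_translate) measurable
  finally show ?thesis by (simp add: strip_norm_iterated[OF A])
qed

text \<open>The inequality is applied to the square of A, which is holomorphic, in one variable
  after the other. The integrations over heights are then moved outside, so that the inner integrals
  run along horizontal lines.\<close>

lemma mean_value_square2:
  assumes A: "entire2 A"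
  shows "ennreal ((cmod (A (z1, z2)))\<^sup>2) \<le> (\<integral>\<^sup>+y1. \<integral>\<^sup>+y2. ennreal (indicator {-2..2} y1 * indicator {-2..2} y2) *
    (\<integral>\<^sup>+x1. \<integral>\<^sup>+x2. ennreal (indicator {-2..2} x1 * indicator {-2..2} x2 * (cmod (A (z1 + Complex x1 y1, z2 + Complex x2 y2)))\<^sup>2) \<partial>lborel \<partial>lborel) \<partial>lborel \<partial>lborel)"
proof -
  note [measurable] = entire2_measurable[OF A]
  let ?i = "indicator {-2..2} :: real \<Rightarrow> real"
  let ?G = "\<lambda>y1 x1 y2 x2. ennreal (?i y1 * ?i y2 * (?i x1 * ?i x2 * (cmod (A (z1 + Complex x1 y1, z2 + Complex x2 y2)))\<^sup>2))"
  have h2: "ennreal ((cmod (A (w, z2)))\<^sup>2) \<le> sq_int (\<lambda>v. (cmod (A (w, z2 + v)))\<^sup>2)" for w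
  proof -
    have "(\<lambda>v. (A (w, z2 + v))\<^sup>2) holomorphic_on UNIV"
      using entire2_holomorphic(2)[OF entire2_shift[OF A, of "(0, z2)"], of w UNIV]
      by (intro holomorphic_intros) (simp add: add.commute)
    from mean_value_square[OF this] show ?thesis by (simp add: norm_power)
  qed
  have h1: "ennreal ((cmod (A (z1, z2)))\<^sup>2) \<le> sq_int (\<lambda>w. (cmod (A (z1 + w, z2)))\<^sup>2)"
  proof -
    have "(\<lambda>v. (A (z1 + v, z2))\<^sup>2) holomorphic_on UNIV"
      using entire2_holomorphic(1)[OF entire2_shift[OF A, of "(z1, 0)"], of z2 UNIV]
      by (intro holomorphic_intros) (simp add: add.commute)
    from mean_value_square[OF this] show ?thesis by (simp add: norm_power)
  qed
  note h1
  also have "sq_int (\<lambda>w. (cmod (A (z1 + w, z2)))\<^sup>2) \<le> (\<integral>\<^sup>+y1. \<integral>\<^sup>+x1. \<integral>\<^sup>+y2. \<integral>\<^sup>+x2. ?G y1 x1 y2 x2 \<partial>lborel \<partial>lborel \<partial>lborel \<partial>lborel)"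
    unfolding sq_int_def
  proof (intro nn_integral_mono)
    fix y1 x1 :: real
    have "ennreal (?i y1 * ?i x1 * (cmod (A (z1 + Complex x1 y1, z2)))\<^sup>2) = ennreal (?i y1 * ?i x1) * ennreal ((cmod (A (z1 + Complex x1 y1, z2)))\<^sup>2)"
      by (rule ennreal_mult) auto
    also have "\<dots> \<le> ennreal (?i y1 * ?i x1) * sq_int (\<lambda>v. (cmod (A (z1 + Complex x1 y1, z2 + v)))\<^sup>2)"
      by (intro mult_left_mono h2) auto
    also have "\<dots> = (\<integral>\<^sup>+y2. \<integral>\<^sup>+x2. ennreal (?i y1 * ?i x1) * ennreal (?i y2 * ?i x2 * (cmod (A (z1 + Complex x1 y1, z2 + Complex x2 y2)))\<^sup>2) \<partial>lborel \<partial>lborel)"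
      unfolding sq_int_def by (simp add: nn_integral_cmult)
    also have "\<dots> = (\<integral>\<^sup>+y2. \<integral>\<^sup>+x2. ?G y1 x1 y2 x2 \<partial>lborel \<partial>lborel)"
      by (intro nn_integral_cong) (simp add: ennreal_mult[symmetric] mult_ac)
    finally show "ennreal (?i y1 * ?i x1 * (cmod (A (z1 + Complex x1 y1, z2)))\<^sup>2) \<le> (\<integral>\<^sup>+y2. \<integral>\<^sup>+x2. ?G y1 x1 y2 x2 \<partial>lborel \<partial>lborel)" .
  qed
  also have "\<dots> = (\<integral>\<^sup>+y1. \<integral>\<^sup>+y2. \<integral>\<^sup>+x1. \<integral>\<^sup>+x2. ?G y1 x1 y2 x2 \<partial>lborel \<partial>lborel \<partial>lborel \<partial>lborel)"
    by (intro nn_integral_cong lborel_pair.Fubini'[symmetric]) measurable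
  also have "\<dots> = (\<integral>\<^sup>+y1. \<integral>\<^sup>+y2. ennreal (?i y1 * ?i y2) *
    (\<integral>\<^sup>+x1. \<integral>\<^sup>+x2. ennreal (?i x1 * ?i x2 * (cmod (A (z1 + Complex x1 y1, z2 + Complex x2 y2)))\<^sup>2) \<partial>lborel \<partial>lborel) \<partial>lborel \<partial>lborel)"
    by (simp add: ennreal_mult nn_integral_cmult)
  finally show ?thesis .
qed

lemma rapid_if_strip_bounded:
  assumes A: "entire2 A"
    and S: "\<And>\<mu> \<nu>. \<mu> > 0 \<Longrightarrow> \<nu> > 0 \<Longrightarrow> \<exists>B. \<forall>y1 y2. \<bar>y1\<bar> < \<nu> \<longrightarrow> \<bar>y2\<bar> < \<nu> \<longrightarrow> strip_norm A \<mu> \<mu> y1 y2 \<le> ennreal B"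
  shows "rapid A"
proof (rule rapidI[OF A])
  fix \<mu> \<nu> :: real assume \<mu>: "\<mu> > 0" and \<nu>: "\<nu> > 0"
  \<comment> \<open>The squares have half side 2, so heights up to \<nu> + 2 occur; 3 keeps the
    inequalities strict.\<close>
  obtain B0 where B0: "\<And>y1 y2. \<bar>y1\<bar> < \<nu> + 3 \<Longrightarrow> \<bar>y2\<bar> < \<nu> + 3 \<Longrightarrow> strip_norm A \<mu> \<mu> y1 y2 \<le> ennreal B0"
    using S[OF \<mu>, of "\<nu> + 3"] \<nu> by auto
  define B where "B = max B0 0"
  have B: "strip_norm A \<mu> \<mu> y1 y2 \<le> ennreal B" if "\<bar>y1\<bar> < \<nu> + 3" "\<bar>y2\<bar> < \<nu> + 3" for y1 y2
    using B0[OF that] by (rule order_trans) (auto simp: B_def intro!: ennreal_leI)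
  \<comment> \<open>16 is the area of the square of heights (y1, y2), and exp (16 pi \<mu>) comes
    from the 4 in \<open>square_strip_bound\<close>.\<close>
  have "cmod (A z) \<le> sqrt (16 * exp (16 * pi * \<mu>) * B) * exp (- \<mu> * rnorm z)" if "in_strip \<nu> z" for z
  proof -
    obtain z1 z2 where z: "z = (z1, z2)" by (cases z)
    let ?i = "indicator {-2..2} :: real \<Rightarrow> real"
    let ?c = "exp (- (4 * pi * \<mu> * (rnorm (z1, z2) - 4)))"
    have "ennreal ((cmod (A (z1, z2)))\<^sup>2) \<le> (\<integral>\<^sup>+y1. \<integral>\<^sup>+y2. ennreal (?i y1 * ?i y2) *
      (\<integral>\<^sup>+x1. \<integral>\<^sup>+x2. ennreal (?i x1 * ?i x2 * (cmod (A (z1 + Complex x1 y1, z2 + Complex x2 y2)))\<^sup>2) \<partial>lborel \<partial>lborel) \<partial>lborel \<partial>lborel)"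
      by (rule mean_value_square2[OF A])
    also have "\<dots> \<le> (\<integral>\<^sup>+y1. \<integral>\<^sup>+y2. ennreal (?i y1) * (ennreal (?i y2) * (ennreal ?c * ennreal B)) \<partial>lborel \<partial>lborel)"
    proof (intro nn_integral_mono)
      fix y1 y2 :: real
      let ?I = "\<integral>\<^sup>+x1. \<integral>\<^sup>+x2. ennreal (?i x1 * ?i x2 * (cmod (A (z1 + Complex x1 y1, z2 + Complex x2 y2)))\<^sup>2) \<partial>lborel \<partial>lborel"
      show "ennreal (?i y1 * ?i y2) * ?I \<le> ennreal (?i y1) * (ennreal (?i y2) * (ennreal ?c * ennreal B))"
      proof (cases "y1 \<in> {-2..2} \<and> y2 \<in> {-2..2}")
        case True
        have "?I \<le> ennreal ?c * strip_norm A \<mu> \<mu> (Im z1 + y1) (Im z2 + y2)" by (rule square_strip_bound[OF A \<mu>])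
        also have "\<dots> \<le> ennreal ?c * ennreal B"
          using True \<open>in_strip \<nu> z\<close> by (intro mult_left_mono B) (auto simp: z in_strip_def)
        finally show ?thesis using True by simp
      qed auto
    qed
    also have "\<dots> = 4 * (4 * (ennreal ?c * ennreal B))"
    proof -
      have "(\<integral>\<^sup>+y. ennreal (?i y) * K \<partial>lborel) = 4 * K" for K
        by (subst nn_integral_multc) (auto simp: ennreal_indicator)
      thus ?thesis by (simp add: nn_integral_cmult)
    qed
    also have "\<dots> = ennreal (16 * ?c * B)"
      by (simp add: ennreal_mult B_def mult.assoc[symmetric])
    finally have "(cmod (A z))\<^sup>2 \<le> 16 * ?c * B" by (simp add: z B_def)
    also have "\<dots> = (16 * exp (16 * pi * \<mu>) * B) * exp (- (4 * pi * \<mu> * rnorm z))"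
      by (simp add: z exp_add[symmetric] algebra_simps)
    also have "\<dots> \<le> (16 * exp (16 * pi * \<mu>) * B) * exp (- (2 * (\<mu> * rnorm z)))"
    proof -
      have "2 * (\<mu> * rnorm z) \<le> (4 * pi) * (\<mu> * rnorm z)"
        using \<mu> pi_ge_two by (intro mult_right_mono) auto
      thus ?thesis by (intro mult_left_mono) (auto simp: B_def mult.assoc)
    qed
    also have "\<dots> = (sqrt (16 * exp (16 * pi * \<mu>) * B) * exp (- \<mu> * rnorm z))\<^sup>2"
    proof -
      have "(sqrt (16 * exp (16 * pi * \<mu>) * B))\<^sup>2 = 16 * exp (16 * pi * \<mu>) * B" by (simp add: B_def)
      moreover have "(exp (- \<mu> * rnorm z))\<^sup>2 = exp (- (2 * (\<mu> * rnorm z)))"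
        by (simp add: power2_eq_square exp_add[symmetric])
      ultimately show ?thesis by (simp only: power_mult_distrib)
    qed
    finally show ?thesis by (rule power2_le_imp_le) (simp add: B_def)
  qed
  thus "\<exists>C. \<forall>z. in_strip \<nu> z \<longrightarrow> cmod (A z) \<le> C * exp (- \<mu> * rnorm z)" by blast
qed

lemma rapid_strip_bounded:
  assumes A: "rapid A"
  shows "\<exists>B. \<forall>y1 y2. \<bar>y1\<bar> < \<nu>1 \<longrightarrow> \<bar>y2\<bar> < \<nu>2 \<longrightarrow> strip_norm A \<mu>1 \<mu>2 y1 y2 \<le> ennreal B"
proof -
  define \<mu> where "\<mu> = \<bar>\<mu>1\<bar> + \<bar>\<mu>2\<bar>"
  \<comment> \<open>Squaring doubles the rate to 4 pi \<mu> + 2; the weight uses up 4 pi \<mu>, and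
    an integrable exponential remains.\<close>
  obtain C where C: "C > 0" "\<And>z. in_strip (\<bar>\<nu>1\<bar> + \<bar>\<nu>2\<bar>) z \<Longrightarrow> cmod (A z) \<le> C * exp (- (2 * pi * \<mu> + 1) * rnorm z)"
    using rapidE[OF A, of "\<bar>\<nu>1\<bar> + \<bar>\<nu>2\<bar>" "2 * pi * \<mu> + 1"] by metis
  have "strip_norm A \<mu>1 \<mu>2 y1 y2 \<le> ennreal (\<integral>x. C\<^sup>2 * exp (- (\<bar>fst x\<bar> + \<bar>snd x\<bar>)) \<partial>lborel)" if y: "\<bar>y1\<bar> < \<nu>1" "\<bar>y2\<bar> < \<nu>2" for y1 y2
  proof -
    have "strip_norm A \<mu>1 \<mu>2 y1 y2 \<le> (\<integral>\<^sup>+x. ennreal (C\<^sup>2 * exp (- (\<bar>fst x\<bar> + \<bar>snd x\<bar>))) \<partial>lborel)"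
      unfolding strip_norm_def case_prod_unfold
    proof (intro nn_integral_mono ennreal_leI)
      fix x :: "real \<times> real"
      let ?z = "(Complex (fst x) y1, Complex (snd x) y2)"
      define r where "r = \<bar>fst x\<bar> + \<bar>snd x\<bar>"
      have "cmod (A ?z) \<le> C * exp (- (2 * pi * \<mu> + 1) * r)"
      proof -
        have "in_strip (\<bar>\<nu>1\<bar> + \<bar>\<nu>2\<bar>) ?z" using y by (auto simp: in_strip_def)
        from C(2)[OF this] show ?thesis by (simp add: rnorm_def r_def)
      qed
      hence "(cmod (A ?z))\<^sup>2 \<le> (C * exp (- (2 * pi * \<mu> + 1) * r))\<^sup>2" by (rule power_mono) simp
      moreover have "exp (4 * pi * (\<mu>1 * \<bar>fst x\<bar> + \<mu>2 * \<bar>snd x\<bar>)) \<le> exp (4 * pi * (\<mu> * r))"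
      proof -
        have "\<mu>1 * \<bar>fst x\<bar> + \<mu>2 * \<bar>snd x\<bar> \<le> \<mu> * \<bar>fst x\<bar> + \<mu> * \<bar>snd x\<bar>"
          by (intro add_mono mult_right_mono) (auto simp: \<mu>_def)
        from mult_left_mono[OF this, of "4 * pi"] show ?thesis by (simp add: r_def distrib_left)
      qed
      ultimately have "(cmod (A ?z))\<^sup>2 * exp (4 * pi * (\<mu>1 * \<bar>fst x\<bar> + \<mu>2 * \<bar>snd x\<bar>))
         \<le> (C * exp (- (2 * pi * \<mu> + 1) * r))\<^sup>2 * exp (4 * pi * (\<mu> * r))" by (intro mult_mono) auto
      also have "\<dots> = C\<^sup>2 * exp (- (2 * pi * \<mu> + 1) * r + - (2 * pi * \<mu> + 1) * r + 4 * pi * (\<mu> * r))"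
        by (simp only: power_mult_distrib power2_eq_square exp_add mult_ac)
      also have "\<dots> \<le> C\<^sup>2 * exp (- r)"
        by (intro mult_left_mono) (auto simp: algebra_simps r_def)
      finally show "(cmod (A ?z))\<^sup>2 * exp (4 * pi * (\<mu>1 * \<bar>fst x\<bar> + \<mu>2 * \<bar>snd x\<bar>)) \<le> C\<^sup>2 * exp (- (\<bar>fst x\<bar> + \<bar>snd x\<bar>))"
        by (simp add: r_def)
    qed
    also have "\<dots> = ennreal (\<integral>x. C\<^sup>2 * exp (- (\<bar>fst x\<bar> + \<bar>snd x\<bar>)) \<partial>lborel)"
      by (intro nn_integral_eq_integral integrable_mult_right integrable_exp_abs2) auto
    finally show ?thesis .
  qed
  thus ?thesis by blast
qed

theorem frakA_iff: "a \<in> frakA \<longleftrightarrow> (\<exists>A. rapid A \<and> a = (\<lambda>x. A (emb x)))"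
proof
  assume "a \<in> frakA"
  then obtain A where A: "entire_extension a A"
    and S: "\<And>\<mu>1 \<mu>2 \<nu>1 \<nu>2. \<mu>1 > 0 \<Longrightarrow> \<mu>2 > 0 \<Longrightarrow> \<nu>1 > 0 \<Longrightarrow> \<nu>2 > 0 \<Longrightarrow>
      (SUP (y1, y2) \<in> {- \<nu>1<..<\<nu>1} \<times> {- \<nu>2<..<\<nu>2}. strip_norm A \<mu>1 \<mu>2 y1 y2) < \<infinity>"
    unfolding frakA_def strip_norm_def by auto
  have "rapid A"
  proof (rule rapid_if_strip_bounded)
    show "entire2 A" using A by (simp add: entire_extension_def)
    fix \<mu> \<nu> :: real assume "\<mu> > 0" "\<nu> > 0"
    hence "(SUP (y1, y2) \<in> {- \<nu><..<\<nu>} \<times> {- \<nu><..<\<nu>}. strip_norm A \<mu> \<mu> y1 y2) < \<infinity>" by (intro S)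
    then obtain B where B: "(SUP (y1, y2) \<in> {- \<nu><..<\<nu>} \<times> {- \<nu><..<\<nu>}. strip_norm A \<mu> \<mu> y1 y2) = ennreal B"
      by (metis ennreal_cases infinity_ennreal_def less_irrefl)
    have "strip_norm A \<mu> \<mu> y1 y2 \<le> ennreal B" if "\<bar>y1\<bar> < \<nu>" "\<bar>y2\<bar> < \<nu>" for y1 y2
      unfolding B[symmetric] using that by (intro SUP_upper2[of "(y1, y2)"]) auto
    thus "\<exists>B. \<forall>y1 y2. \<bar>y1\<bar> < \<nu> \<longrightarrow> \<bar>y2\<bar> < \<nu> \<longrightarrow> strip_norm A \<mu> \<mu> y1 y2 \<le> ennreal B" by blast
  qed
  moreover have "a = (\<lambda>x. A (emb x))" using A by (auto simp: entire_extension_def emb_def)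
  ultimately show "\<exists>A. rapid A \<and> a = (\<lambda>x. A (emb x))" by blast
next
  assume "\<exists>A. rapid A \<and> a = (\<lambda>x. A (emb x))"
  then obtain A where A: "rapid A" "a = (\<lambda>x. A (emb x))" by blast
  have "entire_extension a A" using A rapid_entire2 by (simp add: entire_extension_def emb_def)
  moreover have "(SUP (y1, y2) \<in> {- \<nu>1<..<\<nu>1} \<times> {- \<nu>2<..<\<nu>2}. strip_norm A \<mu>1 \<mu>2 y1 y2) < \<infinity>" for \<mu>1 \<mu>2 \<nu>1 \<nu>2
  proof -
    obtain B where "\<And>y1 y2. \<bar>y1\<bar> < \<nu>1 \<Longrightarrow> \<bar>y2\<bar> < \<nu>2 \<Longrightarrow> strip_norm A \<mu>1 \<mu>2 y1 y2 \<le> ennreal B"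
      using rapid_strip_bounded[OF A(1)] by blast
    hence "(SUP (y1, y2) \<in> {- \<nu>1<..<\<nu>1} \<times> {- \<nu>2<..<\<nu>2}. strip_norm A \<mu>1 \<mu>2 y1 y2) \<le> ennreal B"
      by (intro SUP_least) auto
    thus ?thesis using ennreal_less_top le_less_trans by (metis infinity_ennreal_def)
  qed
  ultimately show "a \<in> frakA" unfolding frakA_def strip_norm_def by blast
qed

lemma entire_ext_emb:
  assumes "rapid A" shows "entire_ext (\<lambda>x. A (emb x)) = A"
  unfolding entire_ext_def
proof (rule the_equality)
  show "entire_extension (\<lambda>x. A (emb x)) A" using assms rapid_entire2 by (simp add: entire_extension_def emb_def)
  fix B assume "entire_extension (\<lambda>x. A (emb x)) B"
  thus "B = A" by (intro entire2_unique) (auto simp: entire_extension_def emb_def rapid_entire2[OF assms])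
qed

subsection \<open>The symplectic Fourier transform\<close>

lemma ewave_add_right: "ewave k (z + w) = ewave k z * ewave k w"
  and ewave_add_left: "ewave (k + l) z = ewave k z * ewave l z"
  by (simp_all add: ewave_def omega_def algebra_simps flip: exp_add)

lemma ewave_swap: "ewave k z = ewave (- z) k"
  by (simp add: ewave_def omega_def algebra_simps)

lemma ewave_0 [simp]: "ewave 0 z = 1" "ewave k 0 = 1" and ewave_self [simp]: "ewave k k = 1"
  by (simp_all add: ewave_def omega_def)

lemma ewave_cancel: "ewave k z * ewave (- k) z = 1"
  by (simp flip: ewave_add_left)

text \<open>Against a real vector only the imaginary part of \<open>w\<close> contributes, so the
  bound is uniform in the real part, in contrast to \<open>cmod_ewave_le\<close>.\<close>

lemma cmod_ewave_emb:
  assumes "in_strip \<nu> w" shows "cmod (ewave w (emb u)) \<le> exp (4 * pi * \<nu> * rnorm (emb u))"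
proof -
  have "cmod (ewave w (emb u)) = exp (4 * pi * (Im (snd w) * fst u - Im (fst w) * snd u))"
    by (simp add: ewave_def omega_def algebra_simps)
  also have "\<dots> \<le> exp (4 * pi * (\<nu> * rnorm (emb u)))"
  proof -
    have "Im (snd w) * fst u \<le> \<nu> * \<bar>fst u\<bar>" "- (Im (fst w) * snd u) \<le> \<nu> * \<bar>snd u\<bar>"
      using assms unfolding in_strip_def
      by (metis abs_ge_self abs_ge_zero abs_mult mult_right_mono order_trans, metis abs_ge_minus_self abs_ge_zero abs_mult mult_right_mono order_trans)
    hence "Im (snd w) * fst u - Im (fst w) * snd u \<le> \<nu> * rnorm (emb u)" by (simp add: rnorm_emb distrib_left)
    thus ?thesis by simp
  qed
  finally show ?thesis by (simp add: mult.assoc)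
qed

text \<open>The symplectic Fourier transform without normalisation, directly at complex
  frequencies.\<close>

definition fhat :: "(c2 \<Rightarrow> complex) \<Rightarrow> c2 \<Rightarrow> complex" where
  "fhat A w = J2 (\<lambda>u. ewave w u * A u)"

lemma J2_cmult: "J2 (\<lambda>u. c * f u) = c * J2 f"
  unfolding J2_def by (rule integral_mult_right_zero)

lemma rapid_measurable0 [measurable_dest]: "rapid A \<Longrightarrow> (\<lambda>x. A (emb x)) \<in> borel_measurable borel"
  using rapid_measurable[of A 0] by simp

lemma rapid_measurable_pair: "rapid A \<Longrightarrow> A \<in> borel_measurable borel"
  by (rule borel_measurable_continuous_onI[OF entire2_continuous[OF rapid_entire2]])

lemma emb_measurable [measurable]: "emb \<in> borel_measurable borel"
  by (rule borel_measurable_continuous_onI[OF continuous_emb])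

lemma continuous_ewave: "continuous_on S (\<lambda>p. ewave (fst p) (snd p))"
  unfolding ewave_def omega_def by (intro continuous_intros)

lemma ewave_measurable [measurable (raw)]:
  assumes "f \<in> borel_measurable M" "g \<in> borel_measurable M"
  shows "(\<lambda>x. ewave (f x) (g x)) \<in> borel_measurable M"
proof -
  have [measurable]: "(\<lambda>p. ewave (fst p) (snd p)) \<in> borel_measurable (borel \<Otimes>\<^sub>M borel)"
    unfolding borel_prod by (rule borel_measurable_continuous_onI[OF continuous_ewave])
  have "(\<lambda>x. (\<lambda>p. ewave (fst p) (snd p)) (f x, g x)) \<in> borel_measurable M" using assms by measurable
  thus ?thesis by simp
qed

text \<open>The factor in front has a modulus that depends exponentially on the real part of
  \<open>w\<close>; it is the source of all decay of \<open>fhat\<close>.\<close>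

lemma fhat_shift:
  assumes "rapid A" shows "fhat A w = ewave w (imag2 t) * fhat (\<lambda>u. A (u + imag2 t)) w"
proof -
  have "fhat A w = J2 (\<lambda>u. ewave w (u + imag2 t) * A (u + imag2 t))"
    unfolding fhat_def by (rule rapid_J2_shift[OF rapid_ewave[OF assms], symmetric])
  also have "(\<lambda>u. ewave w (u + imag2 t) * A (u + imag2 t)) = (\<lambda>u. ewave w (imag2 t) * (ewave w u * A (u + imag2 t)))"
    by (simp add: ewave_add_right mult_ac)
  finally show ?thesis unfolding J2_cmult fhat_def .
qed

lemma entire2_fhat: assumes A: "rapid A" shows "entire2 (fhat A)"
proof -
  note [measurable] = rapid_measurable0[OF A]
  have [measurable]: "fst \<in> borel_measurable (borel :: (real \<times> real) measure)" "snd \<in> borel_measurable (borel :: (real \<times> real) measure)"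
    by (intro borel_measurable_continuous_onI continuous_intros)+
  have "entire2 (\<lambda>z. \<integral>\<xi>. A (emb \<xi>) * exp (\<i> * (fst z * of_real (4 * pi * snd \<xi>) + snd z * of_real (- (4 * pi * fst \<xi>)))) \<partial>lborel)"
  proof (rule entire2_laplace)
    fix R :: real
    show "integrable lborel (\<lambda>\<xi>. cmod (A (emb \<xi>)) * exp (R * (\<bar>4 * pi * snd \<xi>\<bar> + \<bar>- (4 * pi * fst \<xi>)\<bar>)))"
      using rapid_integrable_weight[OF A, of 0 "R * (4 * pi)"]
      by (simp add: rnorm_emb abs_mult algebra_simps)
  qed measurable
  moreover have "fhat A = (\<lambda>z. \<integral>\<xi>. A (emb \<xi>) * exp (\<i> * (fst z * of_real (4 * pi * snd \<xi>) + snd z * of_real (- (4 * pi * fst \<xi>)))) \<partial>lborel)"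
    unfolding fhat_def J2_def
    by (intro ext Bochner_Integration.integral_cong refl) (simp add: ewave_def omega_def algebra_simps)
  ultimately show ?thesis by simp
qed

text \<open>The contour is shifted by \<mu> / (4 pi) in each coordinate, with signs taken from the
  real parts of \<open>w\<close>, so that the factor of \<open>fhat_shift\<close> has modulus exp (-
  \<mu> rnorm w). Only four shifts occur, and the sum of their bounds is a constant for all of
  them.\<close>

lemma rapid_fhat: assumes A: "rapid A" shows "rapid (fhat A)"
proof (rule rapidI[OF entire2_fhat[OF A]])
  fix \<mu> \<nu> :: real assume "\<mu> > 0" "\<nu> > 0"
  define \<tau> where "\<tau> = \<mu> / (4 * pi)"
  define K where "K t = (\<integral>u. cmod (A (emb u + imag2 t)) * exp ((4 * pi * \<nu>) * rnorm (emb u)) \<partial>lborel)" for t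
  have K0: "K t \<ge> 0" for t unfolding K_def by (rule Bochner_Integration.integral_nonneg) simp
  have b: "cmod (fhat (\<lambda>u. A (u + imag2 t)) w) \<le> K t" if w: "in_strip \<nu> w" for w t
  proof -
    have "cmod (fhat (\<lambda>u. A (u + imag2 t)) w) \<le> (\<integral>u. cmod (ewave w (emb u) * A (emb u + imag2 t)) \<partial>lborel)"
      unfolding fhat_def J2_def by (rule integral_norm_bound)
    also have "\<dots> \<le> K t" unfolding K_def
    proof (rule integral_mono'[OF rapid_integrable_weight[OF A]])
      fix u
      show "cmod (ewave w (emb u) * A (emb u + imag2 t)) \<le> cmod (A (emb u + imag2 t)) * exp ((4 * pi * \<nu>) * rnorm (emb u))"
        using mult_right_mono[OF cmod_ewave_emb[OF w], of "cmod (A (emb u + imag2 t))" u]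
        by (simp add: norm_mult mult_ac)
    qed simp
    finally show ?thesis .
  qed
  define C where "C = K (\<tau>, \<tau>) + K (\<tau>, - \<tau>) + K (- \<tau>, \<tau>) + K (- \<tau>, - \<tau>)"
  have "cmod (fhat A w) \<le> C * exp (- \<mu> * rnorm w)" if w: "in_strip \<nu> w" for w
  proof -
    define t where "t = ((if Re (snd w) \<ge> 0 then - \<tau> else \<tau>), (if Re (fst w) \<ge> 0 then \<tau> else - \<tau>))"
    have "cmod (ewave w (imag2 t)) = exp (- (4 * pi * \<tau> * (\<bar>Re (fst w)\<bar> + \<bar>Re (snd w)\<bar>)))"
      by (simp add: ewave_def omega_def imag2_def t_def algebra_simps)
    also have "\<dots> = exp (- \<mu> * rnorm w)" by (simp add: \<tau>_def rnorm_def)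
    finally have e: "cmod (ewave w (imag2 t)) = exp (- \<mu> * rnorm w)" .
    have "cmod (fhat A w) = cmod (ewave w (imag2 t)) * cmod (fhat (\<lambda>u. A (u + imag2 t)) w)"
      by (subst fhat_shift[OF A, of _ t]) (simp add: norm_mult)
    also have "\<dots> \<le> exp (- \<mu> * rnorm w) * K t" unfolding e by (intro mult_left_mono b w) simp
    also have "K t \<le> C" unfolding C_def t_def using K0 by (auto simp: add_nonneg_nonneg add_increasing add_increasing2)
    finally show ?thesis by (simp add: mult.commute)
  qed
  thus "\<exists>C. \<forall>z. in_strip \<nu> z \<longrightarrow> cmod (fhat A z) \<le> C * exp (- \<mu> * rnorm z)" by blast
qed

subsection \<open>The twisted product\<close>

lemma integrable_prod_lborel:
  fixes f :: "'a::euclidean_space \<Rightarrow> complex" and g :: "'b::euclidean_space \<Rightarrow> complex"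
  assumes f: "integrable lborel f" and g: "integrable lborel g"
  shows "integrable lborel (\<lambda>p. f (fst p) * g (snd p))"
proof -
  have [measurable]: "f \<in> borel_measurable borel" "g \<in> borel_measurable borel" using f g by auto
  have "integrable (lborel \<Otimes>\<^sub>M lborel) (\<lambda>p. f (fst p) * g (snd p))"
  proof (rule lborel_pair.Fubini_integrable)
    have "integrable lborel (\<lambda>x. cmod (f x) * (\<integral>y. cmod (g y) \<partial>lborel))"
      using f by (intro integrable_mult_left integrable_norm)
    thus "integrable lborel (\<lambda>x. \<integral>y. norm (f (fst (x, y)) * g (snd (x, y))) \<partial>lborel)"
      using g by (simp add: norm_mult)
    show "(\<lambda>p. f (fst p) * g (snd p)) \<in> borel_measurable (lborel \<Otimes>\<^sub>M lborel)" by measurable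
  qed (use g in auto)
  thus ?thesis by (simp add: lborel_prod)
qed

text \<open>The entire extension of the twisted product.\<close>

definition tw :: "(c2 \<Rightarrow> complex) \<Rightarrow> (c2 \<Rightarrow> complex) \<Rightarrow> c2 \<Rightarrow> complex" where
  "tw A B z = 4 * (\<integral>p. A (emb (fst p)) * B (emb (snd p)) *
     (ewave z (emb (fst p)) * ewave (- z) (emb (snd p)) * ewave (emb (fst p)) (emb (snd p))) \<partial>lborel)"

lemma cmod_ewave_real [simp]: "cmod (ewave (emb u) (emb v)) = 1"
  by (simp add: ewave_def omega_def)

lemma tw_integrable:
  assumes A: "rapid A" and B: "rapid B"
  shows "integrable lborel (\<lambda>p. A (emb (fst p)) * B (emb (snd p)) *
     (ewave z (emb (fst p)) * ewave (- z) (emb (snd p)) * ewave (emb (fst p)) (emb (snd p))))"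
proof -
  note [measurable] = rapid_measurable0[OF A] rapid_measurable0[OF B]
  have "integrable lborel (\<lambda>p. (ewave z (emb (fst p)) * A (emb (fst p))) * (ewave (- z) (emb (snd p)) * B (emb (snd p))))"
    using integrable_prod_lborel[OF rapid_integrable0[OF rapid_ewave[OF A, of z]] rapid_integrable0[OF rapid_ewave[OF B, of "- z"]]] .
  thus ?thesis
  proof (rule Bochner_Integration.integrable_bound)
    have "(\<lambda>p. A (emb (fst p)) * B (emb (snd p)) *
     (ewave z (emb (fst p)) * ewave (- z) (emb (snd p)) * ewave (emb (fst p)) (emb (snd p)))) \<in> borel_measurable (borel \<Otimes>\<^sub>M borel)"
      by measurable
    thus "(\<lambda>p. A (emb (fst p)) * B (emb (snd p)) *
     (ewave z (emb (fst p)) * ewave (- z) (emb (snd p)) * ewave (emb (fst p)) (emb (snd p)))) \<in> borel_measurable lborel"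
      by (simp add: borel_prod)
  qed (auto simp: norm_mult)
qed

lemma integral_prod_lborel2:
  fixes f :: "'a::euclidean_space \<times> 'b::euclidean_space \<Rightarrow> complex"
  assumes "integrable lborel f"
  shows "(\<integral>p. f p \<partial>lborel) = (\<integral>u. (\<integral>v. f (u, v) \<partial>lborel) \<partial>lborel)"
    and "(\<integral>p. f p \<partial>lborel) = (\<integral>v. (\<integral>u. f (u, v) \<partial>lborel) \<partial>lborel)"
  using lborel_pair.integral_fst'[of f] lborel_pair.integral_snd[of "\<lambda>x y. f (x, y)"] assms
  by (simp_all add: lborel_prod)

text \<open>Integrating over u first produces the transform of \<open>A\<close> at z - v. The
  companion \<open>tw_eq2\<close> integrates over v first; the choice between them decides which
  factor can be translated.\<close>

lemma tw_eq1:
  assumes A: "rapid A" and B: "rapid B"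
  shows "tw A B z = 4 * J2 (\<lambda>v. ewave (- z) v * B v * fhat A (z - v))"
proof -
  have e: "ewave z u * ewave u v = ewave (z - v) u" for u v
    using ewave_add_left[of z "- v" u] ewave_swap[of u v] by simp
  have "tw A B z = 4 * (\<integral>v. \<integral>u. A (emb u) * B (emb v) * (ewave z (emb u) * ewave (- z) (emb v) * ewave (emb u) (emb v)) \<partial>lborel \<partial>lborel)"
    unfolding tw_def by (subst integral_prod_lborel2(2)[OF tw_integrable[OF A B]]) simp
  also have "\<dots> = 4 * (\<integral>v. \<integral>u. (ewave (- z) (emb v) * B (emb v)) * (ewave (z - emb v) (emb u) * A (emb u)) \<partial>lborel \<partial>lborel)"
    by (simp add: e[symmetric] mult_ac)
  also have "\<dots> = 4 * J2 (\<lambda>v. ewave (- z) v * B v * fhat A (z - v))"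
    unfolding J2_def fhat_def by simp
  finally show ?thesis .
qed

lemma tw_eq2:
  assumes A: "rapid A" and B: "rapid B"
  shows "tw A B z = 4 * J2 (\<lambda>u. ewave z u * A u * fhat B (u - z))"
proof -
  have e: "ewave (- z) v * ewave u v = ewave (u - z) v" for u v
    using ewave_add_left[of u "- z" v] by simp
  have "tw A B z = 4 * (\<integral>u. \<integral>v. A (emb u) * B (emb v) * (ewave z (emb u) * ewave (- z) (emb v) * ewave (emb u) (emb v)) \<partial>lborel \<partial>lborel)"
    unfolding tw_def by (subst integral_prod_lborel2(1)[OF tw_integrable[OF A B]]) simp
  also have "\<dots> = 4 * (\<integral>u. \<integral>v. (ewave z (emb u) * A (emb u)) * (ewave (emb u - z) (emb v) * B (emb v)) \<partial>lborel \<partial>lborel)"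
    by (simp add: e[symmetric] mult_ac)
  also have "\<dots> = 4 * J2 (\<lambda>u. ewave z u * A u * fhat B (u - z))"
    unfolding J2_def fhat_def by simp
  finally show ?thesis .
qed

lemma tw_shift: "tw A B (z + c) = tw (\<lambda>u. ewave c u * A u) (\<lambda>v. ewave (- c) v * B v) z"
  unfolding tw_def ewave_add_left minus_add_distrib by (simp add: mult_ac)

text \<open>\<open>fhat_shift\<close> at z - v leaves the factor
  \<open>ewave (z - v) (imag2 t)\<close>. It splits into a part in z, which leaves the integral, and
  a part in v, which is the exponential attached to the second factor.\<close>

lemma tw_left:
  assumes A: "rapid A" and B: "rapid B"
  shows "tw (\<lambda>u. A (u + imag2 t)) (\<lambda>v. ewave (imag2 t) v * B v) z = ewave (imag2 t) z * tw A B z"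
proof -
  have "fhat A (z - v) = ewave (- imag2 t) z * (ewave (imag2 t) v * fhat (\<lambda>u. A (u + imag2 t)) (z - v))" for v
    using fhat_shift[OF A, of "z - v" t] ewave_add_left[of z "- v" "imag2 t"] ewave_swap[of z "imag2 t"] ewave_swap[of "imag2 t" v]
    by simp
  hence "tw A B z = ewave (- imag2 t) z * tw (\<lambda>u. A (u + imag2 t)) (\<lambda>v. ewave (imag2 t) v * B v) z"
    unfolding tw_eq1[OF A B] tw_eq1[OF rapid_shift[OF A] rapid_ewave[OF B]]
    by (subst mult.left_commute, subst J2_cmult[symmetric]) (simp only: mult_ac)
  thus ?thesis by (simp add: ewave_cancel flip: mult.assoc)
qed

lemma tw_right:
  assumes A: "rapid A" and B: "rapid B"
  shows "tw (\<lambda>u. ewave (- imag2 t) u * A u) (\<lambda>v. B (v + imag2 t)) z = ewave (- imag2 t) z * tw A B z"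
proof -
  have "fhat B (u - z) = ewave (imag2 t) z * (ewave (- imag2 t) u * fhat (\<lambda>v. B (v + imag2 t)) (u - z))" for u
    using fhat_shift[OF B, of "u - z" t] ewave_add_left[of u "- z" "imag2 t"] ewave_swap[of u "imag2 t"] ewave_swap[of "imag2 t" z]
    by (simp add: mult_ac)
  hence "tw A B z = ewave (imag2 t) z * tw (\<lambda>u. ewave (- imag2 t) u * A u) (\<lambda>v. B (v + imag2 t)) z"
    unfolding tw_eq2[OF A B] tw_eq2[OF rapid_ewave[OF A] rapid_shift[OF B]]
    by (subst mult.left_commute, subst J2_cmult[symmetric]) (simp only: mult_ac)
  thus ?thesis by (simp add: ewave_cancel mult.commute[of "ewave (- imag2 t) z" "ewave (imag2 t) z"] flip: mult.assoc)
qed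

text \<open>The dependence on z is a single exponential with real frequencies 4 pi (u_2 - v_2) and -
  4 pi (u_1 - v_1), hence a Laplace integral over R^4.\<close>

lemma entire2_tw: assumes A: "rapid A" and B: "rapid B" shows "entire2 (tw A B)"
proof -
  note [measurable] = rapid_measurable0[OF A] rapid_measurable0[OF B]
  let ?p = "\<lambda>\<xi>::(real \<times> real) \<times> (real \<times> real). 4 * pi * (snd (fst \<xi>) - snd (snd \<xi>))"
  let ?q = "\<lambda>\<xi>::(real \<times> real) \<times> (real \<times> real). - (4 * pi * (fst (fst \<xi>) - fst (snd \<xi>)))"
  let ?f = "\<lambda>p. 4 * (A (emb (fst p)) * B (emb (snd p)) * ewave (emb (fst p)) (emb (snd p)))"
  have mf: "?f \<in> borel_measurable lborel"
  proof -
    have "?f \<in> borel_measurable (borel \<Otimes>\<^sub>M borel)" by measurable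
    thus ?thesis by (simp add: borel_prod)
  qed
  have mp: "?p \<in> borel_measurable lborel" "?q \<in> borel_measurable lborel"
    by (simp_all, (intro borel_measurable_continuous_onI continuous_intros)+)
  have "entire2 (\<lambda>z. \<integral>\<xi>. ?f \<xi> * exp (\<i> * (fst z * of_real (?p \<xi>) + snd z * of_real (?q \<xi>))) \<partial>lborel)"
  proof (rule entire2_laplace[OF mf mp])
    fix R :: real
    let ?w = "\<lambda>A x. of_real (cmod (A (emb x)) * exp (4 * pi * \<bar>R\<bar> * rnorm (emb x))) :: complex"
    have "integrable lborel (\<lambda>p. ?w A (fst p) * ?w B (snd p))"
      using rapid_integrable_weight[OF A, of 0 "4 * pi * \<bar>R\<bar>"] rapid_integrable_weight[OF B, of 0 "4 * pi * \<bar>R\<bar>"]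
      by (intro integrable_prod_lborel integrable_of_real) simp_all
    hence i: "integrable lborel (\<lambda>p. 4 * (?w A (fst p) * ?w B (snd p)))" by (rule integrable_mult_right)
    show "integrable lborel (\<lambda>\<xi>. cmod (?f \<xi>) * exp (R * (\<bar>?p \<xi>\<bar> + \<bar>?q \<xi>\<bar>)))"
    proof (rule Bochner_Integration.integrable_bound[OF i])
      show "(\<lambda>\<xi>. cmod (?f \<xi>) * exp (R * (\<bar>?p \<xi>\<bar> + \<bar>?q \<xi>\<bar>))) \<in> borel_measurable lborel"
        using mf mp by measurable
      have "cmod (?f \<xi>) * exp (R * (\<bar>?p \<xi>\<bar> + \<bar>?q \<xi>\<bar>)) \<le> cmod (4 * (?w A (fst \<xi>) * ?w B (snd \<xi>)))" for \<xi>
      proof -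
        have "R * (\<bar>?p \<xi>\<bar> + \<bar>?q \<xi>\<bar>) \<le> \<bar>R\<bar> * (\<bar>?p \<xi>\<bar> + \<bar>?q \<xi>\<bar>)" by (intro mult_right_mono) auto
        also have "\<dots> \<le> \<bar>R\<bar> * (4 * pi * rnorm (emb (fst \<xi>)) + 4 * pi * rnorm (emb (snd \<xi>)))"
        proof (intro mult_left_mono)
          have "\<bar>snd (fst \<xi>) - snd (snd \<xi>)\<bar> + \<bar>fst (fst \<xi>) - fst (snd \<xi>)\<bar> \<le> rnorm (emb (fst \<xi>)) + rnorm (emb (snd \<xi>))"
            by (auto simp: rnorm_emb)
          from mult_left_mono[OF this, of "4 * pi"]
          show "\<bar>?p \<xi>\<bar> + \<bar>?q \<xi>\<bar> \<le> 4 * pi * rnorm (emb (fst \<xi>)) + 4 * pi * rnorm (emb (snd \<xi>))"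
            by (simp add: abs_mult distrib_left)
        qed simp
        finally have "exp (R * (\<bar>?p \<xi>\<bar> + \<bar>?q \<xi>\<bar>)) \<le> exp (4 * pi * \<bar>R\<bar> * rnorm (emb (fst \<xi>))) * exp (4 * pi * \<bar>R\<bar> * rnorm (emb (snd \<xi>)))"
          by (simp add: exp_add[symmetric] algebra_simps)
        from mult_left_mono[OF this, of "cmod (?f \<xi>)"] show ?thesis
          by (simp add: norm_mult mult_ac)
      qed
      thus "AE \<xi> in lborel. norm (cmod (?f \<xi>) * exp (R * (\<bar>?p \<xi>\<bar> + \<bar>?q \<xi>\<bar>))) \<le> norm (4 * (?w A (fst \<xi>) * ?w B (snd \<xi>)))"
        by (intro AE_I2) simp
    qed
  qed
  moreover have "tw A B = (\<lambda>z. \<integral>\<xi>. ?f \<xi> * exp (\<i> * (fst z * of_real (?p \<xi>) + snd z * of_real (?q \<xi>))) \<partial>lborel)"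
  proof
    fix z :: c2
    have "ewave z (emb u) * ewave (- z) (emb v) = exp (\<i> * (fst z * of_real (?p (u, v)) + snd z * of_real (?q (u, v))))" for u v
      by (simp add: ewave_def omega_def exp_add[symmetric] algebra_simps)
    from this[of "fst p" "snd p" for p]
    show "tw A B z = (\<integral>\<xi>. ?f \<xi> * exp (\<i> * (fst z * of_real (?p \<xi>) + snd z * of_real (?q \<xi>))) \<partial>lborel)"
      unfolding tw_def by (subst integral_mult_right_zero[symmetric]) (simp only: prod.collapse mult_ac)
  qed
  ultimately show ?thesis by simp
qed

text \<open>In \<open>tw_eq1\<close> the decay in z is that of \<open>fhat A (z - v)\<close>. The
  triangle inequality costs rate \<mu> in v and the exponential on the strip costs 4 pi \<nu>; the
  decay of \<open>B\<close> pays for both.\<close>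

lemma rapid_tw: assumes A: "rapid A" and B: "rapid B" shows "rapid (tw A B)"
proof (rule rapidI[OF entire2_tw[OF A B]])
  fix \<mu> \<nu> :: real assume \<mu>: "\<mu> > 0" and "\<nu> > 0"
  obtain C where C: "C > 0" "\<And>z. in_strip \<nu> z \<Longrightarrow> cmod (fhat A z) \<le> C * exp (- \<mu> * rnorm z)"
    using rapidE[OF rapid_fhat[OF A], of \<nu> \<mu>] by metis
  define D where "D = (\<integral>v. cmod (B (emb v + 0)) * exp ((4 * pi * \<nu> + \<mu>) * rnorm (emb v)) \<partial>lborel)"
  have "cmod (tw A B z) \<le> (4 * C * D) * exp (- \<mu> * rnorm z)" if z: "in_strip \<nu> z" for z
  proof -
    have nz: "in_strip \<nu> (- z)" using z by (simp add: in_strip_def)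
    have "cmod (J2 (\<lambda>v. ewave (- z) v * B v * fhat A (z - v))) \<le> (\<integral>v. cmod (ewave (- z) (emb v) * B (emb v) * fhat A (z - emb v)) \<partial>lborel)"
      unfolding J2_def by (rule integral_norm_bound)
    also have "\<dots> \<le> (\<integral>v. (C * exp (- \<mu> * rnorm z)) * (cmod (B (emb v + 0)) * exp ((4 * pi * \<nu> + \<mu>) * rnorm (emb v))) \<partial>lborel)"
    proof (rule integral_mono'[OF integrable_mult_right[OF rapid_integrable_weight[OF B]]])
      fix v
      have "cmod (fhat A (z - emb v)) \<le> C * exp (- \<mu> * rnorm (z - emb v))"
        by (rule C(2)) (use z in \<open>auto simp: in_strip_def\<close>)
      also have "\<dots> \<le> C * exp (- \<mu> * rnorm z + \<mu> * rnorm (emb v))"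
      proof -
        have "rnorm z \<le> rnorm (z - emb v) + rnorm (emb v)" by (simp add: rnorm_def)
        from mult_left_mono[OF this, of \<mu>] show ?thesis using \<mu> C(1) by (simp add: distrib_left)
      qed
      finally have "cmod (ewave (- z) (emb v)) * cmod (fhat A (z - emb v)) \<le> exp (4 * pi * \<nu> * rnorm (emb v)) * (C * exp (- \<mu> * rnorm z + \<mu> * rnorm (emb v)))"
        by (intro mult_mono cmod_ewave_emb[OF nz]) auto
      also have "\<dots> = (C * exp (- \<mu> * rnorm z)) * exp (4 * pi * \<nu> * rnorm (emb v) + \<mu> * rnorm (emb v))"
        by (simp only: exp_add mult_ac)
      also have "4 * pi * \<nu> * rnorm (emb v) + \<mu> * rnorm (emb v) = (4 * pi * \<nu> + \<mu>) * rnorm (emb v)" by (simp only: distrib_right)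
      finally have "cmod (B (emb v)) * (cmod (ewave (- z) (emb v)) * cmod (fhat A (z - emb v)))
         \<le> cmod (B (emb v)) * ((C * exp (- \<mu> * rnorm z)) * exp ((4 * pi * \<nu> + \<mu>) * rnorm (emb v)))" by (rule mult_left_mono) simp
      thus "cmod (ewave (- z) (emb v) * B (emb v) * fhat A (z - emb v))
         \<le> (C * exp (- \<mu> * rnorm z)) * (cmod (B (emb v + 0)) * exp ((4 * pi * \<nu> + \<mu>) * rnorm (emb v)))"
        by (simp add: norm_mult mult_ac)
    qed (use C(1) in simp)
    also have "\<dots> = (C * exp (- \<mu> * rnorm z)) * D" unfolding D_def by (rule integral_mult_right_zero)
    finally show ?thesis unfolding tw_eq1[OF A B] by (simp add: norm_mult mult_ac)
  qed
  thus "\<exists>C. \<forall>z. in_strip \<nu> z \<longrightarrow> cmod (tw A B z) \<le> C * exp (- \<mu> * rnorm z)" by blast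
qed

subsection \<open>Associativity and involution\<close>

lemma integral_reflect:
  fixes f :: "real \<times> real \<Rightarrow> complex"
  assumes "f \<in> borel_measurable borel"
  shows "(\<integral>u. f (a - u) \<partial>lborel) = (\<integral>u. f u \<partial>lborel)"
proof -
  have "lborel = distr lborel borel (\<lambda>u::real \<times> real. a + (-1) *\<^sub>R u)"
    using lborel_affine[of "-1" a] by (simp add: density_1)
  hence "(\<integral>u. f u \<partial>lborel) = (\<integral>u. f u \<partial>distr lborel borel (\<lambda>u. a + (-1) *\<^sub>R u))" by simp
  also have "\<dots> = (\<integral>u. f (a + (-1) *\<^sub>R u) \<partial>lborel)"
    by (rule integral_distr) (use assms in auto)
  finally show ?thesis by simp
qed

lemma rapid_bounded_real:
  assumes "rapid A" obtains K where "K > 0" "\<And>u. cmod (A (emb u)) \<le> K"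
proof -
  obtain C where C: "C > 0" "\<And>z. in_strip 0 z \<Longrightarrow> cmod (A z) \<le> C * exp (- 1 * rnorm z)"
    using rapidE[OF assms, of 0 1] by metis
  have "cmod (A (emb u)) \<le> C" for u
  proof -
    have "cmod (A (emb u)) \<le> C * exp (- 1 * rnorm (emb u))" by (rule C(2)) (simp add: in_strip_def)
    also have "\<dots> \<le> C * 1" using C(1) by (intro mult_left_mono) auto
    finally show ?thesis by simp
  qed
  thus ?thesis using that C(1) by blast
qed

text \<open>The two forms of \<open>tw\<close> are combined so that \<open>A\<close> and
  \<open>C\<close> occur only through their transforms and \<open>B\<close> is untouched. The
  transforms then stand at u - v and u - x in \<open>G\<close>, and at x - u and v - u in
  \<open>H\<close>; for fixed v the reflection of u in x + v exchanges the two.\<close>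

lemma tw_assoc:
  assumes A: "rapid A" and B: "rapid B" and C: "rapid C"
  shows "tw (tw A B) C (emb x) = tw A (tw B C) (emb x)"
proof -
  let ?z = "emb x"
  define G where "G u v = ewave ?z (emb u) * fhat C (emb u - ?z) * (ewave (- emb u) (emb v) * B (emb v) * fhat A (emb u - emb v))" for u v
  define H where "H u v = ewave (- ?z) (emb u) * fhat A (?z - emb u) * (ewave (emb u) (emb v) * B (emb v) * fhat C (emb v - emb u))" for u v
  note rA = rapid_fhat[OF A] and rC = rapid_fhat[OF C]
  note [measurable] = rapid_measurable0[OF B] rapid_measurable_pair[OF rA] rapid_measurable_pair[OF rC]
  obtain KA where KA: "KA > 0" "\<And>u. cmod (fhat A (emb u)) \<le> KA" using rapid_bounded_real[OF rA] by blast
  obtain KC where KC: "KC > 0" "\<And>u. cmod (fhat C (emb u)) \<le> KC" using rapid_bounded_real[OF rC] by blast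
  have mG: "(\<lambda>p. G (fst p) (snd p)) \<in> borel_measurable (borel \<Otimes>\<^sub>M borel)" unfolding G_def by measurable
  have mH: "(\<lambda>p. H (fst p) (snd p)) \<in> borel_measurable (borel \<Otimes>\<^sub>M borel)" unfolding H_def by measurable
  have intG: "integrable lborel (\<lambda>p. G (fst p) (snd p))"
  proof (rule Bochner_Integration.integrable_bound)
    show "integrable lborel (\<lambda>p. KA * (fhat C (emb (fst p) + - ?z) * B (emb (snd p))))"
      by (intro integrable_mult_right integrable_prod_lborel rapid_integrable rapid_integrable0 rC B)
    show "(\<lambda>p. G (fst p) (snd p)) \<in> borel_measurable lborel" using mG by (simp add: borel_prod)
    show "AE p in lborel. norm (G (fst p) (snd p)) \<le> norm (KA * (fhat C (emb (fst p) + - ?z) * B (emb (snd p))))"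
    proof (rule AE_I2)
      fix p :: "(real \<times> real) \<times> (real \<times> real)"
      have "cmod (G (fst p) (snd p)) = cmod (fhat C (emb (fst p) - ?z)) * cmod (B (emb (snd p))) * cmod (fhat A (emb (fst p - snd p)))"
        unfolding G_def by (simp add: norm_mult emb_diff flip: emb_minus)
      also have "\<dots> \<le> cmod (fhat C (emb (fst p) - ?z)) * cmod (B (emb (snd p))) * KA" by (intro mult_left_mono KA) simp
      finally show "norm (G (fst p) (snd p)) \<le> norm (KA * (fhat C (emb (fst p) + - ?z) * B (emb (snd p))))"
        using KA(1) by (simp add: norm_mult mult_ac)
    qed
  qed
  have intH: "integrable lborel (\<lambda>p. H (fst p) (snd p))"
  proof (rule Bochner_Integration.integrable_bound)
    have i: "integrable lborel (\<lambda>u. fhat A (?z - emb u))"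
    proof -
      have "(\<lambda>u. ewave 0 (emb u) * fhat A (?z - emb u)) \<in> borel_measurable borel" by measurable
      hence m: "(\<lambda>u. fhat A (?z - emb u)) \<in> borel_measurable lborel" by simp
      have "integrable (distr lborel borel (\<lambda>u::real \<times> real. x + (-1) *\<^sub>R u)) (\<lambda>u. fhat A (emb u))"
        using rapid_integrable0[OF rA] lborel_affine[of "-1" x] by (simp add: density_1)
      from integrable_distr[OF _ this] show ?thesis by (simp add: emb_diff)
    qed
    show "integrable lborel (\<lambda>p. KC * (fhat A (?z - emb (fst p)) * B (emb (snd p))))"
      by (intro integrable_mult_right integrable_prod_lborel i rapid_integrable0 B)
    show "(\<lambda>p. H (fst p) (snd p)) \<in> borel_measurable lborel" using mH by (simp add: borel_prod)
    show "AE p in lborel. norm (H (fst p) (snd p)) \<le> norm (KC * (fhat A (?z - emb (fst p)) * B (emb (snd p))))"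
    proof (rule AE_I2)
      fix p :: "(real \<times> real) \<times> (real \<times> real)"
      have "cmod (H (fst p) (snd p)) = cmod (fhat A (?z - emb (fst p))) * cmod (B (emb (snd p))) * cmod (fhat C (emb (snd p - fst p)))"
        unfolding H_def by (simp add: norm_mult emb_diff flip: emb_minus)
      also have "\<dots> \<le> cmod (fhat A (?z - emb (fst p))) * cmod (B (emb (snd p))) * KC" by (intro mult_left_mono KC) simp
      finally show "norm (H (fst p) (snd p)) \<le> norm (KC * (fhat A (?z - emb (fst p)) * B (emb (snd p))))"
        using KC(1) by (simp add: norm_mult mult_ac)
    qed
  qed
  have GH: "G (x + v - u) v = H u v" for u v
  proof -
    have e: "emb (x + v - u) = ?z + emb v - emb u" by (simp add: emb_add emb_diff)
    have "ewave ?z (?z + emb v - emb u) * ewave (- (?z + emb v - emb u)) (emb v) = ewave (- ?z) (emb u) * ewave (emb u) (emb v)"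
      by (simp add: ewave_def omega_def exp_add[symmetric] algebra_simps)
    thus ?thesis unfolding G_def H_def e by (simp add: mult_ac add.commute)
  qed
  have "tw (tw A B) C ?z = 16 * (\<integral>u. \<integral>v. G u v \<partial>lborel \<partial>lborel)"
    unfolding tw_eq2[OF rapid_tw[OF A B] C] tw_eq1[OF A B] J2_def G_def
    by (simp add: mult_ac flip: integral_mult_right_zero integral_mult_left_zero)
  also have "(\<integral>u. \<integral>v. G u v \<partial>lborel \<partial>lborel) = (\<integral>v. \<integral>u. G u v \<partial>lborel \<partial>lborel)"
    using integral_prod_lborel2[OF intG] by simp
  also have "\<dots> = (\<integral>v. \<integral>u. H u v \<partial>lborel \<partial>lborel)"
  proof (rule Bochner_Integration.integral_cong[OF refl])
    fix v
    have "(\<lambda>u. G u v) \<in> borel_measurable borel" unfolding G_def by measurable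
    from integral_reflect[OF this, of "x + v"] show "(\<integral>u. G u v \<partial>lborel) = (\<integral>u. H u v \<partial>lborel)" by (simp add: GH)
  qed
  also have "\<dots> = (\<integral>u. \<integral>v. H u v \<partial>lborel \<partial>lborel)"
    using integral_prod_lborel2[OF intH] by simp
  also have "16 * \<dots> = tw A (tw B C) ?z"
    unfolding tw_eq1[OF A rapid_tw[OF B C]] tw_eq2[OF B C] J2_def H_def
    by (simp add: mult_ac flip: integral_mult_right_zero integral_mult_left_zero)
  finally show ?thesis .
qed

lemma twisted_prod_emb: "twisted_prod (\<lambda>x. A (emb x)) (\<lambda>x. B (emb x)) = (\<lambda>x. tw A B (emb x))"
  unfolding twisted_prod_def tw_def case_prod_unfold
  by (intro ext arg_cong[where f = "\<lambda>t. 4 * t"] Bochner_Integration.integral_cong refl)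
    (simp add: ewave_def omega_def exp_add[symmetric] algebra_simps)

lemma integral_swap_lborel:
  fixes f :: "'a::euclidean_space \<times> 'b::euclidean_space \<Rightarrow> complex"
  assumes "integrable lborel f"
  shows "(\<integral>p. f p \<partial>lborel) = (\<integral>p. f (snd p, fst p) \<partial>lborel)"
proof -
  have "f \<in> borel_measurable (lborel \<Otimes>\<^sub>M lborel)" using assms by (simp add: lborel_prod)
  from lborel_pair.integral_product_swap[OF this] show ?thesis by (simp add: lborel_prod case_prod_unfold)
qed

text \<open>At real points conjugation inverts the phases of the kernel, and exchanging the two
  integration variables restores them with the factors interchanged.\<close>

lemma tw_cnj:
  assumes A: "rapid A" and B: "rapid B"
  shows "cnj (tw A B (emb x)) = tw (\<lambda>z. cnj (B (cnj (fst z), cnj (snd z)))) (\<lambda>z. cnj (A (cnj (fst z), cnj (snd z)))) (emb x)"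
proof -
  have c: "cnj (ewave (emb u) (emb v)) = ewave (emb v) (emb u)" for u v
    by (simp add: ewave_def omega_def exp_cnj algebra_simps)
  have c': "cnj (ewave (- emb u) (emb v)) = ewave (emb u) (emb v)" for u v
    by (simp add: ewave_def omega_def exp_cnj algebra_simps)
  have c'': "cnj (ewave (emb u) (emb v)) = ewave (- emb u) (emb v)" for u v
    by (simp add: ewave_def omega_def exp_cnj algebra_simps)
  have e: "(complex_of_real (fst u), complex_of_real (snd u)) = emb u" for u by (simp add: emb_def)
  have "cnj (tw A B (emb x)) = 4 * (\<integral>p. cnj (A (emb (fst p)) * B (emb (snd p)) *
     (ewave (emb x) (emb (fst p)) * ewave (- emb x) (emb (snd p)) * ewave (emb (fst p)) (emb (snd p)))) \<partial>lborel)"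
    unfolding tw_def complex_cnj_mult[of 4] by (subst Bochner_Integration.integral_cnj[symmetric]) simp
  also have "\<dots> = 4 * (\<integral>p. cnj (A (emb (snd p)) * B (emb (fst p)) *
     (ewave (emb x) (emb (snd p)) * ewave (- emb x) (emb (fst p)) * ewave (emb (snd p)) (emb (fst p)))) \<partial>lborel)"
    by (subst integral_swap_lborel) (use tw_integrable[OF A B, of "emb x"] in \<open>simp_all only: integrable_cnj fst_conv snd_conv\<close>)
  also have "\<dots> = tw (\<lambda>z. cnj (B (cnj (fst z), cnj (snd z)))) (\<lambda>z. cnj (A (cnj (fst z), cnj (snd z)))) (emb x)"
    unfolding tw_def
    by (intro arg_cong[where f = "\<lambda>t. 4 * t"] Bochner_Integration.integral_cong refl)
      (simp only: complex_cnj_mult c' c''[of x] c[of "snd _"] emb_simps complex_cnj_complex_of_real e mult_ac)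
  finally show ?thesis .
qed

subsection \<open>Weyl operators\<close>

definition res :: "(c2 \<Rightarrow> complex) \<Rightarrow> real \<times> real \<Rightarrow> complex" where
  "res A = (\<lambda>x. A (emb x))"

lemma frakA_res: "a \<in> frakA \<longleftrightarrow> (\<exists>A. rapid A \<and> a = res A)"
  by (simp add: frakA_iff res_def)

lemma res_closed [simp]: "rapid A \<Longrightarrow> res A \<in> frakA"
  by (auto simp: frakA_res)

lemma frakAE: assumes "a \<in> frakA" obtains A where "rapid A" "a = res A"
  using assms by (auto simp: frakA_res)

lemma entire_ext_res [simp]: "rapid A \<Longrightarrow> entire_ext (res A) = A"
  unfolding res_def by (rule entire_ext_emb)

lemma A_R2_simps [simp]:
  "carrier A_R2 = frakA" "mult A_R2 = twisted_prod" "zero A_R2 = (\<lambda>x. 0)"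
  "add A_R2 = (\<lambda>a b x. a x + b x)" "smult A_R2 = (\<lambda>c a x. c * a x)" "star A_R2 = (\<lambda>a x. cnj (a x))"
  by (simp_all add: A_R2_def)

lemma res_ops:
  "(\<lambda>x. res A x + res B x) = res (\<lambda>z. A z + B z)" "(\<lambda>x. c * res A x) = res (\<lambda>z. c * A z)"
  by (simp_all add: res_def)

lemma complex_vs_A: "complex_vs A_R2"
proof (rule complex_vsI)
  have "rapid (\<lambda>z. 0)" by (rule rapidI[OF entire2_const]) (auto intro!: exI[of _ 0])
  thus "\<zero>\<^bsub>A_R2\<^esub> \<in> carrier A_R2" by (auto simp: res_def dest!: res_closed)
qed (auto elim!: frakAE simp: res_ops rapid_add rapid_cmult, (simp add: res_def algebra_simps)+)

interpretation A: complex_vs A_R2 by (rule complex_vs_A)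

text \<open>Operators are defined on functions of real variables, while the computations take place
  on the entire extensions; linearity is transported from there.\<close>

lemma lin_map_res:
  assumes "\<And>A. rapid A \<Longrightarrow> rapid (T A)" "\<And>A. rapid A \<Longrightarrow> f (res A) = res (T A)"
    "\<And>A B. T (\<lambda>z. A z + B z) = (\<lambda>z. T A z + T B z)" "\<And>c A. T (\<lambda>z. c * A z) = (\<lambda>z. c * T A z)"
  shows "lin_map A_R2 A_R2 f"
proof (rule lin_mapI)
  show "f x \<in> carrier A_R2" if "x \<in> carrier A_R2" for x
    using that assms(1,2) by (auto elim!: frakAE)
qed (auto elim!: frakAE simp: res_ops assms rapid_add rapid_cmult)

lemma qpow_mult_assoc: "qpow \<gamma> a * (qpow \<gamma> b * x) = qpow \<gamma> (a + b) * x"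
  by (simp add: qpow_add flip: mult.assoc)

locale q_plane =
  fixes \<alpha> \<beta> \<gamma> :: real
  assumes prod: "\<alpha> * \<beta> = \<gamma>" and lam: "qlam \<gamma> \<noteq> 0"
begin

definition lat :: "real \<Rightarrow> real \<Rightarrow> c2" where
  "lat m n = imag2 (- (\<beta> * n / 2), \<alpha> * m / 2)"

lemma lat_simps:
  "lat m n + lat k l = lat (m + k) (n + l)" "- lat m n = lat (- m) (- n)" "lat 0 0 = 0"
  by (simp_all add: lat_def imag2_def algebra_simps add_divide_distrib zero_prod_def)

text \<open>Here \<open>\<alpha> * \<beta> = \<gamma>\<close> enters: on the lattice all symplectic
  phases are powers of q.\<close>

lemma ewave_lat: "ewave (lat m n) (lat k l) = qpow \<gamma> ((n * k - m * l) / 2)"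
proof -
  have "4 * of_real pi * \<i> * omega (lat m n) (lat k l) = 2 * of_real pi * \<i> * of_real (\<alpha> * \<beta>) * of_real ((n * k - m * l) / 2)"
    by (simp add: omega_def lat_def imag2_def algebra_simps)
  thus ?thesis by (simp only: ewave_def qpow_def prod)
qed

text \<open>
  \<open>lat m n = m c + n d\<close> with \<open>c = (0, i\<alpha>/2)\<close> and \<open>d = (- i\<beta>/2, 0)\<close>, so that \<open>ewave c d = q\<^sup>-\<^sup>1\<^sup>/\<^sup>2\<close>. The two index pairs
  of \<open>W\<close> are the exponent and the translation.
\<close>

definition W :: "real \<Rightarrow> real \<Rightarrow> real \<Rightarrow> real \<Rightarrow> (c2 \<Rightarrow> complex) \<Rightarrow> c2 \<Rightarrow> complex" where
  "W m n k l A = (\<lambda>z. ewave (lat m n) z * A (z + lat k l))"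

lemma rapid_W: "rapid A \<Longrightarrow> rapid (W m n k l A)"
  unfolding W_def by (intro rapid_ewave rapid_shift)

declare rapid_W [simp]

lemma W_0 [simp]: "W 0 0 0 0 A = A"
  by (simp add: W_def lat_simps)

lemma W_lin:
  "W m n k l (\<lambda>z. A z + B z) = (\<lambda>z. W m n k l A z + W m n k l B z)"
  "W m n k l (\<lambda>z. A z - B z) = (\<lambda>z. W m n k l A z - W m n k l B z)"
  "W m n k l (\<lambda>z. c * A z) = (\<lambda>z. c * W m n k l A z)"
  "W m n k l (\<lambda>z. A z / c) = (\<lambda>z. W m n k l A z / c)"
  by (simp_all add: W_def algebra_simps)

text \<open>The phase arises from moving the translation by \<open>lat k l\<close> past the
  exponential of \<open>lat m' n'\<close>; otherwise the indices add up.\<close>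

lemma W_W: "W m n k l (W m' n' k' l' A)
    = (\<lambda>z. qpow \<gamma> ((n' * k - m' * l) / 2) * W (m + m') (n + n') (k + k') (l + l') A z)"
proof
  fix z
  have "ewave (lat m n) z * ewave (lat m' n') (z + lat k l) = qpow \<gamma> ((n' * k - m' * l) / 2) * ewave (lat (m + m') (n + n')) z"
    by (simp add: ewave_add_right ewave_lat ewave_add_left mult_ac flip: lat_simps(1))
  thus "W m n k l (W m' n' k' l' A) z = qpow \<gamma> ((n' * k - m' * l) / 2) * W (m + m') (n + n') (k + k') (l + l') A z"
    by (simp add: W_def add.assoc lat_simps flip: mult.assoc)
qed

text \<open>The indices are read off with \<open>res_W\<close>: the exponent (-1, 1) is exp (2 pi
  (\<beta> x2 - \<alpha> x1)), \<open>l = -2\<close> moves x1 by \<beta> i, and \<open>k = 2\<close>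
  moves x2 by \<alpha> i.\<close>

fun gen_op :: "ugen \<Rightarrow> (c2 \<Rightarrow> complex) \<Rightarrow> c2 \<Rightarrow> complex" where
  "gen_op UE A = (\<lambda>z. 1 / qlam \<gamma> * (W (-1) 1 0 (-2) A z - W (-1) 1 0 2 A z))"
| "gen_op UF A = (\<lambda>z. 1 / qlam \<gamma> * (W 1 (-1) 2 0 A z - W 1 (-1) (-2) 0 A z))"
| "gen_op UK1 A = W 0 0 0 1 A"
| "gen_op UK1i A = W 0 0 0 (-1) A"
| "gen_op UK2 A = W 0 0 (-1) 0 A"
| "gen_op UK2i A = W 0 0 1 0 A"

fun left_op :: "ogen \<Rightarrow> (c2 \<Rightarrow> complex) \<Rightarrow> c2 \<Rightarrow> complex" where
  "left_op OX = W 1 0 1 0" | "left_op OY = W 0 1 0 1"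

fun right_op :: "ogen \<Rightarrow> (c2 \<Rightarrow> complex) \<Rightarrow> c2 \<Rightarrow> complex" where
  "right_op OX = W 1 0 (-1) 0" | "right_op OY = W 0 1 0 (-1)"

lemma rapid_ops [simp]:
  assumes "rapid A" shows "rapid (gen_op g A)" "rapid (left_op a A)" "rapid (right_op a A)"
proof -
  show "rapid (gen_op g A)"
    using assms by (cases g) (auto simp del: times_divide_eq_left simp: intro!: rapid_cmult rapid_diff rapid_W)
  show "rapid (left_op a A)" "rapid (right_op a A)" using assms by (cases a; simp add: rapid_W)+
qed

lemma emb_lat: fixes k l :: real shows "emb x + lat k l = (of_real (fst x) - \<beta> * l / 2 * \<i>, of_real (snd x) + \<alpha> * k / 2 * \<i>)"
  by (simp add: lat_def imag2_def prod_eq_iff)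

lemma ewave_lat_emb: fixes m n :: real shows "ewave (lat m n) (emb x) = exp (2 * pi * (n * \<beta> * snd x + m * \<alpha> * fst x))"
proof -
  have "4 * of_real pi * \<i> * omega (lat m n) (emb x) = of_real (2 * pi * (n * \<beta> * snd x + m * \<alpha> * fst x))"
    by (simp add: omega_def lat_def imag2_def algebra_simps)
  thus ?thesis by (simp only: ewave_def exp_of_real)
qed

lemma res_W:
  fixes k l m n x1 x2 :: real and A :: "c2 \<Rightarrow> complex"
  shows "res (W m n k l A) (x1, x2) = exp (2 * pi * (n * \<beta> * x2 + m * \<alpha> * x1))
    * A (of_real x1 - \<beta> * l / 2 * \<i>, of_real x2 + \<alpha> * k / 2 * \<i>)"
  by (auto simp: res_def W_def ewave_lat_emb emb_lat exp_of_real)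

lemma gen_act_res:
  assumes "rapid A"
  shows "fa_gen_act \<gamma> \<alpha> \<beta> g (res A) = res (gen_op g A)"
proof -
  have d: "res (\<lambda>z. c * (B z - C z)) x = c * (res B x - res C x)" for c B C x
    by (auto simp: res_def)
  have "fa_gen_act \<gamma> \<alpha> \<beta> g (res A) (x1, x2) = res (gen_op g A) (x1, x2)" for x1 x2
    using assms
    by (cases g) (simp_all only: gen_op.simps d fa_gen_act.simps entire_ext_res res_W prod.case,
      auto simp: algebra_simps diff_divide_distrib)
  thus ?thesis by auto
qed

lemma mult_gen_res:
  assumes "rapid A"
  shows "left_mult_gen \<alpha> \<beta> a (res A) = res (left_op a A)" "right_mult_gen \<alpha> \<beta> a (res A) = res (right_op a A)"
  using assms by (cases a; auto simp: res_W mult_ac)+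

declare fa_gen_act.simps [simp del] left_mult_gen.simps [simp del] right_mult_gen.simps [simp del]

lemma gen_op_lin:
  "gen_op g (\<lambda>z. A z + B z) = (\<lambda>z. gen_op g A z + gen_op g B z)"
  "gen_op g (\<lambda>z. c * A z) = (\<lambda>z. c * gen_op g A z)"
  by (cases g; simp add: W_lin; simp add: fun_eq_iff add_divide_distrib diff_divide_distrib)
    (cases g; simp add: W_lin; simp add: fun_eq_iff right_diff_distrib)

lemma mult_op_lin:
  "left_op a (\<lambda>z. A z + B z) = (\<lambda>z. left_op a A z + left_op a B z)"
  "left_op a (\<lambda>z. c * A z) = (\<lambda>z. c * left_op a A z)"
  "right_op a (\<lambda>z. A z + B z) = (\<lambda>z. right_op a A z + right_op a B z)"
  "right_op a (\<lambda>z. c * A z) = (\<lambda>z. c * right_op a A z)"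
  by (cases a; simp add: W_lin)+

lemma gen_act_lin: "lin_map A_R2 A_R2 (fa_gen_act \<gamma> \<alpha> \<beta> g)"
  by (rule lin_map_res[where T = "gen_op g"]) (simp_all add: gen_act_res gen_op_lin)

lemma mult_gen_lin: "lin_map A_R2 A_R2 (left_mult_gen \<alpha> \<beta> a)" "lin_map A_R2 A_R2 (right_mult_gen \<alpha> \<beta> a)"
  by (rule lin_map_res[where T = "left_op a"] lin_map_res[where T = "right_op a"];
    simp add: mult_gen_res mult_op_lin)+

lemma gen_op_rels:
  "gen_op UK1 (gen_op UK2 A) = gen_op UK2 (gen_op UK1 A)"
  "gen_op UK1 (gen_op UK1i A) = A" "gen_op UK1i (gen_op UK1 A) = A"
  "gen_op UK2 (gen_op UK2i A) = A" "gen_op UK2i (gen_op UK2 A) = A"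
  "gen_op UK1 (gen_op UE (gen_op UK1i A)) = (\<lambda>z. qpow \<gamma> (1/2) * gen_op UE A z)"
  "gen_op UK2 (gen_op UE (gen_op UK2i A)) = (\<lambda>z. qpow \<gamma> (-1/2) * gen_op UE A z)"
  "gen_op UK1 (gen_op UF (gen_op UK1i A)) = (\<lambda>z. qpow \<gamma> (-1/2) * gen_op UF A z)"
  "gen_op UK2 (gen_op UF (gen_op UK2i A)) = (\<lambda>z. qpow \<gamma> (1/2) * gen_op UF A z)"
  by (simp_all add: W_lin W_W right_diff_distrib)

text \<open>The exponents of E and F cancel, so E F and F E are combinations of the same four
  translations. The coefficients agree for (2, -2) and (-2, 2); for (2, 2) and (-2, -2) they differ
  by q - q^(-1), which cancels one of the two factors 1 / \<open>qlam \<gamma>\<close>.\<close>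

lemma gen_op_EF:
  "gen_op UE (gen_op UF A) z + 1 / qlam \<gamma> * gen_op UK2 (gen_op UK1i (gen_op UK2 (gen_op UK1i A))) z
    = gen_op UF (gen_op UE A) z + 1 / qlam \<gamma> * gen_op UK1 (gen_op UK2i (gen_op UK1 (gen_op UK2i A))) z"
  using lam by (simp add: W_lin W_W qpow_mult_assoc qpow_add field_simps) (simp add: qlam_def algebra_simps)

lemma uq_ops_A: "uq_ops A_R2 \<gamma> (fa_gen_act \<gamma> \<alpha> \<beta>)"
proof (intro uq_ops.intro uq_ops_axioms.intro complex_vs_A gen_act_lin)
  fix v assume "v \<in> carrier A_R2"
  then obtain A where A: "rapid A" "v = res A" by (auto elim!: frakAE)
  note s = A gen_act_res res_ops W_lin W_W qpow_mult_assoc qpow_add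
  show "fa_gen_act \<gamma> \<alpha> \<beta> UE (fa_gen_act \<gamma> \<alpha> \<beta> UF v) \<oplus>\<^bsub>A_R2\<^esub> (1 / qlam \<gamma>) \<odot>\<^bsub>A_R2\<^esub>
       fa_gen_act \<gamma> \<alpha> \<beta> UK2 (fa_gen_act \<gamma> \<alpha> \<beta> UK1i (fa_gen_act \<gamma> \<alpha> \<beta> UK2 (fa_gen_act \<gamma> \<alpha> \<beta> UK1i v)))
     = fa_gen_act \<gamma> \<alpha> \<beta> UF (fa_gen_act \<gamma> \<alpha> \<beta> UE v) \<oplus>\<^bsub>A_R2\<^esub> (1 / qlam \<gamma>) \<odot>\<^bsub>A_R2\<^esub>
       fa_gen_act \<gamma> \<alpha> \<beta> UK1 (fa_gen_act \<gamma> \<alpha> \<beta> UK2i (fa_gen_act \<gamma> \<alpha> \<beta> UK1 (fa_gen_act \<gamma> \<alpha> \<beta> UK2i v)))"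
    using A by (simp add: gen_act_res res_ops gen_op_EF del: gen_op.simps times_divide_eq_left)
qed (auto elim!: frakAE simp: gen_act_res res_ops gen_op_rels simp del: gen_op.simps)

end

subsection \<open>The twisted product and Weyl operators\<close>

lemma tw_add_left:
  assumes "rapid A" "rapid B" "rapid C"
  shows "tw (\<lambda>z. A z + B z) C = (\<lambda>z. tw A C z + tw B C z)"
proof
  fix z
  show "tw (\<lambda>z. A z + B z) C z = tw A C z + tw B C z"
    unfolding tw_def distrib_left[of 4, symmetric]
    by (subst Bochner_Integration.integral_add[symmetric, OF tw_integrable tw_integrable])
      (use assms in \<open>simp_all add: algebra_simps\<close>)
qed

lemma tw_add_right:
  assumes "rapid A" "rapid B" "rapid C"
  shows "tw A (\<lambda>z. B z + C z) = (\<lambda>z. tw A B z + tw A C z)"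
proof
  fix z
  show "tw A (\<lambda>z. B z + C z) z = tw A B z + tw A C z"
    unfolding tw_def distrib_left[of 4, symmetric]
    by (subst Bochner_Integration.integral_add[symmetric, OF tw_integrable tw_integrable])
      (use assms in \<open>simp_all add: algebra_simps\<close>)
qed

lemma tw_cmult: "tw (\<lambda>z. c * A z) B = (\<lambda>z. c * tw A B z)" "tw A (\<lambda>z. c * B z) = (\<lambda>z. c * tw A B z)"
  unfolding tw_def mult.left_commute[of c 4] integral_mult_right_zero[symmetric] by (simp_all add: mult_ac)

lemma tw_diff_left:
  assumes "rapid A" "rapid B" "rapid C"
  shows "tw (\<lambda>z. A z - B z) C = (\<lambda>z. tw A C z - tw B C z)"
  using tw_add_left[OF assms(1) rapid_cmult[OF assms(2), of "-1"] assms(3)] tw_cmult(1)[of "-1" B C] by simp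

lemma tw_diff_right:
  assumes "rapid A" "rapid B" "rapid C"
  shows "tw A (\<lambda>z. B z - C z) = (\<lambda>z. tw A B z - tw A C z)"
  using tw_add_right[OF assms(1,2) rapid_cmult[OF assms(3), of "-1"]] tw_cmult(2)[of A "-1" C] by simp

lemma twisted_prod_res: "twisted_prod (res A) (res B) = res (tw A B)"
  unfolding res_def by (rule twisted_prod_emb)

context q_plane
begin

text \<open>Twisted products with all translations removed: the normal form in \<open>tw_W\<close> below.\<close>

definition tw_nf :: "(c2 \<Rightarrow> complex) \<Rightarrow> (c2 \<Rightarrow> complex) \<Rightarrow> real \<Rightarrow> real \<Rightarrow> real \<Rightarrow> real \<Rightarrow> c2 \<Rightarrow> complex" where
  "tw_nf A B m n m' n' = tw (W m n 0 0 A) (W m' n' 0 0 B)"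

text \<open>By \<open>tw_shift\<close>, translating the argument of a twisted product multiplies its
  two factors by opposite exponentials.\<close>

lemma W_tw: "W m n k l (tw A B) = (\<lambda>z. ewave (lat m n) z * tw_nf A B k l (- k) (- l) z)"
  by (simp add: W_def tw_nf_def tw_shift lat_simps)

text \<open>\<open>tw_left\<close> removes the translation of the first factor but needs
  \<open>ewave (lat k l)\<close> in the second, whose remaining exponent drops by (k, l).
  \<open>tw_right\<close> then removes the translation of the second factor and raises the exponent
  of the first by (k', l'). The power of q collects the exponentials evaluated at the
  translations.\<close>

lemma tw_W:
  assumes A: "rapid A" and B: "rapid B"
  shows "tw (W m n k l A) (W m' n' k' l' B) = (\<lambda>z. qpow \<gamma> ((m * l - n * k + (m' - k) * l' - (n' - l) * k') / 2)
    * (ewave (lat (k - k') (l - l')) z * tw_nf A B (m + k') (n + l') (m' - k) (n' - l) z))"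
proof
  fix z
  define A1 where "A1 = W m n 0 0 A"
  define B1 where "B1 = W (m' - k) (n' - l) 0 0 B"
  have r: "rapid A1" "rapid B1" using A B by (simp_all add: A1_def B1_def)
  have "W m n k l A = (\<lambda>u. qpow \<gamma> ((m * l - n * k) / 2) * A1 (u + lat k l))"
    by (rule ext) (simp add: A1_def W_def ewave_add_right ewave_lat lat_simps qpow_mult_assoc qpow_add mult_ac flip: add_divide_distrib)
  moreover have "W m' n' k' l' B = (\<lambda>v. qpow \<gamma> (((m' - k) * l' - (n' - l) * k') / 2) * (ewave (lat k l) v * B1 (v + lat k' l')))"
  proof
    fix v
    let ?q = "qpow \<gamma> (((m' - k) * l' - (n' - l) * k') / 2)" and ?e = "ewave (lat (m' - k) (n' - l))"
    have 1: "ewave (lat k l) v * ?e v = ewave (lat m' n') v" by (simp add: lat_simps flip: ewave_add_left)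
    have 2: "?q * ?e (lat k' l') = 1"
      by (simp add: ewave_lat qpow_add flip: add_divide_distrib)
    have "?q * (ewave (lat k l) v * B1 (v + lat k' l')) = (?q * ?e (lat k' l')) * (ewave (lat k l) v * ?e v) * B (v + lat k' l')"
      by (simp add: B1_def W_def ewave_add_right lat_simps mult_ac)
    thus "W m' n' k' l' B v = ?q * (ewave (lat k l) v * B1 (v + lat k' l'))" unfolding 1 2 by (simp add: W_def)
  qed
  ultimately have "tw (W m n k l A) (W m' n' k' l' B) z = qpow \<gamma> ((m * l - n * k + (m' - k) * l' - (n' - l) * k') / 2)
     * tw (\<lambda>u. A1 (u + lat k l)) (\<lambda>v. ewave (lat k l) v * B1 (v + lat k' l')) z"
    by (simp only: tw_cmult qpow_mult_assoc) (simp add: add_divide_distrib diff_divide_distrib algebra_simps)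
  also have "tw (\<lambda>u. A1 (u + lat k l)) (\<lambda>v. ewave (lat k l) v * B1 (v + lat k' l')) z
     = ewave (lat k l) z * tw A1 (\<lambda>v. B1 (v + lat k' l')) z"
    unfolding lat_def by (rule tw_left[OF r(1) rapid_shift[OF r(2)]])
  also have "A1 = (\<lambda>u. ewave (- lat k' l') u * W (m + k') (n + l') 0 0 A u)"
    by (rule ext) (simp add: A1_def W_def lat_simps flip: mult.assoc ewave_add_left)
  also have "tw \<dots> (\<lambda>v. B1 (v + lat k' l')) z = ewave (- lat k' l') z * tw (W (m + k') (n + l') 0 0 A) B1 z"
    unfolding lat_def by (rule tw_right[OF rapid_W[OF A, unfolded lat_def] r(2)])
  finally show "tw (W m n k l A) (W m' n' k' l' B) z = qpow \<gamma> ((m * l - n * k + (m' - k) * l' - (n' - l) * k') / 2)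
    * (ewave (lat (k - k') (l - l')) z * tw_nf A B (m + k') (n + l') (m' - k) (n' - l) z)"
    by (simp add: tw_nf_def B1_def lat_simps flip: mult.assoc ewave_add_left)
qed

lemmas tw_W1 = tw_W[where m' = 0 and n' = 0 and k' = 0 and l' = 0, simplified]
lemmas tw_W2 = tw_W[where m = 0 and n = 0 and k = 0 and l = 0, simplified]

lemmas tw_lin = tw_add_left tw_add_right tw_diff_left tw_diff_right tw_cmult

text \<open>In normal form the right-hand side has four terms. Two of them cancel against each
  other, and the other two are the left-hand side.\<close>

lemma gen_op_tw_skew:
  assumes "g = UE \<or> g = UF" and A: "rapid A" and B: "rapid B"
  shows "gen_op g (tw A B) = (\<lambda>z. tw (gen_op g A) (gen_op UK1 (gen_op UK2i B)) z + tw (gen_op UK2 (gen_op UK1i A)) (gen_op g B) z)"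
  using assms(1)
  by (rule disjE) (simp_all add: A B W_tw W_W tw_lin tw_W rapid_diff rapid_cmult lat_simps algebra_simps del: times_divide_eq_left)

lemma gen_op_tw_aut:
  assumes "g \<noteq> UE" "g \<noteq> UF" and A: "rapid A" and B: "rapid B"
  shows "gen_op g (tw A B) = tw (gen_op g A) (gen_op g B)"
  using assms(1,2) by (cases g) (simp_all add: A B W_tw tw_W lat_simps)

text \<open>Exponent and translation are equal for left and opposite for right multiplications;
  precisely then both sides have the same normal form.\<close>

lemma mult_op_tw:
  assumes A: "rapid A" and B: "rapid B"
  shows "left_op a (tw A B) = tw (left_op a A) B" "right_op a (tw A B) = tw A (right_op a B)"
    "tw (right_op a A) B = tw A (left_op a B)"
  by (cases a; simp add: A B W_tw tw_W1 tw_W2 lat_simps)+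

lemma mult_op_commute: "left_op a (right_op b A) = right_op b (left_op a A)"
  by (cases a; cases b; simp add: W_W)

lemma mult_op_rel:
  "left_op OX (left_op OY A) = (\<lambda>z. qpow \<gamma> 1 * left_op OY (left_op OX A) z)"
  "right_op OY (right_op OX A) = (\<lambda>z. qpow \<gamma> 1 * right_op OX (right_op OY A) z)"
  by (simp_all add: W_W qpow_mult_assoc)

end

subsection \<open>The bimodule structure of \<open>\<AA>(\<real>\<^sup>2)\<close>\<close>

lemma lin_map_comp: "lin_map V V' f \<Longrightarrow> lin_map V' V'' g \<Longrightarrow> lin_map V V'' (\<lambda>x. g (f x))"
  by (auto simp: lin_map_def Pi_iff)

lemma lin_map_plus_A:
  assumes "lin_map V A_R2 f" "lin_map V A_R2 g" shows "lin_map V A_R2 (\<lambda>x t. f x t + g x t)"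
  using assms A.a_closed[of "f _" "g _"] unfolding lin_map_def
  by (simp add: Pi_iff) (simp add: algebra_simps)

text \<open>Induction scheme for identities between iterated multiplications. The vector
  \<open>a\<close> stays arbitrary because a generator may be absorbed into it before the hypothesis
  for \<open>z\<close> is used.\<close>

lemma oq_lin_eqI:
  assumes z: "z \<in> carrier (oq_algebra \<gamma>)" and a: "a \<in> frakA"
    and lin: "\<And>a. a \<in> frakA \<Longrightarrow> lin_map (oq_algebra \<gamma>) V (\<lambda>z. f z a)"
      "\<And>a. a \<in> frakA \<Longrightarrow> lin_map (oq_algebra \<gamma>) V (\<lambda>z. f' z a)"
    and one: "\<And>a. a \<in> frakA \<Longrightarrow> f \<one>\<^bsub>oq_algebra \<gamma>\<^esub> a = f' \<one>\<^bsub>oq_algebra \<gamma>\<^esub> a"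
    and gen: "\<And>g z a. \<lbrakk>z \<in> carrier (oq_algebra \<gamma>); \<And>a. a \<in> frakA \<Longrightarrow> f z a = f' z a; a \<in> frakA\<rbrakk>
      \<Longrightarrow> f (omono \<gamma> 1 [g] \<otimes>\<^bsub>oq_algebra \<gamma>\<^esub> z) a = f' (omono \<gamma> 1 [g] \<otimes>\<^bsub>oq_algebra \<gamma>\<^esub> z) a"
  shows "f z a = f' z a"
  using z a
  by (induction z arbitrary: a rule: oq_induct)
    (simp_all add: one gen lin_mapD(2,3)[OF lin(1)] lin_mapD(2,3)[OF lin(2)])

text \<open>The entire extension of the pointwise conjugate on real points.\<close>

definition cn :: "(c2 \<Rightarrow> complex) \<Rightarrow> c2 \<Rightarrow> complex" where
  "cn A = (\<lambda>z. cnj (A (cnj (fst z), cnj (snd z))))"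

lemma rapid_cn [simp]: "rapid A \<Longrightarrow> rapid (cn A)"
  unfolding cn_def by (rule rapid_cnj)

lemma cnj_res: "(\<lambda>x. cnj (res A x)) = res (cn A)"
  by (simp add: res_def cn_def emb_def)

lemma cn_tw: "rapid A \<Longrightarrow> rapid B \<Longrightarrow> res (cn (tw A B)) = res (tw (cn B) (cn A))"
  unfolding cnj_res[symmetric] unfolding res_def cn_def by (rule ext) (rule tw_cnj)

lemma rapid_tw_simp [simp]: "rapid A \<Longrightarrow> rapid B \<Longrightarrow> rapid (tw A B)"
  by (rule rapid_tw)

lemma frakA_mult: "\<lbrakk>a \<in> frakA; b \<in> frakA\<rbrakk> \<Longrightarrow> twisted_prod a b \<in> frakA"
  by (auto elim!: frakAE simp: twisted_prod_res)

lemma frakA_ops [simp]: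
  "\<lbrakk>a \<in> frakA; b \<in> frakA\<rbrakk> \<Longrightarrow> (\<lambda>x. a x + b x) \<in> frakA" "a \<in> frakA \<Longrightarrow> (\<lambda>x. c * a x) \<in> frakA"
  "(\<lambda>x. 0) \<in> frakA" "a \<in> frakA \<Longrightarrow> (\<lambda>x. cnj (a x)) \<in> frakA"
  using A.a_closed[of a b] A.sm_closed[of a c] A.zero_closed by (auto elim!: frakAE simp: cnj_res)

lemma twisted_prod_lin:
  assumes "a \<in> frakA" "b \<in> frakA" "d \<in> frakA"
  shows "twisted_prod (\<lambda>x. a x + b x) d = (\<lambda>x. twisted_prod a d x + twisted_prod b d x)"
    "twisted_prod d (\<lambda>x. a x + b x) = (\<lambda>x. twisted_prod d a x + twisted_prod d b x)"
    "twisted_prod (\<lambda>x. c * a x) d = (\<lambda>x. c * twisted_prod a d x)"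
    "twisted_prod d (\<lambda>x. c * a x) = (\<lambda>x. c * twisted_prod d a x)"
  using assms by (auto elim!: frakAE simp: twisted_prod_res res_ops tw_add_left tw_add_right tw_cmult)

lemma twisted_prod_assoc:
  "\<lbrakk>a \<in> frakA; b \<in> frakA; d \<in> frakA\<rbrakk> \<Longrightarrow> twisted_prod (twisted_prod a b) d = twisted_prod a (twisted_prod b d)"
  by (auto elim!: frakAE simp: twisted_prod_res) (simp add: res_def tw_assoc)

lemma twisted_prod_star:
  "\<lbrakk>a \<in> frakA; b \<in> frakA\<rbrakk> \<Longrightarrow> (\<lambda>x. cnj (twisted_prod a b x)) = twisted_prod (\<lambda>x. cnj (b x)) (\<lambda>x. cnj (a x))"
  by (auto elim!: frakAE simp: twisted_prod_res cnj_res cn_tw)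

context q_plane
begin

declare gen_op.simps [simp del] left_op.simps [simp del] right_op.simps [simp del]

text \<open>\<open>ewave (lat m n)\<close> is real at real points, so the exponent is kept, while
  the imaginary translation changes sign.\<close>

lemma cn_W: "cn (W m n k l A) = W m n (- k) (- l) (cn A)"
proof
  fix z :: c2
  have "cnj (ewave (lat m n) (cnj (fst z), cnj (snd z))) = ewave (lat m n) z"
    by (simp add: ewave_def omega_def lat_def imag2_def exp_cnj algebra_simps)
  thus "cn (W m n k l A) z = W m n (- k) (- l) (cn A) z"
    by (simp add: cn_def W_def lat_def imag2_def)
qed

text \<open>For E and F two signs cancel: conjugation negates 1 / \<open>qlam \<gamma>\<close> and
  exchanges the two translations in the difference.\<close>

lemma cn_gen_op: "cn (gen_op g A) = gen_op (inv_gen g) (cn A)"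
proof -
  have "cn (\<lambda>z. 1 / qlam \<gamma> * (B z - C z)) = (\<lambda>z. 1 / qlam \<gamma> * (cn C z - cn B z))" for B C
    by (simp add: cn_def minus_divide_left)
  thus ?thesis by (cases g) (simp_all only: gen_op.simps inv_gen.simps cn_W, simp_all)
qed

lemma cn_mult_op: "cn (left_op a A) = right_op a (cn A)"
  by (cases a; simp add: cn_W left_op.simps right_op.simps)

abbreviation "D \<equiv> fa_gen_act \<gamma> \<alpha> \<beta>"
abbreviation "Lg \<equiv> left_mult_gen \<alpha> \<beta>"
abbreviation "Rg \<equiv> right_mult_gen \<alpha> \<beta>"
abbreviation "Lm \<equiv> left_mult \<alpha> \<beta>"
abbreviation "Rm \<equiv> right_mult \<alpha> \<beta>"
abbreviation "Oq \<equiv> oq_algebra \<gamma>"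

lemmas gen_res = gen_act_res mult_gen_res twisted_prod_res res_ops cnj_res

lemmas D_lin = lin_mapD[OF gen_act_lin, simplified]
lemmas Lg_lin = lin_mapD[OF mult_gen_lin(1), simplified]
lemmas Rg_lin = lin_mapD[OF mult_gen_lin(2), simplified]

lemma left_rep: "left_word_rep A_R2 (oq_rels \<gamma>) (foldr Lg)"
proof (rule A.left_word_repI[OF mult_gen_lin(1)])
  fix r v assume r: "r \<in> oq_rels \<gamma>" and v: "v \<in> carrier A_R2"
  have w: "foldr Lg w v \<in> carrier A_R2" for w using v by (induction w) (auto simp: Lg_lin)
  have "Lg OX (Lg OY v) = (\<lambda>x. qpow \<gamma> 1 * Lg OY (Lg OX v) x)"
    using v by (auto elim!: frakAE simp: gen_res mult_op_rel)
  thus "lin_ext A_R2 (\<lambda>w. foldr Lg w v) r = \<zero>\<^bsub>A_R2\<^esub>"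
    using r w A.r_neg[of "\<lambda>x. qpow \<gamma> 1 * Lg OY (Lg OX v) x"] v
    by (simp add: A.lin_map_minus_free[OF A.lin_map_lin_ext_free[OF w]] A.lin_ext_single A.minus_eq Lg_lin)
qed

lemma right_rep: "right_word_rep A_R2 (oq_rels \<gamma>) (fold Rg)"
proof (rule A.right_word_repI[OF mult_gen_lin(2)])
  fix r v assume r: "r \<in> oq_rels \<gamma>" and v: "v \<in> carrier A_R2"
  have w: "fold Rg w v \<in> carrier A_R2" for w using v by (induction w arbitrary: v) (auto simp: Rg_lin)
  have "Rg OY (Rg OX v) = (\<lambda>x. qpow \<gamma> 1 * Rg OX (Rg OY v) x)"
    using v by (auto elim!: frakAE simp: gen_res mult_op_rel)
  thus "lin_ext A_R2 (\<lambda>w. fold Rg w v) r = \<zero>\<^bsub>A_R2\<^esub>"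
    using r w A.r_neg[of "\<lambda>x. qpow \<gamma> 1 * Rg OX (Rg OY v) x"] v
    by (simp add: A.lin_map_minus_free[OF A.lin_map_lin_ext_free[OF w]] A.lin_ext_single A.minus_eq Rg_lin)
qed

lemma left_mult_eq: "Lm = word_act A_R2 (foldr Lg)"
  by (intro ext) (simp add: left_mult_def word_act_def free_act_def)

lemma right_mult_eq: "Rm = (\<lambda>a z. word_act A_R2 (fold Rg) z a)"
  by (intro ext) (simp add: right_mult_def word_act_def free_right_act_def)

interpretation L: left_word_rep A_R2 "oq_rels \<gamma>" "foldr Lg" by (rule left_rep)
interpretation R: right_word_rep A_R2 "oq_rels \<gamma>" "fold Rg" by (rule right_rep)

lemma Lm_lin_left: "a \<in> frakA \<Longrightarrow> lin_map Oq A_R2 (\<lambda>z. Lm z a)"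
  and Lm_lin_right: "z \<in> carrier Oq \<Longrightarrow> lin_map A_R2 A_R2 (Lm z)"
  and Rm_lin_left: "a \<in> frakA \<Longrightarrow> lin_map Oq A_R2 (Rm a)"
  and Rm_lin_right: "z \<in> carrier Oq \<Longrightarrow> lin_map A_R2 A_R2 (\<lambda>a. Rm a z)"
  using L.word_act_lin_left[of a] L.word_act_lin_right[of z] R.word_act_lin_left[of a] R.word_act_lin_right[of z]
  by (simp_all add: left_mult_eq right_mult_eq oq_algebra_eq)

lemmas Lm_lin = lin_mapD[OF Lm_lin_left, simplified] lin_mapD(2,3)[OF Lm_lin_right, simplified]
lemmas Rm_lin = lin_mapD[OF Rm_lin_left, simplified] lin_mapD(2,3)[OF Rm_lin_right, simplified]

lemma Lm_zero: "a \<in> frakA \<Longrightarrow> Lm \<zero>\<^bsub>Oq\<^esub> a = (\<lambda>x. 0)" "z \<in> carrier Oq \<Longrightarrow> Lm z (\<lambda>x. 0) = (\<lambda>x. 0)"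
  using lin_map_zero[OF O.complex_vs_axioms complex_vs_A Lm_lin_left] lin_map_zero[OF complex_vs_A complex_vs_A Lm_lin_right]
  by simp_all

lemma Rm_zero: "a \<in> frakA \<Longrightarrow> Rm a \<zero>\<^bsub>Oq\<^esub> = (\<lambda>x. 0)" "z \<in> carrier Oq \<Longrightarrow> Rm (\<lambda>x. 0) z = (\<lambda>x. 0)"
  using lin_map_zero[OF O.complex_vs_axioms complex_vs_A Rm_lin_left] lin_map_zero[OF complex_vs_A complex_vs_A Rm_lin_right]
  by simp_all

lemma Lm_mult:
  assumes "a \<in> frakA"
  shows "\<lbrakk>y \<in> carrier Oq; z \<in> carrier Oq\<rbrakk> \<Longrightarrow> Lm (y \<otimes>\<^bsub>Oq\<^esub> z) a = Lm y (Lm z a)"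
    and "Lm \<one>\<^bsub>Oq\<^esub> a = a" and "Lm (omono \<gamma> c [g]) a = (\<lambda>x. c * Lg g a x)"
  using L.word_act_mult[of y z a] L.word_act_one[of a] L.word_act_mono[of a c "[g]"] assms
  by (simp_all add: left_mult_eq oq_algebra_eq omono_eq)

lemma Rm_mult:
  assumes "a \<in> frakA"
  shows "\<lbrakk>y \<in> carrier Oq; z \<in> carrier Oq\<rbrakk> \<Longrightarrow> Rm a (y \<otimes>\<^bsub>Oq\<^esub> z) = Rm (Rm a y) z"
    and "Rm a \<one>\<^bsub>Oq\<^esub> = a" and "Rm a (omono \<gamma> c [g]) = (\<lambda>x. c * Rg g a x)"
  using R.word_act_mult[of y z a] R.word_act_one[of a] R.word_act_mono[of a c "[g]"] assms
  by (simp_all add: right_mult_eq oq_algebra_eq omono_eq)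

lemmas mult_simps = Lm_mult Rm_mult Lm_lin(1) Rm_lin(1) Lg_lin(1) Rg_lin(1) D_lin(1) frakA_mult

lemma twisted_prod_lin_map:
  "a \<in> frakA \<Longrightarrow> lin_map A_R2 A_R2 (twisted_prod a)" "a \<in> frakA \<Longrightarrow> lin_map A_R2 A_R2 (\<lambda>b. twisted_prod b a)"
  by (rule lin_mapI; simp add: twisted_prod_lin frakA_mult)+

lemmas lin_intros = lin_map_plus_A Lm_lin_left Rm_lin_left lin_map_comp[OF _ Lm_lin_right] lin_map_comp[OF _ Rm_lin_right]
  lin_map_comp[OF _ twisted_prod_lin_map(1)] lin_map_comp[OF _ twisted_prod_lin_map(2)] lin_map_comp[OF _ gen_act_lin]

text \<open>Two nested inductions: along \<open>z\<close> for a single generator on the left, then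
  along \<open>y\<close>.\<close>

lemma Lm_Rm:
  assumes "y \<in> carrier Oq" "z \<in> carrier Oq" "a \<in> frakA" shows "Lm y (Rm a z) = Rm (Lm y a) z"
proof -
  have g: "Lg g (Rg h b) = Rg h (Lg g b)" if "b \<in> frakA" for g h b
    using that by (auto elim!: frakAE simp: gen_res mult_op_commute)
  have 1: "Lg g (Rm b z) = Rm (Lg g b) z" if "b \<in> frakA" for g b
    by (rule oq_lin_eqI[OF assms(2) that, where V = A_R2])
      (auto intro!: lin_intros lin_map_comp[OF _ mult_gen_lin(1)] simp: mult_simps g)
  show ?thesis
    by (rule oq_lin_eqI[OF assms(1,3), where V = A_R2])
      (auto intro!: lin_intros assms simp: mult_simps 1 assms(2))
qed

lemma Lm_twisted:
  assumes "z \<in> carrier Oq" "a \<in> frakA" "b \<in> frakA" shows "twisted_prod (Lm z a) b = Lm z (twisted_prod a b)"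
proof -
  have g: "Lg g (twisted_prod a b) = twisted_prod (Lg g a) b" if "a \<in> frakA" for a g
    using that assms(3) by (auto elim!: frakAE simp: gen_res mult_op_tw)
  show ?thesis
    by (rule oq_lin_eqI[OF assms(1,2), where V = A_R2])
      (auto intro!: lin_intros assms frakA_mult simp: mult_simps g[symmetric] assms(3))
qed

lemma Rm_twisted:
  assumes "z \<in> carrier Oq" "a \<in> frakA" "b \<in> frakA" shows "twisted_prod a (Rm b z) = Rm (twisted_prod a b) z"
proof -
  have g: "Rg g (twisted_prod a b) = twisted_prod a (Rg g b)" if "b \<in> frakA" for b g
    using that assms(2) by (auto elim!: frakAE simp: gen_res mult_op_tw)
  show ?thesis
    by (rule oq_lin_eqI[OF assms(1,3), where V = A_R2])
      (auto intro!: lin_intros assms frakA_mult simp: mult_simps g assms(2))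
qed

lemma Rm_Lm_twisted:
  assumes "z \<in> carrier Oq" "a \<in> frakA" "b \<in> frakA" shows "twisted_prod (Rm a z) b = twisted_prod a (Lm z b)"
proof -
  have g: "twisted_prod (Rg g a) b = twisted_prod a (Lg g b)" if "a \<in> frakA" "b \<in> frakA" for a b g
    using that by (auto elim!: frakAE simp: gen_res mult_op_tw)
  show ?thesis
    by (rule oq_lin_eqI[OF assms(1,2), where V = A_R2])
      (auto intro!: lin_intros assms frakA_mult simp: mult_simps g assms(3))
qed

lemma cnj_lin: "lin_map A_R2 (conj_algebra A_R2) (\<lambda>a x. cnj (a x))"
  by (rule lin_mapI) (simp_all add: conj_algebra_def)

lemma lin_map_conj: "lin_map V V' f \<Longrightarrow> lin_map (conj_algebra V) (conj_algebra V') f"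
  by (simp add: lin_map_def conj_algebra_def)

lemma lin_map_opp: "lin_map V V' f \<Longrightarrow> lin_map (opp_algebra V) V' f"
  by (simp add: lin_map_def opp_algebra_def)

text \<open>Both sides are antilinear in \<open>z\<close>, hence linear into the conjugate space,
  where \<open>oq_lin_eqI\<close> applies; on generators the exchange of left and right is
  \<open>cn_mult_op\<close>.\<close>

lemma cnj_Lm:
  assumes "z \<in> carrier Oq" "a \<in> frakA"
  shows "(\<lambda>x. cnj (Lm z a x)) = Rm (\<lambda>x. cnj (a x)) (star (O_R2q \<gamma>) z)"
proof -
  have g: "(\<lambda>x. cnj (Lg g a x)) = Rg g (\<lambda>x. cnj (a x))" if "a \<in> frakA" for a g
    using that by (auto elim!: frakAE simp: gen_res cn_mult_op)
  show ?thesis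
    by (rule oq_lin_eqI[OF assms, where V = "conj_algebra A_R2"])
      (auto intro!: lin_map_comp[OF Lm_lin_left cnj_lin] lin_map_comp[OF alg_homD(1)[OF oq_star_hom(1)] lin_map_conj[OF lin_map_opp[OF Rm_lin_left]]]
        simp: mult_simps g oq_starD oq_star_hom(2))
qed

lemma cnj_Rm:
  assumes "z \<in> carrier Oq" "a \<in> frakA"
  shows "(\<lambda>x. cnj (Rm a z x)) = Lm (star (O_R2q \<gamma>) z) (\<lambda>x. cnj (a x))"
  using cnj_Lm[of "star (O_R2q \<gamma>) z" "\<lambda>x. cnj (a x)"] assms
  by (simp add: oq_starD oq_star_star fun_eq_iff) (metis complex_cnj_cnj)

end

subsection \<open>The twisted Leibniz rule for mixed products\<close>

context q_plane
begin

abbreviation "DK a \<equiv> D UK1 (D UK2i a)"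
abbreviation "DKi a \<equiv> D UK2 (D UK1i a)"
abbreviation "Dq \<equiv> oq_gen_act \<gamma>"

lemmas oq_closed = lin_mapD(1)[OF oq_gen_act_lin] lin_mapD(1)[OF alg_homD(1)[OF oq_K_hom]]
  lin_mapD(1)[OF alg_homD(1)[OF oq_K_inv_hom]] oq_gen_val_closed

lemmas oq_lin_intros = lin_intros lin_map_comp[OF oq_gen_act_lin Lm_lin_left] lin_map_comp[OF oq_gen_act_lin Rm_lin_left]
  lin_map_comp[OF alg_homD(1)[OF oq_K_hom] Rm_lin_left] lin_map_comp[OF alg_homD(1)[OF oq_K_inv_hom] Lm_lin_left]

lemma D_twisted_skew:
  assumes "g = UE \<or> g = UF" "a \<in> frakA" "b \<in> frakA"
  shows "D g (twisted_prod a b) = (\<lambda>x. twisted_prod (D g a) (DK b) x + twisted_prod (DKi a) (D g b) x)"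
  using assms(2,3) by (auto elim!: frakAE simp: gen_res gen_op_tw_skew[OF assms(1)])

lemma D_twisted_aut:
  assumes "g \<noteq> UE" "g \<noteq> UF" "a \<in> frakA" "b \<in> frakA"
  shows "D g (twisted_prod a b) = twisted_prod (D g a) (D g b)"
  using assms(3,4) by (auto elim!: frakAE simp: gen_res gen_op_tw_aut[OF assms(1,2)])

section \<open>Group-like generators on mixed products\<close>

lemma oq_aut_gen_act:
  assumes "g \<noteq> UE" "g \<noteq> UF"
  shows "Dq g (omono \<gamma> c [a]) = omono \<gamma> (c * oq_weight \<gamma> g a) [a]"
    "Dq g \<one>\<^bsub>Oq\<^esub> = \<one>\<^bsub>Oq\<^esub>"
    "\<lbrakk>y \<in> carrier Oq; z \<in> carrier Oq\<rbrakk> \<Longrightarrow> Dq g (y \<otimes>\<^bsub>Oq\<^esub> z) = Dq g y \<otimes>\<^bsub>Oq\<^esub> Dq g z"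
  using oq_aut_hom(2)[OF assms] alg_homD(2,3)[OF oq_aut_hom(1)[OF assms]] by (simp_all add: oq_aut_act[OF assms])

lemma gen_op_mult_aut:
  assumes "g \<noteq> UE" "g \<noteq> UF"
  shows "gen_op g (left_op a A) = (\<lambda>z. oq_weight \<gamma> g a * left_op a (gen_op g A) z)"
    "gen_op g (right_op a A) = (\<lambda>z. oq_weight \<gamma> g a * right_op a (gen_op g A) z)"
  using assms by (cases g; cases a; simp add: gen_op.simps left_op.simps right_op.simps W_W)+

lemma D_Lm_aut:
  assumes g: "g \<noteq> UE" "g \<noteq> UF" and "z \<in> carrier Oq" "a \<in> frakA"
  shows "D g (Lm z a) = Lm (Dq g z) (D g a)"
proof -
  have 1: "D g (Lg h a) = (\<lambda>x. oq_weight \<gamma> g h * Lg h (D g a) x)" if "a \<in> frakA" for a h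
    using that by (auto elim!: frakAE simp: gen_res gen_op_mult_aut[OF g])
  show ?thesis
    by (rule oq_lin_eqI[OF assms(3,4), where V = A_R2])
      (auto intro!: oq_lin_intros simp: mult_simps oq_aut_gen_act[OF g] 1 oq_closed)
qed

lemma D_Rm_aut:
  assumes g: "g \<noteq> UE" "g \<noteq> UF" and "z \<in> carrier Oq" "a \<in> frakA"
  shows "D g (Rm a z) = Rm (D g a) (Dq g z)"
proof -
  have 1: "D g (Rg h a) = (\<lambda>x. oq_weight \<gamma> g h * Rg h (D g a) x)" if "a \<in> frakA" for a h
    using that by (auto elim!: frakAE simp: gen_res gen_op_mult_aut[OF g])
  show ?thesis
    by (rule oq_lin_eqI[OF assms(3,4), where V = A_R2])
      (auto intro!: oq_lin_intros simp: mult_simps oq_aut_gen_act[OF g] 1 oq_closed Rm_lin)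
qed

section \<open>Skew-primitive generators on mixed products\<close>

lemma oq_K_act: "oq_K \<gamma> z = Dq UK1 (Dq UK2i z)" "oq_K_inv \<gamma> z = Dq UK2 (Dq UK1i z)"
  by (simp_all add: oq_K_def oq_K_inv_def oq_aut_act)

lemma DK_Lm: "z \<in> carrier Oq \<Longrightarrow> a \<in> frakA \<Longrightarrow> DK (Lm z a) = Lm (oq_K \<gamma> z) (DK a)"
  by (simp add: D_Lm_aut oq_K_act oq_closed mult_simps)

lemma DKi_Rm: "z \<in> carrier Oq \<Longrightarrow> a \<in> frakA \<Longrightarrow> DKi (Rm a z) = Rm (DKi a) (oq_K_inv \<gamma> z)"
  by (simp add: D_Rm_aut oq_K_act oq_closed mult_simps)

text \<open>For E with x and for F with y, the two summands of \<open>gen_op g\<close> acquire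
  different powers of q when moved past \<open>left_op h\<close>. The discrepancy is a multiple of q
  - q^(-1), which cancels 1 / \<open>qlam \<gamma>\<close> and leaves the term coming from E x = y
  or F y = x. For the other pairs the powers agree.\<close>

lemma D_Lg_skew:
  assumes g: "g = UE \<or> g = UF" and a: "a \<in> frakA"
  shows "D g (Lg h a) = (\<lambda>x. Lm (oq_gen_val \<gamma> g h) (DK a) x + Lm (oq_K_inv \<gamma> (omono \<gamma> 1 [h])) (D g a) x)"
proof -
  obtain A where A: "rapid A" "a = res A" using a by (rule frakAE)
  have "gen_op g (left_op h A) = (\<lambda>z. (if (g, h) = (UE, OX) then left_op OY (gen_op UK1 (gen_op UK2i A)) z
      else if (g, h) = (UF, OY) then left_op OX (gen_op UK1 (gen_op UK2i A)) z else 0)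
      + qpow \<gamma> (- oq_sgn h / 2) * left_op h (gen_op g A) z)"
    using g by (cases h) (auto simp: gen_op.simps left_op.simps W_lin W_W fun_eq_iff field_simps lam qpow_mult_assoc,
      simp_all add: qlam_def algebra_simps qpow_mult_assoc)
  thus ?thesis using g A
    by (cases h) (auto simp: gen_res oq_K_gen Lm_mult Lm_zero)
qed

lemma D_Rg_skew:
  assumes g: "g = UE \<or> g = UF" and a: "a \<in> frakA"
  shows "D g (Rg h a) = (\<lambda>x. Rm (D g a) (oq_K \<gamma> (omono \<gamma> 1 [h])) x + Rm (DKi a) (oq_gen_val \<gamma> g h) x)"
proof -
  obtain A where A: "rapid A" "a = res A" using a by (rule frakAE)
  have "gen_op g (right_op h A) = (\<lambda>z. qpow \<gamma> (oq_sgn h / 2) * right_op h (gen_op g A) z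
      + (if (g, h) = (UE, OX) then right_op OY (gen_op UK2 (gen_op UK1i A)) z
      else if (g, h) = (UF, OY) then right_op OX (gen_op UK2 (gen_op UK1i A)) z else 0))"
    using g by (cases h) (auto simp: gen_op.simps right_op.simps W_lin W_W fun_eq_iff field_simps lam qpow_mult_assoc,
      simp_all add: qlam_def algebra_simps qpow_mult_assoc)
  thus ?thesis using g A
    by (cases h) (auto simp: gen_res oq_K_gen Rm_mult Rm_zero)
qed

lemma D_Lm_skew:
  assumes g: "g = UE \<or> g = UF" and "z \<in> carrier Oq" "a \<in> frakA"
  shows "D g (Lm z a) = (\<lambda>x. Lm (Dq g z) (DK a) x + Lm (oq_K_inv \<gamma> z) (D g a) x)"
  by (rule oq_lin_eqI[OF assms(2,3), where V = A_R2])
    (auto intro!: oq_lin_intros simp: mult_simps oq_skew_leibniz[OF g] oq_skew_one[OF g] oq_skew_gen[OF g] D_Lg_skew[OF g]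
      alg_homD(2,3)[OF oq_K_inv_hom] DK_Lm oq_closed Lm_lin Lm_zero add.assoc)

lemma D_Rm_skew:
  assumes g: "g = UE \<or> g = UF" and "z \<in> carrier Oq" "a \<in> frakA"
  shows "D g (Rm a z) = (\<lambda>x. Rm (D g a) (oq_K \<gamma> z) x + Rm (DKi a) (Dq g z) x)"
proof -
  have k: "DKi (Rg h a) = Rm (DKi a) (oq_K_inv \<gamma> (omono \<gamma> 1 [h]))" if "a \<in> frakA" for h a
    using DKi_Rm[of "omono \<gamma> 1 [h]" a] that by (simp add: mult_simps)
  show ?thesis
    by (rule oq_lin_eqI[OF assms(2,3), where V = A_R2])
      (auto intro!: oq_lin_intros simp: mult_simps oq_skew_leibniz[OF g] oq_skew_one[OF g] oq_skew_gen[OF g] D_Rg_skew[OF g]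
        alg_homD(2,3)[OF oq_K_hom] k oq_closed Rm_lin Rm_zero add.assoc)
qed

lemma cnj_D: "a \<in> frakA \<Longrightarrow> (\<lambda>x. cnj (D g a x)) = D (inv_gen g) (\<lambda>x. cnj (a x))"
  by (auto elim!: frakAE simp: gen_res cn_gen_op)

subsection \<open>The algebra \<open>\<A>(\<real>\<^sup>+\<^sup>+\<^sub>q)\<close>\<close>

abbreviation "Z \<equiv> A_Rqpp \<gamma> \<alpha> \<beta>"

lemma Z_simps [simp]:
  "carrier Z = carrier Oq \<times> frakA"
  "(z, a) \<otimes>\<^bsub>Z\<^esub> (w, b) = (z \<otimes>\<^bsub>Oq\<^esub> w, \<lambda>x. Lm z b x + Rm a w x + twisted_prod a b x)"
  "(z, a) \<oplus>\<^bsub>Z\<^esub> (w, b) = (z \<oplus>\<^bsub>Oq\<^esub> w, \<lambda>x. a x + b x)"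
  "c \<odot>\<^bsub>Z\<^esub> (z, a) = (c \<odot>\<^bsub>Oq\<^esub> z, \<lambda>x. c * a x)"
  "\<zero>\<^bsub>Z\<^esub> = (\<zero>\<^bsub>Oq\<^esub>, \<lambda>x. 0)"
  "star Z (z, a) = (star (O_R2q \<gamma>) z, \<lambda>x. cnj (a x))"
  by (simp_all add: A_Rqpp_def)

lemma complex_vs_Z: "complex_vs Z"
  by (rule complex_vsI) (auto simp: O.a_ac O.sm_add_left O.sm_add_right O.sm_mult algebra_simps)

text \<open>Associativity across the summands is the list of bimodule laws: \<open>Lm_mult\<close>,
  \<open>Rm_mult\<close> and \<open>Lm_Rm\<close> when one factor lies in \<open>frakA\<close>;
  \<open>Lm_twisted\<close>, \<open>Rm_Lm_twisted\<close> and \<open>Rm_twisted\<close> when two do,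
  with the polynomial on the left, in the middle and on the right.\<close>

lemma star_algebra_Z: "star_algebra Z"
proof (intro star_algebra.intro star_algebra_axioms.intro complex_vs.module_complex complex_vs_Z)
  fix x y z c assume x: "x \<in> carrier Z"
  show "star Z x \<in> carrier Z" "star Z (star Z x) = x" "star Z (c \<odot>\<^bsub>Z\<^esub> x) = cnj c \<odot>\<^bsub>Z\<^esub> star Z x"
    using x by (auto simp: oq_starD oq_star_star)
  assume y: "y \<in> carrier Z"
  note l = Lm_lin Rm_lin twisted_prod_lin frakA_mult
  show "x \<otimes>\<^bsub>Z\<^esub> y \<in> carrier Z" using x y by (auto simp: l)
  show "(c \<odot>\<^bsub>Z\<^esub> x) \<otimes>\<^bsub>Z\<^esub> y = c \<odot>\<^bsub>Z\<^esub> (x \<otimes>\<^bsub>Z\<^esub> y)" "x \<otimes>\<^bsub>Z\<^esub> (c \<odot>\<^bsub>Z\<^esub> y) = c \<odot>\<^bsub>Z\<^esub> (x \<otimes>\<^bsub>Z\<^esub> y)"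
    using x y by (auto simp: l O.sm_mult_left O.sm_mult_right algebra_simps)
  show "star Z (x \<oplus>\<^bsub>Z\<^esub> y) = star Z x \<oplus>\<^bsub>Z\<^esub> star Z y" using x y by (auto simp: oq_starD)
  have s: "cnj (Lm z a t) = Rm (\<lambda>x. cnj (a x)) (star (O_R2q \<gamma>) z) t"
    "cnj (Rm a z t) = Lm (star (O_R2q \<gamma>) z) (\<lambda>x. cnj (a x)) t"
    "cnj (twisted_prod a b t) = twisted_prod (\<lambda>x. cnj (b x)) (\<lambda>x. cnj (a x)) t"
    if "z \<in> carrier Oq" "a \<in> frakA" "b \<in> frakA" for z a b t
    using fun_cong[OF cnj_Lm, of z a t] fun_cong[OF cnj_Rm, of z a t] fun_cong[OF twisted_prod_star, of a b t] that by simp_all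
  show "star Z (x \<otimes>\<^bsub>Z\<^esub> y) = star Z y \<otimes>\<^bsub>Z\<^esub> star Z x"
    using x y by (auto simp: s oq_starD add_ac)
  assume z: "z \<in> carrier Z"
  show "(x \<otimes>\<^bsub>Z\<^esub> y) \<otimes>\<^bsub>Z\<^esub> z = x \<otimes>\<^bsub>Z\<^esub> (y \<otimes>\<^bsub>Z\<^esub> z)"
    using x y z by (auto simp: l O.m_assoc Lm_mult Rm_mult Lm_Rm Lm_twisted Rm_twisted Rm_Lm_twisted twisted_prod_assoc add_ac)
  show "(x \<oplus>\<^bsub>Z\<^esub> y) \<otimes>\<^bsub>Z\<^esub> z = x \<otimes>\<^bsub>Z\<^esub> z \<oplus>\<^bsub>Z\<^esub> y \<otimes>\<^bsub>Z\<^esub> z"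
    "x \<otimes>\<^bsub>Z\<^esub> (y \<oplus>\<^bsub>Z\<^esub> z) = x \<otimes>\<^bsub>Z\<^esub> y \<oplus>\<^bsub>Z\<^esub> x \<otimes>\<^bsub>Z\<^esub> z"
    using x y z by (auto simp: l O.l_distr O.r_distr algebra_simps)
qed

abbreviation "act \<equiv> A_Rqpp_act \<gamma> \<alpha> \<beta>"

lemma fa_act_eq: "fa_act \<gamma> \<alpha> \<beta> = word_act A_R2 (foldr D)"
  by (intro ext) (simp add: fa_act_def word_act_def free_act_def)

lemma gen_module_star_Z: "gen_module_star \<gamma> Z act"
proof (intro gen_module_star.intro gen_module_star_axioms.intro star_algebra_Z)
  interpret UO: left_word_rep Oq "uq_rels \<gamma>" "foldr Dq"
    by (rule uq_ops.uq_word_rep[OF uq_ops_oq[OF lam]])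
  interpret UA: left_word_rep A_R2 "uq_rels \<gamma>" "foldr D"
    by (rule uq_ops.uq_word_rep[OF uq_ops_A])
  have e: "act f (z, a) = (word_act Oq (foldr Dq) f z, word_act A_R2 (foldr D) f a)" for f z a
    by (simp add: A_Rqpp_act_def oq_act_eq fa_act_eq)
  note UOl = UO.word_act_lin_left[folded uq_algebra_eq] UO.word_act_lin_right[folded uq_algebra_eq]
  note UAl = UA.word_act_lin_left[folded uq_algebra_eq] UA.word_act_lin_right[folded uq_algebra_eq]
  note l1 = lin_mapD[OF UOl(1), simplified] lin_mapD[OF UAl(1), simplified]
  note l2 = lin_mapD(2,3)[OF UOl(2), simplified] lin_mapD(2,3)[OF UAl(2), simplified]
  note m = UO.word_act_mult[folded uq_algebra_eq] UA.word_act_mult[folded uq_algebra_eq]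
    UO.word_act_one[folded uq_algebra_eq] UA.word_act_one[folded uq_algebra_eq]
  \<comment> \<open>A monomial acts by applying its generators in each component, so every Leibniz
    law splits into one on the quantum plane, two on mixed products and one on the twisted
    product.\<close>
  have mono: "act (umono \<gamma> 1 w) (z, a) = (foldr Dq w z, foldr D w a)" if "(z, a) \<in> carrier Z" for w z a
    using that UO.word_act_mono[of z 1 w] UA.word_act_mono[of a 1 w] UO.closed[of z w] UA.closed[of a w]
    by (simp add: e umono_eq)
  note c = oq_closed D_lin(1)
  show "lin_map (uq_algebra \<gamma>) Z (\<lambda>f. act f x)" if "x \<in> carrier Z" for x
    using that by (cases x) (auto intro!: lin_mapI simp: e l1)
  show "lin_map Z Z (act f)" if "f \<in> carrier (uq_algebra \<gamma>)" for f
    using that by (intro lin_mapI) (auto simp: e l1 l2)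
  fix x y assume x: "x \<in> carrier Z"
  show "act (f \<otimes>\<^bsub>uq_algebra \<gamma>\<^esub> g) x = act f (act g x)"
    if "f \<in> carrier (uq_algebra \<gamma>)" "g \<in> carrier (uq_algebra \<gamma>)" for f g
    using x that by (cases x) (simp add: e m)
  show "act \<one>\<^bsub>uq_algebra \<gamma>\<^esub> x = x" using x by (cases x) (simp add: e m)
  show "star Z (act (umono \<gamma> 1 [k]) x) = act (umono \<gamma> 1 [inv_gen k]) (star Z x)" for k
    using x by (cases x) (simp add: mono oq_star_gen_act cnj_D oq_starD)
  assume y: "y \<in> carrier Z"
  show "act (umono \<gamma> 1 [k]) (x \<otimes>\<^bsub>Z\<^esub> y) = act (umono \<gamma> 1 [k]) x \<otimes>\<^bsub>Z\<^esub> act (umono \<gamma> 1 [k]) y"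
    if "k \<noteq> UE" "k \<noteq> UF" for k
    using x y by (cases x; cases y) (simp add: mono c mult_simps D_lin oq_aut_gen_act[OF that] D_Lm_aut[OF that] D_Rm_aut[OF that] D_twisted_aut[OF that])
  show "act (umono \<gamma> 1 [k]) (x \<otimes>\<^bsub>Z\<^esub> y) = act (umono \<gamma> 1 [k]) x \<otimes>\<^bsub>Z\<^esub> act (umono \<gamma> 1 [UK1, UK2i]) y
      \<oplus>\<^bsub>Z\<^esub> act (umono \<gamma> 1 [UK2, UK1i]) x \<otimes>\<^bsub>Z\<^esub> act (umono \<gamma> 1 [k]) y" if "k = UE \<or> k = UF" for k
    using x y by (cases x; cases y) (simp add: mono c mult_simps D_lin oq_skew_leibniz[OF that] D_Lm_skew[OF that] D_Rm_skew[OF that]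
      D_twisted_skew[OF that] oq_K_act add_ac)
qed

end

text \<open>Vanishing of q - q^(-1) would force q^2 = 1.\<close>

lemma qlam_nonzero:
  assumes "q \<noteq> 1" "q \<noteq> -1" "q = exp (2 * of_real pi * \<i> * of_real \<gamma>)"
  shows "qlam \<gamma> \<noteq> 0"
proof
  assume "qlam \<gamma> = 0"
  moreover have q: "q = qpow \<gamma> 1" using assms(3) by (simp add: qpow_def)
  ultimately have "q * q = qpow \<gamma> (-1) * qpow \<gamma> 1" by (simp add: qlam_def)
  hence "q * q = 1" by (simp add: qpow_add)
  thus False using assms(1,2) by (simp add: square_eq_1_iff)
qed

theorem theorem21:
  fixes \<alpha> \<beta> \<gamma> :: real and q :: complex
  assumes "cmod q = 1" and "q \<noteq> 1" and "q \<noteq> -1"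
    and "q = exp (2 * of_real pi * \<i> * of_real \<gamma>)"
    and "\<alpha> * \<beta> = \<gamma>"
  shows "module_star_algebra (uq_gl2_R \<gamma>) (A_Rqpp \<gamma> \<alpha> \<beta>) (A_Rqpp_act \<gamma> \<alpha> \<beta>)"
proof -
  interpret q_plane \<alpha> \<beta> \<gamma> by unfold_locales (use assms(5) qlam_nonzero[OF assms(2-4)] in auto)
  interpret gen_module_star \<gamma> "A_Rqpp \<gamma> \<alpha> \<beta>" "A_Rqpp_act \<gamma> \<alpha> \<beta>" by (rule gen_module_star_Z)
  show ?thesis by (rule module_star_algebra)
qed

end
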